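(* Let $X$ be a compact connected CW complex whose fundamental group $G=\pi_1(X)$ is virtually cyclic, let $\widetilde X$ be its universal covering, and let $p\ge 1$. Let $\mathcal F$ be the directed set of all finite index normal subgroups of $G$ and for $i\in\mathcal F$, corresponding to $G_i\trianglelefteq G$, let $\overline X_i=G_i\backslash\widetilde X$ be the corresponding finite Galois covering of $X$. Suppose that $\alpha^{(2)}_p(\widetilde X)<\infty^+$. Then \[ \alpha^{(2)}_p(\widetilde X)=\limsup_{i\in\mathcal F}\alpha_p(\overline X_i). \]
   Context: Spectral distribution function and Novikov--Shubin numbers. For a countable discrete group $G$ and $A\in M(r,s;\mathbb C G)$, let $A^*$ be obtained from $A$ by transposing and applying the involution $(\sum\lambda_g g)^*=\sum\overline{\lambda_g}g^{-1}$ to the entries. Let $r^{(2)}_{AA^*}\colon(\ell^2G)^r\to(\ell^2G)^r$, $x\mapsto xAA^*$, let $E^{AA^*}_\lambda=\chi_{[0,\lambda]}(r^{(2)}_{AA^*})$ be its spectral projections, and set $F_A(\lambda)=\operatorname{tr}_{\mathcal N(G)}E^{AA^*}_{\lambda^2}$ for $\lambda\ge0$, where $\operatorname{tr}_{\mathcal N(G)}$ is the von Neumann trace of the group von Neumann algebra, extended diagonally to matrices. If $F_A(\lambda)=F_A(0)$ for some $\lambda>0$, the Novikov--Shubin number of $A$ is the formal symbol $\infty^+$. Otherwise the upper Novikov--Shubin number is \[\overline\alpha^{(2)}(A)=\limsup_{\lambda\to0^+}\frac{\log(F_A(\lambda)-F_A(0))}{\log\lambda}\in[0,\infty]\] and the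 lower one $\underline\alpha^{(2)}(A)$ is defined with $\liminf$ instead. When both agree, the common value is denoted $\alpha^{(2)}(A)$; this is always the case if $G$ is virtually cyclic. By convention $c<\infty<\infty^+$ for all $c\in[0,\infty)$. Alpha numbers. For a finite index normal subgroup $G_i\trianglelefteq G$, let $A_i\in M(r,s;\mathbb C(G/G_i))$ be the image of $A$ under $\mathbb C G\to\mathbb C(G/G_i)$ applied entrywise. Via the regular representation of $G/G_i$ (i.e. as the linear map $\mathbb C(G/G_i)^r\to\mathbb C(G/G_i)^s$, $x\mapsto xA_i$, in the bases of group elements), view $A_i$ as a complex matrix of size $r[G:G_i]\times s[G:G_i]$. If $A_i\neq0$, let $\sigma^+(A_i)$ be its smallest positive singular value and $m^+(A_i)=\dim_{\mathbb C}\ker(A_iA_i^*-\sigma^+(A_i)^2)$ its multiplicity. The alpha number is \[\alpha(A_i)=\frac{\log\left(m^+(A_i)/[G:G_i]\right)}{\log\sigma^+(A_i)}.\] If the Novikov--Shubin number of $A$ is $<\infty^+$, then $\sigma^+(A_i)\to0$ along the net of all finite index normal subgroups, so $\alpha(A_i)$ is defined for all sufficiently large $i$; only these matter for upper and lower limits. Spaces. Choosing a cellular basis of $X$ identifies the cellular chain module $C_p(\widetilde X)$ with $(\mathbb Z G)^{N_p}$, where $N_p$ is the number of $p$-cells of $X$, and the differential $d_p\colon C_p(\widetilde X)\to C_{p-1}(\widetilde X)$ with right multiplication by a matrix $A(\widetilde X,p)\in M(N_p,N_{p-1};\mathbb Z G)$. Put $\alpha^{(2)}_p(\widetilde X)=\alpha^{(2)}(A(\widetilde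 X,p))$. The $p$-th cellular differential of $\overline X_i=G_i\backslash\widetilde X$ is represented by the matrix $A(\widetilde X,p)_i$ over $\mathbb Z(G/G_i)$, and $\alpha_p(\overline X_i)=\alpha(A(\widetilde X,p)_i)$. These numbers do not depend on the choices. Nets. $\mathcal F$ is directed by reverse inclusion of subgroups ($i\le j$ iff $G_j\subseteq G_i$). For a net $(x_i)$ of real numbers, $\limsup_{i}x_i=\inf_{i}\sup_{j\ge i}x_j$ and $\liminf_i x_i=\sup_i\inf_{j\ge i}x_j$. *)

theory Defs
  imports
    "HOL-Homology.Homology"
    "HOL-Analysis.Analysis"
    "Jordan_Normal_Form.Schur_Decomposition"
    "Jordan_Normal_Form.Jordan_Normal_Form_Uniqueness"
begin

section \<open>Fundamental group and universal covering\<close>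

definition loops :: "'a topology \<Rightarrow> 'a \<Rightarrow> (real \<Rightarrow> 'a) set" where
  "loops X x = {\<gamma>. pathin X \<gamma> \<and> \<gamma> 0 = x \<and> \<gamma> 1 = x}"

definition loop_homotopic :: "'a topology \<Rightarrow> 'a \<Rightarrow> (real \<Rightarrow> 'a) \<Rightarrow> (real \<Rightarrow> 'a) \<Rightarrow> bool" where
  "loop_homotopic X x = homotopic_with (\<lambda>\<gamma>. \<gamma> 0 = x \<and> \<gamma> 1 = x) (top_of_set {0..1}) X"

text \<open>The same formula as \<open>joinpaths\<close>, which is restricted to class \<open>topological_space\<close>.\<close>

definition join_loops :: "(real \<Rightarrow> 'a) \<Rightarrow> (real \<Rightarrow> 'a) \<Rightarrow> real \<Rightarrow> 'a" where
  "join_loops \<gamma> \<delta> = (\<lambda>t. if t \<le> 1 / 2 then \<gamma> (2 * t) else \<delta> (2 * t - 1))"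

definition loop_class :: "'a topology \<Rightarrow> 'a \<Rightarrow> (real \<Rightarrow> 'a) \<Rightarrow> (real \<Rightarrow> 'a) set" where
  "loop_class X x \<gamma> = {\<delta>. loop_homotopic X x \<gamma> \<delta>}"

definition fundamental_group :: "'a topology \<Rightarrow> 'a \<Rightarrow> (real \<Rightarrow> 'a) set monoid" where
  "fundamental_group X x =
     \<lparr>carrier = loop_class X x ` loops X x,
      monoid.mult = (\<lambda>P Q. \<Union>\<gamma>\<in>P. \<Union>\<delta>\<in>Q. loop_class X x (join_loops \<gamma> \<delta>)),
      one = loop_class X x (\<lambda>_. x)\<rparr>"

definition virtually_cyclic :: "('g, 'm) monoid_scheme \<Rightarrow> bool" where
  "virtually_cyclic G \<longleftrightarrow>
     group G \<and> (\<exists>x\<in>carrier G. finite (rcosets\<^bsub>G\<^esub> (generate G {x})))"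

definition simply_connected_space :: "'a topology \<Rightarrow> bool" where
  "simply_connected_space E \<longleftrightarrow> path_connected_space E \<and>
     (\<forall>e\<in>topspace E. \<forall>\<gamma>\<in>loops E e. loop_homotopic E e \<gamma> (\<lambda>_. e))"

definition covering_map :: "'b topology \<Rightarrow> 'a topology \<Rightarrow> ('b \<Rightarrow> 'a) \<Rightarrow> bool" where
  "covering_map E X q \<longleftrightarrow>
     continuous_map E X q \<and> q ` topspace E = topspace X \<and>
     (\<forall>x\<in>topspace X. \<exists>U. openin X U \<and> x \<in> U \<and>
        (\<exists>\<V>. \<Union>\<V> = {e \<in> topspace E. q e \<in> U} \<and> pairwise disjnt \<V> \<and>
          (\<forall>V\<in>\<V>. openin E V \<and>
             homeomorphic_map (subtopology E V) (subtopology X U) q)))"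

definition universal_covering :: "'b topology \<Rightarrow> 'a topology \<Rightarrow> ('b \<Rightarrow> 'a) \<Rightarrow> bool" where
  "universal_covering E X q \<longleftrightarrow> covering_map E X q \<and> simply_connected_space E"

definition deck_transformation :: "'b topology \<Rightarrow> ('b \<Rightarrow> 'a) \<Rightarrow> ('b \<Rightarrow> 'b) \<Rightarrow> bool" where
  "deck_transformation E q \<tau> \<longleftrightarrow> homeomorphic_map E E \<tau> \<and> (\<forall>e\<in>topspace E. q (\<tau> e) = q e)"

text \<open>The left action of \<open>fundamental_group X (q e)\<close> on the universal covering: the class of a
  loop acts by the deck transformation that moves \<open>e\<close> to the end point of the lift of
  the loop starting at \<open>e\<close>.  On \<open>topspace E\<close> this determines the deck transformation.\<close>

definition deck_action :: "'b topology \<Rightarrow> ('b \<Rightarrow> 'a) \<Rightarrow> 'b \<Rightarrow> (real \<Rightarrow> 'a) set \<Rightarrow> 'b \<Rightarrow> 'b" where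
  "deck_action E q e g = (SOME \<tau>. deck_transformation E q \<tau> \<and>
     (\<exists>\<gamma>\<in>g. \<exists>\<delta>. pathin E \<delta> \<and> \<delta> 0 = e \<and> (\<forall>t\<in>{0..1}. q (\<delta> t) = \<gamma> t) \<and> \<tau> e = \<delta> 1))"

section \<open>CW complexes\<close>

definition disk :: "nat \<Rightarrow> (nat \<Rightarrow> real) topology" where
  "disk n = subtopology (Euclidean_space n) {x. (\<Sum>i<n. (x i)\<^sup>2) \<le> 1}"

definition open_disk :: "nat \<Rightarrow> (nat \<Rightarrow> real) set" where
  "open_disk n = {x \<in> topspace (Euclidean_space n). (\<Sum>i<n. (x i)\<^sup>2) < 1}"

definition disk_boundary :: "nat \<Rightarrow> (nat \<Rightarrow> real) set" where
  "disk_boundary n = {x \<in> topspace (Euclidean_space n). (\<Sum>i<n. (x i)\<^sup>2) = 1}"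

record ('a, 'c) cell_structure =
  cells :: "'c set"
  cell_dim :: "'c \<Rightarrow> nat"
  char_map :: "'c \<Rightarrow> (nat \<Rightarrow> real) \<Rightarrow> 'a"

definition open_cell :: "('a, 'c) cell_structure \<Rightarrow> 'c \<Rightarrow> 'a set" where
  "open_cell K c = char_map K c ` open_disk (cell_dim K c)"

definition cells_of_dim :: "('a, 'c) cell_structure \<Rightarrow> nat \<Rightarrow> 'c set" where
  "cells_of_dim K n = {c \<in> cells K. cell_dim K c = n}"

definition cw_complex :: "'a topology \<Rightarrow> ('a, 'c) cell_structure \<Rightarrow> bool" where
  "cw_complex X K \<longleftrightarrow>
     Hausdorff_space X \<and>
     (\<forall>c\<in>cells K.
        continuous_map (disk (cell_dim K c)) X (char_map K c) \<and>
        homeomorphic_map (subtopology (disk (cell_dim K c)) (open_disk (cell_dim K c)))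
          (subtopology X (open_cell K c)) (char_map K c)) \<and>
     disjoint_family_on (open_cell K) (cells K) \<and>
     (\<Union>c\<in>cells K. open_cell K c) = topspace X \<and>
     (\<forall>c\<in>cells K. \<exists>F\<subseteq>cells K. finite F \<and> (\<forall>d\<in>F. cell_dim K d < cell_dim K c) \<and>
        char_map K c ` disk_boundary (cell_dim K c) \<subseteq> (\<Union>d\<in>F. open_cell K d)) \<and>
     (\<forall>A\<subseteq>topspace X.
        (\<forall>c\<in>cells K. closedin (disk (cell_dim K c))
           {x \<in> topspace (disk (cell_dim K c)). char_map K c x \<in> A}) \<longrightarrow> closedin X A)"

section \<open>Cellular chain complex of the universal covering\<close>

text \<open>To avoid negative dimensions, skeleta are indexed by a strict bound on the dimension:
  \<open>lifted_skeleton E q K n\<close> is the preimage in \<open>E\<close> of the \<open>(n - 1)\<close>-skeleton.\<close>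

definition lifted_skeleton :: "'b topology \<Rightarrow> ('b \<Rightarrow> 'a) \<Rightarrow> ('a, 'c) cell_structure \<Rightarrow> nat \<Rightarrow> 'b set" where
  "lifted_skeleton E q K n =
     {e \<in> topspace E. \<exists>c\<in>cells K. cell_dim K c < n \<and> q e \<in> open_cell K c}"

definition cellular_chain_group ::
    "'b topology \<Rightarrow> ('b \<Rightarrow> 'a) \<Rightarrow> ('a, 'c) cell_structure \<Rightarrow> nat \<Rightarrow> 'b chain set monoid" where
  "cellular_chain_group E q K p =
     relative_homology_group (int p)
       (subtopology E (lifted_skeleton E q K (Suc p))) (lifted_skeleton E q K p)"

text \<open>The boundary map of the triple formed by the lifted \<open>p\<close>-, \<open>(p - 1)\<close>- and
  \<open>(p - 2)\<close>-skeleta; only meaningful for \<open>p \<ge> 1\<close>.\<close>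

definition cellular_differential ::
    "'b topology \<Rightarrow> ('b \<Rightarrow> 'a) \<Rightarrow> ('a, 'c) cell_structure \<Rightarrow> nat \<Rightarrow> 'b chain set \<Rightarrow> 'b chain set" where
  "cellular_differential E q K p =
     hom_relboundary (int p) (subtopology E (lifted_skeleton E q K (Suc p)))
       (lifted_skeleton E q K p) (lifted_skeleton E q K (p - 1))"

definition chain_action ::
    "'b topology \<Rightarrow> ('b \<Rightarrow> 'a) \<Rightarrow> ('a, 'c) cell_structure \<Rightarrow> nat \<Rightarrow> ('b \<Rightarrow> 'b) \<Rightarrow>
      'b chain set \<Rightarrow> 'b chain set" where
  "chain_action E q K p \<tau> =
     hom_induced (int p)
       (subtopology E (lifted_skeleton E q K (Suc p))) (lifted_skeleton E q K p)
       (subtopology E (lifted_skeleton E q K (Suc p))) (lifted_skeleton E q K p) \<tau>"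

text \<open>A cellular basis in degree \<open>p\<close> enumerates the \<open>p\<close>-cells of \<open>X\<close> and chooses, for each of
  them, a lift of its characteristic map and an orientation, that is, a generator of the
  infinite cyclic group \<open>H\<^sub>p(D\<^sup>p, S\<^sup>p\<^sup>-\<^sup>1)\<close>.\<close>

definition cellular_basis ::
    "'a topology \<Rightarrow> ('a, 'c) cell_structure \<Rightarrow> 'b topology \<Rightarrow> ('b \<Rightarrow> 'a) \<Rightarrow> nat \<Rightarrow> nat \<Rightarrow>
      (nat \<Rightarrow> 'b chain set) \<Rightarrow> bool" where
  "cellular_basis X K E q p N b \<longleftrightarrow>
     (\<exists>c. bij_betw c {..<N} (cells_of_dim K p) \<and>
       (\<forall>i<N. \<exists>\<phi> z.
          continuous_map (disk p) E \<phi> \<and>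
          (\<forall>x\<in>topspace (disk p). q (\<phi> x) = char_map K (c i) x) \<and>
          z \<in> carrier (relative_homology_group (int p) (disk p) (disk_boundary p)) \<and>
          generate (relative_homology_group (int p) (disk p) (disk_boundary p)) {z} =
            carrier (relative_homology_group (int p) (disk p) (disk_boundary p)) \<and>
          b i = hom_induced (int p) (disk p) (disk_boundary p)
                  (subtopology E (lifted_skeleton E q K (Suc p))) (lifted_skeleton E q K p) \<phi> z))"

section \<open>Matrices over group rings\<close>

text \<open>An element of a group ring over \<open>G\<close> is a function of finite support contained in
  \<open>carrier G\<close>; an \<open>r \<times> s\<close> matrix is a family of such elements, of which only the entries with
  \<open>i < r\<close> and \<open>j < s\<close> matter.\<close>

definition group_ring_mat ::
    "('g, 'm) monoid_scheme \<Rightarrow> nat \<Rightarrow> nat \<Rightarrow> (nat \<Rightarrow> nat \<Rightarrow> 'g \<Rightarrow> 'k::zero) \<Rightarrow> bool" where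
  "group_ring_mat G r s A \<longleftrightarrow>
     (\<forall>i<r. \<forall>j<s. finite {g. A i j g \<noteq> 0} \<and> {g. A i j g \<noteq> 0} \<subseteq> carrier G)"

text \<open>In right multiplication by \<open>A\<close>, the basis element \<open>b i\<close> is sent to the sum over \<open>j < s\<close>
  and \<open>g\<close> of \<open>A i j g\<close> times \<open>g \<cdot> b' j\<close>; the homology groups are written multiplicatively.\<close>

definition represents_differential ::
    "'a topology \<Rightarrow> ('a, 'c) cell_structure \<Rightarrow> 'b topology \<Rightarrow> ('b \<Rightarrow> 'a) \<Rightarrow> 'b \<Rightarrow> nat \<Rightarrow>
      nat \<Rightarrow> nat \<Rightarrow> (nat \<Rightarrow> nat \<Rightarrow> (real \<Rightarrow> 'a) set \<Rightarrow> int) \<Rightarrow> bool" where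
  "represents_differential X K E q e p r s A \<longleftrightarrow>
     group_ring_mat (fundamental_group X (q e)) r s A \<and>
     (\<exists>b b'. cellular_basis X K E q p r b \<and> cellular_basis X K E q (p - 1) s b' \<and>
       (\<forall>i<r. cellular_differential E q K p (b i) =
          finprod (cellular_chain_group E q K (p - 1))
            (\<lambda>(j, g). chain_action E q K (p - 1) (deck_action E q e g) (b' j)
                        [^]\<^bsub>cellular_chain_group E q K (p - 1)\<^esub> A i j g)
            {(j, g). j < s \<and> g \<in> carrier (fundamental_group X (q e)) \<and> A i j g \<noteq> 0}))"

definition gr_times ::
    "('g, 'm) monoid_scheme \<Rightarrow> ('g \<Rightarrow> complex) \<Rightarrow> ('g \<Rightarrow> complex) \<Rightarrow> 'g \<Rightarrow> complex" where
  "gr_times G a b g =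
     (if g \<in> carrier G
      then \<Sum>h | h \<in> carrier G \<and> b h \<noteq> 0. a (g \<otimes>\<^bsub>G\<^esub> inv\<^bsub>G\<^esub> h) * b h else 0)"

definition gr_mat_times ::
    "('g, 'm) monoid_scheme \<Rightarrow> nat \<Rightarrow> (nat \<Rightarrow> nat \<Rightarrow> 'g \<Rightarrow> complex) \<Rightarrow>
      (nat \<Rightarrow> nat \<Rightarrow> 'g \<Rightarrow> complex) \<Rightarrow> nat \<Rightarrow> nat \<Rightarrow> 'g \<Rightarrow> complex" where
  "gr_mat_times G s A B i k g = (\<Sum>j<s. gr_times G (A i j) (B j k) g)"

definition gr_mat_adjoint ::
    "('g, 'm) monoid_scheme \<Rightarrow> (nat \<Rightarrow> nat \<Rightarrow> 'g \<Rightarrow> complex) \<Rightarrow> nat \<Rightarrow> nat \<Rightarrow> 'g \<Rightarrow> complex" where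
  "gr_mat_adjoint G A j i g = (if g \<in> carrier G then cnj (A i j (inv\<^bsub>G\<^esub> g)) else 0)"

text \<open>Right multiplication of row vectors of length \<open>r\<close>, given as functions on
  \<open>{..<r} \<times> carrier G\<close>, by an \<open>r \<times> s\<close> matrix.\<close>

definition right_mult ::
    "('g, 'm) monoid_scheme \<Rightarrow> nat \<Rightarrow> nat \<Rightarrow> (nat \<Rightarrow> nat \<Rightarrow> 'g \<Rightarrow> complex) \<Rightarrow>
      (nat \<times> 'g \<Rightarrow> complex) \<Rightarrow> nat \<times> 'g \<Rightarrow> complex" where
  "right_mult G r s B x =
     (\<lambda>(j, g). if j < s then \<Sum>i<r. gr_times G (\<lambda>h. x (i, h)) (B i j) g else 0)"

section \<open>Spectral projections on \<open>\<ell>\<^sup>2\<close>\<close>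

definition ell2 :: "'k set \<Rightarrow> ('k \<Rightarrow> complex) set" where
  "ell2 I = {x. (\<forall>k. k \<notin> I \<longrightarrow> x k = 0) \<and> (\<lambda>k. (cmod (x k))\<^sup>2) summable_on I}"

definition ell2_inner :: "'k set \<Rightarrow> ('k \<Rightarrow> complex) \<Rightarrow> ('k \<Rightarrow> complex) \<Rightarrow> complex" where
  "ell2_inner I x y = (\<Sum>\<^sub>\<infinity>k\<in>I. x k * cnj (y k))"

text \<open>Linearity and boundedness of an orthogonal projection follow from symmetry and
  idempotence.\<close>

definition orth_projection :: "'k set \<Rightarrow> (('k \<Rightarrow> complex) \<Rightarrow> 'k \<Rightarrow> complex) \<Rightarrow> bool" where
  "orth_projection I Q \<longleftrightarrow>
     (\<forall>x\<in>ell2 I. Q x \<in> ell2 I \<and> Q (Q x) = Q x) \<and>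
     (\<forall>x\<in>ell2 I. \<forall>y\<in>ell2 I. ell2_inner I (Q x) y = ell2_inner I x (Q y))"

text \<open>\<open>P\<close> is the projection-valued measure of the bounded self-adjoint operator \<open>T\<close>, i.e.
  \<open>T = \<integral> t dP(t)\<close> in the weak sense.  By the spectral theorem and polarization, \<open>P\<close> exists and
  is unique on Borel sets and \<open>ell2 I\<close>.\<close>

definition spectral_measure ::
    "'k set \<Rightarrow> (('k \<Rightarrow> complex) \<Rightarrow> 'k \<Rightarrow> complex) \<Rightarrow>
      (real set \<Rightarrow> ('k \<Rightarrow> complex) \<Rightarrow> 'k \<Rightarrow> complex) \<Rightarrow> bool" where
  "spectral_measure I T P \<longleftrightarrow>
     (\<forall>B\<in>sets borel. orth_projection I (P B)) \<and>
     (\<forall>x\<in>ell2 I. P UNIV x = x) \<and>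
     (\<forall>x\<in>ell2 I. \<exists>\<mu>::real measure. finite_measure \<mu> \<and> sets \<mu> = sets borel \<and>
        (\<forall>B\<in>sets borel. ell2_inner I (P B x) x = complex_of_real (measure \<mu> B)) \<and>
        integrable \<mu> (\<lambda>t. t) \<and>
        ell2_inner I (T x) x = complex_of_real (\<integral>t. t \<partial>\<mu>))"

definition spectral_projection ::
    "'k set \<Rightarrow> (('k \<Rightarrow> complex) \<Rightarrow> 'k \<Rightarrow> complex) \<Rightarrow> real set \<Rightarrow> ('k \<Rightarrow> complex) \<Rightarrow> 'k \<Rightarrow> complex" where
  "spectral_projection I T = (SOME P. spectral_measure I T P)"

section \<open>Novikov--Shubin numbers\<close>

text \<open>The von Neumann trace of an \<open>r \<times> r\<close> matrix over the group von Neumann algebra, viewed as an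
  operator on the \<open>r\<close>-fold sum of \<open>\<ell>\<^sup>2G\<close>.\<close>

definition vn_trace ::
    "('g, 'm) monoid_scheme \<Rightarrow> nat \<Rightarrow> ((nat \<times> 'g \<Rightarrow> complex) \<Rightarrow> nat \<times> 'g \<Rightarrow> complex) \<Rightarrow> complex" where
  "vn_trace G r Q =
     (\<Sum>i<r. let \<delta> = (\<lambda>k. if k = (i, \<one>\<^bsub>G\<^esub>) then 1 else 0)
             in ell2_inner ({..<r} \<times> carrier G) (Q \<delta>) \<delta>)"

definition spectral_distribution ::
    "('g, 'm) monoid_scheme \<Rightarrow> nat \<Rightarrow> nat \<Rightarrow> (nat \<Rightarrow> nat \<Rightarrow> 'g \<Rightarrow> complex) \<Rightarrow> real \<Rightarrow> real" where
  "spectral_distribution G r s A l =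
     Re (vn_trace G r
       (spectral_projection ({..<r} \<times> carrier G)
         (right_mult G r r (gr_mat_times G s A (gr_mat_adjoint G A))) {0..l\<^sup>2}))"

text \<open>\<open>Infinity_plus\<close> is the formal symbol larger than \<open>NS_val \<infinity>\<close>.\<close>

datatype ns_number = NS_val ereal | Infinity_plus

instantiation ns_number :: linorder
begin

fun less_eq_ns_number :: "ns_number \<Rightarrow> ns_number \<Rightarrow> bool" where
  "less_eq_ns_number _ Infinity_plus \<longleftrightarrow> True"
| "less_eq_ns_number Infinity_plus (NS_val _) \<longleftrightarrow> False"
| "less_eq_ns_number (NS_val a) (NS_val b) \<longleftrightarrow> a \<le> b"

definition less_ns_number :: "ns_number \<Rightarrow> ns_number \<Rightarrow> bool" where
  "less_ns_number a b \<longleftrightarrow> a \<le> b \<and> \<not> b \<le> a"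

instance
proof
  fix x y z :: ns_number
  show "(x < y) = (x \<le> y \<and> \<not> y \<le> x)" by (rule less_ns_number_def)
  show "x \<le> x" by (cases x) auto
  show "x \<le> y \<Longrightarrow> y \<le> z \<Longrightarrow> x \<le> z" by (cases x; cases y; cases z) auto
  show "x \<le> y \<Longrightarrow> y \<le> x \<Longrightarrow> x = y" by (cases x; cases y) auto
  show "x \<le> y \<or> y \<le> x" by (cases x; cases y) auto
qed

end

definition upper_novikov_shubin ::
    "('g, 'm) monoid_scheme \<Rightarrow> nat \<Rightarrow> nat \<Rightarrow> (nat \<Rightarrow> nat \<Rightarrow> 'g \<Rightarrow> complex) \<Rightarrow> ns_number" where
  "upper_novikov_shubin G r s A =
     (let F = spectral_distribution G r s A in
      if \<exists>l>0. F l = F 0 then Infinity_plus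
      else NS_val (Limsup (at_right 0) (\<lambda>l. ereal (ln (F l - F 0) / ln l))))"

definition lower_novikov_shubin ::
    "('g, 'm) monoid_scheme \<Rightarrow> nat \<Rightarrow> nat \<Rightarrow> (nat \<Rightarrow> nat \<Rightarrow> 'g \<Rightarrow> complex) \<Rightarrow> ns_number" where
  "lower_novikov_shubin G r s A =
     (let F = spectral_distribution G r s A in
      if \<exists>l>0. F l = F 0 then Infinity_plus
      else NS_val (Liminf (at_right 0) (\<lambda>l. ereal (ln (F l - F 0) / ln l))))"

text \<open>The common value; unspecified if the upper and the lower number differ.\<close>

definition novikov_shubin ::
    "('g, 'm) monoid_scheme \<Rightarrow> nat \<Rightarrow> nat \<Rightarrow> (nat \<Rightarrow> nat \<Rightarrow> 'g \<Rightarrow> complex) \<Rightarrow> ns_number" where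
  "novikov_shubin G r s A =
     (THE a. upper_novikov_shubin G r s A = a \<and> lower_novikov_shubin G r s A = a)"

section \<open>Alpha numbers\<close>

definition finite_index_normal :: "('g, 'm) monoid_scheme \<Rightarrow> 'g set set" where
  "finite_index_normal G = {H. H \<lhd> G \<and> finite (rcosets\<^bsub>G\<^esub> H)}"

text \<open>The entrywise image of a matrix under the projection of \<open>G\<close> onto a quotient whose elements
  are cosets \<open>C\<close>.\<close>

definition quotient_mat ::
    "(nat \<Rightarrow> nat \<Rightarrow> 'g \<Rightarrow> complex) \<Rightarrow> nat \<Rightarrow> nat \<Rightarrow> 'g set \<Rightarrow> complex" where
  "quotient_mat A i j C = (\<Sum>g | g \<in> C \<and> A i j g \<noteq> 0. A i j g)"

text \<open>The complex matrix of \<open>x \<mapsto> x B\<close> for a finite group \<open>Q\<close> of order \<open>n\<close>, in the bases of group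
  elements: \<open>(i, g)\<close> is sent to the sum over \<open>j\<close> and \<open>h\<close> of \<open>B i j (g\<^sup>-\<^sup>1 h)\<close> times \<open>(j, h)\<close>.
  The pair of \<open>i\<close> and the \<open>k\<close>-th group element has position \<open>i * n + k\<close>.\<close>

definition regular_mat ::
    "('q, 'm) monoid_scheme \<Rightarrow> nat \<Rightarrow> nat \<Rightarrow> (nat \<Rightarrow> nat \<Rightarrow> 'q \<Rightarrow> complex) \<Rightarrow> complex mat" where
  "regular_mat Q r s B =
     (let n = card (carrier Q); e = (SOME e. bij_betw e {..<n} (carrier Q)) in
      mat (r * n) (s * n)
        (\<lambda>(a, b). B (a div n) (b div n) (inv\<^bsub>Q\<^esub> (e (a mod n)) \<otimes>\<^bsub>Q\<^esub> e (b mod n))))"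

definition positive_singular_values :: "complex mat \<Rightarrow> real set" where
  "positive_singular_values M =
     {\<sigma>. \<sigma> > 0 \<and> eigenvalue (M * mat_adjoint M) (complex_of_real (\<sigma>\<^sup>2))}"

definition sigma_plus :: "complex mat \<Rightarrow> real" where
  "sigma_plus M = Min (positive_singular_values M)"

definition mult_plus :: "complex mat \<Rightarrow> nat" where
  "mult_plus M = kernel_dim (char_matrix (M * mat_adjoint M) (complex_of_real ((sigma_plus M)\<^sup>2)))"

text \<open>The alpha number of the image of \<open>A\<close> over the quotient of \<open>G\<close> by \<open>H\<close>; meaningless if this
  image vanishes.\<close>

definition alpha_number ::
    "('g, 'm) monoid_scheme \<Rightarrow> nat \<Rightarrow> nat \<Rightarrow> (nat \<Rightarrow> nat \<Rightarrow> 'g \<Rightarrow> complex) \<Rightarrow> 'g set \<Rightarrow> real" where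
  "alpha_number G r s A H =
     (let M = regular_mat (G Mod H) r s (quotient_mat A) in
      ln (real (mult_plus M) / real (card (rcosets\<^bsub>G\<^esub> H))) / ln (sigma_plus M))"

text \<open>The upper limit of a real-valued net indexed by a family of sets, which is directed by
  reverse inclusion.\<close>

definition net_limsup :: "'g set set \<Rightarrow> ('g set \<Rightarrow> real) \<Rightarrow> ereal" where
  "net_limsup \<F> f = (INF H\<in>\<F>. SUP K\<in>{K \<in> \<F>. K \<subseteq> H}. ereal (f K))"

end

theory Submission
  imports Defs "HOL-Probability.Probability" "Jordan_Normal_Form.Jordan_Normal_Form_Existence"
begin

text \<open>Only the linear algebra over the virtually cyclic group \<open>G\<close> matters.  Suppose \<open>G\<close> is infinite,
  with an infinite cyclic subgroup \<open>Z\<close> of index \<open>m\<close>.  Inducing the characters \<open>z \<in> S\<^sup>1\<close> of \<open>Z\<close> to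
  \<open>G\<close> turns \<open>A A\<^sup>*\<close> into a family of positive semidefinite matrices of size \<open>r m\<close> that is polynomial
  in \<open>z\<close> and \<open>z\<^sup>-\<^sup>1\<close>, with eigenvalue lists \<open>ev z\<close>.  All moments of the spectral measure of \<open>A A\<^sup>*\<close>
  are averages of power sums of \<open>ev z\<close> over the circle, so \<open>F\<^sub>A(\<lambda>) - F\<^sub>A(0)\<close> is, up to the factor
  \<open>1 / m\<close>, the average number of eigenvalues in the interval from \<open>0\<close> (excluded) to \<open>\<lambda>\<^sup>2\<close>.  For the quotient by
  \<open>n Z\<close>, if normal, the eigenvalues of \<open>A\<^sub>i A\<^sub>i\<^sup>*\<close> are those in the lists \<open>ev z\<close> for the \<open>n\<close>-th roots of unity \<open>z\<close>.

  Comparing orders of zeros of the first two nonzero coefficients of the characteristic polynomial,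
  either the positive eigenvalues are bounded away from \<open>0\<close>, or there are a finite set \<open>W\<close> on the
  circle and \<open>k \<ge> 1\<close> such that they are at least \<open>c dist(z, W) ^ k\<close>, with the matching upper bound
  near one point of \<open>W\<close>.  In the second case the Novikov-Shubin number is \<open>2 / k\<close>.  Since some
  \<open>n\<close>-th root of unity lies within \<open>2 \<pi> / n\<close> of that point without being equal to it, the alpha numbers
  are at most \<open>2 / k + o(1)\<close>.  Conversely, there are arbitrarily divisible \<open>n\<close> for which no \<open>n\<close>-th root
  of unity outside \<open>W\<close> is closer to \<open>W\<close> than a constant over \<open>n\<close>; for these the alpha
  number is at least \<open>2 / k - o(1)\<close>.\<close>

section \<open>The Hausdorff moment problem on an interval\<close>


text \<open>\<open>spectral_projection\<close> is a choice among families that are tied to the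
  operator only through quadratic forms. So such a family must be constructed for a positive
  operator, and every other one must be shown to agree with it on half-lines; both reduce to
  existence and uniqueness of measures with given moments on a bounded interval. Moments also
  replace continuous branches of eigenvalues and decompositions of representations: traces of powers
  depend on characters only. And if p is the lowest nonzero coefficient of the characteristic
  polynomial and q the next one, then |q / p| is the sum of the reciprocals of the positive
  eigenvalues wherever p is nonzero, hence comparable to the reciprocal of the smallest. The
  exponent 2 / k arises twice: dist^k \<le> \<lambda>^2 cuts out arcs of length of order
  \<lambda>^(2 / k), and a smallest singular value of order n^(-k / 2) with bounded multiplicity has
  log(1 / n) / log(n^(-k / 2)) = 2 / k. An n-th root of unity may come much closer to a point of W
  than 1 / n, which lowers the alpha number; therefore only an upper limit can be expected.\<close>

lemma binomial_falling_factorial: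
  fixes N k j :: nat
  assumes "j \<le> N" "k \<le> N"
  shows "real (N choose k) * (\<Prod>i<j. real k - real i)
       = (\<Prod>i<j. real N - real i) * (if j \<le> k then real ((N - j) choose (k - j)) else 0)"
  using assms
proof (induction j)
  case (Suc j)
  then have IH: "real (N choose k) * (\<Prod>i<j. real k - real i)
       = (\<Prod>i<j. real N - real i) * (if j \<le> k then real ((N - j) choose (k - j)) else 0)" by simp
  consider "k < j" | "k = j" | "Suc j \<le> k" by linarith
  then show ?case
  proof cases
    case 1
    then have "(\<Prod>i<j. real k - real i) = 0" by auto
    then show ?thesis using 1 by simp
  next
    case 2
    then show ?thesis by simp
  next
    case 3
    then obtain a where a: "k - j = Suc a" by (metis Suc_diff_Suc Suc_le_lessD)
    have "Suc a * ((N - j) choose Suc a) = (N - j) * ((N - j - 1) choose a)"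
      by (rule binomial_absorption)
    then have "real (k - j) * real ((N - j) choose (k - j)) = real (N - j) * real ((N - Suc j) choose (k - Suc j))"
      using a by (metis Suc_eq_plus1 diff_Suc_1 diff_diff_left of_nat_mult)
    then have ab: "(real k - real j) * real ((N - j) choose (k - j)) = (real N - real j) * real ((N - Suc j) choose (k - Suc j))"
      using 3 Suc.prems by (simp add: of_nat_diff)
    have "real (N choose k) * (\<Prod>i<Suc j. real k - real i) = (real k - real j) * (real (N choose k) * (\<Prod>i<j. real k - real i))"
      by simp
    also have "\<dots> = (\<Prod>i<j. real N - real i) * ((real k - real j) * real ((N - j) choose (k - j)))"
      using 3 IH by simp
    finally show ?thesis using 3 ab by simp
  qed
qed simp

text \<open>Think of \<open>d k j\<close> as the integral of t^k (1 - t)^j. The recursion is then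
  t^k (1 - t)^(j + 1) = t^k (1 - t)^j - t^(k + 1) (1 - t)^j, and the claim expands 1 = (t + (1 -
  t))^n inside the integral of t^j (1 - t)^l.\<close>

lemma difference_binomial_sum:
  fixes d :: "nat \<Rightarrow> nat \<Rightarrow> real"
  assumes d: "\<And>k j. d k (Suc j) = d k j - d (Suc k) j"
  shows "(\<Sum>i\<le>n. real (n choose i) * d (j + i) (n - i + l)) = d j l"
proof (induction n arbitrary: j l)
  case (Suc n)
  have "(\<Sum>i\<le>Suc n. real (Suc n choose i) * d (j + i) (Suc n - i + l))
    = d j (Suc n + l) + (\<Sum>i\<le>n. real (Suc n choose Suc i) * d (j + Suc i) (n - i + l))"
    by (subst sum.atMost_Suc_shift) simp
  also have "(\<Sum>i\<le>n. real (Suc n choose Suc i) * d (j + Suc i) (n - i + l))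
     = (\<Sum>i\<le>n. real (n choose i) * d (Suc j + i) (n - i + l)) + (\<Sum>i\<le>n. real (n choose Suc i) * d (j + Suc i) (n - i + l))"
    unfolding sum.distrib[symmetric] by (intro sum.cong refl) (simp add: algebra_simps)
  also have "(\<Sum>i\<le>n. real (n choose i) * d (Suc j + i) (n - i + l)) = d (Suc j) l" by (rule Suc)
  also have "d j (Suc n + l) + (d (Suc j) l + (\<Sum>i\<le>n. real (n choose Suc i) * d (j + Suc i) (n - i + l)))
    = d (Suc j) l + (\<Sum>i\<le>Suc n. real (n choose i) * d (j + i) (Suc n - i + l))"
    by (subst sum.atMost_Suc_shift[of _ n]) simp
  also have "(\<Sum>i\<le>Suc n. real (n choose i) * d (j + i) (Suc n - i + l)) = (\<Sum>i\<le>n. real (n choose i) * d (j + i) (n - i + Suc l))"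
    by (simp add: Suc_diff_le)
  also have "\<dots> = d j (Suc l)" by (rule Suc)
  finally show ?case by (simp add: d)
qed simp

text \<open>These are the weights of Bernstein's approximation, with mass (N choose k)
  \<open>d k (N - k)\<close> at k / N. Their normalized factorial moments are exact for every N, so
  only the passage from factorial to ordinary powers costs an error.\<close>

lemma difference_falling_factorial_sum:
  fixes d :: "nat \<Rightarrow> nat \<Rightarrow> real"
  assumes d: "\<And>k j. d k (Suc j) = d k j - d (Suc k) j" and j: "j \<le> N"
  shows "(\<Sum>k\<le>N. real (N choose k) * d k (N - k) * (\<Prod>i<j. (real k - real i) / (real N - real i))) = d j 0"
proof -
  have nz: "(\<Prod>i<j. real N - real i) \<noteq> 0" using j by auto
  have "(\<Sum>k\<le>N. real (N choose k) * d k (N - k) * (\<Prod>i<j. (real k - real i) / (real N - real i)))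
     = (\<Sum>k\<le>N. (if j \<le> k then real ((N - j) choose (k - j)) else 0) * d k (N - k))"
    using binomial_falling_factorial[OF j] nz
    by (intro sum.cong refl) (auto simp: prod_dividef field_simps)
  also have "\<dots> = (\<Sum>k\<in>{j..N}. real ((N - j) choose (k - j)) * d k (N - k))"
    by (rule sum.mono_neutral_cong_right) auto
  also have "\<dots> = (\<Sum>i\<le>N - j. real ((N - j) choose i) * d (j + i) ((N - j) - i + 0))"
    by (rule sum.reindex_bij_witness[where i="\<lambda>i. i + j" and j="\<lambda>k. k - j"]) (use j in \<open>auto simp: add.commute\<close>)
  also have "\<dots> = d j 0" using difference_binomial_sum[where d=d and j=j and n="N - j" and l=0] d by simp
  finally show ?thesis .
qed

text \<open>The hypothesis \<open>2 * j < N\<close> keeps every factor in [-1, 1], also the negative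
  ones with k < i, so the difference of the products is at most the sum of the differences of the
  factors.\<close>

lemma falling_factorial_ratio_close:
  fixes N k j :: nat
  assumes "2 * j < N" "k \<le> N"
  shows "\<bar>(\<Prod>i<j. (real k - real i) / (real N - real i)) - (real k / real N) ^ j\<bar> \<le> real j * (real j / (real N - real j))"
proof -
  have "norm ((\<Prod>i<j. (real k - real i) / (real N - real i)) - (\<Prod>i<j. real k / real N))
     \<le> (\<Sum>i<j. norm ((real k - real i) / (real N - real i) - real k / real N))"
    by (rule norm_prod_diff) (use assms in \<open>auto simp: divide_simps\<close>)
  also have "\<dots> \<le> (\<Sum>i<j. real j / (real N - real j))"
  proof (rule sum_mono)
    fix i assume "i \<in> {..<j}"
    then have i: "i < j" by simp
    have N: "real N > 0" "real N - real i > 0" using assms i by auto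
    have "(real k - real i) / (real N - real i) - real k / real N = - (real i * ((real N - real k) / (real N * (real N - real i))))"
      using N by (simp add: field_simps)
    then have "norm ((real k - real i) / (real N - real i) - real k / real N) = real i * ((real N - real k) / (real N * (real N - real i)))"
      using N assms(2) by simp
    also have "\<dots> \<le> real i * (real N / (real N * (real N - real i)))"
      using N by (intro mult_left_mono divide_right_mono) auto
    also have "\<dots> = real i / (real N - real i)" using N by simp
    also have "\<dots> \<le> real j / (real N - real j)" using i assms by (intro frac_le) auto
    finally show "norm ((real k - real i) / (real N - real i) - real k / real N) \<le> real j / (real N - real j)" .
  qed
  finally show ?thesis by simp
qed

text \<open>Bernstein's laws on the grid k / N all live on [0, 1], so they are tight and a
  subsequence converges weakly. Moments pass to the limit because powers agree on [0, 1] with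
  bounded continuous functions.\<close>

theorem hausdorff_moment_prob:
  fixes d :: "nat \<Rightarrow> nat \<Rightarrow> real"
  assumes d: "\<And>k j. d k (Suc j) = d k j - d (Suc k) j" and nonneg: "\<And>k j. 0 \<le> d k j" and d1: "d 0 0 = 1"
  obtains \<mu> :: "real measure" where "real_distribution \<mu>" "AE t in \<mu>. 0 \<le> t \<and> t \<le> 1"
    "\<And>n. (\<integral>t. t ^ n \<partial>\<mu>) = d n 0"
proof -
  define w where "w N k = (if k \<le> N then real (N choose k) * d k (N - k) else 0)" for N k
  have w0: "0 \<le> w N k" for N k using nonneg by (simp add: w_def)
  have sumw: "(\<Sum>k\<le>N. w N k) = 1" for N
    using difference_falling_factorial_sum[of d 0 N] d d1 by (simp add: w_def)
  have nnw: "(\<integral>\<^sup>+ k. ennreal (w N k) \<partial>count_space UNIV) = 1" for N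
  proof -
    have "(\<integral>\<^sup>+ k. ennreal (w N k) \<partial>count_space UNIV) = (\<Sum>k\<le>N. ennreal (w N k))"
      by (rule nn_integral_count_space') (auto simp: w_def)
    also have "\<dots> = 1" using w0 sumw by (simp add: sum_ennreal)
    finally show ?thesis .
  qed
  define p where "p N = embed_pmf (w N)" for N
  have pmfp: "pmf (p N) k = w N k" for N k
    unfolding p_def by (rule pmf_embed_pmf) (use w0 nnw in auto)
  have setp: "set_pmf (p N) \<subseteq> {..N}" for N by (auto simp: set_pmf_iff pmfp w_def split: if_splits)
  define \<nu> where "\<nu> N = distr (measure_pmf (p N)) borel (\<lambda>k. real k / real N)" for N
  have rd: "real_distribution (\<nu> N)" for N
    unfolding \<nu>_def by (intro prob_space.real_distribution_distr) (auto simp: measure_pmf.prob_space_axioms)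
  have int\<nu>: "(\<integral>t. f t \<partial>\<nu> N) = (\<Sum>k\<le>N. w N k * f (real k / real N))" if "f \<in> borel_measurable borel" for f :: "real \<Rightarrow> real" and N
  proof -
    have "(\<integral>t. f t \<partial>\<nu> N) = measure_pmf.expectation (p N) (\<lambda>k. f (real k / real N))"
      unfolding \<nu>_def by (rule integral_distr) (use that in auto)
    also have "\<dots> = (\<Sum>k\<le>N. f (real k / real N) * pmf (p N) k)"
      by (rule integral_measure_pmf_real) (use setp in blast)+
    finally show ?thesis by (simp add: pmfp mult.commute)
  qed
  have "tight \<nu>"
    unfolding tight_def
  proof safe
    fix \<epsilon> :: real assume "\<epsilon> > 0"
    \<comment> \<open>Tightness is stated with half-open intervals; starting at -1 keeps an atom at
      0 inside. For N = 0 division by zero puts all mass at 0.\<close>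
    have "measure (\<nu> N) {-1<..1} = 1" for N
    proof -
      have "measure (\<nu> N) {-1<..1} = measure (measure_pmf (p N)) ((\<lambda>k. real k / real N) -` {-1<..1})"
        unfolding \<nu>_def by (subst measure_distr) auto
      also have "\<dots> = 1"
      proof -
        have "-1 < real k / real N \<and> real k / real N \<le> 1" if "k \<in> set_pmf (p N)" for k
        proof -
          have "0 \<le> real k / real N" by simp
          moreover have "real k / real N \<le> 1" using setp[of N] that by (cases "N = 0") (auto simp: field_simps)
          ultimately show ?thesis by linarith
        qed
        then show ?thesis by (subst measure_pmf.prob_eq_1) (auto simp: AE_measure_pmf_iff)
      qed
      finally show ?thesis .
    qed
    then show "\<exists>a b. a < b \<and> (\<forall>n. 1 - \<epsilon> < measure (\<nu> n) {a<..b})"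
      using \<open>\<epsilon> > 0\<close> by (intro exI[of _ "-1"] exI[of _ 1]) auto
  qed (rule rd)
  from tight_imp_convergent_subsubsequence[OF this strict_mono_id]
  obtain r \<mu> where r: "strict_mono (r :: nat \<Rightarrow> nat)" and \<mu>: "real_distribution \<mu>" and wc: "weak_conv_m (\<nu> \<circ> r) \<mu>"
    by auto
  interpret \<mu>: real_distribution \<mu> by fact
  have conv: "(\<lambda>n. \<Sum>k\<le>r n. w (r n) k * f (real k / real (r n))) \<longlonglongrightarrow> (\<integral>t. f t \<partial>\<mu>)"
    if "continuous_on UNIV f" "\<And>t. \<bar>f t\<bar> \<le> 1" for f :: "real \<Rightarrow> real"
  proof -
    have "(\<lambda>n. integral\<^sup>L ((\<nu> \<circ> r) n) f) \<longlonglongrightarrow> integral\<^sup>L \<mu> f"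
      by (rule weak_conv_imp_integral_bdd_continuous_conv[where B=1])
         (use rd \<mu> wc that in \<open>auto simp: continuous_on_eq_continuous_at comp_def\<close>)
    then show ?thesis using int\<nu>[OF borel_measurable_continuous_onI[OF that(1)]] by simp
  qed
  have AE: "AE t in \<mu>. 0 \<le> t \<and> t \<le> 1"
  proof -
    \<comment> \<open>\<open>f\<close> is bounded, continuous and zero exactly on [0, 1]; its
      integral vanishes for all approximating laws, hence for the limit.\<close>
    define f where "f t = min 1 (max 0 (max (- t) (t - 1)))" for t :: real
    have cf: "continuous_on UNIV f" unfolding f_def by (intro continuous_intros)
    have [measurable]: "f \<in> borel_measurable borel" by (rule borel_measurable_continuous_onI[OF cf])
    have fb: "\<bar>f t\<bar> \<le> 1" "0 \<le> f t" for t by (auto simp: f_def)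
    have "f (real k / real N) = 0" if "k \<le> N" for k N
      using that by (cases "N = 0") (auto simp: f_def)
    then have "(\<lambda>n. \<Sum>k\<le>r n. w (r n) k * f (real k / real (r n))) = (\<lambda>_. 0)" by auto
    then have "(\<integral>t. f t \<partial>\<mu>) = 0" using conv[OF cf fb(1)] by (simp add: LIMSEQ_const_iff)
    moreover have "integrable \<mu> f"
      by (rule \<mu>.integrable_const_bound[where B=1]) (use fb in auto)
    ultimately have "AE t in \<mu>. f t = 0" using fb by (subst (asm) integral_nonneg_eq_0_iff_AE) auto
    then show ?thesis by eventually_elim (auto simp: f_def min_def max_def split: if_splits)
  qed
  have "(\<integral>t. t ^ j \<partial>\<mu>) = d j 0" for j
  proof -
    \<comment> \<open>Weak convergence asks for bounded test functions, so the power is truncated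
      outside [0, 1].\<close>
    define f where "f t = (max 0 (min 1 t)) ^ j" for t :: real
    have cf: "continuous_on UNIV f" unfolding f_def by (intro continuous_intros)
    have [measurable]: "f \<in> borel_measurable borel" by (rule borel_measurable_continuous_onI[OF cf])
    have fb: "\<bar>f t\<bar> \<le> 1" for t by (auto simp: f_def power_le_one)
    have fk: "f (real k / real N) = (real k / real N) ^ j" if "k \<le> N" for k N
      using that by (cases "N = 0") (auto simp: f_def)
    have lim: "(\<lambda>N. \<Sum>k\<le>N. w N k * f (real k / real N)) \<longlonglongrightarrow> d j 0"
    proof (rule LIM_zero_cancel, rule Lim_null_comparison)
      show "\<forall>\<^sub>F N in sequentially. norm ((\<Sum>k\<le>N. w N k * f (real k / real N)) - d j 0) \<le> real j * (real j / (real N - real j))"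
        using eventually_gt_at_top[of "2 * j"]
      proof eventually_elim
        case (elim N)
        have "d j 0 = (\<Sum>k\<le>N. w N k * (\<Prod>i<j. (real k - real i) / (real N - real i)))"
          using difference_falling_factorial_sum[of d j N] d elim by (simp add: w_def)
        then have "norm ((\<Sum>k\<le>N. w N k * f (real k / real N)) - d j 0)
          = norm (\<Sum>k\<le>N. w N k * ((real k / real N) ^ j - (\<Prod>i<j. (real k - real i) / (real N - real i))))"
          by (simp only: right_diff_distrib sum_subtractf) (simp add: fk)
        also have "\<dots> \<le> (\<Sum>k\<le>N. w N k * (real j * (real j / (real N - real j))))"
        proof (rule sum_norm_le)
          fix k assume "k \<in> {..N}"
          then have "\<bar>(real k / real N) ^ j - (\<Prod>i<j. (real k - real i) / (real N - real i))\<bar> \<le> real j * (real j / (real N - real j))"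
            using falling_factorial_ratio_close[OF elim, of k] by (simp add: abs_minus_commute)
          then show "norm (w N k * ((real k / real N) ^ j - (\<Prod>i<j. (real k - real i) / (real N - real i))))
            \<le> w N k * (real j * (real j / (real N - real j)))"
            unfolding real_norm_def abs_mult abs_of_nonneg[OF w0] by (rule mult_left_mono[OF _ w0])
        qed
        also have "\<dots> = real j * (real j / (real N - real j))"
          by (simp only: sum_distrib_right[symmetric] sumw mult_1_left)
        finally show ?case .
      qed
      show "(\<lambda>N. real j * (real j / (real N - real j))) \<longlonglongrightarrow> 0"
      proof -
        have "filterlim (\<lambda>N. - real j + real N) at_top sequentially"
          by (rule filterlim_tendsto_add_at_top[OF tendsto_const filterlim_real_sequentially])
        then have "filterlim (\<lambda>N. real N - real j) at_infinity sequentially"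
          by (intro filterlim_at_top_imp_at_infinity) (simp add: algebra_simps)
        then show ?thesis by (intro tendsto_mult_right_zero tendsto_divide_0[OF tendsto_const])
      qed
    qed
    have "(\<integral>t. f t \<partial>\<mu>) = d j 0"
      by (rule LIMSEQ_unique[OF conv[OF cf fb] LIMSEQ_subseq_LIMSEQ[OF lim r, unfolded comp_def]])
    moreover have "(\<integral>t. t ^ j \<partial>\<mu>) = (\<integral>t. f t \<partial>\<mu>)"
    proof (rule integral_cong_AE)
      show "AE t in \<mu>. t ^ j = f t" using AE by eventually_elim (simp add: f_def)
    qed auto
    ultimately show ?thesis by simp
  qed
  with that \<mu> AE show ?thesis by blast
qed


text \<open>Complex coefficients and densities \<open>g j\<close> are allowed so that linearity,
  symmetry, idempotence and commutation of spectral projections all become instances. The proof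
  climbs from polynomials to continuous functions (Weierstrass), to half-lines (bounded limits) and
  to Borel sets (Dynkin systems).\<close>

lemma moment_combination_zero:
  fixes c :: "'j \<Rightarrow> complex" and \<mu> :: "'j \<Rightarrow> real measure" and g :: "'j \<Rightarrow> real \<Rightarrow> real"
  assumes J: "finite J"
    and fm: "\<And>j. j \<in> J \<Longrightarrow> finite_measure (\<mu> j)"
    and sets: "\<And>j. j \<in> J \<Longrightarrow> sets (\<mu> j) = sets borel"
    and AE: "\<And>j. j \<in> J \<Longrightarrow> AE t in \<mu> j. 0 \<le> t \<and> t \<le> M"
    and meas: "\<And>j. j \<in> J \<Longrightarrow> g j \<in> borel_measurable borel"
    and bound: "\<And>j t. j \<in> J \<Longrightarrow> 0 \<le> t \<Longrightarrow> t \<le> M \<Longrightarrow> \<bar>g j t\<bar> \<le> K"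
    and mom: "\<And>n. (\<Sum>j\<in>J. c j * complex_of_real (\<integral>t. t ^ n * g j t \<partial>\<mu> j)) = 0"
    and C: "C \<in> sets borel"
  shows "(\<Sum>j\<in>J. c j * complex_of_real (\<integral>t. indicator C t * g j t \<partial>\<mu> j)) = 0"
proof -
  define \<Lambda> where "\<Lambda> f = (\<Sum>j\<in>J. c j * complex_of_real (\<integral>t. f t * g j t \<partial>\<mu> j))" for f :: "real \<Rightarrow> real"
  have measj: "f \<in> borel_measurable (\<mu> j)" if "j \<in> J" "f \<in> borel_measurable borel" for j and f :: "real \<Rightarrow> real"
    by (subst measurable_cong_sets[OF sets[OF that(1)] refl]) (rule that(2))
  have AEb: "AE t in \<mu> j. \<bar>f t * g j t\<bar> \<le> B * \<bar>K\<bar>"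
    if "j \<in> J" "\<And>t. 0 \<le> t \<Longrightarrow> t \<le> M \<Longrightarrow> \<bar>f t\<bar> \<le> B" for j and f :: "real \<Rightarrow> real" and B
    using AE[OF that(1)]
  proof eventually_elim
    case (elim t)
    then have "\<bar>f t\<bar> \<le> B" "\<bar>g j t\<bar> \<le> \<bar>K\<bar>" using that(2)[of t] bound[OF that(1), of t] by auto
    then show ?case unfolding abs_mult by (intro mult_mono) auto
  qed
  have intb: "integrable (\<mu> j) (\<lambda>t. f t * g j t)"
    if "j \<in> J" "f \<in> borel_measurable borel" "\<And>t. 0 \<le> t \<Longrightarrow> t \<le> M \<Longrightarrow> \<bar>f t\<bar> \<le> B" for j and f :: "real \<Rightarrow> real" and B
    using AEb[OF that(1,3)] measj[OF that(1) that(2)] measj[OF that(1) meas[OF that(1)]]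
    by (intro finite_measure.integrable_const_bound[OF fm[OF that(1)], where B="B * \<bar>K\<bar>"]) auto
  have intc: "integrable (\<mu> j) (\<lambda>t. f t * g j t)" if "j \<in> J" "continuous_on UNIV f" for j f
  proof -
    have "bounded (f ` {0..M})" by (intro compact_imp_bounded compact_continuous_image continuous_on_subset[OF that(2)]) auto
    then obtain B where "\<And>t. 0 \<le> t \<Longrightarrow> t \<le> M \<Longrightarrow> \<bar>f t\<bar> \<le> B" unfolding bounded_iff by force
    then show ?thesis by (rule intb[OF that(1) borel_measurable_continuous_onI[OF that(2)]])
  qed
  have poly: "\<Lambda> (\<lambda>t. \<Sum>i\<le>n. a i * t ^ i) = 0" for a :: "nat \<Rightarrow> real" and n
  proof -
    have "(\<integral>t. (\<Sum>i\<le>n. a i * t ^ i) * g j t \<partial>\<mu> j) = (\<Sum>i\<le>n. a i * (\<integral>t. t ^ i * g j t \<partial>\<mu> j))" if "j \<in> J" for j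
    proof -
      have "(\<integral>t. (\<Sum>i\<le>n. a i * t ^ i) * g j t \<partial>\<mu> j) = (\<integral>t. (\<Sum>i\<le>n. a i * (t ^ i * g j t)) \<partial>\<mu> j)"
        by (simp add: sum_distrib_right mult.assoc)
      also have "\<dots> = (\<Sum>i\<le>n. \<integral>t. a i * (t ^ i * g j t) \<partial>\<mu> j)"
        by (rule Bochner_Integration.integral_sum) (auto intro!: integrable_mult_right intc[OF that] continuous_intros)
      finally show ?thesis by simp
    qed
    then have "\<Lambda> (\<lambda>t. \<Sum>i\<le>n. a i * t ^ i) = (\<Sum>j\<in>J. c j * (\<Sum>i\<le>n. complex_of_real (a i) * complex_of_real (\<integral>t. t ^ i * g j t \<partial>\<mu> j)))"
      unfolding \<Lambda>_def by (intro sum.cong) auto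
    also have "\<dots> = (\<Sum>i\<le>n. complex_of_real (a i) * (\<Sum>j\<in>J. c j * complex_of_real (\<integral>t. t ^ i * g j t \<partial>\<mu> j)))"
      unfolding sum_distrib_left by (subst sum.swap) (simp add: mult_ac)
    finally show ?thesis by (simp add: mom)
  qed
  have cont: "\<Lambda> f = 0" if f: "continuous_on UNIV f" for f
  proof -
    define D where "D = (\<Sum>j\<in>J. cmod (c j) * (\<bar>K\<bar> * measure (\<mu> j) (space (\<mu> j))))"
    have "cmod (\<Lambda> f) \<le> e * D" if e: "e > 0" for e
    proof -
      obtain p where p: "real_polynomial_function p" "\<And>t. t \<in> {0..M} \<Longrightarrow> \<bar>f t - p t\<bar> < e"
        by (rule Stone_Weierstrass_real_polynomial_function[OF compact_Icc continuous_on_subset[OF f subset_UNIV] e]) blast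
      then obtain a n where pa: "p = (\<lambda>t. \<Sum>i\<le>n. a i * t ^ i)"
        using real_polynomial_function_iff_sum by blast
      have cp: "continuous_on UNIV p" unfolding pa by (intro continuous_intros)
      have "\<Lambda> f = \<Lambda> f - \<Lambda> p" using poly pa by simp
      also have "\<dots> = (\<Sum>j\<in>J. c j * complex_of_real (\<integral>t. (f t - p t) * g j t \<partial>\<mu> j))"
      proof -
        have "(\<integral>t. (f t - p t) * g j t \<partial>\<mu> j) = (\<integral>t. f t * g j t \<partial>\<mu> j) - (\<integral>t. p t * g j t \<partial>\<mu> j)" if "j \<in> J" for j
          unfolding left_diff_distrib by (rule Bochner_Integration.integral_diff) (use intc[OF that] f cp in auto)
        then show ?thesis unfolding \<Lambda>_def sum_subtractf[symmetric]
          by (intro sum.cong refl) (simp add: right_diff_distrib)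
      qed
      also have "cmod \<dots> \<le> (\<Sum>j\<in>J. cmod (c j) * (e * \<bar>K\<bar> * measure (\<mu> j) (space (\<mu> j))))"
      proof (rule sum_norm_le)
        fix j assume j: "j \<in> J"
        interpret finite_measure "\<mu> j" by (rule fm[OF j])
        have b: "\<And>t. 0 \<le> t \<Longrightarrow> t \<le> M \<Longrightarrow> \<bar>f t - p t\<bar> \<le> e" using p(2) by force
        have "integrable (\<mu> j) (\<lambda>t. (f t - p t) * g j t)"
          by (rule intc[OF j]) (intro continuous_intros f cp)
        then have "(\<integral>t. norm ((f t - p t) * g j t) \<partial>\<mu> j) \<le> (\<integral>t. e * \<bar>K\<bar> \<partial>\<mu> j)"
          using AEb[OF j, of "\<lambda>t. f t - p t" e] b by (intro integral_mono_AE) simp_all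
        then have "norm (\<integral>t. (f t - p t) * g j t \<partial>\<mu> j) \<le> (\<integral>t. e * \<bar>K\<bar> \<partial>\<mu> j)"
          by (rule order_trans[OF integral_norm_bound])
        then show "cmod (c j * complex_of_real (\<integral>t. (f t - p t) * g j t \<partial>\<mu> j)) \<le> cmod (c j) * (e * \<bar>K\<bar> * measure (\<mu> j) (space (\<mu> j)))"
          unfolding norm_mult by (intro mult_left_mono) (auto simp: mult_ac)
      qed
      also have "\<dots> = e * D" unfolding D_def sum_distrib_left by (intro sum.cong refl) (simp add: mult_ac)
      finally show ?thesis .
    qed
    note * = this
    have "D \<ge> 0" unfolding D_def by (intro sum_nonneg mult_nonneg_nonneg) auto
    show ?thesis
    proof (rule ccontr)
      assume "\<Lambda> f \<noteq> 0"
      then have pos: "cmod (\<Lambda> f) > 0" by simp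
      have "cmod (\<Lambda> f) \<le> cmod (\<Lambda> f) / (2 * (D + 1)) * D" using *[of "cmod (\<Lambda> f) / (2 * (D + 1))"] pos \<open>D \<ge> 0\<close> by simp
      also have "\<dots> = cmod (\<Lambda> f) * (D / (2 * (D + 1)))" by simp
      also have "\<dots> < cmod (\<Lambda> f) * 1" using pos \<open>D \<ge> 0\<close> by (intro mult_strict_left_mono) auto
      finally show False by simp
    qed
  qed
  have lim: "(\<lambda>n. \<Lambda> (F n)) \<longlonglongrightarrow> \<Lambda> f"
    if "\<And>n. F n \<in> borel_measurable borel" "f \<in> borel_measurable borel" "\<And>n t. \<bar>F n t\<bar> \<le> 1" "\<And>t. (\<lambda>n. F n t) \<longlonglongrightarrow> f t" for F f
    unfolding \<Lambda>_def
  proof (intro tendsto_sum tendsto_mult tendsto_const tendsto_of_real)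
    fix j assume j: "j \<in> J"
    interpret finite_measure "\<mu> j" by (rule fm[OF j])
    show "(\<lambda>n. \<integral>t. F n t * g j t \<partial>\<mu> j) \<longlonglongrightarrow> (\<integral>t. f t * g j t \<partial>\<mu> j)"
    proof (rule integral_dominated_convergence[where w="\<lambda>_. 1 * \<bar>K\<bar>"])
      show "AE t in \<mu> j. (\<lambda>n. F n t * g j t) \<longlonglongrightarrow> f t * g j t" by (intro AE_I2 tendsto_mult that(4) tendsto_const)
      show "AE t in \<mu> j. norm (F n t * g j t) \<le> 1 * \<bar>K\<bar>" for n using AEb[OF j, of "F n" 1] that(3) by simp
      show "(\<lambda>t. f t * g j t) \<in> borel_measurable (\<mu> j)"
        by (rule borel_measurable_times[OF measj[OF j that(2)] measj[OF j meas[OF j]]])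
      show "(\<lambda>t. F n t * g j t) \<in> borel_measurable (\<mu> j)" for n
        by (rule borel_measurable_times[OF measj[OF j that(1)] measj[OF j meas[OF j]]])
      show "integrable (\<mu> j) (\<lambda>_. 1 * \<bar>K\<bar>)" by simp
    qed
  qed
  have atMost: "\<Lambda> (indicator {..a}) = 0" for a
  proof -
    \<comment> \<open>Continuous ramps that start falling at a, with slope -n; they decrease to the
      indicator of the closed half-line.\<close>
    define F where "F n t = max 0 (1 - real n * max 0 (t - a))" for n t
    have cF: "continuous_on UNIV (F n)" for n unfolding F_def by (intro continuous_intros)
    have conv: "(\<lambda>n. F n t) \<longlonglongrightarrow> indicator {..a} t" for t
    proof (cases "t \<le> a")
      case True
      then show ?thesis by (simp add: F_def)
    next
      case False
      obtain N where N: "1 / (t - a) < real N" using reals_Archimedean2 by blast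
      have "\<forall>\<^sub>F n in sequentially. F n t = 0"
        using eventually_ge_at_top[of N]
      proof eventually_elim
        case (elim n)
        have "1 < real N * (t - a)" using N False by (simp add: field_simps)
        also have "\<dots> \<le> real n * (t - a)" using elim False by (intro mult_right_mono) auto
        finally show ?case using False by (simp add: F_def)
      qed
      then show ?thesis using False by (simp add: tendsto_eventually)
    qed
    have "(\<lambda>n. \<Lambda> (F n)) \<longlonglongrightarrow> \<Lambda> (indicator {..a})"
      by (rule lim) (auto simp: conv borel_measurable_continuous_onI[OF cF], auto simp: F_def)
    moreover have "\<Lambda> (F n) = 0" for n by (rule cont[OF cF])
    ultimately show ?thesis by (simp add: LIMSEQ_const_iff)
  qed
  have C': "C \<in> sigma_sets UNIV (range (\<lambda>a::real. {..a}))"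
    using C unfolding borel_eq_atMost by (simp add: sets_measure_of)
  have bor: "A \<in> sets borel" if "A \<in> sigma_sets UNIV (range (\<lambda>a::real. {..a}))" for A :: "real set"
    using that unfolding borel_eq_atMost by (simp add: sets_measure_of)
  have int_ind: "integrable (\<mu> j) (\<lambda>t. indicator A t * g j t)" if "j \<in> J" "A \<in> sets borel" for j A
    by (rule intb[OF that(1), where B=1]) (use that in \<open>auto simp: indicator_def\<close>)
  have "\<Lambda> (indicator C) = 0"
  proof (rule sigma_sets_induct_disjoint[OF _ _ C', where P="\<lambda>A. \<Lambda> (indicator A) = 0"])
    show "Int_stable (range (\<lambda>a::real. {..a}))"
      by (auto simp: Int_stable_def image_iff intro: exI[of _ "min _ _"])
  next
    fix A :: "real set" assume "A \<in> range atMost" then show "\<Lambda> (indicator A) = 0" using atMost by auto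
  next
    show "\<Lambda> (indicator {}) = 0" by (simp add: \<Lambda>_def)
  next
    fix A :: "real set" assume A: "A \<in> sigma_sets UNIV (range atMost)" and A0: "\<Lambda> (indicator A) = 0"
    have "\<Lambda> (indicator (UNIV - A)) = \<Lambda> (\<lambda>t. 1) - \<Lambda> (indicator A)"
    proof -
      have "(\<integral>t. indicator (UNIV - A) t * g j t \<partial>\<mu> j) = (\<integral>t. 1 * g j t \<partial>\<mu> j) - (\<integral>t. indicator A t * g j t \<partial>\<mu> j)" if "j \<in> J" for j
      proof -
        have "(\<integral>t. indicator (UNIV - A) t * g j t \<partial>\<mu> j) = (\<integral>t. 1 * g j t - indicator A t * g j t \<partial>\<mu> j)"
          by (intro Bochner_Integration.integral_cong refl) (auto simp: indicator_def)
        also have "\<dots> = (\<integral>t. 1 * g j t \<partial>\<mu> j) - (\<integral>t. indicator A t * g j t \<partial>\<mu> j)"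
          by (rule Bochner_Integration.integral_diff) (use int_ind[OF that bor[OF A]] int_ind[OF that, of UNIV] in auto)
        finally show ?thesis .
      qed
      then show ?thesis unfolding \<Lambda>_def sum_subtractf[symmetric] by (intro sum.cong refl) (simp add: right_diff_distrib)
    qed
    also have "\<Lambda> (\<lambda>t. 1) = 0" by (rule cont) auto
    finally show "\<Lambda> (indicator (UNIV - A)) = 0" using A0 by simp
  next
    fix A :: "nat \<Rightarrow> real set" assume dis: "disjoint_family A" and A: "range A \<subseteq> sigma_sets UNIV (range atMost)"
      and A0: "\<And>i. \<Lambda> (indicator (A i)) = 0"
    have Ab: "A i \<in> sets borel" for i using A bor by blast
    have ind: "indicator (\<Union>i<n. A i) t = (\<Sum>i<n. indicator (A i) t :: real)" for n t
      by (rule indicator_UN_disjoint) (use dis in \<open>auto simp: disjoint_family_on_def\<close>)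
    have "\<Lambda> (indicator (\<Union>i<n. A i)) = (\<Sum>i<n. \<Lambda> (indicator (A i)))" for n
    proof -
      have "(\<integral>t. indicator (\<Union>i<n. A i) t * g j t \<partial>\<mu> j) = (\<Sum>i<n. \<integral>t. indicator (A i) t * g j t \<partial>\<mu> j)" if "j \<in> J" for j
        unfolding ind sum_distrib_right by (rule Bochner_Integration.integral_sum) (use int_ind[OF that Ab] in auto)
      then show ?thesis unfolding \<Lambda>_def by (subst sum.swap) (simp add: sum_distrib_left)
    qed
    then have z: "\<Lambda> (indicator (\<Union>i<n. A i)) = 0" for n using A0 by simp
    have "(\<lambda>n. \<Lambda> (indicator (\<Union>i<n. A i))) \<longlonglongrightarrow> \<Lambda> (indicator (\<Union>i. A i))"
    proof (rule lim)
      show "(\<lambda>n. indicator (\<Union>i<n. A i) t :: real) \<longlonglongrightarrow> indicator (\<Union>i. A i) t" for t by (rule LIMSEQ_indicator_UN)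
    qed (use Ab in \<open>auto simp: indicator_def\<close>)
    then show "\<Lambda> (indicator (\<Union>i. A i)) = 0" using z by (simp add: LIMSEQ_const_iff)
  qed auto
  then show ?thesis by (simp add: \<Lambda>_def)
qed

section \<open>Square-summable functions and positive operators\<close>


text \<open>Vectors are bare functions constrained by membership in \<open>ell2 I\<close>. One
  operation with two scalars covers sums, differences and multiples, so linearity of a map is a
  single equation.\<close>

definition lincomb :: "complex \<Rightarrow> ('k \<Rightarrow> complex) \<Rightarrow> complex \<Rightarrow> ('k \<Rightarrow> complex) \<Rightarrow> 'k \<Rightarrow> complex" where
  "lincomb a x b y = (\<lambda>k. a * x k + b * y k)"

definition unit_vec_at :: "'k \<Rightarrow> 'k \<Rightarrow> complex" where
  "unit_vec_at a = (\<lambda>k. if k = a then 1 else 0)"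

text \<open>The squared \<open>ell2\<close> norm; keeping the square avoids roots in the quadratic
  estimates.\<close>

definition nsq :: "'k set \<Rightarrow> ('k \<Rightarrow> complex) \<Rightarrow> real" where
  "nsq I x = Re (ell2_inner I x x)"

lemma ell2_outside: "x \<in> ell2 I \<Longrightarrow> k \<notin> I \<Longrightarrow> x k = 0"
  by (simp add: ell2_def)

lemma ell2_lincomb [simp, intro]:
  assumes "x \<in> ell2 I" "y \<in> ell2 I"
  shows "lincomb a x b y \<in> ell2 I"
proof -
  have sm: "(\<lambda>k. 2 * (cmod a)\<^sup>2 * (cmod (x k))\<^sup>2 + 2 * (cmod b)\<^sup>2 * (cmod (y k))\<^sup>2) summable_on I"
    using assms by (intro summable_on_add summable_on_cmult_right) (auto simp: ell2_def)
  have "(\<lambda>k. (cmod (a * x k + b * y k))\<^sup>2) summable_on I"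
  proof (rule summable_on_comparison_test[OF sm])
    fix k
    have "(cmod (a * x k + b * y k))\<^sup>2 \<le> (cmod (a * x k) + cmod (b * y k))\<^sup>2"
      by (intro power_mono norm_triangle_ineq) auto
    also have "\<dots> \<le> 2 * (cmod (a * x k))\<^sup>2 + 2 * (cmod (b * y k))\<^sup>2"
      using zero_le_power2[of "cmod (a * x k) - cmod (b * y k)"] unfolding power2_sum power2_diff by linarith
    finally show "(cmod (a * x k + b * y k))\<^sup>2 \<le> 2 * (cmod a)\<^sup>2 * (cmod (x k))\<^sup>2 + 2 * (cmod b)\<^sup>2 * (cmod (y k))\<^sup>2"
      by (simp add: norm_mult power_mult_distrib)
  qed auto
  then show ?thesis using assms by (auto simp: ell2_def lincomb_def)
qed

lemma ell2_zero [simp]: "(\<lambda>k. 0) \<in> ell2 I"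
  by (simp add: ell2_def)

lemma ell2_scale [intro]: "x \<in> ell2 I \<Longrightarrow> (\<lambda>k. a * x k) \<in> ell2 I"
  using ell2_lincomb[of x I x a 0] by (simp add: lincomb_def)

lemma ell2_sum:
  "finite J \<Longrightarrow> (\<And>j. j \<in> J \<Longrightarrow> f j \<in> ell2 I) \<Longrightarrow> (\<lambda>k. \<Sum>j\<in>J. f j k) \<in> ell2 I"
proof (induction J rule: finite_induct)
  case (insert j J)
  then have "lincomb 1 (f j) 1 (\<lambda>k. \<Sum>j\<in>J. f j k) \<in> ell2 I" by auto
  then show ?case using insert.hyps by (simp add: lincomb_def)
qed simp

lemma ell2_finite_support:
  assumes "finite F" "F \<subseteq> I" "\<And>k. k \<notin> F \<Longrightarrow> x k = 0"
  shows "x \<in> ell2 I"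
proof -
  have "(\<lambda>k. (cmod (x k))\<^sup>2) summable_on I \<longleftrightarrow> (\<lambda>k. (cmod (x k))\<^sup>2) summable_on F"
    by (rule summable_on_cong_neutral) (use assms in auto)
  then show ?thesis using assms by (auto simp: ell2_def)
qed

lemma ell2_unit_vec_at [simp, intro]: "a \<in> I \<Longrightarrow> unit_vec_at a \<in> ell2 I"
  by (rule ell2_finite_support[of "{a}"]) (auto simp: unit_vec_at_def)

lemma ell2_inner_summable:
  assumes "x \<in> ell2 I" "y \<in> ell2 I"
  shows "(\<lambda>k. x k * cnj (y k)) summable_on I"
proof -
  have "(\<lambda>k. norm (x k * cnj (y k))) summable_on I"
  proof (rule summable_on_comparison_test)
    show "(\<lambda>k. (cmod (x k))\<^sup>2 + (cmod (y k))\<^sup>2) summable_on I"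
      using assms by (intro summable_on_add) (auto simp: ell2_def)
    fix k
    have "2 * (cmod (x k) * cmod (y k)) \<le> (cmod (x k))\<^sup>2 + (cmod (y k))\<^sup>2"
      using zero_le_power2[of "cmod (x k) - cmod (y k)"] unfolding power2_diff by linarith
    moreover have "0 \<le> cmod (x k) * cmod (y k)" by simp
    ultimately have "cmod (x k) * cmod (y k) \<le> (cmod (x k))\<^sup>2 + (cmod (y k))\<^sup>2" by linarith
    then show "norm (x k * cnj (y k)) \<le> (cmod (x k))\<^sup>2 + (cmod (y k))\<^sup>2"
      by (simp add: norm_mult)
  qed auto
  then show ?thesis by (rule abs_summable_summable)
qed

lemma ell2_inner_lincomb:
  assumes "x \<in> ell2 I" "x' \<in> ell2 I" "y \<in> ell2 I"
  shows "ell2_inner I (lincomb a x b x') y = a * ell2_inner I x y + b * ell2_inner I x' y"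
proof -
  have "ell2_inner I (lincomb a x b x') y = (\<Sum>\<^sub>\<infinity>k\<in>I. a * (x k * cnj (y k)) + b * (x' k * cnj (y k)))"
    unfolding ell2_inner_def lincomb_def by (simp add: algebra_simps)
  also have "\<dots> = a * ell2_inner I x y + b * ell2_inner I x' y"
    unfolding ell2_inner_def
    by (subst infsum_add) (use assms in \<open>auto intro!: summable_on_cmult_right ell2_inner_summable simp: infsum_cmult_right'\<close>)
  finally show ?thesis .
qed

lemma ell2_inner_commute: "ell2_inner I y x = cnj (ell2_inner I x y)"
  unfolding ell2_inner_def infsum_cnj[symmetric] by (simp add: mult.commute)

lemma ell2_inner_lincomb_right:
  assumes "x \<in> ell2 I" "y \<in> ell2 I" "y' \<in> ell2 I"
  shows "ell2_inner I x (lincomb a y b y') = cnj a * ell2_inner I x y + cnj b * ell2_inner I x y'"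
  using ell2_inner_lincomb[OF assms(2,3,1), of a b] ell2_inner_commute[of I]
  by (metis complex_cnj_add complex_cnj_mult)

lemma ell2_inner_self_real:
  "ell2_inner I x x = complex_of_real (\<Sum>\<^sub>\<infinity>k\<in>I. (cmod (x k))\<^sup>2)"
proof -
  let ?f = "\<lambda>k. (cmod (x k))\<^sup>2"
  have "(\<Sum>\<^sub>\<infinity>k\<in>I. complex_of_real (?f k)) = complex_of_real (infsum ?f I)"
  proof (cases "?f summable_on I")
    case True
    then show ?thesis by (intro infsumI has_sum_of_real has_sum_infsum)
  next
    case False
    have "\<not> (\<lambda>k. complex_of_real (?f k)) summable_on I"
      using summable_on_Re[of "\<lambda>k. complex_of_real (?f k)" I] False by auto
    then show ?thesis by (simp only: infsum_not_exists infsum_not_exists[OF False] of_real_0 not_False_eq_True)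
  qed
  then show ?thesis unfolding ell2_inner_def complex_norm_square[symmetric] .
qed

lemma nsq_eq: "nsq I x = (\<Sum>\<^sub>\<infinity>k\<in>I. (cmod (x k))\<^sup>2)"
  by (simp add: nsq_def ell2_inner_self_real)

lemma ell2_inner_self: "ell2_inner I x x = complex_of_real (nsq I x)"
  by (simp add: nsq_eq ell2_inner_self_real)

lemma nsq_nonneg [simp]: "0 \<le> nsq I x"
  unfolding nsq_eq by (rule infsum_nonneg) simp

lemma nsq_lincomb:
  assumes "x \<in> ell2 I" "y \<in> ell2 I"
  shows "nsq I (lincomb a x b y) = (cmod a)\<^sup>2 * nsq I x + 2 * Re (a * cnj b * ell2_inner I x y) + (cmod b)\<^sup>2 * nsq I y"
proof -
  define w where "w = ell2_inner I x y"
  have w': "ell2_inner I y x = cnj w" unfolding w_def by (rule ell2_inner_commute)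
  have "ell2_inner I (lincomb a x b y) (lincomb a x b y)
    = a * (cnj a * ell2_inner I x x + cnj b * w) + b * (cnj a * cnj w + cnj b * ell2_inner I y y)"
    using assms by (simp add: ell2_inner_lincomb ell2_inner_lincomb_right ell2_lincomb w' w_def[symmetric] algebra_simps)
  also have "\<dots> = of_real ((cmod a)\<^sup>2) * of_real (nsq I x) + a * cnj b * w + cnj (a * cnj b * w) + of_real ((cmod b)\<^sup>2) * of_real (nsq I y)"
    unfolding complex_norm_square ell2_inner_self by (simp add: algebra_simps)
  finally show ?thesis
    unfolding nsq_def[of I "lincomb a x b y"] w_def[symmetric] by (simp del: of_real_power add: algebra_simps)
qed

lemma ell2_inner_unit_vec_at:
  assumes "a \<in> I"
  shows "ell2_inner I x (unit_vec_at a) = x a"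
proof -
  have "ell2_inner I x (unit_vec_at a) = (\<Sum>\<^sub>\<infinity>k\<in>{a}. x k)"
    unfolding ell2_inner_def by (rule infsum_cong_neutral) (use assms in \<open>auto simp: unit_vec_at_def\<close>)
  then show ?thesis by simp
qed

lemma ell2_eqI:
  assumes "x \<in> ell2 I" "y \<in> ell2 I" "\<And>z. z \<in> ell2 I \<Longrightarrow> ell2_inner I x z = ell2_inner I y z"
  shows "x = y"
proof
  fix k
  show "x k = y k"
    using assms(3)[OF ell2_unit_vec_at, of k] assms(1,2) by (cases "k \<in> I") (auto simp: ell2_inner_unit_vec_at ell2_outside)
qed

lemma nsq_eq_0:
  assumes "x \<in> ell2 I" "nsq I x = 0"
  shows "x = (\<lambda>k. 0)"
proof
  fix k
  have sm: "(\<lambda>k. (cmod (x k))\<^sup>2) summable_on I" using assms(1) by (simp add: ell2_def)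
  have "(cmod (x k))\<^sup>2 \<le> 0" if "k \<in> I"
    using finite_sum_le_infsum[OF sm, of "{k}"] that assms(2) by (simp add: nsq_eq)
  then show "x k = 0" using assms(1) ell2_outside by (cases "k \<in> I") auto
qed

lemma ell2_inner_zero [simp]: "ell2_inner I (\<lambda>k. 0) y = 0" "ell2_inner I y (\<lambda>k. 0) = 0"
  by (simp_all add: ell2_inner_def)

text \<open>Cauchy-Schwarz for an abstract positive form with values a, b on the diagonal and w off
  it; it serves the inner product and the form of a Borel set alike. The optimal scalar is - w / b;
  for b = 0 a large multiple of - w contradicts nonnegativity unless w = 0.\<close>

lemma cmod_square_le_of_nonneg_quadratic:
  fixes a b :: real and w :: complex
  assumes "\<And>c :: complex. 0 \<le> a + 2 * Re (cnj c * w) + (cmod c)\<^sup>2 * b" and "0 \<le> b"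
  shows "(cmod w)\<^sup>2 \<le> a * b"
proof (cases "b = 0")
  have cw: "cnj w * w = of_real ((cmod w)\<^sup>2)" by (simp only: complex_norm_square mult.commute)
  case True
  have *: "0 \<le> a - 2 * t * (cmod w)\<^sup>2" for t :: real
    using assms(1)[of "- of_real t * w"] True by (simp add: mult.assoc cw del: of_real_power)
  have "w = 0"
  proof (rule ccontr)
    assume "w \<noteq> 0"
    then have "0 < (cmod w)\<^sup>2" by simp
    \<comment> \<open>With this t the lower bound in \<open>*\<close> equals -1.\<close>
    then show False using *[of "(a + 1) / (2 * (cmod w)\<^sup>2)"] by (simp add: field_simps)
  qed
  then show ?thesis using True by simp
next
  have cw: "cnj w * w = of_real ((cmod w)\<^sup>2)" by (simp only: complex_norm_square mult.commute)
  case False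
  then have b: "b > 0" using assms(2) by simp
  have "0 \<le> a + 2 * Re (cnj (- w / of_real b) * w) + (cmod (- w / of_real b))\<^sup>2 * b" by (rule assms(1))
  also have "Re (cnj (- w / of_real b) * w) = - (cmod w)\<^sup>2 / b"
    by (simp add: cw del: of_real_power)
  also have "(cmod (- w / of_real b))\<^sup>2 * b = (cmod w)\<^sup>2 / b"
    using b by (simp add: norm_divide power_divide power2_eq_square)
  finally have "(cmod w)\<^sup>2 / b \<le> a" by simp
  then show ?thesis using b by (simp add: field_simps)
qed

lemma ell2_approx_finite_support:
  assumes x: "x \<in> ell2 I" and e: "e > 0"
  obtains F where "finite F" "F \<subseteq> I" "nsq I (lincomb 1 x (-1) (\<lambda>k. if k \<in> F then x k else 0)) < e"
proof -
  have sm: "(\<lambda>k. (cmod (x k))\<^sup>2) summable_on I" using x by (simp add: ell2_def)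
  obtain F where F: "finite F" "F \<subseteq> I" "dist (\<Sum>k\<in>F. (cmod (x k))\<^sup>2) (\<Sum>\<^sub>\<infinity>k\<in>I. (cmod (x k))\<^sup>2) \<le> e / 2"
    using infsum_finite_approximation[OF sm, of "e / 2"] e by auto
  have "nsq I (lincomb 1 x (-1) (\<lambda>k. if k \<in> F then x k else 0)) = (\<Sum>\<^sub>\<infinity>k\<in>I - F. (cmod (x k))\<^sup>2)"
    unfolding nsq_eq lincomb_def by (rule infsum_cong_neutral) auto
  also have "\<dots> = (\<Sum>\<^sub>\<infinity>k\<in>I. (cmod (x k))\<^sup>2) - (\<Sum>\<^sub>\<infinity>k\<in>F. (cmod (x k))\<^sup>2)"
    by (rule infsum_Diff) (use sm F in auto)
  also have "\<dots> < e" using F(3) e unfolding dist_real_def abs_le_iff by (simp add: F(1))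
  finally show ?thesis using that F by blast
qed

text \<open>Over the complex numbers the quadratic form determines the map: x + y yields the sum of
  the two mixed terms and x + i y their difference, so both vanish.\<close>

lemma lincomb_inner_zero_imp:
  assumes "\<And>x. x \<in> ell2 I \<Longrightarrow> ell2_inner I (S x) x = 0"
    and "\<And>x. x \<in> ell2 I \<Longrightarrow> S x \<in> ell2 I"
    and lin: "\<And>a b x y. x \<in> ell2 I \<Longrightarrow> y \<in> ell2 I \<Longrightarrow> S (lincomb a x b y) = lincomb a (S x) b (S y)"
    and x: "x \<in> ell2 I"
  shows "S x = (\<lambda>k. 0)"
proof (rule ell2_eqI)
  fix y assume y: "y \<in> ell2 I"
  have "ell2_inner I (S x) y + ell2_inner I (S y) x = 0"
    using assms(1)[of "lincomb 1 x 1 y"] assms(1)[of x] assms(1)[of y] x y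
    by (simp add: lin ell2_inner_lincomb ell2_inner_lincomb_right assms(2) ell2_lincomb algebra_simps)
  moreover have "- \<i> * ell2_inner I (S x) y + \<i> * ell2_inner I (S y) x = 0"
    using assms(1)[of "lincomb 1 x \<i> y"] assms(1)[of x] assms(1)[of y] x y
    by (simp add: lin ell2_inner_lincomb ell2_inner_lincomb_right assms(2) ell2_lincomb algebra_simps)
  then have "\<i> * (ell2_inner I (S y) x - ell2_inner I (S x) y) = 0" by (simp add: algebra_simps)
  then have "ell2_inner I (S y) x = ell2_inner I (S x) y" by simp
  ultimately show "ell2_inner I (S x) y = ell2_inner I (\<lambda>k. 0) y" by simp
qed (use assms x in auto)

section \<open>Positive bounded operators and their powers\<close>

locale ell2_positive_op =
  fixes I :: "'k set" and T :: "('k \<Rightarrow> complex) \<Rightarrow> 'k \<Rightarrow> complex" and M :: real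
  assumes maps [simp]: "x \<in> ell2 I \<Longrightarrow> T x \<in> ell2 I"
    and lin: "x \<in> ell2 I \<Longrightarrow> y \<in> ell2 I \<Longrightarrow> T (lincomb a x b y) = lincomb a (T x) b (T y)"
    and sym: "x \<in> ell2 I \<Longrightarrow> y \<in> ell2 I \<Longrightarrow> ell2_inner I (T x) y = ell2_inner I x (T y)"
    and pos: "x \<in> ell2 I \<Longrightarrow> 0 \<le> Re (ell2_inner I (T x) x)"
    and bound: "x \<in> ell2 I \<Longrightarrow> Re (ell2_inner I (T x) x) \<le> M * nsq I x"
    and M_pos: "M > 0"
begin

lemma pow_maps [simp]: "x \<in> ell2 I \<Longrightarrow> (T ^^ n) x \<in> ell2 I"
  by (induction n) auto

lemma pow_lin: "x \<in> ell2 I \<Longrightarrow> y \<in> ell2 I \<Longrightarrow> (T ^^ n) (lincomb a x b y) = lincomb a ((T ^^ n) x) b ((T ^^ n) y)"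
  by (induction n) (auto simp: lin)

lemma pow_sym: "x \<in> ell2 I \<Longrightarrow> y \<in> ell2 I \<Longrightarrow> ell2_inner I ((T ^^ n) x) y = ell2_inner I x ((T ^^ n) y)"
proof (induction n arbitrary: x)
  case (Suc n)
  then show ?case by (simp add: funpow_swap1 Suc.IH[OF maps] sym)
qed simp

lemma pow_self_real: "x \<in> ell2 I \<Longrightarrow> ell2_inner I ((T ^^ n) x) x = complex_of_real (Re (ell2_inner I ((T ^^ n) x) x))"
  using pow_sym[of x x n] ell2_inner_commute[of I "(T ^^ n) x" x]
  by (metis Reals_cnj_iff of_real_Re)

text \<open>\<open>TA\<close> is T / M and \<open>TS\<close> is 1 - T / M: two commuting positive
  operators with sum 1 that stand for t and 1 - t in the moment problem. The summand with
  coefficient 0 writes a multiple as a \<open>lincomb\<close>.\<close>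

definition TA :: "('k \<Rightarrow> complex) \<Rightarrow> 'k \<Rightarrow> complex" where "TA x = lincomb (of_real (1 / M)) (T x) 0 x"
definition TS :: "('k \<Rightarrow> complex) \<Rightarrow> 'k \<Rightarrow> complex" where "TS x = lincomb 1 x (-1) (TA x)"

lemma TA_maps [simp]: "x \<in> ell2 I \<Longrightarrow> TA x \<in> ell2 I" by (auto simp: TA_def)
lemma TS_maps [simp]: "x \<in> ell2 I \<Longrightarrow> TS x \<in> ell2 I" by (auto simp: TS_def)
lemma TA_lin: "x \<in> ell2 I \<Longrightarrow> y \<in> ell2 I \<Longrightarrow> TA (lincomb a x b y) = lincomb a (TA x) b (TA y)"
  unfolding TA_def by (simp add: lin) (simp add: lincomb_def algebra_simps add_divide_distrib)
lemma TS_TA: "x \<in> ell2 I \<Longrightarrow> TS (TA x) = TA (TS x)"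
  unfolding TS_def by (subst TA_lin) auto
lemma TS_lin: "x \<in> ell2 I \<Longrightarrow> y \<in> ell2 I \<Longrightarrow> TS (lincomb a x b y) = lincomb a (TS x) b (TS y)"
  by (auto simp: TS_def TA_lin, auto simp: lincomb_def algebra_simps)
lemma TA_sym: "x \<in> ell2 I \<Longrightarrow> y \<in> ell2 I \<Longrightarrow> ell2_inner I (TA x) y = ell2_inner I x (TA y)"
  by (simp add: TA_def ell2_inner_lincomb ell2_inner_lincomb_right sym)
lemma TS_sym: "x \<in> ell2 I \<Longrightarrow> y \<in> ell2 I \<Longrightarrow> ell2_inner I (TS x) y = ell2_inner I x (TS y)"
  by (simp add: TS_def ell2_inner_lincomb ell2_inner_lincomb_right TA_sym)
lemma TA_pos: "x \<in> ell2 I \<Longrightarrow> 0 \<le> Re (ell2_inner I (TA x) x)"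
  using pos[of x] M_pos by (simp add: TA_def ell2_inner_lincomb)
lemma TS_pos: "x \<in> ell2 I \<Longrightarrow> 0 \<le> Re (ell2_inner I (TS x) x)"
  using bound[of x] M_pos by (simp add: TS_def TA_def[of x] ell2_inner_lincomb nsq_def field_simps ell2_lincomb)
lemma TA_pow_maps [simp]: "x \<in> ell2 I \<Longrightarrow> (TA ^^ n) x \<in> ell2 I" by (induction n) auto
lemma TS_pow_maps [simp]: "x \<in> ell2 I \<Longrightarrow> (TS ^^ n) x \<in> ell2 I" by (induction n) auto
lemma TA_TS_pow: "x \<in> ell2 I \<Longrightarrow> TA ((TS ^^ n) x) = (TS ^^ n) (TA x)"
  by (induction n) (auto simp: TS_TA[symmetric])
lemma TS_TA_pow: "x \<in> ell2 I \<Longrightarrow> TS ((TA ^^ n) x) = (TA ^^ n) (TS x)"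
  by (induction n) (auto simp: TS_TA)
lemma TA_pow_lin: "x \<in> ell2 I \<Longrightarrow> y \<in> ell2 I \<Longrightarrow> (TA ^^ n) (lincomb a x b y) = lincomb a ((TA ^^ n) x) b ((TA ^^ n) y)"
  by (induction n) (auto simp: TA_lin)
lemma TA_pow: "x \<in> ell2 I \<Longrightarrow> (TA ^^ n) x = lincomb (of_real ((1 / M) ^ n)) ((T ^^ n) x) 0 x"
proof (induction n)
  case (Suc n)
  then have *: "(TA ^^ Suc n) x = lincomb (of_real ((1 / M) ^ n)) (TA ((T ^^ n) x)) 0 (TA x)" by (simp add: TA_lin)
  show ?case by (subst *) (simp add: TA_def lincomb_def mult_ac)
qed (simp add: lincomb_def)

text \<open>Two equal factors are moved to the two sides of the inner product, which lowers an
  exponent by two and replaces x by its image. This leaves exponents 0 and 1, where everything but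
  the mixed product is covered by 0 \<le> T \<le> M.\<close>

lemma TA_TS_nonneg: "x \<in> ell2 I \<Longrightarrow> 0 \<le> Re (ell2_inner I ((TA ^^ k) ((TS ^^ j) x)) x)"
proof (induction "k + j" arbitrary: k j x rule: less_induct)
  case less
  note x = less.prems
  consider k' where "k = Suc (Suc k')" | j' where "j = Suc (Suc j')" | "k \<in> {0, 1}" "j \<in> {0, 1}"
    by (cases k; cases "k - 1"; cases j; cases "j - 1") auto
  then show ?case
  proof cases
    case 1
    have "ell2_inner I ((TA ^^ k) ((TS ^^ j) x)) x = ell2_inner I (TA ((TA ^^ k') (TA ((TS ^^ j) x)))) x"
      by (simp add: 1 funpow_swap1)
    also have "\<dots> = ell2_inner I ((TA ^^ k') ((TS ^^ j) (TA x))) (TA x)"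
      using x by (simp add: TA_sym TA_TS_pow)
    finally show ?thesis using less.hyps[of k' j "TA x"] 1 x by simp
  next
    case 2
    have "ell2_inner I ((TA ^^ k) ((TS ^^ j) x)) x = ell2_inner I ((TA ^^ k) (TS ((TS ^^ j') (TS x)))) x"
      by (simp add: 2 funpow_swap1)
    also have "\<dots> = ell2_inner I ((TA ^^ k) ((TS ^^ j') (TS x))) (TS x)"
      using x by (simp add: TS_sym TS_TA_pow[symmetric])
    finally show ?thesis using less.hyps[of k j' "TS x"] 2 x by simp
  next
    case 3
    have "0 \<le> Re (ell2_inner I (TA (TS x)) x)"
    proof -
      \<comment> \<open>As A + S = 1 and A, S commute, A S = A S A + S A S, a sum of conjugates of
        positive operators.\<close>
      have x_eq: "x = lincomb 1 (TA x) 1 (TS x)" by (auto simp: TS_def lincomb_def)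
      have "ell2_inner I (TA (TS x)) x = ell2_inner I (lincomb 1 (TA (TS (TA x))) 1 (TA (TS (TS x)))) x"
        by (subst (1) x_eq) (simp add: TS_lin TA_lin x)
      also have "\<dots> = ell2_inner I (TS (TA x)) (TA x) + ell2_inner I (TA (TS x)) (TS x)"
        using x by (simp add: ell2_inner_lincomb TA_sym TS_TA[symmetric] TS_sym)
      finally show ?thesis using TS_pos[of "TA x"] TA_pos[of "TS x"] x by simp
    qed
    moreover have "0 \<le> Re (ell2_inner I x x)" using nsq_nonneg[of I x] by (simp add: nsq_def)
    ultimately show ?thesis using 3 TA_pos[OF x] TS_pos[OF x] by auto
  qed
qed

end


section \<open>Existence of the spectral measure of a positive operator\<close>

context ell2_positive_op begin

text \<open>By \<open>TA_TS_nonneg\<close> the values of the mixed powers, divided by the squared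
  norm, satisfy the conditions of the Hausdorff problem. A constant density and the push-forward
  along t to M t undo the two normalizations; the zero vector, where one cannot divide, gets the
  null measure.\<close>

lemma moment_measure_exists:
  assumes x: "x \<in> ell2 I"
  shows "\<exists>\<mu> :: real measure. finite_measure \<mu> \<and> sets \<mu> = sets borel \<and> (AE t in \<mu>. 0 \<le> t \<and> t \<le> M) \<and>
    (\<forall>n. (\<integral>t. t ^ n \<partial>\<mu>) = Re (ell2_inner I ((T ^^ n) x) x))"
proof (cases "nsq I x = 0")
  case True
  then have x0: "x = (\<lambda>k. 0)" by (rule nsq_eq_0[OF x])
  have "finite_measure (null_measure borel :: real measure)" by (rule finite_measureI) simp
  have AE: "AE t in (null_measure borel :: real measure). P t" for P
    by (rule AE_I[where N=UNIV]) auto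
  have "(T ^^ n) x = (\<lambda>k. 0)" for n
    using pow_lin[OF x x, of n 0 0] by (simp add: x0 lincomb_def)
  then show ?thesis using \<open>finite_measure (null_measure borel)\<close> AE integral_eq_zero_AE[OF AE]
    by (intro exI[of _ "null_measure borel"]) simp
next
  case False
  then have nx: "nsq I x > 0" using nsq_nonneg[of I x] by linarith
  define d where "d k j = Re (ell2_inner I ((TA ^^ k) ((TS ^^ j) x)) x) / nsq I x" for k j
  have rec: "d k (Suc j) = d k j - d (Suc k) j" for k j
  proof -
    have "(TS ^^ Suc j) x = lincomb 1 ((TS ^^ j) x) (-1) (TA ((TS ^^ j) x))"
      by (simp add: TS_def[of "(TS ^^ j) x"])
    then have "(TA ^^ k) ((TS ^^ Suc j) x) = lincomb 1 ((TA ^^ k) ((TS ^^ j) x)) (-1) ((TA ^^ Suc k) ((TS ^^ j) x))"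
      using x by (simp add: TA_pow_lin funpow_swap1)
    then show ?thesis unfolding d_def using x
      by (simp add: ell2_inner_lincomb diff_divide_distrib)
  qed
  have "0 \<le> d k j" for k j unfolding d_def using TA_TS_nonneg[OF x, of k j] nx by simp
  moreover have "d 0 0 = 1" using nx by (simp add: d_def nsq_def)
  ultimately obtain \<mu>0 where "real_distribution \<mu>0" and AE0: "AE t in \<mu>0. 0 \<le> t \<and> t \<le> 1"
    and m0: "\<And>n. (\<integral>t. t ^ n \<partial>\<mu>0) = d n 0"
    using hausdorff_moment_prob[of d] rec by blast
  interpret \<mu>0: real_distribution \<mu>0 by fact
  define \<mu>1 where "\<mu>1 = density \<mu>0 (\<lambda>_. ennreal (nsq I x))"
  define \<mu> where "\<mu> = distr \<mu>1 borel (\<lambda>t. M * t)"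
  have s1: "sets \<mu>1 = sets borel" by (simp add: \<mu>1_def)
  have meas1: "(\<lambda>t. M * t) \<in> measurable \<mu>1 borel"
    by (subst measurable_cong_sets[OF s1 refl]) simp
  have "emeasure \<mu>1 (space \<mu>1) = ennreal (nsq I x)"
    using \<mu>0.emeasure_space_1 by (simp add: \<mu>1_def emeasure_density nn_integral_cmult)
  then interpret \<mu>1: finite_measure \<mu>1 by (intro finite_measureI) simp
  have "finite_measure \<mu>" unfolding \<mu>_def by (rule \<mu>1.finite_measure_distr[OF meas1])
  moreover have "AE t in \<mu>1. 0 \<le> t \<and> t \<le> 1"
    unfolding \<mu>1_def using AE0 by (subst AE_density) auto
  then have "AE t in \<mu>. 0 \<le> t \<and> t \<le> M"
    unfolding \<mu>_def using M_pos by (subst AE_distr_iff[OF meas1]) (auto elim!: eventually_mono simp: mult_le_cancel_left1)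
  moreover have "(\<integral>t. t ^ n \<partial>\<mu>) = Re (ell2_inner I ((T ^^ n) x) x)" for n
  proof -
    have "(\<integral>t. t ^ n \<partial>\<mu>) = (\<integral>t. (M * t) ^ n \<partial>\<mu>1)"
      unfolding \<mu>_def by (rule integral_distr[OF meas1]) simp
    also have "\<dots> = (\<integral>t. nsq I x * (M * t) ^ n \<partial>\<mu>0)"
      unfolding \<mu>1_def by (subst integral_density) (auto simp: nx)
    also have "\<dots> = nsq I x * M ^ n * d n 0"
      by (simp add: power_mult_distrib m0)
    also have "\<dots> = Re (ell2_inner I ((T ^^ n) x) x)"
      using nx M_pos x by (simp add: d_def TA_pow ell2_inner_lincomb power_divide)
    finally show ?thesis .
  qed
  ultimately show ?thesis by (intro exI[of _ \<mu>]) (simp add: \<mu>_def)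
qed

definition mu :: "('k \<Rightarrow> complex) \<Rightarrow> real measure" where
  "mu x = (SOME \<mu>. finite_measure \<mu> \<and> sets \<mu> = sets borel \<and> (AE t in \<mu>. 0 \<le> t \<and> t \<le> M) \<and>
    (\<forall>n. (\<integral>t. t ^ n \<partial>\<mu>) = Re (ell2_inner I ((T ^^ n) x) x)))"

lemma mu:
  assumes "x \<in> ell2 I"
  shows "finite_measure (mu x)" "sets (mu x) = sets borel" "AE t in mu x. 0 \<le> t \<and> t \<le> M"
    "(\<integral>t. t ^ n \<partial>mu x) = Re (ell2_inner I ((T ^^ n) x) x)"
  using someI_ex[OF moment_measure_exists[OF assms]] unfolding mu_def[symmetric] by auto

lemma mu_AE:
  assumes "x \<in> ell2 I" shows "AE t in mu x. 0 \<le> t" "AE t in mu x. t \<le> M"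
  using mu(3)[OF assms] by auto

lemma mu_space: "x \<in> ell2 I \<Longrightarrow> space (mu x) = UNIV"
  using sets_eq_imp_space_eq[OF mu(2)] by simp

lemma mu_total: "x \<in> ell2 I \<Longrightarrow> measure (mu x) UNIV = nsq I x"
  using mu(4)[of x 0] by (simp add: mu_space nsq_def)

text \<open>The polarized form of the operator g(T). The measures \<open>mu x\<close> are chosen
  separately for each vector, so sesquilinearity in x and y is not visible and has to be derived
  from moments.\<close>

definition form :: "(real \<Rightarrow> real) \<Rightarrow> ('k \<Rightarrow> complex) \<Rightarrow> ('k \<Rightarrow> complex) \<Rightarrow> complex" where
  "form g x y = (\<Sum>k<4. \<i> ^ k / 4 * complex_of_real (\<integral>t. g t \<partial>mu (lincomb 1 x (\<i> ^ k) y)))"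

lemma polarization_sum:
  assumes "x \<in> ell2 I" "y \<in> ell2 I" "u \<in> ell2 I" "v \<in> ell2 I"
    and "\<And>a b. L (lincomb a x b y) = lincomb a u b v"
    and "\<And>k. r k = Re (ell2_inner I (L (lincomb 1 x (\<i> ^ k) y)) (lincomb 1 x (\<i> ^ k) y))"
    and "\<And>z. z \<in> ell2 I \<Longrightarrow> ell2_inner I (L z) z = of_real (Re (ell2_inner I (L z) z))"
  shows "(\<Sum>k<4. \<i> ^ k / 4 * complex_of_real (r k)) = ell2_inner I u y"
proof -
  have "complex_of_real (r k) = ell2_inner I u x + cnj (\<i> ^ k) * ell2_inner I u y + \<i> ^ k * ell2_inner I v x + \<i> ^ k * cnj (\<i> ^ k) * ell2_inner I v y" for k
  proof -
    have "complex_of_real (r k) = ell2_inner I (L (lincomb 1 x (\<i> ^ k) y)) (lincomb 1 x (\<i> ^ k) y)"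
      unfolding assms(6) by (rule assms(7)[symmetric]) (use assms in auto)
    also have "\<dots> = ell2_inner I u x + cnj (\<i> ^ k) * ell2_inner I u y + \<i> ^ k * ell2_inner I v x + \<i> ^ k * cnj (\<i> ^ k) * ell2_inner I v y"
      unfolding assms(5) using assms(1-4)
      by (simp add: ell2_inner_lincomb ell2_inner_lincomb_right ell2_lincomb algebra_simps)
    finally show ?thesis .
  qed
  then show ?thesis
    by (simp add: numeral_eq_Suc algebra_simps)
qed

lemma form_power:
  assumes "x \<in> ell2 I" "y \<in> ell2 I"
  shows "form (\<lambda>t. t ^ n) x y = ell2_inner I ((T ^^ n) x) y"
  unfolding form_def
  by (rule polarization_sum[where L="T ^^ n" and v="(T ^^ n) y" and x=x])
     (use assms in \<open>auto simp: mu(4) ell2_lincomb pow_lin pow_self_real[symmetric]\<close>)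

text \<open>On powers of t the form is an inner product with a power of T, so an identity between
  forms can be checked there and is then transferred to indicators of Borel sets.\<close>

lemma form_combination_zero:
  assumes J: "finite J"
    and xy: "\<And>j. j \<in> J \<Longrightarrow> x j \<in> ell2 I" "\<And>j. j \<in> J \<Longrightarrow> y j \<in> ell2 I"
    and g: "\<And>j. j \<in> J \<Longrightarrow> g j \<in> borel_measurable borel"
    and bd: "\<And>j t. j \<in> J \<Longrightarrow> 0 \<le> t \<Longrightarrow> t \<le> M \<Longrightarrow> \<bar>g j t\<bar> \<le> K"
    and mom: "\<And>n. (\<Sum>j\<in>J. c j * form (\<lambda>t. t ^ n * g j t) (x j) (y j)) = 0"
    and C: "C \<in> sets borel"
  shows "(\<Sum>j\<in>J. c j * form (\<lambda>t. indicator C t * g j t) (x j) (y j)) = 0"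
proof -
  have eq: "(\<Sum>j\<in>J. c j * form (\<lambda>t. h t * g j t) (x j) (y j)) =
     (\<Sum>p\<in>J \<times> {..<4}. (c (fst p) * \<i> ^ snd p / 4) * complex_of_real (\<integral>t. h t * g (fst p) t \<partial>mu (lincomb 1 (x (fst p)) (\<i> ^ snd p) (y (fst p)))))" for h
    unfolding form_def sum_distrib_left by (subst sum.cartesian_product) (simp add: case_prod_beta mult.assoc)
  show ?thesis
    unfolding eq
    by (rule moment_combination_zero[where K=K and M=M])
       (use J xy g bd C mom[unfolded eq] in \<open>auto simp: mu(1,2) mu_AE ell2_lincomb\<close>)
qed

abbreviation "qf C x \<equiv> measure (mu x) C"
abbreviation "sf C x y \<equiv> form (indicator C) x y"

lemma form_indicator: 
  assumes "x \<in> ell2 I" "y \<in> ell2 I" "C \<in> sets borel"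
  shows "sf C x y = (\<Sum>k<4. \<i> ^ k / 4 * complex_of_real (qf C (lincomb 1 x (\<i> ^ k) y)))"
  unfolding form_def by (intro sum.cong refl) (simp add: mu_space assms ell2_lincomb)

lemma measure_combination_zero:
  assumes J: "finite J" and x: "\<And>j. j \<in> J \<Longrightarrow> x j \<in> ell2 I"
    and mom: "\<And>n. (\<Sum>j\<in>J. c j * ell2_inner I ((T ^^ n) (x j)) (x j)) = 0"
    and C: "C \<in> sets borel"
  shows "(\<Sum>j\<in>J. c j * complex_of_real (qf C (x j))) = 0"
proof -
  have "(\<Sum>j\<in>J. c j * complex_of_real (\<integral>t. indicator C t * 1 \<partial>mu (x j))) = 0"
  proof (rule moment_combination_zero[OF J, where K=1 and M=M])
    show "(\<Sum>j\<in>J. c j * complex_of_real (\<integral>t. t ^ n * 1 \<partial>mu (x j))) = 0" for n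
      unfolding mom[of n, symmetric] by (intro sum.cong refl) (use x in \<open>simp add: mu(4) pow_self_real[symmetric]\<close>)
  qed (use x C in \<open>auto simp: mu(1,2) mu_AE\<close>)
  then show ?thesis using x by (simp add: mu_space)
qed

lemma sf_self:
  assumes x: "x \<in> ell2 I" and C: "C \<in> sets borel"
  shows "sf C x x = complex_of_real (qf C x)"
proof -
  \<comment> \<open>The four polarization vectors and \<open>x\<close> itself, the latter with
    coefficient -1: the claim becomes the vanishing of one combination of five measures.\<close>
  define X where "X k = (if k < 4 then lincomb 1 x (\<i> ^ k) x else x)" for k :: nat
  define c where "c k = (if k < 4 then \<i> ^ k / 4 else - 1)" for k :: nat
  have split: "sum f {..<5} = sum f {..<4} + f 4" for f :: "nat \<Rightarrow> complex"
    using sum.lessThan_Suc[of f 4] by (simp add: numeral_eq_Suc)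
  have "(\<Sum>k<5. c k * complex_of_real (qf C (X k))) = 0"
  proof (rule measure_combination_zero[OF _ _ _ C])
    fix n
    have "(\<Sum>k<4. \<i> ^ k / 4 * ell2_inner I ((T ^^ n) (X k)) (X k)) = form (\<lambda>t. t ^ n) x x"
      unfolding form_def using x by (intro sum.cong refl) (simp add: X_def mu(4) ell2_lincomb pow_self_real[symmetric])
    also have "\<dots> = ell2_inner I ((T ^^ n) x) x" by (rule form_power[OF x x])
    finally show "(\<Sum>k<5. c k * ell2_inner I ((T ^^ n) (X k)) (X k)) = 0"
      unfolding split by (simp add: c_def X_def)
  qed (use x in \<open>auto simp: X_def\<close>)
  then show ?thesis unfolding split form_indicator[OF x x C] by (simp add: c_def X_def)
qed

lemma sf_lincomb:
  assumes "x \<in> ell2 I" "x' \<in> ell2 I" "y \<in> ell2 I" and C: "C \<in> sets borel"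
  shows "sf C (lincomb a x b x') y = a * sf C x y + b * sf C x' y"
proof -
  define X where "X k = (if k = 0 then lincomb a x b x' else if k = 1 then x else x')" for k :: nat
  define c where "c k = (if k = 0 then -1 else if k = 1 then a else b)" for k :: nat
  have s3: "sum f {..<3} = f 0 + f 1 + f 2" for f :: "nat \<Rightarrow> complex" by (simp add: numeral_eq_Suc)
  have "(\<Sum>k<3. c k * form (\<lambda>t. indicator C t * 1) (X k) y) = 0"
    by (rule form_combination_zero[where K=1])
       (use assms in \<open>auto simp: X_def s3 c_def ell2_lincomb form_power pow_lin ell2_inner_lincomb\<close>)
  then show ?thesis by (simp add: s3 c_def X_def algebra_simps)
qed

lemma sf_commute:
  assumes x: "x \<in> ell2 I" and y: "y \<in> ell2 I" and C: "C \<in> sets borel"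
  shows "sf C y x = cnj (sf C x y)"
proof -
  define X where "X k = (if k < 4 then lincomb 1 y (\<i> ^ k) x else lincomb 1 x (\<i> ^ (k - 4)) y)" for k :: nat
  define c where "c k = (if k < 4 then \<i> ^ k / 4 else - cnj (\<i> ^ (k - 4) / 4))" for k :: nat
  have split: "sum f {..<8} = sum f {..<4} + sum (\<lambda>k. f (k + 4)) {..<4}" for f :: "nat \<Rightarrow> complex"
    by (simp add: numeral_eq_Suc)
  have "(\<Sum>k<8. c k * complex_of_real (qf C (X k))) = 0"
  proof (rule measure_combination_zero[OF _ _ _ C])
    fix n
    have "(\<Sum>k<4. \<i> ^ k / 4 * ell2_inner I ((T ^^ n) (lincomb 1 u (\<i> ^ k) v)) (lincomb 1 u (\<i> ^ k) v)) = form (\<lambda>t. t ^ n) u v"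
      if "u \<in> ell2 I" "v \<in> ell2 I" for u v
      unfolding form_def using that by (intro sum.cong refl) (simp add: mu(4) ell2_lincomb pow_self_real[symmetric])
    note 1 = this
    have "(\<Sum>k<4. cnj (\<i> ^ k / 4) * ell2_inner I ((T ^^ n) (lincomb 1 x (\<i> ^ k) y)) (lincomb 1 x (\<i> ^ k) y)) = cnj (form (\<lambda>t. t ^ n) x y)"
      unfolding 1[OF x y, symmetric] cnj_sum complex_cnj_mult
      using pow_self_real[OF ell2_lincomb[OF x y]] by (intro sum.cong refl) (metis complex_cnj_complex_of_real)
    moreover have "cnj (form (\<lambda>t. t ^ n) x y) = form (\<lambda>t. t ^ n) y x"
      unfolding form_power[OF x y] form_power[OF y x] pow_sym[OF y x] by (rule ell2_inner_commute[symmetric])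
    ultimately show "(\<Sum>k<8. c k * ell2_inner I ((T ^^ n) (X k)) (X k)) = 0"
      unfolding split using 1[OF y x] by (simp add: c_def X_def sum_negf)
  qed (use x y in \<open>auto simp: X_def\<close>)
  then show ?thesis unfolding split form_indicator[OF x y C] form_indicator[OF y x C]
    by (simp add: c_def X_def sum_negf cnj_sum)
qed

lemma sf_lincomb_right:
  assumes "x \<in> ell2 I" "y \<in> ell2 I" "y' \<in> ell2 I" and C: "C \<in> sets borel"
  shows "sf C x (lincomb a y b y') = cnj a * sf C x y + cnj b * sf C x y'"
  unfolding sf_commute[OF ell2_lincomb[OF assms(2,3)] assms(1) C] sf_lincomb[OF assms(2,3,1) C]
  by (simp add: sf_commute[OF assms(2,1) C] sf_commute[OF assms(3,1) C])

lemma qf_le_nsq: "x \<in> ell2 I \<Longrightarrow> qf C x \<le> nsq I x"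
  using finite_measure.bounded_measure[OF mu(1), of x C] mu_total[of x] by (simp add: mu_space)

lemma sf_CS:
  assumes x: "x \<in> ell2 I" and y: "y \<in> ell2 I" and C: "C \<in> sets borel"
  shows "(cmod (sf C x y))\<^sup>2 \<le> nsq I x * nsq I y"
proof -
  have "(cmod (sf C x y))\<^sup>2 \<le> qf C x * qf C y"
  proof (rule cmod_square_le_of_nonneg_quadratic)
    fix c
    have "0 \<le> Re (sf C (lincomb 1 x c y) (lincomb 1 x c y))"
      using sf_self[OF ell2_lincomb[OF x y] C, of 1 c] by simp
    also have "sf C (lincomb 1 x c y) (lincomb 1 x c y) = sf C x x + cnj c * sf C x y + cnj (cnj c * sf C x y) + (c * cnj c) * sf C y y"
      using x y C by (simp add: sf_lincomb sf_lincomb_right ell2_lincomb algebra_simps sf_commute[OF x y])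
    also have "Re \<dots> = qf C x + 2 * Re (cnj c * sf C x y) + (cmod c)\<^sup>2 * qf C y"
      unfolding sf_self[OF x C] sf_self[OF y C] complex_norm_square[symmetric] by (simp del: of_real_power)
    finally show "0 \<le> qf C x + 2 * Re (cnj c * sf C x y) + (cmod c)\<^sup>2 * qf C y" .
  qed simp
  also have "\<dots> \<le> nsq I x * nsq I y" by (intro mult_mono qf_le_nsq x y) auto
  finally show ?thesis .
qed

text \<open>The Riesz vector of the bounded form, written down directly: its coordinates are the
  values of the form on the unit vectors.\<close>

definition spec :: "real set \<Rightarrow> ('k \<Rightarrow> complex) \<Rightarrow> 'k \<Rightarrow> complex" where
  "spec C x = (\<lambda>k. if k \<in> I then sf C x (unit_vec_at k) else 0)"

lemma sf_spec_finite:
  assumes x: "x \<in> ell2 I" and C: "C \<in> sets borel" and F: "finite F" "F \<subseteq> I"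
  shows "sf C x (\<lambda>k. if k \<in> F then y k else 0) = (\<Sum>k\<in>F. spec C x k * cnj (y k))"
  using F
proof (induction F rule: finite_induct)
  case empty
  have "sf C x (lincomb 0 x 0 x) = 0" using x C by (simp add: sf_lincomb_right)
  then show ?case by (simp add: lincomb_def)
next
  case (insert a F)
  have a: "a \<in> I" using insert by simp
  have yF: "(\<lambda>k. if k \<in> F then y k else 0) \<in> ell2 I"
    by (rule ell2_finite_support[of F]) (use insert in auto)
  have "(\<lambda>k. if k \<in> insert a F then y k else 0) = lincomb (y a) (unit_vec_at a) 1 (\<lambda>k. if k \<in> F then y k else 0)"
    using insert.hyps by (auto simp: lincomb_def unit_vec_at_def)
  then have "sf C x (\<lambda>k. if k \<in> insert a F then y k else 0) = cnj (y a) * sf C x (unit_vec_at a) + (\<Sum>k\<in>F. spec C x k * cnj (y k))"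
    using insert x C yF a by (simp add: sf_lincomb_right ell2_unit_vec_at)
  then show ?case using insert a by (simp add: spec_def mult.commute)
qed

text \<open>Testing the form on a finite truncation of the vector itself gives, by Cauchy-Schwarz,
  that the partial sum S of its squared coordinates satisfies S^2 \<le> S
  \<open>nsq I x\<close>.\<close>

lemma spec_maps [simp]:
  assumes x: "x \<in> ell2 I" and C: "C \<in> sets borel"
  shows "spec C x \<in> ell2 I"
proof -
  have "(\<lambda>k. (cmod (spec C x k))\<^sup>2) summable_on I"
  proof (rule nonneg_bdd_above_summable_on)
    have "(\<Sum>k\<in>F. (cmod (spec C x k))\<^sup>2) \<le> nsq I x" if F: "F \<subseteq> I" "finite F" for F
    proof -
      define u where "u = (\<lambda>k. if k \<in> F then spec C x k else 0)"
      define S where "S = (\<Sum>k\<in>F. (cmod (spec C x k))\<^sup>2)"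
      have u: "u \<in> ell2 I" unfolding u_def by (rule ell2_finite_support[of F]) (use F in auto)
      have "nsq I u = (\<Sum>\<^sub>\<infinity>k\<in>F. (cmod (spec C x k))\<^sup>2)"
        unfolding nsq_eq by (rule infsum_cong_neutral) (use F in \<open>auto simp: u_def\<close>)
      then have nu: "nsq I u = S" using F by (simp add: S_def)
      have "sf C x u = complex_of_real S"
        unfolding u_def sf_spec_finite[OF x C F(2,1)] S_def of_real_sum complex_norm_square by simp
      then have "S\<^sup>2 \<le> nsq I x * S" using sf_CS[OF x u C] nu by simp
      moreover have "S \<ge> 0" unfolding S_def by (intro sum_nonneg) auto
      ultimately have "S \<le> nsq I x" using nsq_nonneg[of I x] by (cases "S = 0") (auto simp: power2_eq_square)
      then show ?thesis by (simp add: S_def)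
    qed
    then show "bdd_above (sum (\<lambda>k. (cmod (spec C x k))\<^sup>2) ` {F. F \<subseteq> I \<and> finite F})"
      by (auto intro!: bdd_aboveI)
  qed auto
  then show ?thesis by (auto simp: ell2_def spec_def)
qed

lemma ell2_CS:
  assumes "x \<in> ell2 I" "y \<in> ell2 I"
  shows "(cmod (ell2_inner I x y))\<^sup>2 \<le> nsq I x * nsq I y"
proof (rule cmod_square_le_of_nonneg_quadratic)
  fix c
  show "0 \<le> nsq I x + 2 * Re (cnj c * ell2_inner I x y) + (cmod c)\<^sup>2 * nsq I y"
    using nsq_lincomb[OF assms, of 1 c] nsq_nonneg[of I "lincomb 1 x c y"] by simp
qed simp

text \<open>Both sides are bounded in y by Cauchy-Schwarz and agree on vectors of finite support,
  which are dense.\<close>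

lemma inner_spec:
  assumes x: "x \<in> ell2 I" and y: "y \<in> ell2 I" and C: "C \<in> sets borel"
  shows "ell2_inner I (spec C x) y = sf C x y"
proof (rule ccontr)
  define D where "D = ell2_inner I (spec C x) y - sf C x y"
  assume "\<not> ?thesis"
  then have D: "cmod D > 0" by (simp add: D_def)
  \<comment> \<open>From (a + b)^2 \<le> 2 a^2 + 2 b^2 and the two Cauchy-Schwarz bounds; the
    summand 1 keeps B positive.\<close>
  define B where "B = 2 * nsq I (spec C x) + 2 * nsq I x + 1"
  have B: "B > 0" unfolding B_def using nsq_nonneg[of I "spec C x"] nsq_nonneg[of I x] by linarith
  obtain F where F: "finite F" "F \<subseteq> I" and Fe: "nsq I (lincomb 1 y (-1) (\<lambda>k. if k \<in> F then y k else 0)) < (cmod D)\<^sup>2 / B"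
    using ell2_approx_finite_support[OF y, of "(cmod D)\<^sup>2 / B"] D B by auto
  define yF where "yF = (\<lambda>k. if k \<in> F then y k else 0)"
  define z where "z = lincomb 1 y (-1) yF"
  have yF: "yF \<in> ell2 I" unfolding yF_def by (rule ell2_finite_support[of F]) (use F in auto)
  have z: "z \<in> ell2 I" unfolding z_def using y yF by auto
  have "ell2_inner I (spec C x) yF = (\<Sum>\<^sub>\<infinity>k\<in>F. spec C x k * cnj (y k))"
    unfolding ell2_inner_def by (rule infsum_cong_neutral) (use F in \<open>auto simp: yF_def\<close>)
  also have "\<dots> = sf C x yF" unfolding yF_def sf_spec_finite[OF x C F] using F by simp
  finally have "D = ell2_inner I (spec C x) z - sf C x z"
    unfolding D_def z_def using x y yF C by (simp add: ell2_inner_lincomb_right sf_lincomb_right)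
  then have "cmod D \<le> cmod (ell2_inner I (spec C x) z) + cmod (sf C x z)" by (metis norm_triangle_ineq4)
  then have "(cmod D)\<^sup>2 \<le> (cmod (ell2_inner I (spec C x) z) + cmod (sf C x z))\<^sup>2" by (intro power_mono) auto
  also have "\<dots> \<le> 2 * (cmod (ell2_inner I (spec C x) z))\<^sup>2 + 2 * (cmod (sf C x z))\<^sup>2"
    using zero_le_power2[of "cmod (ell2_inner I (spec C x) z) - cmod (sf C x z)"] unfolding power2_sum power2_diff by linarith
  also have "\<dots> \<le> 2 * (nsq I (spec C x) * nsq I z) + 2 * (nsq I x * nsq I z)"
    using ell2_CS[OF spec_maps[OF x C] z] sf_CS[OF x z C] by linarith
  also have "\<dots> \<le> B * nsq I z" unfolding B_def by (simp add: algebra_simps)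
  also have "\<dots> < (cmod D)\<^sup>2" using Fe B by (simp add: z_def yF_def pos_less_divide_eq mult.commute)
  finally show False using B by simp
qed

text \<open>A power of T in the second argument may be moved into the function under the form,
  because both sides have the inner products with T^(m + n) as their moments.\<close>

lemma form_pow_right:
  assumes x: "x \<in> ell2 I" and y: "y \<in> ell2 I" and C: "C \<in> sets borel"
  shows "sf C x ((T ^^ n) y) = form (\<lambda>t. indicator C t * t ^ n) x y"
proof -
  define Y where "Y k = (if k = 0 then (T ^^ n) y else y)" for k :: nat
  define g :: "nat \<Rightarrow> real \<Rightarrow> real" where "g k = (if k = 0 then (\<lambda>t. 1) else (\<lambda>t. t ^ n))" for k
  define c where "c k = (if k = 0 then 1 else -1 :: complex)" for k :: nat
  have s2: "sum f {..<2} = f 0 + f 1" for f :: "nat \<Rightarrow> complex" by (simp add: numeral_eq_Suc)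
  have "(\<Sum>k<2. c k * form (\<lambda>t. indicator C t * g k t) x (Y k)) = 0"
  proof (rule form_combination_zero[where K="max 1 (M ^ n)"])
    show "(\<Sum>j<2. c j * form (\<lambda>t. t ^ m * g j t) x (Y j)) = 0" for m
      using x y by (simp add: s2 g_def c_def Y_def form_power power_add[symmetric] pow_sym[symmetric])
        (simp add: form_power funpow_add add.commute[of m n])
    show "\<bar>g j t\<bar> \<le> max 1 (M ^ n)" if "0 \<le> t" "t \<le> M" for j t
      using that power_mono[of t M n] by (auto simp: g_def)
  qed (use x y C in \<open>auto simp: Y_def g_def\<close>)
  then show ?thesis by (simp add: s2 g_def c_def Y_def)
qed

text \<open>The product rule behind idempotence: by \<open>form_pow_right\<close> the moments of the
  form at \<open>spec C x\<close> are those of the form at x weighted with the indicator of C, and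
  an indicator equals its square.\<close>

lemma sf_spec:
  assumes x: "x \<in> ell2 I" and y: "y \<in> ell2 I" and C: "C \<in> sets borel"
  shows "sf C (spec C x) y = sf C x y"
proof -
  define X where "X k = (if k = 0 then spec C x else x)" for k :: nat
  define g :: "nat \<Rightarrow> real \<Rightarrow> real" where "g k = (if k = 0 then (\<lambda>t. 1) else indicator C)" for k
  define c where "c k = (if k = 0 then 1 else -1 :: complex)" for k :: nat
  have s2: "sum f {..<2} = f 0 + f 1" for f :: "nat \<Rightarrow> complex" by (simp add: numeral_eq_Suc)
  have "(\<Sum>k<2. c k * form (\<lambda>t. indicator C t * g k t) (X k) y) = 0"
  proof (rule form_combination_zero[where K=1])
    fix m
    have "form (\<lambda>t. t ^ m) (spec C x) y = ell2_inner I (spec C x) ((T ^^ m) y)"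
      using x y C by (simp add: form_power pow_sym)
    also have "\<dots> = sf C x ((T ^^ m) y)" using x y C by (simp add: inner_spec)
    also have "\<dots> = form (\<lambda>t. indicator C t * t ^ m) x y" by (rule form_pow_right[OF x y C])
    finally show "(\<Sum>j<2. c j * form (\<lambda>t. t ^ m * g j t) (X j) y) = 0"
      by (simp add: s2 g_def c_def X_def mult.commute)
  qed (use x y C in \<open>auto simp: X_def g_def indicator_def\<close>)
  moreover have "(\<lambda>t. indicator C t * indicator C t :: real) = indicator C" by (auto simp: indicator_def)
  ultimately show ?thesis by (simp add: s2 g_def c_def X_def)
qed

lemma spectral_measure_spec: "spectral_measure I T spec"
  unfolding spectral_measure_def orth_projection_def
proof (intro conjI ballI)
  fix C :: "real set" and x y assume C: "C \<in> sets borel" and x: "x \<in> ell2 I" and y: "y \<in> ell2 I"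
  show "spec C x \<in> ell2 I" using x C by simp
  show "spec C (spec C x) = spec C x"
    by (rule ell2_eqI[of _ I]) (use x C in \<open>auto simp: inner_spec sf_spec\<close>)
  show "ell2_inner I (spec C x) y = ell2_inner I x (spec C y)"
    unfolding ell2_inner_commute[of I x] using x y C by (simp add: inner_spec sf_commute[OF y x])
next
  fix x assume x: "x \<in> ell2 I"
  show "spec UNIV x = x"
  proof (rule ell2_eqI[of _ I])
    fix z assume z: "z \<in> ell2 I"
    have "ell2_inner I (spec UNIV x) z = sf UNIV x z" using x z by (simp add: inner_spec)
    also have "\<dots> = form (\<lambda>t. t ^ 0) x z" by (simp add: form_def)
    also have "\<dots> = ell2_inner I x z" by (simp only: form_power[OF x z] funpow.simps id_apply)
    finally show "ell2_inner I (spec UNIV x) z = ell2_inner I x z" .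
  qed (use x in auto)
  interpret finite_measure "mu x" by (rule mu(1)[OF x])
  have meas: "(\<lambda>t. t) \<in> borel_measurable (mu x)" by (subst measurable_cong_sets[OF mu(2)[OF x] refl]) simp
  have "integrable (mu x) (\<lambda>t. t)"
  proof (rule integrable_const_bound[where B=M])
    show "AE t in mu x. norm t \<le> M" using mu(3)[OF x] by eventually_elim simp
  qed (rule meas)
  moreover have "ell2_inner I (T x) x = complex_of_real (\<integral>t. t \<partial>mu x)"
    using mu(4)[OF x, of 1] pow_self_real[OF x, of 1] by simp
  ultimately show "\<exists>\<mu>. finite_measure \<mu> \<and> sets \<mu> = sets borel \<and>
      (\<forall>B\<in>sets borel. ell2_inner I (spec B x) x = complex_of_real (measure \<mu> B)) \<and>
      integrable \<mu> (\<lambda>t. t) \<and> ell2_inner I (T x) x = complex_of_real (\<integral>t. t \<partial>\<mu>)"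
    using mu[OF x] x by (intro exI[of _ "mu x"]) (simp add: inner_spec sf_self)
qed

end


text \<open>Prepares the splitting of the quadratic form of T on a sum of two vectors whose spectral
  measures add up.\<close>

lemma nn_integral_add_measure:
  fixes f :: "'a \<Rightarrow> ennreal"
  assumes s: "sets \<mu> = sets \<nu>" "sets \<mu>' = sets \<nu>"
    and add: "\<And>A. A \<in> sets \<nu> \<Longrightarrow> emeasure \<nu> A = emeasure \<mu> A + emeasure \<mu>' A"
    and f: "f \<in> borel_measurable \<nu>"
  shows "(\<integral>\<^sup>+t. f t \<partial>\<nu>) = (\<integral>\<^sup>+t. f t \<partial>\<mu>) + (\<integral>\<^sup>+t. f t \<partial>\<mu>')"
proof -
  have m: "h \<in> borel_measurable \<mu>" "h \<in> borel_measurable \<mu>'" if "h \<in> borel_measurable \<nu>" for h :: "'a \<Rightarrow> ennreal"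
    using that measurable_cong_sets[OF s(1) refl] measurable_cong_sets[OF s(2) refl] by blast+
  have sp: "space \<mu> = space \<nu>" "space \<mu>' = space \<nu>" using s[THEN sets_eq_imp_space_eq] by simp_all
  show ?thesis using f
  proof (induction rule: borel_measurable_induct)
    case (cong f g)
    have "integral\<^sup>N \<kappa> f = integral\<^sup>N \<kappa> g" if "space \<kappa> = space \<nu>" for \<kappa>
      by (rule nn_integral_cong) (use cong that in auto)
    then show ?case using cong sp by metis
  next
    case (set A)
    then show ?case using add s by simp
  next
    case (mult u c)
    then show ?case using m[OF mult(2)] by (simp add: nn_integral_cmult distrib_left)
  next
    case (add u v)
    then show ?case using m[OF add(1)] m[OF add(3)] by (simp add: nn_integral_add add_ac)
  next
    case (seq U)
    have inc: "incseq (\<lambda>i. integral\<^sup>N \<kappa> (U i))" for \<kappa>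
      using seq(3) by (auto simp: incseq_def le_fun_def intro!: nn_integral_mono)
    have Sup: "Sup (range U) = (\<lambda>x. SUP i. U i x)" by (simp add: image_comp fun_eq_iff)
    have conv: "integral\<^sup>N \<kappa> (Sup (range U)) = (SUP i. integral\<^sup>N \<kappa> (U i))" if "\<And>i. U i \<in> borel_measurable \<kappa>" for \<kappa>
      unfolding Sup using seq(3) that by (rule nn_integral_monotone_convergence_SUP)
    have IH: "integral\<^sup>N \<nu> (U i) = integral\<^sup>N \<mu> (U i) + integral\<^sup>N \<mu>' (U i)" for i
      using seq by blast
    show ?case
      unfolding seq(4) conv[OF seq(1)] conv[OF m(1)[OF seq(1)]] conv[OF m(2)[OF seq(1)]] IH
      by (rule ennreal_SUP_add[OF inc inc])
  qed
qed

lemma integral_add_measure: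
  fixes f :: "'a \<Rightarrow> real"
  assumes s: "sets \<mu> = sets \<nu>" "sets \<mu>' = sets \<nu>"
    and add: "\<And>A. A \<in> sets \<nu> \<Longrightarrow> emeasure \<nu> A = emeasure \<mu> A + emeasure \<mu>' A"
    and f: "integrable \<nu> f" "integrable \<mu> f" "integrable \<mu>' f"
  shows "(\<integral>t. f t \<partial>\<nu>) = (\<integral>t. f t \<partial>\<mu>) + (\<integral>t. f t \<partial>\<mu>')"
proof -
  have fin: "(\<integral>\<^sup>+t. ennreal (f t) \<partial>\<kappa>) < \<top>" "(\<integral>\<^sup>+t. ennreal (- f t) \<partial>\<kappa>) < \<top>" if "integrable \<kappa> f" for \<kappa>
    using that unfolding real_integrable_def by (auto simp: less_top)
  have "f \<in> borel_measurable \<nu>" using f(1) by auto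
  then have "(\<integral>\<^sup>+t. ennreal (f t) \<partial>\<nu>) = (\<integral>\<^sup>+t. ennreal (f t) \<partial>\<mu>) + (\<integral>\<^sup>+t. ennreal (f t) \<partial>\<mu>')"
    "(\<integral>\<^sup>+t. ennreal (- f t) \<partial>\<nu>) = (\<integral>\<^sup>+t. ennreal (- f t) \<partial>\<mu>) + (\<integral>\<^sup>+t. ennreal (- f t) \<partial>\<mu>')"
    by (auto intro!: nn_integral_add_measure[OF s add])
  then show ?thesis
    unfolding real_lebesgue_integral_def[OF f(1)] real_lebesgue_integral_def[OF f(2)] real_lebesgue_integral_def[OF f(3)]
    using fin[OF f(2)] fin[OF f(3)] by (simp add: enn2real_plus)
qed

section \<open>Uniqueness of the spectral projections on half-lines\<close>

context ell2_positive_op begin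

context
  fixes P assumes sp: "spectral_measure I T P"
begin

lemma P_maps [simp]: "B \<in> sets borel \<Longrightarrow> x \<in> ell2 I \<Longrightarrow> P B x \<in> ell2 I"
  using sp by (auto simp: spectral_measure_def orth_projection_def)

lemma P_idem: "B \<in> sets borel \<Longrightarrow> x \<in> ell2 I \<Longrightarrow> P B (P B x) = P B x"
  using sp by (auto simp: spectral_measure_def orth_projection_def)

lemma P_sym: "B \<in> sets borel \<Longrightarrow> x \<in> ell2 I \<Longrightarrow> y \<in> ell2 I \<Longrightarrow> ell2_inner I (P B x) y = ell2_inner I x (P B y)"
  using sp by (auto simp: spectral_measure_def orth_projection_def)

lemma P_UNIV: "x \<in> ell2 I \<Longrightarrow> P UNIV x = x"
  using sp by (auto simp: spectral_measure_def)

lemma P_lincomb: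
  assumes B: "B \<in> sets borel" and x: "x \<in> ell2 I" and y: "y \<in> ell2 I"
  shows "P B (lincomb a x b y) = lincomb a (P B x) b (P B y)"
proof (rule ell2_eqI[of _ I])
  fix z assume z: "z \<in> ell2 I"
  show "ell2_inner I (P B (lincomb a x b y)) z = ell2_inner I (lincomb a (P B x) b (P B y)) z"
    using B x y z by (simp add: P_sym ell2_lincomb ell2_inner_lincomb)
qed (use B x y in auto)

lemma P_inner_self:
  assumes B: "B \<in> sets borel" and x: "x \<in> ell2 I"
  shows "ell2_inner I (P B x) x = complex_of_real (nsq I (P B x))"
  using P_sym[OF B P_maps[OF B x] x] B x by (simp add: P_idem ell2_inner_self)

lemma P_measure:
  assumes x: "x \<in> ell2 I"
  obtains \<mu> :: "real measure" where "finite_measure \<mu>" "sets \<mu> = sets borel"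
    "\<And>B. B \<in> sets borel \<Longrightarrow> measure \<mu> B = nsq I (P B x)" "integrable \<mu> (\<lambda>t. t)"
    "Re (ell2_inner I (T x) x) = (\<integral>t. t \<partial>\<mu>)"
proof -
  obtain \<mu> :: "real measure" where \<mu>: "finite_measure \<mu>" "sets \<mu> = sets borel"
    "\<And>B. B \<in> sets borel \<Longrightarrow> ell2_inner I (P B x) x = complex_of_real (measure \<mu> B)"
    "integrable \<mu> (\<lambda>t. t)" "ell2_inner I (T x) x = complex_of_real (\<integral>t. t \<partial>\<mu>)"
    using sp x unfolding spectral_measure_def by blast
  have "measure \<mu> B = nsq I (P B x)" if "B \<in> sets borel" for B
    using \<mu>(3)[OF that] P_inner_self[OF that x] by simp
  with \<mu> show ?thesis by (intro that[of \<mu>]) auto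
qed

lemma P_nsq_Un:
  assumes "A \<in> sets borel" "B \<in> sets borel" "A \<inter> B = {}" and x: "x \<in> ell2 I"
  shows "nsq I (P (A \<union> B) x) = nsq I (P A x) + nsq I (P B x)"
proof -
  obtain \<mu> :: "real measure" where \<mu>: "finite_measure \<mu>" "sets \<mu> = sets borel"
    "\<And>B. B \<in> sets borel \<Longrightarrow> measure \<mu> B = nsq I (P B x)"
    using P_measure[OF x] by metis
  show ?thesis
    using finite_measure.finite_measure_Union[OF \<mu>(1), of A B] \<mu>(2,3) assms by simp
qed

text \<open>The quadratic forms agree because they are values of one measure, and over the complex
  numbers this already determines the maps.\<close>

lemma P_Un:
  assumes A: "A \<in> sets borel" and B: "B \<in> sets borel" and "A \<inter> B = {}" and x: "x \<in> ell2 I"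
  shows "P (A \<union> B) x = lincomb 1 (P A x) 1 (P B x)"
proof -
  define S where "S x = lincomb 1 (P (A \<union> B) x) (-1) (lincomb 1 (P A x) 1 (P B x))" for x
  have AB: "A \<union> B \<in> sets borel" using A B by simp
  have "S x = (\<lambda>k. 0)"
  proof (rule lincomb_inner_zero_imp[of I, OF _ _ _ x])
    fix x assume x: "x \<in> ell2 I"
    show "S x \<in> ell2 I" unfolding S_def using A B AB x by auto
    show "ell2_inner I (S x) x = 0"
      unfolding S_def using A B AB x P_nsq_Un[OF A B assms(3) x]
      by (simp add: ell2_inner_lincomb ell2_lincomb P_inner_self)
  next
    fix a b x y assume "x \<in> ell2 I" "y \<in> ell2 I"
    then show "S (lincomb a x b y) = lincomb a (S x) b (S y)"
      unfolding S_def using A B AB by (simp add: P_lincomb) (simp add: lincomb_def algebra_simps)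
  qed
  then have "P (A \<union> B) x k - (P A x k + P B x k) = 0" for k
    using fun_cong[of _ _ k] unfolding S_def lincomb_def by (fastforce simp: algebra_simps)
  then show ?thesis by (auto simp: lincomb_def)
qed

lemma P_contract:
  assumes B: "B \<in> sets borel" and x: "x \<in> ell2 I"
  shows "nsq I (P B x) \<le> nsq I x"
proof -
  have "nsq I (P (B \<union> - B) x) = nsq I (P B x) + nsq I (P (- B) x)"
    by (rule P_nsq_Un) (use B x in auto)
  then show ?thesis using P_UNIV[OF x] nsq_nonneg[of I "P (- B) x"] by simp
qed

text \<open>On the range of P B the contraction P (A \<union> B) has as squared norm the sum of
  those of P A and of P B, which is the identity there; nothing is left for P A.\<close>

lemma P_disjoint:
  assumes A: "A \<in> sets borel" and B: "B \<in> sets borel" and d: "A \<inter> B = {}" and x: "x \<in> ell2 I"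
  shows "P A (P B x) = (\<lambda>k. 0)"
proof (rule nsq_eq_0[of _ I])
  have "nsq I (P (A \<union> B) (P B x)) = nsq I (P A (P B x)) + nsq I (P B x)"
    using P_nsq_Un[OF A B d P_maps[OF B x]] P_idem[OF B x] by simp
  moreover have "nsq I (P (A \<union> B) (P B x)) \<le> nsq I (P B x)" using A B x by (intro P_contract) auto
  ultimately show "nsq I (P A (P B x)) = 0" using nsq_nonneg[of I "P A (P B x)"] by linarith
qed (use A B x in auto)

lemma P_Int:
  assumes A: "A \<in> sets borel" and B: "B \<in> sets borel" and x: "x \<in> ell2 I"
  shows "P A (P B x) = P (A \<inter> B) x"
proof -
  have AB: "A \<inter> B \<in> sets borel" "A - B \<in> sets borel" "B - A \<in> sets borel" using A B by auto
  have "P A y = lincomb 1 (P (A \<inter> B) y) 1 (P (A - B) y)" if "y \<in> ell2 I" for y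
  proof -
    have "P A y = P ((A \<inter> B) \<union> (A - B)) y" by (simp add: Int_Diff_Un)
    also have "\<dots> = lincomb 1 (P (A \<inter> B) y) 1 (P (A - B) y)" by (rule P_Un) (use AB that in auto)
    finally show ?thesis .
  qed
  note A_split = this
  have B_split: "P B x = lincomb 1 (P (A \<inter> B) x) 1 (P (B - A) x)"
  proof -
    have "P B x = P ((A \<inter> B) \<union> (B - A)) x" by (rule arg_cong[where f="\<lambda>C. P C x"]) auto
    also have "\<dots> = lincomb 1 (P (A \<inter> B) x) 1 (P (B - A) x)" by (rule P_Un) (use AB x in auto)
    finally show ?thesis .
  qed
  have 1: "P (A \<inter> B) (P (B - A) x) = (\<lambda>k. 0)" "P (A - B) (P (A \<inter> B) x) = (\<lambda>k. 0)" "P (A - B) (P (B - A) x) = (\<lambda>k. 0)"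
    by (rule P_disjoint; use AB x in auto)+
  show ?thesis
    unfolding A_split[OF P_maps[OF B x]] unfolding B_split using AB x
    by (simp add: P_lincomb P_idem 1) (simp add: lincomb_def)
qed

lemma P_compl:
  assumes B: "B \<in> sets borel" and x: "x \<in> ell2 I"
  shows "x = lincomb 1 (P B x) 1 (P (- B) x)"
proof -
  have "P (B \<union> - B) x = lincomb 1 (P B x) 1 (P (- B) x)" by (rule P_Un) (use B x in auto)
  then show ?thesis using P_UNIV[OF x] by simp
qed

text \<open>A vector in the range of P B has no mass outside B, so bounds on the set B become bounds
  on the quadratic form of T.\<close>

lemma P_range_measure:
  assumes B: "B \<in> sets borel" and y: "y \<in> ell2 I" and yB: "P B y = y"
  obtains \<mu> :: "real measure" where "finite_measure \<mu>" "AE t in \<mu>. t \<in> B" "measure \<mu> (space \<mu>) = nsq I y"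
    "integrable \<mu> (\<lambda>t. t)" "Re (ell2_inner I (T y) y) = (\<integral>t. t \<partial>\<mu>)"
proof -
  obtain \<mu> :: "real measure" where \<mu>: "finite_measure \<mu>" "sets \<mu> = sets borel"
    "\<And>B. B \<in> sets borel \<Longrightarrow> measure \<mu> B = nsq I (P B y)" "integrable \<mu> (\<lambda>t. t)"
    "Re (ell2_inner I (T y) y) = (\<integral>t. t \<partial>\<mu>)"
    using P_measure[OF y] by metis
  interpret finite_measure \<mu> by fact
  have sp: "space \<mu> = UNIV" using sets_eq_imp_space_eq[OF \<mu>(2)] by simp
  have "P (- B) y = (\<lambda>k. 0)" using P_disjoint[of "- B" B y] B y yB by simp
  then have "measure \<mu> (- B) = 0" using \<mu>(3)[of "- B"] B by (simp add: nsq_def)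
  then have "emeasure \<mu> (- B) = 0" by (simp add: emeasure_eq_measure)
  then have "AE t in \<mu>. t \<in> B"
    using B \<mu>(2) by (intro AE_I[where N="- B"]) auto
  moreover have "measure \<mu> (space \<mu>) = nsq I y" using \<mu>(3)[of UNIV] P_UNIV[OF y] sp by simp
  ultimately show ?thesis using that \<mu> by blast
qed

lemma P_range_le:
  assumes B: "B \<in> sets borel" and y: "y \<in> ell2 I" and yB: "P B y = y" and Bc: "B \<subseteq> {..c}"
  shows "Re (ell2_inner I (T y) y) \<le> c * nsq I y"
proof -
  obtain \<mu> :: "real measure" where \<mu>: "finite_measure \<mu>" "AE t in \<mu>. t \<in> B" "measure \<mu> (space \<mu>) = nsq I y"
    "integrable \<mu> (\<lambda>t. t)" "Re (ell2_inner I (T y) y) = (\<integral>t. t \<partial>\<mu>)"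
    using P_range_measure[OF B y yB] by metis
  interpret finite_measure \<mu> by fact
  have "(\<integral>t. t \<partial>\<mu>) \<le> (\<integral>t. c \<partial>\<mu>)"
  proof (rule integral_mono_AE[OF \<mu>(4)])
    show "AE t in \<mu>. t \<le> c" using \<mu>(2) by eventually_elim (use Bc in auto)
  qed simp
  then show ?thesis using \<mu> by (simp add: mult.commute)
qed

lemma P_range_ge:
  assumes B: "B \<in> sets borel" and y: "y \<in> ell2 I" and yB: "P B y = y" and Bc: "B \<subseteq> {c..}"
  shows "c * nsq I y \<le> Re (ell2_inner I (T y) y)"
proof -
  obtain \<mu> :: "real measure" where \<mu>: "finite_measure \<mu>" "AE t in \<mu>. t \<in> B" "measure \<mu> (space \<mu>) = nsq I y"
    "integrable \<mu> (\<lambda>t. t)" "Re (ell2_inner I (T y) y) = (\<integral>t. t \<partial>\<mu>)"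
    using P_range_measure[OF B y yB] by metis
  interpret finite_measure \<mu> by fact
  have "(\<integral>t. c \<partial>\<mu>) \<le> (\<integral>t. t \<partial>\<mu>)"
  proof (rule integral_mono_AE[OF _ \<mu>(4)])
    show "AE t in \<mu>. c \<le> t" using \<mu>(2) by eventually_elim (use Bc in auto)
  qed simp
  then show ?thesis using \<mu> by (simp add: mult.commute)
qed

lemma P_negative:
  assumes x: "x \<in> ell2 I"
  shows "P {..<0} x = (\<lambda>k. 0)"
proof -
  define y where "y = P {..<0} x"
  have y: "y \<in> ell2 I" "P {..<0} y = y" unfolding y_def using x by (auto simp: P_idem)
  obtain \<mu> :: "real measure" where \<mu>: "finite_measure \<mu>" "AE t in \<mu>. t \<in> {..<0}" "measure \<mu> (space \<mu>) = nsq I y"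
    "integrable \<mu> (\<lambda>t. t)" "Re (ell2_inner I (T y) y) = (\<integral>t. t \<partial>\<mu>)"
    using P_range_measure[OF _ y] by (metis lessThan_borel)
  interpret finite_measure \<mu> by fact
  have "(\<integral>t. - t \<partial>\<mu>) \<le> 0" using pos[OF y(1)] \<mu>(5) by simp
  moreover have AE: "AE t in \<mu>. 0 \<le> - t" using \<mu>(2) by eventually_elim simp
  then have "0 \<le> (\<integral>t. - t \<partial>\<mu>)" by (rule integral_nonneg_AE)
  ultimately have "(\<integral>t. - t \<partial>\<mu>) = 0" by simp
  then have "AE t in \<mu>. - t = 0"
    using integral_nonneg_eq_0_iff_AE[of \<mu> "\<lambda>t. - t"] AE \<mu>(4) by simp
  then have "AE t in \<mu>. False" using \<mu>(2) by eventually_elim simp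
  then have "(\<integral>t. 1 \<partial>\<mu>) = (\<integral>t. (0::real) \<partial>\<mu>)"
    by (intro integral_cong_AE) (auto elim: eventually_mono)
  then have "measure \<mu> (space \<mu>) = 0" by simp
  then show ?thesis using \<mu>(3) y(1) nsq_eq_0 unfolding y_def by metis
qed

text \<open>A spectral measure is tied to T only through quadratic forms. For u in the range of P B
  and v in that of P (- B) the measures of u and v add up to the measure of u + v, so the mixed term
  of T has real part zero; replacing y by i y handles the imaginary part.\<close>

lemma P_T_orthogonal:
  assumes B: "B \<in> sets borel" and x: "x \<in> ell2 I" and y: "y \<in> ell2 I"
  shows "ell2_inner I (T (P B x)) (P (- B) y) = 0"
proof -
  have Bc: "- B \<in> sets borel" using B by simp
  have Re0: "Re (ell2_inner I (T (P B x)) (P (- B) y)) = 0" if y: "y \<in> ell2 I" for y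
  proof -
    define u v where "u = P B x" and "v = P (- B) y"
    have u: "u \<in> ell2 I" and v: "v \<in> ell2 I" unfolding u_def v_def using B Bc x y by auto
    define w where "w = lincomb 1 u 1 v"
    have w: "w \<in> ell2 I" unfolding w_def using u v by auto
    have nsq_add: "nsq I (P C w) = nsq I (P C u) + nsq I (P C v)" if C: "C \<in> sets borel" for C
    proof -
      have "ell2_inner I (P C u) (P C v) = ell2_inner I (P C u) v"
        using C u v by (metis P_idem P_maps P_sym)
      also have "\<dots> = ell2_inner I (P (- B) (P C (P B x))) y"
        unfolding u_def v_def using C B Bc x y by (simp add: P_sym)
      also have "P (- B) (P C (P B x)) = (\<lambda>k. 0)"
      proof -
        have "P (- B) (P C (P B x)) = P (- B) (P (C \<inter> B) x)" using P_Int[OF C B x] by simp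
        also have "\<dots> = (\<lambda>k. 0)" by (rule P_disjoint) (use B C x in auto)
        finally show ?thesis .
      qed
      finally have "ell2_inner I (P C u) (P C v) = 0" by simp
      then show ?thesis unfolding w_def using C u v by (simp add: P_lincomb nsq_lincomb)
    qed
    obtain \<mu> :: "real measure" where \<mu>: "finite_measure \<mu>" "sets \<mu> = sets borel"
      "\<And>B. B \<in> sets borel \<Longrightarrow> measure \<mu> B = nsq I (P B u)" "integrable \<mu> (\<lambda>t. t)"
      "Re (ell2_inner I (T u) u) = (\<integral>t. t \<partial>\<mu>)" using P_measure[OF u] by metis
    obtain \<mu>' :: "real measure" where \<mu>': "finite_measure \<mu>'" "sets \<mu>' = sets borel"
      "\<And>B. B \<in> sets borel \<Longrightarrow> measure \<mu>' B = nsq I (P B v)" "integrable \<mu>' (\<lambda>t. t)"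
      "Re (ell2_inner I (T v) v) = (\<integral>t. t \<partial>\<mu>')" using P_measure[OF v] by metis
    obtain \<nu> :: "real measure" where \<nu>: "finite_measure \<nu>" "sets \<nu> = sets borel"
      "\<And>B. B \<in> sets borel \<Longrightarrow> measure \<nu> B = nsq I (P B w)" "integrable \<nu> (\<lambda>t. t)"
      "Re (ell2_inner I (T w) w) = (\<integral>t. t \<partial>\<nu>)" using P_measure[OF w] by metis
    have "(\<integral>t. t \<partial>\<nu>) = (\<integral>t. t \<partial>\<mu>) + (\<integral>t. t \<partial>\<mu>')"
    proof (rule integral_add_measure)
      fix A assume "A \<in> sets \<nu>"
      then have "A \<in> sets borel" using \<nu>(2) by simp
      then show "emeasure \<nu> A = emeasure \<mu> A + emeasure \<mu>' A"
        using nsq_add \<mu>(3) \<mu>'(3) \<nu>(3)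
        by (simp add: finite_measure.emeasure_eq_measure[OF \<mu>(1)] finite_measure.emeasure_eq_measure[OF \<mu>'(1)]
            finite_measure.emeasure_eq_measure[OF \<nu>(1)] flip: ennreal_plus)
    qed (use \<mu> \<mu>' \<nu> in auto)
    then have "Re (ell2_inner I (T w) w) = Re (ell2_inner I (T u) u) + Re (ell2_inner I (T v) v)"
      using \<mu>(5) \<mu>'(5) \<nu>(5) by simp
    moreover have "ell2_inner I (T w) w = ell2_inner I (T u) u + ell2_inner I (T u) v + cnj (ell2_inner I (T u) v) + ell2_inner I (T v) v"
      unfolding w_def using u v sym[OF v u] ell2_inner_commute[of I v "T u"]
      by (simp add: lin ell2_inner_lincomb ell2_inner_lincomb_right ell2_lincomb)
    ultimately show ?thesis by (simp add: u_def v_def)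
  qed
  have "Re (ell2_inner I (T (P B x)) (P (- B) (lincomb \<i> y 0 y))) = 0"
    by (rule Re0) (use y in auto)
  then have "Im (ell2_inner I (T (P B x)) (P (- B) y)) = 0"
    using B Bc x y by (simp add: P_lincomb ell2_inner_lincomb_right)
  then show ?thesis using Re0[OF y] by (simp add: complex_eq_iff)
qed

lemma P_T_commute:
  assumes B: "B \<in> sets borel" and x: "x \<in> ell2 I"
  shows "P B (T x) = T (P B x)"
proof -
  have Bc: "- B \<in> sets borel" using B by simp
  have 1: "P (- C) (T (P C x)) = (\<lambda>k. 0)" if C: "C \<in> sets borel" for C
  proof (rule ell2_eqI[of _ I])
    fix z assume "z \<in> ell2 I"
    then show "ell2_inner I (P (- C) (T (P C x))) z = ell2_inner I (\<lambda>k. 0) z"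
      using P_T_orthogonal[OF C x] C x by (simp add: P_sym)
  qed (use C x in auto)
  have 2: "T (P B x) = P B (T (P B x))"
  proof -
    have "T (P B x) = lincomb 1 (P B (T (P B x))) 1 (P (- B) (T (P B x)))"
      by (rule P_compl[OF B]) (use B x in auto)
    also have "\<dots> = P B (T (P B x))" using 1[OF B] by (simp add: lincomb_def)
    finally show ?thesis .
  qed
  have "P B (T x) = P B (T (lincomb 1 (P B x) 1 (P (- B) x)))" using P_compl[OF B x] by simp
  also have "\<dots> = lincomb 1 (P B (T (P B x))) 1 (P B (T (P (- B) x)))"
    using B Bc x by (simp add: lin P_lincomb)
  also have "P B (T (P (- B) x)) = (\<lambda>k. 0)" using 1[OF Bc] by simp
  finally show ?thesis using 2 by (simp add: lincomb_def)
qed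

text \<open>Commuting with the powers of T means commuting with all moments, and these determine
  \<open>spec\<close>; hence P also commutes with the constructed projections.\<close>

lemma P_pow_commute:
  assumes B: "B \<in> sets borel" and x: "x \<in> ell2 I"
  shows "P B ((T ^^ n) x) = (T ^^ n) (P B x)"
  by (induction n) (use B x in \<open>auto simp: P_T_commute\<close>)

lemma P_spec_commute:
  assumes B: "B \<in> sets borel" and C: "C \<in> sets borel" and x: "x \<in> ell2 I"
  shows "spec C (P B x) = P B (spec C x)"
proof (rule ell2_eqI[of _ I])
  fix y assume y: "y \<in> ell2 I"
  define X where "X k = (if k = 0 then P B x else x)" for k :: nat
  define Y where "Y k = (if k = 0 then y else P B y)" for k :: nat
  define c where "c k = (if k = 0 then 1 else -1 :: complex)" for k :: nat
  have s2: "sum f {..<2} = f 0 + f 1" for f :: "nat \<Rightarrow> complex" by (simp add: numeral_eq_Suc)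
  have "(\<Sum>k<2. c k * form (\<lambda>t. indicator C t * 1) (X k) (Y k)) = 0"
  proof (rule form_combination_zero[where K=1])
    show "(\<Sum>j<2. c j * form (\<lambda>t. t ^ m * 1) (X j) (Y j)) = 0" for m
      using x y B by (simp add: s2 c_def X_def Y_def form_power P_pow_commute[symmetric] P_sym)
  qed (use x y C B in \<open>auto simp: X_def Y_def\<close>)
  then have "sf C (P B x) y = sf C x (P B y)" by (simp add: s2 c_def X_def Y_def)
  then show "ell2_inner I (spec C (P B x)) y = ell2_inner I (P B (spec C x)) y"
    using x y B C by (simp add: inner_spec P_sym)
qed (use B C x in auto)

end

text \<open>For c' > c, a vector in the ranges of both P {..c} and Q {c'<..} has quadratic form at
  most c times and at least c' times its squared norm, hence vanishes. Then c' descends to c along c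
  + 1 / (n + 1).\<close>

lemma spectral_measure_range_subset:
  assumes P: "spectral_measure I T P" and Q: "spectral_measure I T Q"
    and comm: "\<And>B C x. B \<in> sets borel \<Longrightarrow> C \<in> sets borel \<Longrightarrow> x \<in> ell2 I \<Longrightarrow> Q C (P B x) = P B (Q C x)"
    and x: "x \<in> ell2 I"
  shows "Q {..c} (P {..c} x) = P {..c} x"
proof -
  define z where "z = P {..c} x"
  have z: "z \<in> ell2 I" "P {..c} z = z" unfolding z_def using x by (auto simp: P_maps[OF P] P_idem[OF P])
  have zero: "nsq I (Q {c'<..} z) = 0" if c': "c < c'" for c'
  proof -
    define y where "y = Q {c'<..} z"
    have y: "y \<in> ell2 I" unfolding y_def using z by (simp add: P_maps[OF Q])
    have "P {..c} y = y" unfolding y_def using comm[of "{..c}" "{c'<..}" z] z by simp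
    then have "Re (ell2_inner I (T y) y) \<le> c * nsq I y"
      using y by (intro P_range_le[OF P, of "{..c}"]) auto
    moreover have "c' * nsq I y \<le> Re (ell2_inner I (T y) y)"
      using y z by (intro P_range_ge[OF Q, of "{c'<..}"]) (auto simp: y_def P_idem[OF Q])
    ultimately have "(c' - c) * nsq I y \<le> 0" by (simp add: algebra_simps)
    then show ?thesis using c' nsq_nonneg[of I y] unfolding y_def by (simp add: mult_le_0_iff)
  qed
  obtain \<mu> :: "real measure" where \<mu>: "finite_measure \<mu>" "sets \<mu> = sets borel"
    "\<And>B. B \<in> sets borel \<Longrightarrow> measure \<mu> B = nsq I (Q B z)"
    using P_measure[OF Q z(1)] by metis
  interpret finite_measure \<mu> by fact
  have "emeasure \<mu> (\<Union>n. {c + inverse (real (Suc n))<..}) = 0"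
    by (rule emeasure_UN_eq_0) (auto simp: emeasure_eq_measure \<mu> zero)
  also have "(\<Union>n. {c + inverse (real (Suc n))<..}) = {c<..}"
  proof safe
    fix t n assume "c + inverse (real (Suc n)) < t"
    moreover have "0 < inverse (real (Suc n))" by simp
    ultimately show "c < t" by linarith
  next
    fix t assume "c < t"
    then obtain n where "inverse (real (Suc n)) < t - c" using reals_Archimedean[of "t - c"] by auto
    then show "t \<in> (\<Union>n. {c + inverse (real (Suc n))<..})" by (auto intro!: exI[of _ n])
  qed
  finally have "nsq I (Q {c<..} z) = 0" using \<mu>(3)[of "{c<..}"] by (simp add: emeasure_eq_measure)
  then have "Q (- {..c}) z = (\<lambda>k. 0)"
    using nsq_eq_0[OF P_maps[OF Q _ z(1)], of "{c<..}"] by (simp add: Compl_atMost)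
  moreover have "z = lincomb 1 (Q {..c} z) 1 (Q (- {..c}) z)"
    by (rule P_compl[OF Q]) (use z in auto)
  ultimately have "z = Q {..c} z" by (simp add: lincomb_def)
  then show ?thesis by (simp add: z_def)
qed

text \<open>Each family fixes the range of the other, so Q P = P and P Q = Q; symmetry of the
  projections turns this into P = Q.\<close>

lemma spectral_measure_atMost_unique:
  assumes P: "spectral_measure I T P" and x: "x \<in> ell2 I"
  shows "P {..c} x = spec {..c} x"
proof (rule ell2_eqI[of _ I])
  note S = spectral_measure_spec
  have c: "{..c} \<in> sets borel" by simp
  fix y assume y: "y \<in> ell2 I"
  have 1: "spec {..c} (P {..c} x) = P {..c} x" if "x \<in> ell2 I" for x
    by (rule spectral_measure_range_subset[OF P S]) (use that P_spec_commute[OF P] in auto)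
  have 2: "P {..c} (spec {..c} x) = spec {..c} x" if "x \<in> ell2 I" for x
    by (rule spectral_measure_range_subset[OF S P]) (use that P_spec_commute[OF P] in auto)
  have "ell2_inner I (P {..c} x) y = ell2_inner I (spec {..c} (P {..c} x)) y" using 1[OF x] by simp
  also have "\<dots> = ell2_inner I x (P {..c} (spec {..c} y))"
    using x y c by (simp add: P_sym[OF S] P_sym[OF P] P_maps[OF P])
  also have "\<dots> = ell2_inner I x (spec {..c} y)" using 2[OF y] by simp
  also have "\<dots> = ell2_inner I (spec {..c} x) y" using x y c by (simp add: P_sym[OF S])
  finally show "ell2_inner I (P {..c} x) y = ell2_inner I (spec {..c} x) y" .
qed (use x in \<open>auto simp: P_maps[OF P]\<close>)

text \<open>Positivity of T forces P {..<0} = 0, so {0..c} may be replaced by {..c}, where the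
  chosen family agrees with the constructed one.\<close>

theorem inner_spectral_projection:
  assumes x: "x \<in> ell2 I" and c: "0 \<le> c"
  shows "ell2_inner I (spectral_projection I T {0..c} x) x = complex_of_real (measure (mu x) {0..c})"
proof -
  define P where "P = spectral_projection I T"
  have P: "spectral_measure I T P"
    unfolding P_def spectral_projection_def by (rule someI[of _ spec]) (rule spectral_measure_spec)
  have eq: "R {0..c} x = R {..c} x" if R: "spectral_measure I T R" for R
  proof -
    have "R {..c} x = R ({..<0} \<union> {0..c}) x" using c by (intro arg_cong[where f="\<lambda>C. R C x"]) auto
    also have "\<dots> = lincomb 1 (R {..<0} x) 1 (R {0..c} x)" by (rule P_Un[OF R]) (use x in auto)
    also have "\<dots> = R {0..c} x" using P_negative[OF R x] by (simp add: lincomb_def)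
    finally show ?thesis by simp
  qed
  have "P {0..c} x = spec {0..c} x"
    using eq[OF P] eq[OF spectral_measure_spec] spectral_measure_atMost_unique[OF P x] by simp
  then show ?thesis using x by (simp add: P_def inner_spec sf_self)
qed

end

section \<open>Group rings and right multiplication\<close>


text \<open>The linear extension of \<phi> from group elements to the group ring. Characters, matrix
  coefficients and translates of vectors all enter through this pairing.\<close>

definition gr_eval :: "('g \<Rightarrow> complex) \<Rightarrow> ('g \<Rightarrow> complex) \<Rightarrow> complex" where
  "gr_eval a \<phi> = (\<Sum>g | a g \<noteq> 0. a g * \<phi> g)"

definition gr_elem :: "('g, 'm) monoid_scheme \<Rightarrow> ('g \<Rightarrow> complex) \<Rightarrow> bool" where
  "gr_elem G a \<longleftrightarrow> finite {g. a g \<noteq> 0} \<and> {g. a g \<noteq> 0} \<subseteq> carrier G"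

lemma gr_elemD: "gr_elem G a \<Longrightarrow> finite {g. a g \<noteq> 0}" "gr_elem G a \<Longrightarrow> a g \<noteq> 0 \<Longrightarrow> g \<in> carrier G"
  "gr_elem G a \<Longrightarrow> g \<notin> carrier G \<Longrightarrow> a g = 0"
  by (auto simp: gr_elem_def)

lemma gr_eval_superset:
  assumes "finite S" "{g. a g \<noteq> 0} \<subseteq> S"
  shows "gr_eval a \<phi> = (\<Sum>g\<in>S. a g * \<phi> g)"
  unfolding gr_eval_def by (rule sum.mono_neutral_left) (use assms in auto)

lemma gr_eval_sum:
  assumes "finite J" "\<And>j. j \<in> J \<Longrightarrow> gr_elem G (a j)"
  shows "gr_eval (\<lambda>g. \<Sum>j\<in>J. a j g) \<phi> = (\<Sum>j\<in>J. gr_eval (a j) \<phi>)"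
proof -
  define S where "S = (\<Union>j\<in>J. {g. a j g \<noteq> 0})"
  have S: "finite S" unfolding S_def using assms gr_elemD(1) by blast
  have "gr_eval (\<lambda>g. \<Sum>j\<in>J. a j g) \<phi> = (\<Sum>g\<in>S. (\<Sum>j\<in>J. a j g) * \<phi> g)"
    by (rule gr_eval_superset[OF S]) (auto simp: S_def intro: ccontr sum.neutral)
  also have "\<dots> = (\<Sum>j\<in>J. \<Sum>g\<in>S. a j g * \<phi> g)"
    unfolding sum_distrib_right by (rule sum.swap)
  also have "\<dots> = (\<Sum>j\<in>J. gr_eval (a j) \<phi>)"
    by (intro sum.cong refl gr_eval_superset[symmetric] S) (auto simp: S_def)
  finally show ?thesis .
qed

lemma gr_elem_sum:
  assumes "finite J" "\<And>j. j \<in> J \<Longrightarrow> gr_elem G (a j)"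
  shows "gr_elem G (\<lambda>g. \<Sum>j\<in>J. a j g)"
proof -
  have "{g. (\<Sum>j\<in>J. a j g) \<noteq> 0} \<subseteq> (\<Union>j\<in>J. {g. a j g \<noteq> 0})" by (auto intro: ccontr sum.neutral)
  moreover have "finite (\<Union>j\<in>J. {g. a j g \<noteq> 0})" using assms gr_elemD(1) by blast
  ultimately show ?thesis using assms unfolding gr_elem_def by (blast intro: finite_subset)
qed

context group begin

lemma gr_elem_times:
  assumes a: "gr_elem G a" and b: "gr_elem G b"
  shows "gr_elem G (gr_times G a b)"
proof -
  have "{g. gr_times G a b g \<noteq> 0} \<subseteq> (\<lambda>(u, h). u \<otimes> h) ` ({g. a g \<noteq> 0} \<times> {g. b g \<noteq> 0})"
  proof
    fix g assume "g \<in> {g. gr_times G a b g \<noteq> 0}"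
    then have g: "g \<in> carrier G" and nz: "(\<Sum>h | h \<in> carrier G \<and> b h \<noteq> 0. a (g \<otimes> inv h) * b h) \<noteq> 0"
      by (auto simp: gr_times_def split: if_splits)
    obtain h where h: "h \<in> carrier G" "b h \<noteq> 0" "a (g \<otimes> inv h) \<noteq> 0"
      by (rule sum.not_neutral_contains_not_neutral[OF nz]) auto
    have "g = (g \<otimes> inv h) \<otimes> h" using g h by (simp add: m_assoc)
    then show "g \<in> (\<lambda>(u, h). u \<otimes> h) ` ({g. a g \<noteq> 0} \<times> {g. b g \<noteq> 0})" using h by (auto simp: image_iff intro!: bexI[of _ "g \<otimes> inv h"])
  qed
  moreover have "finite ((\<lambda>(u, h). u \<otimes> h) ` ({g. a g \<noteq> 0} \<times> {g. b g \<noteq> 0}))"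
    using a b by (auto dest: gr_elemD(1))
  ultimately show ?thesis unfolding gr_elem_def by (auto simp: gr_times_def intro: finite_subset split: if_splits)
qed

lemma gr_times_eval:
  assumes b: "gr_elem G b" and g: "g \<in> carrier G"
  shows "gr_times G x b g = gr_eval b (\<lambda>h. x (g \<otimes> inv h))"
proof -
  have "{h \<in> carrier G. b h \<noteq> 0} = {h. b h \<noteq> 0}" using gr_elemD(2)[OF b] by auto
  then show ?thesis using g by (simp add: gr_times_def gr_eval_def mult.commute)
qed

text \<open>The substitution u = g h^(-1) turns the convolution into an iterated evaluation; this is
  what makes a representation multiplicative on matrices over the group ring.\<close>

lemma gr_eval_times:
  assumes a: "gr_elem G a" and b: "gr_elem G b"
  shows "gr_eval (gr_times G a b) \<phi> = gr_eval a (\<lambda>u. gr_eval b (\<lambda>h. \<phi> (u \<otimes> h)))"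
proof -
  let ?A = "{g. a g \<noteq> 0}" and ?B = "{g. b g \<noteq> 0}"
  define S where "S = (\<lambda>(u, h). u \<otimes> h) ` (?A \<times> ?B)"
  have fA: "finite ?A" and fB: "finite ?B" using a b by (auto dest: gr_elemD(1))
  have cA: "?A \<subseteq> carrier G" and cB: "?B \<subseteq> carrier G" using a b by (auto dest: gr_elemD(2))
  have S: "finite S" unfolding S_def using fA fB by auto
  have SG: "S \<subseteq> carrier G" unfolding S_def using cA cB by auto
  have sub: "{g. gr_times G a b g \<noteq> 0} \<subseteq> S"
  proof
    fix g assume "g \<in> {g. gr_times G a b g \<noteq> 0}"
    then have g: "g \<in> carrier G" and nz: "(\<Sum>h | h \<in> carrier G \<and> b h \<noteq> 0. a (g \<otimes> inv h) * b h) \<noteq> 0"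
      by (auto simp: gr_times_def split: if_splits)
    obtain h where h: "h \<in> carrier G" "b h \<noteq> 0" "a (g \<otimes> inv h) \<noteq> 0"
      by (rule sum.not_neutral_contains_not_neutral[OF nz]) auto
    have "g = (g \<otimes> inv h) \<otimes> h" using g h by (simp add: m_assoc)
    then show "g \<in> S" using h unfolding S_def by (auto simp: image_iff intro!: bexI[of _ "g \<otimes> inv h"])
  qed
  have "gr_eval (gr_times G a b) \<phi> = (\<Sum>g\<in>S. (\<Sum>h\<in>?B. a (g \<otimes> inv h) * b h) * \<phi> g)"
    unfolding gr_eval_superset[OF S sub] using SG
    by (intro sum.cong refl) (auto simp: gr_times_eval[OF b] gr_eval_def mult.commute intro!: sum.cong)
  also have "\<dots> = (\<Sum>h\<in>?B. \<Sum>g\<in>S. a (g \<otimes> inv h) * b h * \<phi> g)"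
    unfolding sum_distrib_right by (rule sum.swap)
  also have "\<dots> = (\<Sum>h\<in>?B. \<Sum>u\<in>?A. a u * b h * \<phi> (u \<otimes> h))"
  proof (rule sum.cong[OF refl])
    fix h assume h: "h \<in> ?B"
    then have hG: "h \<in> carrier G" using cB by auto
    have "(\<Sum>u\<in>?A. a u * b h * \<phi> (u \<otimes> h)) = (\<Sum>g\<in>(\<lambda>u. u \<otimes> h) ` ?A. a (g \<otimes> inv h) * b h * \<phi> g)"
      using cA hG by (subst sum.reindex) (auto simp: inj_on_def m_assoc subset_iff intro!: sum.cong)
    also have "\<dots> = (\<Sum>g\<in>S. a (g \<otimes> inv h) * b h * \<phi> g)"
    proof (rule sum.mono_neutral_left[OF S])
      show "(\<lambda>u. u \<otimes> h) ` ?A \<subseteq> S" using h by (auto simp: S_def)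
      show "\<forall>g\<in>S - (\<lambda>u. u \<otimes> h) ` ?A. a (g \<otimes> inv h) * b h * \<phi> g = 0"
      proof
        fix g assume g: "g \<in> S - (\<lambda>u. u \<otimes> h) ` ?A"
        then have "g \<in> carrier G" using SG by auto
        then have "g = (g \<otimes> inv h) \<otimes> h" using hG by (simp add: m_assoc)
        then have "a (g \<otimes> inv h) = 0" using g by (auto simp: image_iff)
        then show "a (g \<otimes> inv h) * b h * \<phi> g = 0" by simp
      qed
    qed
    finally show "(\<Sum>g\<in>S. a (g \<otimes> inv h) * b h * \<phi> g) = (\<Sum>u\<in>?A. a u * b h * \<phi> (u \<otimes> h))" by simp
  qed
  also have "\<dots> = (\<Sum>u\<in>?A. \<Sum>h\<in>?B. a u * b h * \<phi> (u \<otimes> h))" by (rule sum.swap)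
  also have "\<dots> = gr_eval a (\<lambda>u. gr_eval b (\<lambda>h. \<phi> (u \<otimes> h)))"
    unfolding gr_eval_def sum_distrib_left by (simp add: mult.assoc)
  finally show ?thesis .
qed

lemma gr_mat_elem: "group_ring_mat G r s A \<Longrightarrow> i < r \<Longrightarrow> j < s \<Longrightarrow> gr_elem G (A i j)"
  by (auto simp: group_ring_mat_def gr_elem_def)

lemma gr_matI: "(\<And>i j. i < r \<Longrightarrow> j < s \<Longrightarrow> gr_elem G (A i j)) \<Longrightarrow> group_ring_mat G r s A"
  by (auto simp: group_ring_mat_def gr_elem_def)

lemma gr_mat_times_mat:
  assumes "group_ring_mat G r s A" "group_ring_mat G s u B"
  shows "group_ring_mat G r u (gr_mat_times G s A B)"
proof (rule gr_matI)
  fix i k assume "i < r" "k < u"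
  then have "gr_elem G (\<lambda>g. \<Sum>j\<in>{..<s}. gr_times G (A i j) (B j k) g)"
    using assms by (intro gr_elem_sum gr_elem_times gr_mat_elem) auto
  then show "gr_elem G (gr_mat_times G s A B i k)" by (simp add: gr_mat_times_def[abs_def])
qed

lemma gr_mat_times_eval:
  assumes "group_ring_mat G r s A" "group_ring_mat G s u B" "i < r" "k < u"
  shows "gr_eval (gr_mat_times G s A B i k) \<phi> = (\<Sum>j<s. gr_eval (A i j) (\<lambda>u. gr_eval (B j k) (\<lambda>h. \<phi> (u \<otimes> h))))"
proof -
  have "gr_eval (gr_mat_times G s A B i k) \<phi> = gr_eval (\<lambda>g. \<Sum>j\<in>{..<s}. gr_times G (A i j) (B j k) g) \<phi>"
    by (simp add: gr_mat_times_def[abs_def])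
  also have "\<dots> = (\<Sum>j<s. gr_eval (gr_times G (A i j) (B j k)) \<phi>)"
    using assms by (intro gr_eval_sum[where G=G] gr_elem_times gr_mat_elem) auto
  also have "\<dots> = (\<Sum>j<s. gr_eval (A i j) (\<lambda>u. gr_eval (B j k) (\<lambda>h. \<phi> (u \<otimes> h))))"
    using assms by (intro sum.cong refl gr_eval_times gr_mat_elem) auto
  finally show ?thesis .
qed

lemma gr_adjoint_supp:
  "{g. gr_mat_adjoint G A j i g \<noteq> 0} = (\<lambda>g. inv g) ` {g \<in> carrier G. A i j g \<noteq> 0}"
proof safe
  fix g assume "gr_mat_adjoint G A j i g \<noteq> 0"
  then have "g \<in> carrier G" "A i j (inv g) \<noteq> 0" by (auto simp: gr_mat_adjoint_def split: if_splits)
  then show "g \<in> (\<lambda>g. inv g) ` {g \<in> carrier G. A i j g \<noteq> 0}" by (intro image_eqI[of _ _ "inv g"]) auto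
qed (simp add: gr_mat_adjoint_def)

lemma gr_adjoint_mat:
  assumes "group_ring_mat G r s A" shows "group_ring_mat G s r (gr_mat_adjoint G A)"
proof (rule gr_matI)
  fix j i assume "j < s" "i < r"
  then have "gr_elem G (A i j)" using assms gr_mat_elem by blast
  then have "finite {g \<in> carrier G. A i j g \<noteq> 0}" using gr_elemD(1) by fastforce
  then show "gr_elem G (gr_mat_adjoint G A j i)" unfolding gr_elem_def gr_adjoint_supp by auto
qed

lemma gr_adjoint_eval:
  assumes "gr_elem G (A i j)"
  shows "gr_eval (gr_mat_adjoint G A j i) \<phi> = cnj (gr_eval (A i j) (\<lambda>g. cnj (\<phi> (inv g))))"
proof -
  have eq: "{g \<in> carrier G. A i j g \<noteq> 0} = {g. A i j g \<noteq> 0}" using gr_elemD(2)[OF assms] by auto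
  have c: "g \<in> carrier G" if "A i j g \<noteq> 0" for g using gr_elemD(2)[OF assms] that by auto
  have "gr_eval (gr_mat_adjoint G A j i) \<phi> = (\<Sum>g | A i j g \<noteq> 0. gr_mat_adjoint G A j i (inv g) * \<phi> (inv g))"
    unfolding gr_eval_def gr_adjoint_supp eq
    by (subst sum.reindex[OF inj_on_subset[OF inv_inj]]) (use c in auto)
  also have "\<dots> = cnj (gr_eval (A i j) (\<lambda>g. cnj (\<phi> (inv g))))"
    unfolding gr_eval_def cnj_sum by (intro sum.cong refl) (simp add: gr_mat_adjoint_def c)
  finally show ?thesis .
qed

end


section \<open>Right multiplication as a positive operator\<close>

context group begin

text \<open>Right translation by h from coordinate i to coordinate j. Right multiplication is a
  finite combination of these partial isometries, so boundedness and adjoint reduce to a single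
  translation.\<close>

definition transl :: "nat \<Rightarrow> nat \<Rightarrow> 'a \<Rightarrow> (nat \<times> 'a \<Rightarrow> complex) \<Rightarrow> nat \<times> 'a \<Rightarrow> complex" where
  "transl i j h x = (\<lambda>(j', g). if j' = j \<and> g \<in> carrier G then x (i, g \<otimes> inv h) else 0)"

lemma transl_reindex:
  assumes "h \<in> carrier G" "j < s" and "\<And>k. k \<notin> {j} \<times> carrier G \<Longrightarrow> f k = 0" "\<And>g. g \<in> carrier G \<Longrightarrow> f (j, g) = f' (i, g \<otimes> inv h)"
    "i < r" "\<And>k. k \<in> {..<r} \<times> carrier G \<Longrightarrow> k \<notin> {i} \<times> carrier G \<Longrightarrow> f' k = 0"
  shows "f summable_on ({..<s} \<times> carrier G) \<longleftrightarrow> f' summable_on ({..<r} \<times> carrier G)"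
    and "infsum f ({..<s} \<times> carrier G) = infsum f' ({..<r} \<times> carrier G)"
proof -
  have bij: "bij_betw (\<lambda>(_, g). (i, g \<otimes> inv h)) ({j} \<times> carrier G) ({i} \<times> carrier G)"
    by (rule bij_betw_byWitness[where f'="\<lambda>(_, g). (j, g \<otimes> h)"]) (use assms(1) in \<open>auto simp: m_assoc\<close>)
  have "f summable_on ({..<s} \<times> carrier G) \<longleftrightarrow> f summable_on ({j} \<times> carrier G)"
    by (rule summable_on_cong_neutral) (use assms in auto)
  also have "\<dots> \<longleftrightarrow> (\<lambda>k. f' ((\<lambda>(_, g). (i, g \<otimes> inv h)) k)) summable_on ({j} \<times> carrier G)"
    by (rule summable_on_cong) (use assms in auto)
  also have "\<dots> \<longleftrightarrow> f' summable_on ({i} \<times> carrier G)" by (rule summable_on_reindex_bij_betw[OF bij])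
  also have "\<dots> \<longleftrightarrow> f' summable_on ({..<r} \<times> carrier G)"
    by (rule summable_on_cong_neutral) (use assms in auto)
  finally show "f summable_on ({..<s} \<times> carrier G) \<longleftrightarrow> f' summable_on ({..<r} \<times> carrier G)" .
  have "infsum f ({..<s} \<times> carrier G) = infsum f ({j} \<times> carrier G)"
    by (rule infsum_cong_neutral) (use assms in auto)
  also have "\<dots> = infsum (\<lambda>k. f' ((\<lambda>(_, g). (i, g \<otimes> inv h)) k)) ({j} \<times> carrier G)"
    by (rule infsum_cong) (use assms in auto)
  also have "\<dots> = infsum f' ({i} \<times> carrier G)" by (rule infsum_reindex_bij_betw[OF bij])
  also have "\<dots> = infsum f' ({..<r} \<times> carrier G)"
    by (rule infsum_cong_neutral) (use assms in auto)
  finally show "infsum f ({..<s} \<times> carrier G) = infsum f' ({..<r} \<times> carrier G)" .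
qed

lemma transl_ell2:
  assumes x: "x \<in> ell2 ({..<r} \<times> carrier G)" and h: "h \<in> carrier G" and ij: "i < r" "j < s"
  shows "transl i j h x \<in> ell2 ({..<s} \<times> carrier G)"
    and "nsq ({..<s} \<times> carrier G) (transl i j h x) \<le> nsq ({..<r} \<times> carrier G) x"
proof -
  define f' where "f' k = (if fst k = i then (cmod (x k))\<^sup>2 else 0)" for k
  have sx: "(\<lambda>k. (cmod (x k))\<^sup>2) summable_on ({..<r} \<times> carrier G)" using x by (simp add: ell2_def)
  have sf: "f' summable_on ({..<r} \<times> carrier G)"
    by (rule summable_on_comparison_test[OF sx]) (auto simp: f'_def)
  note R = transl_reindex[OF h ij(2), of "\<lambda>k. (cmod (transl i j h x k))\<^sup>2" f' i r]
  have "(\<lambda>k. (cmod (transl i j h x k))\<^sup>2) summable_on ({..<s} \<times> carrier G) \<longleftrightarrow> f' summable_on ({..<r} \<times> carrier G)"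
    by (rule R(1)) (use ij in \<open>auto simp: transl_def f'_def split: if_splits\<close>)
  then show "transl i j h x \<in> ell2 ({..<s} \<times> carrier G)" using sf ij by (auto simp: ell2_def transl_def)
  have "nsq ({..<s} \<times> carrier G) (transl i j h x) = infsum f' ({..<r} \<times> carrier G)"
    unfolding nsq_eq by (rule R(2)) (use ij in \<open>auto simp: transl_def f'_def split: if_splits\<close>)
  also have "\<dots> \<le> nsq ({..<r} \<times> carrier G) x"
    unfolding nsq_eq by (rule infsum_mono[OF sf sx]) (auto simp: f'_def)
  finally show "nsq ({..<s} \<times> carrier G) (transl i j h x) \<le> nsq ({..<r} \<times> carrier G) x" .
qed

lemma transl_inner:
  assumes h: "h \<in> carrier G" and ij: "i < r" "j < s"
  shows "ell2_inner ({..<s} \<times> carrier G) (transl i j h x) y = ell2_inner ({..<r} \<times> carrier G) x (transl j i (inv h) y)"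
  unfolding ell2_inner_def
  by (rule transl_reindex(2)[OF h ij(2), where i=i]) (use ij h in \<open>auto simp: transl_def m_assoc split: if_splits\<close>)

definition gr_supp :: "nat \<Rightarrow> nat \<Rightarrow> (nat \<Rightarrow> nat \<Rightarrow> 'a \<Rightarrow> complex) \<Rightarrow> (nat \<times> nat \<times> 'a) set" where
  "gr_supp r s A = (SIGMA i:{..<r}. SIGMA j:{..<s}. {g. A i j g \<noteq> 0})"

lemma finite_gr_supp: "group_ring_mat G r s A \<Longrightarrow> finite (gr_supp r s A)"
  unfolding gr_supp_def by (intro finite_SigmaI) (auto simp: group_ring_mat_def)

lemma gr_supp_carrier: "group_ring_mat G r s A \<Longrightarrow> (i, j, h) \<in> gr_supp r s A \<Longrightarrow> h \<in> carrier G"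
  unfolding gr_supp_def by (auto simp: group_ring_mat_def)

lemma right_mult_eq_eval:
  assumes A: "group_ring_mat G r s A"
  shows "right_mult G r s A x (j, g) = (if j < s \<and> g \<in> carrier G then \<Sum>i<r. gr_eval (A i j) (\<lambda>h. x (i, g \<otimes> inv h)) else 0)"
proof (cases "j < s \<and> g \<in> carrier G")
  case True
  then show ?thesis using gr_times_eval[OF gr_mat_elem[OF A]] by (auto simp: right_mult_def intro!: sum.cong)
next
  case False
  then show ?thesis by (auto simp: right_mult_def gr_times_def)
qed

lemma right_mult_eq_transl:
  assumes A: "group_ring_mat G r s A"
  shows "right_mult G r s A x = (\<lambda>k. \<Sum>p\<in>gr_supp r s A. A (fst p) (fst (snd p)) (snd (snd p)) * transl (fst p) (fst (snd p)) (snd (snd p)) x k)"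
proof (rule ext, clarify)
  fix j g
  have fin: "finite {h. A i j h \<noteq> 0}" if "i < r" "j < s" for i j using A that by (auto simp: group_ring_mat_def)
  have "(\<Sum>p\<in>gr_supp r s A. A (fst p) (fst (snd p)) (snd (snd p)) * transl (fst p) (fst (snd p)) (snd (snd p)) x (j, g))
    = (\<Sum>i<r. \<Sum>j'<s. \<Sum>h | A i j' h \<noteq> 0. A i j' h * transl i j' h x (j, g))"
  proof -
    let ?F = "\<lambda>i j' h. A i j' h * transl i j' h x (j, g)"
    have "(\<Sum>i<r. \<Sum>j'<s. \<Sum>h | A i j' h \<noteq> 0. ?F i j' h) = (\<Sum>i<r. \<Sum>q\<in>(SIGMA j:{..<s}. {g. A i j g \<noteq> 0}). ?F i (fst q) (snd q))"
      using fin by (intro sum.cong refl) (simp add: sum.Sigma case_prod_beta)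
    also have "\<dots> = (\<Sum>p\<in>gr_supp r s A. ?F (fst p) (fst (snd p)) (snd (snd p)))"
      unfolding gr_supp_def using fin by (subst sum.Sigma) (auto simp: case_prod_beta intro!: finite_SigmaI)
    finally show ?thesis by simp
  qed
  also have "\<dots> = (\<Sum>i<r. \<Sum>j'<s. if j' = j then (if g \<in> carrier G then gr_eval (A i j) (\<lambda>h. x (i, g \<otimes> inv h)) else 0) else 0)"
    by (intro sum.cong refl) (auto simp: transl_def gr_eval_def)
  also have "\<dots> = right_mult G r s A x (j, g)"
    unfolding right_mult_eq_eval[OF A] by (auto simp: sum.delta)
  finally show "right_mult G r s A x (j, g) = (\<Sum>p\<in>gr_supp r s A. A (fst p) (fst (snd p)) (snd (snd p)) * transl (fst p) (fst (snd p)) (snd (snd p)) x (j, g))" by simp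
qed

lemma right_mult_ell2:
  assumes A: "group_ring_mat G r s A" and x: "x \<in> ell2 ({..<r} \<times> carrier G)"
  shows "right_mult G r s A x \<in> ell2 ({..<s} \<times> carrier G)"
  unfolding right_mult_eq_transl[OF A]
proof (rule ell2_sum[OF finite_gr_supp[OF A]])
  fix p assume p: "p \<in> gr_supp r s A"
  obtain i j h where ijh: "p = (i, j, h)" by (cases p) auto
  then show "(\<lambda>k. A (fst p) (fst (snd p)) (snd (snd p)) * transl (fst p) (fst (snd p)) (snd (snd p)) x k) \<in> ell2 ({..<s} \<times> carrier G)"
    using p x gr_supp_carrier[OF A] by (intro ell2_scale transl_ell2(1)) (auto simp: gr_supp_def)
qed

lemma right_mult_lincomb:
  assumes A: "group_ring_mat G r s A"
  shows "right_mult G r s A (lincomb a x b y) = lincomb a (right_mult G r s A x) b (right_mult G r s A y)"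
proof -
  have "transl i j h (lincomb a x b y) k = a * transl i j h x k + b * transl i j h y k" for i j h k
    by (cases k) (auto simp: transl_def lincomb_def)
  note tr = this
  have lc: "lincomb a F b H k = a * F k + b * H k" for F H and k :: "nat \<times> 'a" by (simp add: lincomb_def)
  show ?thesis
    unfolding right_mult_eq_transl[OF A]
    by (rule ext, unfold lc tr sum_distrib_left sum.distrib[symmetric]) (intro sum.cong refl, simp add: algebra_simps)
qed

lemma ell2_inner_sum_left:
  "finite J \<Longrightarrow> (\<And>j. j \<in> J \<Longrightarrow> f j \<in> ell2 I) \<Longrightarrow> y \<in> ell2 I \<Longrightarrow>
    ell2_inner I (\<lambda>k. \<Sum>j\<in>J. c j * f j k) y = (\<Sum>j\<in>J. c j * ell2_inner I (f j) y)"
proof (induction J rule: finite_induct)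
  case (insert j J)
  have "ell2_inner I (\<lambda>k. \<Sum>j\<in>insert j J. c j * f j k) y = ell2_inner I (lincomb (c j) (f j) 1 (\<lambda>k. \<Sum>j\<in>J. c j * f j k)) y"
    using insert.hyps by (simp add: lincomb_def)
  also have "\<dots> = c j * ell2_inner I (f j) y + ell2_inner I (\<lambda>k. \<Sum>j\<in>J. c j * f j k) y"
    using insert by (subst ell2_inner_lincomb) (auto intro!: ell2_sum ell2_scale)
  finally show ?case using insert by simp
qed simp

lemma right_mult_adjoint:
  assumes A: "group_ring_mat G r s A" and x: "x \<in> ell2 ({..<r} \<times> carrier G)" and y: "y \<in> ell2 ({..<s} \<times> carrier G)"
  shows "ell2_inner ({..<s} \<times> carrier G) (right_mult G r s A x) y = ell2_inner ({..<r} \<times> carrier G) x (right_mult G s r (gr_mat_adjoint G A) y)"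
proof -
  let ?Is = "{..<s} \<times> carrier G" and ?Ir = "{..<r} \<times> carrier G"
  note A' = gr_adjoint_mat[OF A]
  have "ell2_inner ?Is (right_mult G r s A x) y
    = (\<Sum>p\<in>gr_supp r s A. A (fst p) (fst (snd p)) (snd (snd p)) * ell2_inner ?Is (transl (fst p) (fst (snd p)) (snd (snd p)) x) y)"
    unfolding right_mult_eq_transl[OF A]
    by (rule ell2_inner_sum_left[OF finite_gr_supp[OF A] _ y])
       (use x gr_supp_carrier[OF A] in \<open>auto simp: gr_supp_def intro!: transl_ell2(1)\<close>)
  also have "\<dots> = (\<Sum>q\<in>gr_supp s r (gr_mat_adjoint G A).
      cnj (gr_mat_adjoint G A (fst q) (fst (snd q)) (snd (snd q))) * ell2_inner ?Ir x (transl (fst q) (fst (snd q)) (snd (snd q)) y))"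
  proof (rule sum.reindex_bij_witness[where i="\<lambda>(j, i, h). (i, j, inv h)" and j="\<lambda>(i, j, h). (j, i, inv h)"])
    fix p assume p: "p \<in> gr_supp r s A"
    obtain i j h where ijh: "p = (i, j, h)" by (cases p) auto
    have h: "h \<in> carrier G" "i < r" "j < s" "A i j h \<noteq> 0" using p gr_supp_carrier[OF A, of i j h] unfolding ijh by (auto simp: gr_supp_def)
    show "(\<lambda>(j, i, h). (i, j, inv h)) ((\<lambda>(i, j, h). (j, i, inv h)) p) = p" using h by (simp add: ijh)
    show "(\<lambda>(i, j, h). (j, i, inv h)) p \<in> gr_supp s r (gr_mat_adjoint G A)"
      using h by (auto simp: ijh gr_supp_def gr_mat_adjoint_def)
    show "cnj (gr_mat_adjoint G A (fst ((\<lambda>(i, j, h). (j, i, inv h)) p)) (fst (snd ((\<lambda>(i, j, h). (j, i, inv h)) p)))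
             (snd (snd ((\<lambda>(i, j, h). (j, i, inv h)) p)))) *
         ell2_inner ?Ir x (transl (fst ((\<lambda>(i, j, h). (j, i, inv h)) p)) (fst (snd ((\<lambda>(i, j, h). (j, i, inv h)) p)))
             (snd (snd ((\<lambda>(i, j, h). (j, i, inv h)) p))) y) =
         A (fst p) (fst (snd p)) (snd (snd p)) * ell2_inner ?Is (transl (fst p) (fst (snd p)) (snd (snd p)) x) y"
      unfolding ijh using transl_inner[OF h(1-3), of x y] by (simp add: h(1) gr_mat_adjoint_def)
  next
    fix q assume q: "q \<in> gr_supp s r (gr_mat_adjoint G A)"
    obtain j i h where ijh: "q = (j, i, h)" by (cases q) auto
    have q': "j < s" "i < r" "gr_mat_adjoint G A j i h \<noteq> 0" using q by (simp_all add: ijh gr_supp_def)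
    have hG: "h \<in> carrier G" using gr_supp_carrier[OF A', of j i h] q by (simp add: ijh)
    then have hA: "A i j (inv h) \<noteq> 0" using q'(3) by (simp add: gr_mat_adjoint_def)
    note h = hG q'(2,1) hA
    show "(\<lambda>(i, j, h). (j, i, inv h)) ((\<lambda>(j, i, h). (i, j, inv h)) q) = q" using h by (simp add: ijh)
    show "(\<lambda>(j, i, h). (i, j, inv h)) q \<in> gr_supp r s A" using h by (auto simp: ijh gr_supp_def)
  qed
  also have "\<dots> = cnj (\<Sum>q\<in>gr_supp s r (gr_mat_adjoint G A).
      gr_mat_adjoint G A (fst q) (fst (snd q)) (snd (snd q)) * ell2_inner ?Ir (transl (fst q) (fst (snd q)) (snd (snd q)) y) x)"
    unfolding cnj_sum complex_cnj_mult ell2_inner_commute[of ?Ir x, symmetric] ..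
  also have "\<dots> = cnj (ell2_inner ?Ir (right_mult G s r (gr_mat_adjoint G A) y) x)"
    unfolding right_mult_eq_transl[OF A']
    by (subst ell2_inner_sum_left[OF finite_gr_supp[OF A'] _ x])
       (use y gr_supp_carrier[OF A'] in \<open>auto simp: gr_supp_def intro!: transl_ell2(1)\<close>)
  also have "\<dots> = ell2_inner ?Ir x (right_mult G s r (gr_mat_adjoint G A) y)" by (rule ell2_inner_commute[symmetric])
  finally show ?thesis .
qed

text \<open>The crude factor \<open>2 ^ card J\<close> comes from iterating |x + y|^2 \<le> 2 |x|^2
  + 2 |y|^2, a consequence of the parallelogram law.\<close>

lemma nsq_sum_le:
  "finite J \<Longrightarrow> (\<And>j. j \<in> J \<Longrightarrow> f j \<in> ell2 I \<and> nsq I (f j) \<le> B) \<Longrightarrow> 0 \<le> B \<Longrightarrow>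
    nsq I (\<lambda>k. \<Sum>j\<in>J. c j * f j k) \<le> (\<Sum>i\<in>J. 2 ^ card J * (cmod (c i))\<^sup>2) * B"
proof (induction J rule: finite_induct)
  case (insert j J)
  let ?g = "\<lambda>k. \<Sum>j\<in>J. c j * f j k"
  have g: "?g \<in> ell2 I" using insert by (intro ell2_sum ell2_scale) auto
  have fj: "f j \<in> ell2 I" using insert by simp
  have "nsq I (lincomb (c j) (f j) 1 ?g) + nsq I (lincomb (c j) (f j) (-1) ?g) = 2 * ((cmod (c j))\<^sup>2 * nsq I (f j)) + 2 * nsq I ?g"
    unfolding nsq_lincomb[OF fj g] by simp
  then have "nsq I (lincomb (c j) (f j) 1 ?g) \<le> 2 * ((cmod (c j))\<^sup>2 * nsq I (f j)) + 2 * nsq I ?g"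
    using nsq_nonneg[of I "lincomb (c j) (f j) (-1) ?g"] by linarith
  also have "\<dots> \<le> 2 * ((cmod (c j))\<^sup>2 * B) + 2 * ((\<Sum>i\<in>J. 2 ^ card J * (cmod (c i))\<^sup>2) * B)"
    using insert by (intro add_mono mult_left_mono) auto
  also have "\<dots> \<le> 2 ^ card (insert j J) * ((cmod (c j))\<^sup>2 * B) + (\<Sum>i\<in>J. 2 ^ card (insert j J) * (cmod (c i))\<^sup>2) * B"
  proof (rule add_mono)
    have "(2::real) \<le> 2 ^ card (insert j J)" using insert.hyps self_le_power[of "2::real" "card (insert j J)"] by simp
    then show "2 * ((cmod (c j))\<^sup>2 * B) \<le> 2 ^ card (insert j J) * ((cmod (c j))\<^sup>2 * B)"
      using insert.prems by (intro mult_right_mono) auto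
    show "2 * ((\<Sum>i\<in>J. 2 ^ card J * (cmod (c i))\<^sup>2) * B) \<le> (\<Sum>i\<in>J. 2 ^ card (insert j J) * (cmod (c i))\<^sup>2) * B"
      using insert.hyps by (simp add: sum_distrib_left sum_distrib_right mult.assoc)
  qed
  finally show ?case using insert.hyps by (simp add: lincomb_def algebra_simps)
qed (simp add: nsq_def)

lemma right_mult_bounded:
  assumes A: "group_ring_mat G r s A"
  obtains B where "0 < B" "\<And>x. x \<in> ell2 ({..<r} \<times> carrier G) \<Longrightarrow>
    nsq ({..<s} \<times> carrier G) (right_mult G r s A x) \<le> B * nsq ({..<r} \<times> carrier G) x"
proof -
  define B where "B = (\<Sum>p\<in>gr_supp r s A. 2 ^ card (gr_supp r s A) * (cmod (A (fst p) (fst (snd p)) (snd (snd p))))\<^sup>2)"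
  have B: "0 \<le> B" unfolding B_def by (intro sum_nonneg) auto
  have "nsq ({..<s} \<times> carrier G) (right_mult G r s A x) \<le> (B + 1) * nsq ({..<r} \<times> carrier G) x"
    if x: "x \<in> ell2 ({..<r} \<times> carrier G)" for x
  proof -
    have "nsq ({..<s} \<times> carrier G) (right_mult G r s A x) \<le> B * nsq ({..<r} \<times> carrier G) x"
      unfolding right_mult_eq_transl[OF A] B_def
      by (rule nsq_sum_le[OF finite_gr_supp[OF A]])
         (use x gr_supp_carrier[OF A] in \<open>auto simp: gr_supp_def intro!: transl_ell2\<close>)
    then show ?thesis using nsq_nonneg[of "{..<r} \<times> carrier G" x] unfolding distrib_right by linarith
  qed
  then show ?thesis using that[of "B + 1"] B by simp
qed

lemma right_mult_compose:
  assumes A: "group_ring_mat G r s A" and B: "group_ring_mat G s u B"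
  shows "right_mult G s u B (right_mult G r s A x) = right_mult G r u (gr_mat_times G s A B) x"
proof (rule ext, clarify)
  fix k g
  note AB = gr_mat_times_mat[OF A B]
  show "right_mult G s u B (right_mult G r s A x) (k, g) = right_mult G r u (gr_mat_times G s A B) x (k, g)"
  proof (cases "k < u \<and> g \<in> carrier G")
    case True
    then have k: "k < u" and g: "g \<in> carrier G" by auto
    have "right_mult G s u B (right_mult G r s A x) (k, g) = (\<Sum>j<s. gr_eval (B j k) (\<lambda>h. right_mult G r s A x (j, g \<otimes> inv h)))"
      using True by (simp add: right_mult_eq_eval[OF B])
    also have "\<dots> = (\<Sum>j<s. \<Sum>i<r. gr_eval (A i j) (\<lambda>v. gr_eval (B j k) (\<lambda>h. x (i, g \<otimes> inv (v \<otimes> h)))))"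
    proof (rule sum.cong[OF refl])
      fix j assume "j \<in> {..<s}"
      then have j: "j < s" by simp
      note Bjk = gr_mat_elem[OF B j k]
      have "gr_eval (B j k) (\<lambda>h. right_mult G r s A x (j, g \<otimes> inv h))
        = (\<Sum>h | B j k h \<noteq> 0. \<Sum>i<r. \<Sum>v | A i j v \<noteq> 0. A i j v * (B j k h * x (i, g \<otimes> inv (v \<otimes> h))))"
        unfolding gr_eval_def
      proof (rule sum.cong[OF refl])
        fix h assume "h \<in> {h. B j k h \<noteq> 0}"
        then have h: "h \<in> carrier G" using gr_elemD(2)[OF Bjk] by auto
        have "x (i, g \<otimes> inv h \<otimes> inv v) = x (i, g \<otimes> inv (v \<otimes> h))" if "i < r" "A i j v \<noteq> 0" for i v
        proof -
          have "v \<in> carrier G" using gr_elemD(2)[OF gr_mat_elem[OF A]] that j by blast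
          then show ?thesis using g h by (simp add: inv_mult_group m_assoc)
        qed
        then have "(\<Sum>i<r. gr_eval (A i j) (\<lambda>v. x (i, g \<otimes> inv h \<otimes> inv v))) = (\<Sum>i<r. \<Sum>v | A i j v \<noteq> 0. A i j v * x (i, g \<otimes> inv (v \<otimes> h)))"
          unfolding gr_eval_def by (intro sum.cong refl) auto
        then show "B j k h * right_mult G r s A x (j, g \<otimes> inv h) = (\<Sum>i<r. \<Sum>v | A i j v \<noteq> 0. A i j v * (B j k h * x (i, g \<otimes> inv (v \<otimes> h))))"
          using g h j by (simp add: right_mult_eq_eval[OF A] sum_distrib_left mult_ac)
      qed
      also have "\<dots> = (\<Sum>i<r. \<Sum>h | B j k h \<noteq> 0. \<Sum>v | A i j v \<noteq> 0. A i j v * (B j k h * x (i, g \<otimes> inv (v \<otimes> h))))"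
        by (rule sum.swap)
      also have "\<dots> = (\<Sum>i<r. \<Sum>v | A i j v \<noteq> 0. \<Sum>h | B j k h \<noteq> 0. A i j v * (B j k h * x (i, g \<otimes> inv (v \<otimes> h))))"
        by (intro sum.cong refl sum.swap)
      finally show "gr_eval (B j k) (\<lambda>h. right_mult G r s A x (j, g \<otimes> inv h))
        = (\<Sum>i<r. gr_eval (A i j) (\<lambda>v. gr_eval (B j k) (\<lambda>h. x (i, g \<otimes> inv (v \<otimes> h)))))"
        by (simp add: gr_eval_def sum_distrib_left)
    qed
    also have "\<dots> = (\<Sum>i<r. \<Sum>j<s. gr_eval (A i j) (\<lambda>v. gr_eval (B j k) (\<lambda>h. x (i, g \<otimes> inv (v \<otimes> h)))))"
      by (rule sum.swap)
    also have "\<dots> = (\<Sum>i<r. gr_eval (gr_mat_times G s A B i k) (\<lambda>h. x (i, g \<otimes> inv h)))"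
      using k by (intro sum.cong refl gr_mat_times_eval[OF A B, symmetric]) auto
    also have "\<dots> = right_mult G r u (gr_mat_times G s A B) x (k, g)"
      using True by (simp add: right_mult_eq_eval[OF AB])
    finally show ?thesis .
  next
    case False
    then show ?thesis by (auto simp: right_mult_eq_eval[OF B] right_mult_eq_eval[OF AB])
  qed
qed

text \<open>Pairing x A A^* with y is pairing x A with y A. This yields symmetry and positivity, and
  M bounds the squared norm of right multiplication by A.\<close>

lemma right_mult_positive_op:
  assumes A: "group_ring_mat G r s A"
  obtains M where "ell2_positive_op ({..<r} \<times> carrier G) (right_mult G r r (gr_mat_times G s A (gr_mat_adjoint G A))) M"
proof -
  let ?I = "{..<r} \<times> carrier G" and ?J = "{..<s} \<times> carrier G" and ?A' = "gr_mat_adjoint G A"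
  note A' = gr_adjoint_mat[OF A]
  note B = gr_mat_times_mat[OF A A']
  let ?T = "right_mult G r r (gr_mat_times G s A ?A')"
  have T: "?T x = right_mult G s r ?A' (right_mult G r s A x)" for x by (simp add: right_mult_compose[OF A A'])
  obtain M where M: "0 < M" "\<And>x. x \<in> ell2 ?I \<Longrightarrow> nsq ?J (right_mult G r s A x) \<le> M * nsq ?I x"
    using right_mult_bounded[OF A] by metis
  have in1: "ell2_inner ?I x (?T y) = ell2_inner ?J (right_mult G r s A x) (right_mult G r s A y)" if "x \<in> ell2 ?I" "y \<in> ell2 ?I" for x y
    unfolding T using right_mult_adjoint[OF A that(1) right_mult_ell2[OF A that(2)]] by simp
  have in2: "ell2_inner ?I (?T x) y = ell2_inner ?J (right_mult G r s A x) (right_mult G r s A y)" if "x \<in> ell2 ?I" "y \<in> ell2 ?I" for x y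
    using in1[OF that(2,1)] ell2_inner_commute by metis
  have "ell2_positive_op ?I ?T M"
  proof
    fix x y :: "nat \<times> 'a \<Rightarrow> complex" and a b assume x: "x \<in> ell2 ?I"
    show "?T x \<in> ell2 ?I" by (rule right_mult_ell2[OF B x])
    show "0 \<le> Re (ell2_inner ?I (?T x) x)" unfolding in2[OF x x] by (simp add: ell2_inner_self)
    show "Re (ell2_inner ?I (?T x) x) \<le> M * nsq ?I x" unfolding in2[OF x x] using M(2)[OF x] by (simp add: ell2_inner_self)
    assume y: "y \<in> ell2 ?I"
    show "?T (lincomb a x b y) = lincomb a (?T x) b (?T y)" by (rule right_mult_lincomb[OF B])
    show "ell2_inner ?I (?T x) y = ell2_inner ?I x (?T y)" unfolding in1[OF x y] in2[OF x y] ..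
  qed (rule M(1))
  then show ?thesis by (rule that)
qed

primrec gr_mat_pow :: "nat \<Rightarrow> (nat \<Rightarrow> nat \<Rightarrow> 'a \<Rightarrow> complex) \<Rightarrow> nat \<Rightarrow> nat \<Rightarrow> nat \<Rightarrow> 'a \<Rightarrow> complex" where
  "gr_mat_pow r B 0 = (\<lambda>i j g. if i = j \<and> g = \<one> then 1 else 0)"
| "gr_mat_pow r B (Suc n) = gr_mat_times G r (gr_mat_pow r B n) B"

lemma gr_mat_pow_mat: "group_ring_mat G r r B \<Longrightarrow> group_ring_mat G r r (gr_mat_pow r B n)"
proof (induction n)
  case 0
  have "gr_elem G (\<lambda>g. if i = j \<and> g = \<one> then 1 else 0)" for i j :: nat
    by (auto simp: gr_elem_def intro: finite_subset[of _ "{\<one>}"])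
  then show ?case by (intro gr_matI) simp
qed (simp add: gr_mat_times_mat)

text \<open>Turns the moments of the operator at the basis vector of coordinate i into coefficients
  of matrix powers; those at the neutral element, for j = i, sum up to the traces of these
  powers.\<close>

lemma right_mult_pow_unit:
  assumes B: "group_ring_mat G r r B" and i: "i < r" "j < r" "g \<in> carrier G"
  shows "((right_mult G r r B) ^^ n) (unit_vec_at (i, \<one>)) (j, g) = gr_mat_pow r B n i j g"
  using i(2,3)
proof (induction n arbitrary: j g)
  case 0
  then show ?case by (auto simp: unit_vec_at_def)
next
  case (Suc n)
  have "((right_mult G r r B) ^^ Suc n) (unit_vec_at (i, \<one>)) (j, g)
     = (\<Sum>l<r. gr_eval (B l j) (\<lambda>h. (right_mult G r r B ^^ n) (unit_vec_at (i, \<one>)) (l, g \<otimes> inv h)))"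
    using Suc.prems by (simp add: right_mult_eq_eval[OF B])
  also have "\<dots> = (\<Sum>l<r. gr_eval (B l j) (\<lambda>h. gr_mat_pow r B n i l (g \<otimes> inv h)))"
    unfolding gr_eval_def
  proof (intro sum.cong refl)
    fix l h assume "l \<in> {..<r}" "h \<in> {h. B l j h \<noteq> 0}"
    then have "h \<in> carrier G" "l < r" using gr_elemD(2)[OF gr_mat_elem[OF B]] Suc.prems by auto
    then show "B l j h * (right_mult G r r B ^^ n) (unit_vec_at (i, \<one>)) (l, g \<otimes> inv h) = B l j h * gr_mat_pow r B n i l (g \<otimes> inv h)"
      using Suc.prems by (simp add: Suc.IH)
  qed
  also have "\<dots> = gr_mat_pow r B (Suc n) i j g"
    using Suc.prems by (simp add: gr_mat_times_def gr_times_eval[OF gr_mat_elem[OF B]])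
  finally show ?case .
qed

end

section \<open>Eigenvalues of positive semidefinite matrices\<close>


definition tr_mat :: "complex mat \<Rightarrow> complex" where
  "tr_mat A = (\<Sum>i<dim_row A. A $$ (i, i))"

lemma index_mult_mat_sum:
  assumes "A \<in> carrier_mat n k" "B \<in> carrier_mat k m" "i < n" "j < m"
  shows "(A * B) $$ (i, j) = (\<Sum>l<k. A $$ (i, l) * B $$ (l, j))"
  using assms by (auto simp: scalar_prod_def lessThan_atLeast0 intro!: sum.cong)

lemma tr_mat_commute:
  assumes A: "A \<in> carrier_mat n m" and B: "B \<in> carrier_mat m n"
  shows "tr_mat (A * B) = tr_mat (B * A)"
proof -
  have "tr_mat (A * B) = (\<Sum>i<n. \<Sum>l<m. A $$ (i, l) * B $$ (l, i))"
    unfolding tr_mat_def using A B by (intro sum.cong) (auto simp: index_mult_mat_sum simp del: index_mult_mat(1))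
  also have "\<dots> = (\<Sum>l<m. \<Sum>i<n. B $$ (l, i) * A $$ (i, l))" by (subst sum.swap) (simp add: mult.commute)
  also have "\<dots> = tr_mat (B * A)"
    unfolding tr_mat_def using A B by (intro sum.cong) (auto simp: index_mult_mat_sum simp del: index_mult_mat(1))
  finally show ?thesis .
qed

lemma upper_triangular_mult:
  fixes A :: "complex mat"
  assumes A: "A \<in> carrier_mat n n" "upper_triangular A" and B: "B \<in> carrier_mat n n" "upper_triangular B"
  shows "upper_triangular (A * B)" "i < n \<Longrightarrow> (A * B) $$ (i, i) = A $$ (i, i) * B $$ (i, i)"
proof -
  have zero: "A $$ (i, l) * B $$ (l, j) = 0" if "i < n" "l < n" "j < n" "l < i \<or> j < l" for i j l
    using that A B by (auto dest: upper_triangularD)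
  show "upper_triangular (A * B)"
  proof (rule upper_triangularI)
    fix i j assume ij: "j < i" "i < dim_row (A * B)"
    then have "i < n" "j < n" using A by auto
    then have "(A * B) $$ (i, j) = (\<Sum>l<n. A $$ (i, l) * B $$ (l, j))" using A B by (intro index_mult_mat_sum) auto
    also have "\<dots> = 0" using ij \<open>i < n\<close> \<open>j < n\<close> by (intro sum.neutral ballI zero) auto
    finally show "(A * B) $$ (i, j) = 0" .
  qed
  assume i: "i < n"
  have "(A * B) $$ (i, i) = (\<Sum>l<n. A $$ (i, l) * B $$ (l, i))" using A B i by (intro index_mult_mat_sum) auto
  also have "\<dots> = (\<Sum>l<n. if l = i then A $$ (i, i) * B $$ (i, i) else 0)"
  proof (intro sum.cong refl)
    fix l assume "l \<in> {..<n}"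
    then show "A $$ (i, l) * B $$ (l, i) = (if l = i then A $$ (i, i) * B $$ (i, i) else 0)"
      using zero[of i l i] i by (cases "l = i") (auto simp: neq_iff)
  qed
  finally show "(A * B) $$ (i, i) = A $$ (i, i) * B $$ (i, i)" using i by simp
qed

lemma upper_triangular_pow:
  fixes A :: "complex mat"
  assumes A: "A \<in> carrier_mat n n" "upper_triangular A"
  shows "upper_triangular (A ^\<^sub>m k) \<and> (\<forall>i<n. (A ^\<^sub>m k) $$ (i, i) = (A $$ (i, i)) ^ k)"
proof (induction k)
  case 0
  then show ?case using A by auto
next
  case (Suc k)
  then show ?case using upper_triangular_mult[of "A ^\<^sub>m k" n A] A by (auto simp: mult.commute)
qed

text \<open>A scalar is carried along because the induced matrices become polynomial in z only after
  multiplication by a power of z.\<close>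

lemma char_poly_smult_similar:
  fixes A :: "complex mat"
  assumes A: "A \<in> carrier_mat n n" and w: "similar_mat_wit A B P Q" and ut: "upper_triangular B"
  shows "char_poly (c \<cdot>\<^sub>m A) = (\<Prod>a\<leftarrow>diag_mat B. [:- (c * a), 1:])"
proof -
  note D = similar_mat_witD2[OF A w]
  have ut': "upper_triangular (c \<cdot>\<^sub>m B)"
  proof (rule upper_triangularI)
    fix i j assume "j < i" "i < dim_row (c \<cdot>\<^sub>m B)"
    then show "(c \<cdot>\<^sub>m B) $$ (i, j) = 0" using D(5) upper_triangularD[OF ut, of j i] by auto
  qed
  have "similar_mat (c \<cdot>\<^sub>m A) (c \<cdot>\<^sub>m B)"
  proof (rule similar_matI[of _ _ P Q n])
    have "P * (c \<cdot>\<^sub>m B) * Q = c \<cdot>\<^sub>m (P * B * Q)"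
      using D by (simp add: mult_smult_distrib[of P n n B n] mult_smult_assoc_mat[of "P * B" n n Q n])
    then show "c \<cdot>\<^sub>m A = P * (c \<cdot>\<^sub>m B) * Q" using D(3) by simp
  qed (use D A in auto)
  then have "char_poly (c \<cdot>\<^sub>m A) = char_poly (c \<cdot>\<^sub>m B)" by (rule char_poly_similar)
  also have "\<dots> = (\<Prod>a\<leftarrow>diag_mat (c \<cdot>\<^sub>m B). [:- a, 1:])"
    by (rule char_poly_upper_triangular[of _ n]) (use D ut' in auto)
  also have "diag_mat (c \<cdot>\<^sub>m B) = map (\<lambda>a. c * a) (diag_mat B)"
    using D by (auto simp: diag_mat_def)
  finally show ?thesis by (simp add: comp_def)
qed

lemma order_prod_list_linear: "order x (\<Prod>a\<leftarrow>as. [:- a, 1:]) = count_list as (x :: complex)"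
proof (induction as)
  case (Cons a as)
  have nz: "(\<Prod>a\<leftarrow>as. [:- a, 1:]) \<noteq> (0 :: complex poly)" by (auto simp: prod_list_zero_iff)
  have "order x (\<Prod>a\<leftarrow>a # as. [:- a, 1:]) = order x [:- a, 1:] + order x (\<Prod>a\<leftarrow>as. [:- a, 1:])"
    using nz by (simp add: order_mult del: mult_pCons_left)
  moreover have "order x [:- a, 1:] = (if a = x then 1 else 0)"
    using order_power_n_n[of x 1] by (auto intro: order_0I)
  ultimately show ?case using Cons by simp
qed (simp add: order_0I)

text \<open>In Jordan form the geometric multiplicity counts the blocks of x and the algebraic one
  adds their sizes. Two-sided bounds are enough for alpha numbers, where a bounded factor in the
  multiplicity disappears in the limit.\<close>

lemma kernel_dim_char_matrix:
  fixes A :: "complex mat"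
  assumes A: "A \<in> carrier_mat n n" and cp: "char_poly A = (\<Prod>a\<leftarrow>as. [:- a, 1:])"
  shows "kernel_dim (char_matrix A x) \<le> count_list as x"
    and "x \<in> set as \<Longrightarrow> 1 \<le> kernel_dim (char_matrix A x)"
proof -
  obtain n_as where jnf: "jordan_nf A n_as" using jordan_nf_exists[OF A cp] by blast
  define ns where "ns = map fst [(n, e)\<leftarrow>n_as . e = x]"
  have "(char_matrix A x) ^\<^sub>m 1 = char_matrix A x" using char_matrix_closed[OF A, of x] by simp
  then have kd: "kernel_dim (char_matrix A x) = (\<Sum>n\<leftarrow>ns. min 1 n)"
    using dim_gen_eigenspace[OF jnf, of x 1] by (simp add: dim_gen_eigenspace_def ns_def)
  have "order x (char_poly A) = sum_list ns"
    unfolding jordan_nf_order[OF jnf] ns_def by (intro arg_cong[where f=sum_list] arg_cong[where f="map fst"] filter_cong) auto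
  then have cnt: "count_list as x = sum_list ns" unfolding cp order_prod_list_linear .
  have "(\<Sum>n\<leftarrow>ns. min 1 n) \<le> sum_list ns"
    using sum_list_mono[of ns "\<lambda>n. min 1 n" "\<lambda>n. n"] by simp
  then show "kernel_dim (char_matrix A x) \<le> count_list as x" using kd cnt by simp
  assume "x \<in> set as"
  then have "0 < sum_list ns" using cnt by (metis count_list_0_iff gr0I)
  then obtain k where "k \<in> set ns" "k > 0" by (metis gr0I not_gr_zero sum_list_eq_0_iff)
  then have "1 \<in> set (map (\<lambda>n. min 1 n) ns)" by (force simp: image_iff)
  then show "1 \<le> kernel_dim (char_matrix A x)" using kd member_le_sum_list[of 1 "map (min 1) ns"] by simp
qed

lemma dim_mat_adjoint [simp]: "dim_row (mat_adjoint D) = dim_col D" "dim_col (mat_adjoint D) = dim_row D"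
  by (auto simp: mat_adjoint_def)

lemma mat_adjoint_index: "i < dim_col D \<Longrightarrow> j < dim_row D \<Longrightarrow> mat_adjoint D $$ (i, j) = cnj (D $$ (j, i))" for D :: "complex mat"
  by (simp add: mat_adjoint_def mat_of_rows_index)

lemma index_mult_mat_vec_sum:
  "M \<in> carrier_mat n k \<Longrightarrow> v \<in> carrier_vec k \<Longrightarrow> i < n \<Longrightarrow> (M *\<^sub>v v) $ i = (\<Sum>j<k. M $$ (i, j) * v $ j)"
  by (auto simp: scalar_prod_def lessThan_atLeast0 intro!: sum.cong)

text \<open>Pairing the eigenvector equation with v gives e |v|^2 = |w|^2 for w = D^* v.\<close>

lemma psd_eigenvalue:
  fixes D :: "complex mat"
  assumes D: "D \<in> carrier_mat n k" and ev: "eigenvalue (D * mat_adjoint D) e"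
  shows "\<exists>x\<ge>0. e = complex_of_real x"
proof -
  have D': "mat_adjoint D \<in> carrier_mat k n" using D by auto
  obtain v where v: "v \<in> carrier_vec n" "v \<noteq> 0\<^sub>v n" "D * mat_adjoint D *\<^sub>v v = e \<cdot>\<^sub>v v"
    using ev D by (auto simp: eigenvalue_def eigenvector_def)
  define w where "w l = (\<Sum>j<n. cnj (D $$ (j, l)) * v $ j)" for l
  have comp: "(\<Sum>l<k. D $$ (i, l) * w l) = e * v $ i" if i: "i < n" for i
  proof -
    have "e * v $ i = (D * mat_adjoint D *\<^sub>v v) $ i" using v i by simp
    also have "\<dots> = (\<Sum>j<n. (D * mat_adjoint D) $$ (i, j) * v $ j)"
      by (rule index_mult_mat_vec_sum) (use D v i in auto)
    also have "\<dots> = (\<Sum>j<n. (\<Sum>l<k. D $$ (i, l) * cnj (D $$ (j, l))) * v $ j)"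
      using D D' i by (intro sum.cong refl) (simp add: index_mult_mat_sum[OF D D'] mat_adjoint_index del: index_mult_mat(1))
    also have "\<dots> = (\<Sum>j<n. \<Sum>l<k. D $$ (i, l) * (cnj (D $$ (j, l)) * v $ j))"
      by (simp add: sum_distrib_right mult.assoc)
    also have "\<dots> = (\<Sum>l<k. \<Sum>j<n. D $$ (i, l) * (cnj (D $$ (j, l)) * v $ j))"
      by (rule sum.swap)
    also have "\<dots> = (\<Sum>l<k. D $$ (i, l) * w l)" by (simp add: w_def sum_distrib_left)
    finally show ?thesis by simp
  qed
  define S where "S = (\<Sum>i<n. (cmod (v $ i))\<^sup>2)"
  have "e * complex_of_real S = (\<Sum>i<n. e * v $ i * cnj (v $ i))"
    unfolding S_def of_real_sum complex_norm_square sum_distrib_left by (simp add: mult.assoc)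
  also have "\<dots> = (\<Sum>i<n. (\<Sum>l<k. D $$ (i, l) * w l) * cnj (v $ i))" by (intro sum.cong refl) (simp add: comp)
  also have "\<dots> = (\<Sum>i<n. \<Sum>l<k. w l * (D $$ (i, l) * cnj (v $ i)))" unfolding sum_distrib_right by (simp add: mult_ac)
  also have "\<dots> = (\<Sum>l<k. \<Sum>i<n. w l * (D $$ (i, l) * cnj (v $ i)))" by (rule sum.swap)
  also have "\<dots> = (\<Sum>l<k. w l * cnj (w l))" by (simp add: w_def sum_distrib_left)
  also have "\<dots> = complex_of_real (\<Sum>l<k. (cmod (w l))\<^sup>2)" unfolding of_real_sum complex_norm_square ..
  finally have eS: "e * complex_of_real S = complex_of_real (\<Sum>l<k. (cmod (w l))\<^sup>2)" .
  obtain i where i: "i < n" "v $ i \<noteq> 0" using v by (metis eq_vecI carrier_vecD index_zero_vec)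
  have "0 < (cmod (v $ i))\<^sup>2" using i by simp
  also have "\<dots> \<le> S" unfolding S_def by (rule member_le_sum) (use i in auto)
  finally have S: "S > 0" .
  then have "e = complex_of_real ((\<Sum>l<k. (cmod (w l))\<^sup>2) / S)" using eS by (simp add: field_simps)
  moreover have "0 \<le> (\<Sum>l<k. (cmod (w l))\<^sup>2) / S" using S by (intro divide_nonneg_pos sum_nonneg) auto
  ultimately show ?thesis by blast
qed

text \<open>The order of the list is left open, so all clauses are symmetric in its entries. They
  form one predicate because the list is picked by a single choice.\<close>

definition psd_eigs_spec :: "complex mat \<Rightarrow> real list \<Rightarrow> bool" where
  "psd_eigs_spec N ls \<longleftrightarrow> length ls = dim_row N \<and> (\<forall>x\<in>set ls. 0 \<le> x) \<and>
     (\<forall>k. tr_mat (N ^\<^sub>m k) = complex_of_real (\<Sum>x\<leftarrow>ls. x ^ k)) \<and>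
     (\<forall>c. char_poly (c \<cdot>\<^sub>m N) = (\<Prod>x\<leftarrow>ls. [:- (c * complex_of_real x), 1:])) \<and>
     (\<forall>x. eigenvalue N (complex_of_real x) \<longleftrightarrow> x \<in> set ls) \<and>
     (\<forall>x. kernel_dim (char_matrix N (complex_of_real x)) \<le> count_list ls x) \<and>
     (\<forall>x\<in>set ls. 1 \<le> kernel_dim (char_matrix N (complex_of_real x)))"

text \<open>Schur triangularization: the diagonal of one triangular matrix yields both the
  characteristic polynomial and the traces of all powers.\<close>

lemma psd_eigs_exist:
  fixes D :: "complex mat"
  assumes D: "D \<in> carrier_mat n k"
  shows "\<exists>ls. psd_eigs_spec (D * mat_adjoint D) ls"
proof -
  let ?N = "D * mat_adjoint D"
  have N: "?N \<in> carrier_mat n n" using D by auto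
  obtain as where cp: "char_poly ?N = (\<Prod>a\<leftarrow>as. [:- a, 1:])" and len: "length as = n"
    using char_poly_factorized[OF N] by blast
  obtain B P Q where sd: "schur_decomposition ?N as = (B, P, Q)" by (cases "schur_decomposition ?N as") auto
  have w: "similar_mat_wit ?N B P Q" and ut: "upper_triangular B" and dg: "diag_mat B = as"
    using schur_decomposition[OF N cp sd] by auto
  note W = similar_mat_witD2[OF N w]
  have ev: "eigenvalue ?N x \<longleftrightarrow> x \<in> set as" for x
    unfolding eigenvalue_root_char_poly[OF N] cp poly_prod_list by (auto simp: prod_list_zero_iff)
  define ls where "ls = map Re as"
  have real: "a = complex_of_real (Re a) \<and> 0 \<le> Re a" if "a \<in> set as" for a
    using psd_eigenvalue[OF D] ev[of a] that by fastforce
  have as: "as = map complex_of_real ls" unfolding ls_def map_map comp_def using real by (simp add: map_idI)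
  have tr: "tr_mat (?N ^\<^sub>m k) = complex_of_real (\<Sum>x\<leftarrow>ls. x ^ k)" for k
  proof -
    note Wk = similar_mat_witD2[OF pow_carrier_mat[OF N, of k] similar_mat_wit_pow[OF w]]
    have "tr_mat (?N ^\<^sub>m k) = tr_mat (P * (B ^\<^sub>m k * Q))" using Wk by (simp add: assoc_mult_mat[of P n n "B ^\<^sub>m k" n Q n])
    also have "\<dots> = tr_mat (B ^\<^sub>m k * Q * P)" using Wk by (intro tr_mat_commute) auto
    also have "\<dots> = tr_mat (B ^\<^sub>m k)" using Wk right_mult_one_mat[OF Wk(5)] by (simp add: assoc_mult_mat[of "B ^\<^sub>m k" n n Q n P n])
    also have "\<dots> = (\<Sum>i<n. (B $$ (i, i)) ^ k)"
      unfolding tr_mat_def using upper_triangular_pow[OF W(5) ut, of k] W(5) by (intro sum.cong) auto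
    also have "\<dots> = (\<Sum>a\<leftarrow>as. a ^ k)"
      unfolding dg[symmetric] diag_mat_def using W(5) by (simp add: sum_list_sum_nth lessThan_atLeast0)
    also have "\<dots> = complex_of_real (\<Sum>x\<leftarrow>ls. x ^ k)" unfolding as by (induction ls) auto
    finally show ?thesis .
  qed
  have cnt: "count_list as (complex_of_real x) = count_list ls x" for x
    unfolding as by (induction ls) auto
  have "psd_eigs_spec ?N ls"
    unfolding psd_eigs_spec_def
  proof (intro conjI allI ballI)
    show "length ls = dim_row ?N" using len D by (simp add: ls_def)
    show "0 \<le> x" if "x \<in> set ls" for x using that real by (auto simp: ls_def)
    show "tr_mat (?N ^\<^sub>m k) = complex_of_real (\<Sum>x\<leftarrow>ls. x ^ k)" for k by (rule tr)
    show "char_poly (c \<cdot>\<^sub>m ?N) = (\<Prod>x\<leftarrow>ls. [:- (c * complex_of_real x), 1:])" for c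
      unfolding char_poly_smult_similar[OF N w ut] dg unfolding as by (simp add: comp_def)
    show "eigenvalue ?N (complex_of_real x) \<longleftrightarrow> x \<in> set ls" for x
      unfolding ev as by auto
    show "kernel_dim (char_matrix ?N (complex_of_real x)) \<le> count_list ls x" for x
      using kernel_dim_char_matrix(1)[OF N cp, of "complex_of_real x"] cnt by simp
    show "1 \<le> kernel_dim (char_matrix ?N (complex_of_real x))" if "x \<in> set ls" for x
      by (rule kernel_dim_char_matrix(2)[OF N cp]) (use that in \<open>simp add: as\<close>)
  qed
  then show ?thesis ..
qed

definition psd_eigs :: "complex mat \<Rightarrow> real list" where
  "psd_eigs D = (SOME ls. psd_eigs_spec (D * mat_adjoint D) ls)"

lemma psd_eigs:
  fixes D :: "complex mat"
  assumes D: "D \<in> carrier_mat n k"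
  shows "length (psd_eigs D) = n" "x \<in> set (psd_eigs D) \<Longrightarrow> 0 \<le> x"
    "tr_mat ((D * mat_adjoint D) ^\<^sub>m j) = complex_of_real (\<Sum>x\<leftarrow>psd_eigs D. x ^ j)"
    "char_poly (c \<cdot>\<^sub>m (D * mat_adjoint D)) = (\<Prod>x\<leftarrow>psd_eigs D. [:- (c * complex_of_real x), 1:])"
    "eigenvalue (D * mat_adjoint D) (complex_of_real x) \<longleftrightarrow> x \<in> set (psd_eigs D)"
    "kernel_dim (char_matrix (D * mat_adjoint D) (complex_of_real x)) \<le> count_list (psd_eigs D) x"
    "x \<in> set (psd_eigs D) \<Longrightarrow> 1 \<le> kernel_dim (char_matrix (D * mat_adjoint D) (complex_of_real x))"
proof -
  have sp: "psd_eigs_spec (D * mat_adjoint D) (psd_eigs D)"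
    unfolding psd_eigs_def by (rule someI_ex[OF psd_eigs_exist[OF D]])
  show "length (psd_eigs D) = n" using sp D by (simp add: psd_eigs_spec_def)
  show "tr_mat ((D * mat_adjoint D) ^\<^sub>m j) = complex_of_real (\<Sum>x\<leftarrow>psd_eigs D. x ^ j)"
    "char_poly (c \<cdot>\<^sub>m (D * mat_adjoint D)) = (\<Prod>x\<leftarrow>psd_eigs D. [:- (c * complex_of_real x), 1:])"
    "eigenvalue (D * mat_adjoint D) (complex_of_real x) \<longleftrightarrow> x \<in> set (psd_eigs D)"
    "kernel_dim (char_matrix (D * mat_adjoint D) (complex_of_real x)) \<le> count_list (psd_eigs D) x"
    using sp unfolding psd_eigs_spec_def by blast+
  show "0 \<le> x" "1 \<le> kernel_dim (char_matrix (D * mat_adjoint D) (complex_of_real x))" if "x \<in> set (psd_eigs D)"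
    using sp that unfolding psd_eigs_spec_def by blast+
qed


section \<open>Unitary representations applied to group ring matrices\<close>

lemma sum_div_mod: "(\<Sum>k<s * m. F (k div m) (k mod m)) = (\<Sum>j<s. \<Sum>c<(m::nat). (F j c :: complex))"
proof (cases "m = 0")
  case False
  have "(\<Sum>j<s. \<Sum>c<m. F j c) = (\<Sum>(j, c)\<in>{..<s} \<times> {..<m}. F j c)" by (rule sum.cartesian_product)
  also have "\<dots> = (\<Sum>k<s * m. F (k div m) (k mod m))"
  proof (rule sum.reindex_bij_witness[where i="\<lambda>k. (k div m, k mod m)" and j="\<lambda>(j, c). j * m + c"])
    fix p assume p: "p \<in> {..<s} \<times> {..<m}"
    then obtain j c where jc: "p = (j, c)" "j < s" "c < m" by auto
    then show "(\<lambda>k. (k div m, k mod m)) ((\<lambda>(j, c). j * m + c) p) = p" by simp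
    have "j * m + c < j * m + m" using jc by simp
    also have "\<dots> \<le> s * m" using jc by (metis Suc_leI add.commute mult_Suc mult_le_mono1)
    finally show "(\<lambda>(j, c). j * m + c) p \<in> {..<s * m}" using jc by simp
    show "F ((\<lambda>(j, c). j * m + c) p div m) ((\<lambda>(j, c). j * m + c) p mod m) = (case p of (j, c) \<Rightarrow> F j c)" using jc by simp
  next
    fix k assume "k \<in> {..<s * m}"
    then show "(\<lambda>k. (k div m, k mod m)) k \<in> {..<s} \<times> {..<m}" using False by (auto simp: less_mult_imp_div_less)
    show "(\<lambda>(j, c). j * m + c) ((\<lambda>k. (k div m, k mod m)) k) = k" by simp
  qed
  finally show ?thesis by simp
qed simp

text \<open>A unitary representation of degree m, given by its matrix coefficients; unitarity is the
  clause on inverses.\<close>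

definition matrix_rep :: "('g, 'b) monoid_scheme \<Rightarrow> nat \<Rightarrow> (nat \<Rightarrow> nat \<Rightarrow> 'g \<Rightarrow> complex) \<Rightarrow> bool" where
  "matrix_rep G m \<pi> \<longleftrightarrow>
     (\<forall>a<m. \<forall>c<m. \<forall>g\<in>carrier G. \<forall>h\<in>carrier G. \<pi> a c (g \<otimes>\<^bsub>G\<^esub> h) = (\<Sum>b<m. \<pi> a b g * \<pi> b c h)) \<and>
     (\<forall>a<m. \<forall>b<m. \<forall>g\<in>carrier G. \<pi> a b (inv\<^bsub>G\<^esub> g) = cnj (\<pi> b a g)) \<and>
     (\<forall>a<m. \<forall>b<m. \<pi> a b \<one>\<^bsub>G\<^esub> = (if a = b then 1 else 0))"

text \<open>The representation applied entrywise, as a block matrix with blocks of size m; positions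
  i * m + a follow the indexing of \<open>regular_mat\<close>.\<close>

definition rep_mat :: "nat \<Rightarrow> nat \<Rightarrow> nat \<Rightarrow> (nat \<Rightarrow> nat \<Rightarrow> 'g \<Rightarrow> complex) \<Rightarrow> (nat \<Rightarrow> nat \<Rightarrow> 'g \<Rightarrow> complex) \<Rightarrow> complex mat" where
  "rep_mat m r s \<pi> A = mat (r * m) (s * m) (\<lambda>(a, b). gr_eval (A (a div m) (b div m)) (\<pi> (a mod m) (b mod m)))"

lemma rep_mat_carrier [simp]: "rep_mat m r s \<pi> A \<in> carrier_mat (r * m) (s * m)"
  by (simp add: rep_mat_def)

lemma rep_mat_dim [simp]: "dim_row (rep_mat m r s \<pi> A) = r * m" "dim_col (rep_mat m r s \<pi> A) = s * m"
  by (simp_all add: rep_mat_def)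

lemma gr_eval_cong: "(\<And>g. a g \<noteq> 0 \<Longrightarrow> \<phi> g = \<psi> g) \<Longrightarrow> gr_eval a \<phi> = gr_eval a \<psi>"
  unfolding gr_eval_def by (intro sum.cong) auto

lemma gr_eval_sum_right: "gr_eval a (\<lambda>g. \<Sum>b\<in>J. \<phi> b g) = (\<Sum>b\<in>J. gr_eval a (\<phi> b))"
  unfolding gr_eval_def sum_distrib_left by (rule sum.swap)

lemma gr_eval_mult_right: "gr_eval a (\<lambda>g. c * \<phi> g) = c * gr_eval a \<phi>" "gr_eval a (\<lambda>g. \<phi> g * c) = gr_eval a \<phi> * c"
  unfolding gr_eval_def by (simp_all add: sum_distrib_left sum_distrib_right mult_ac)

lemma div_mod_bounds: "a < r * m \<Longrightarrow> a div m < r \<and> a mod m < (m::nat)"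
  by (cases "m = 0") (auto simp: less_mult_imp_div_less)

context group begin

lemma rep_mat_times:
  assumes \<pi>: "matrix_rep G m \<pi>" and A: "group_ring_mat G r s A" and B: "group_ring_mat G s u B"
  shows "rep_mat m r u \<pi> (gr_mat_times G s A B) = rep_mat m r s \<pi> A * rep_mat m s u \<pi> B"
proof (rule eq_matI)
  fix a b assume "a < dim_row (rep_mat m r s \<pi> A * rep_mat m s u \<pi> B)" "b < dim_col (rep_mat m r s \<pi> A * rep_mat m s u \<pi> B)"
  then have ab: "a < r * m" "b < u * m" by auto
  define i a' k b' where "i = a div m" and "a' = a mod m" and "k = b div m" and "b' = b mod m"
  have bounds: "i < r" "a' < m" "k < u" "b' < m"
    using div_mod_bounds[OF ab(1)] div_mod_bounds[OF ab(2)] by (auto simp: i_def a'_def k_def b'_def)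
  have "(rep_mat m r s \<pi> A * rep_mat m s u \<pi> B) $$ (a, b) = (\<Sum>l<s * m. rep_mat m r s \<pi> A $$ (a, l) * rep_mat m s u \<pi> B $$ (l, b))"
    by (rule index_mult_mat_sum[of _ "r * m" _ _ "u * m"]) (use ab in auto)
  also have "\<dots> = (\<Sum>l<s * m. gr_eval (A i (l div m)) (\<pi> a' (l mod m)) * gr_eval (B (l div m) k) (\<pi> (l mod m) b'))"
    using ab by (intro sum.cong refl) (simp add: rep_mat_def i_def a'_def k_def b'_def)
  also have "\<dots> = (\<Sum>j<s. \<Sum>c<m. gr_eval (A i j) (\<pi> a' c) * gr_eval (B j k) (\<pi> c b'))"
    by (rule sum_div_mod)
  also have "\<dots> = (\<Sum>j<s. gr_eval (A i j) (\<lambda>g. gr_eval (B j k) (\<lambda>h. \<pi> a' b' (g \<otimes> h))))"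
  proof (rule sum.cong[OF refl])
    fix j assume "j \<in> {..<s}"
    then have j: "j < s" by simp
    have "gr_eval (A i j) (\<lambda>g. gr_eval (B j k) (\<lambda>h. \<pi> a' b' (g \<otimes> h))) = gr_eval (A i j) (\<lambda>g. gr_eval (B j k) (\<lambda>h. \<Sum>c<m. \<pi> a' c g * \<pi> c b' h))"
      using \<pi> bounds gr_elemD(2)[OF gr_mat_elem[OF A bounds(1) j]] gr_elemD(2)[OF gr_mat_elem[OF B j bounds(3)]]
      by (intro gr_eval_cong) (simp add: matrix_rep_def)
    also have "\<dots> = (\<Sum>c<m. gr_eval (A i j) (\<pi> a' c) * gr_eval (B j k) (\<pi> c b'))"
      by (simp add: gr_eval_sum_right gr_eval_mult_right)
    finally show "(\<Sum>c<m. gr_eval (A i j) (\<pi> a' c) * gr_eval (B j k) (\<pi> c b')) = gr_eval (A i j) (\<lambda>g. gr_eval (B j k) (\<lambda>h. \<pi> a' b' (g \<otimes> h)))" by simp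
  qed
  also have "\<dots> = gr_eval (gr_mat_times G s A B i k) (\<pi> a' b')"
    by (rule gr_mat_times_eval[OF A B bounds(1,3), symmetric])
  also have "\<dots> = rep_mat m r u \<pi> (gr_mat_times G s A B) $$ (a, b)"
    using ab by (simp add: rep_mat_def i_def a'_def k_def b'_def)
  finally show "rep_mat m r u \<pi> (gr_mat_times G s A B) $$ (a, b) = (rep_mat m r s \<pi> A * rep_mat m s u \<pi> B) $$ (a, b)" by simp
qed auto

lemma rep_mat_adjoint:
  assumes \<pi>: "matrix_rep G m \<pi>" and A: "group_ring_mat G r s A"
  shows "rep_mat m s r \<pi> (gr_mat_adjoint G A) = mat_adjoint (rep_mat m r s \<pi> A)"
proof (rule eq_matI)
  fix a b assume "a < dim_row (mat_adjoint (rep_mat m r s \<pi> A))" "b < dim_col (mat_adjoint (rep_mat m r s \<pi> A))"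
  then have ab: "a < s * m" "b < r * m" by auto
  have el: "gr_elem G (A (b div m) (a div m))" using gr_mat_elem[OF A] div_mod_bounds[OF ab(1)] div_mod_bounds[OF ab(2)] by blast
  have "gr_eval (A (b div m) (a div m)) (\<lambda>g. cnj (\<pi> (a mod m) (b mod m) (inv g))) = gr_eval (A (b div m) (a div m)) (\<pi> (b mod m) (a mod m))"
    using \<pi> div_mod_bounds[OF ab(1)] div_mod_bounds[OF ab(2)] gr_elemD(2)[OF el]
    by (intro gr_eval_cong) (simp add: matrix_rep_def)
  then show "rep_mat m s r \<pi> (gr_mat_adjoint G A) $$ (a, b) = mat_adjoint (rep_mat m r s \<pi> A) $$ (a, b)"
    using ab by (simp add: mat_adjoint_index rep_mat_def gr_adjoint_eval[where A=A, OF el])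
qed auto

lemma rep_mat_pow:
  assumes \<pi>: "matrix_rep G m \<pi>" and B: "group_ring_mat G r r B"
  shows "rep_mat m r r \<pi> (gr_mat_pow r B n) = rep_mat m r r \<pi> B ^\<^sub>m n"
proof (induction n)
  case 0
  show ?case
  proof (rule eq_matI)
    fix a b assume "a < dim_row (rep_mat m r r \<pi> B ^\<^sub>m 0)" "b < dim_col (rep_mat m r r \<pi> B ^\<^sub>m 0)"
    then have ab: "a < r * m" "b < r * m" by auto
    have "gr_eval (\<lambda>g. if i = j \<and> g = \<one> then 1 else 0) \<phi> = (if i = j then \<phi> \<one> else 0)" for i j :: nat and \<phi>
      by (subst gr_eval_superset[of "{\<one>}"]) auto
    moreover have "a = b \<longleftrightarrow> a div m = b div m \<and> a mod m = b mod m" by (metis div_mult_mod_eq)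
    ultimately show "rep_mat m r r \<pi> (gr_mat_pow r B 0) $$ (a, b) = (rep_mat m r r \<pi> B ^\<^sub>m 0) $$ (a, b)"
      using ab \<pi> div_mod_bounds[OF ab(1)] div_mod_bounds[OF ab(2)]
      by (auto simp: rep_mat_def matrix_rep_def)
  qed auto
next
  case (Suc n)
  then show ?case by (simp add: rep_mat_times[OF \<pi> gr_mat_pow_mat[OF B] B])
qed

lemma tr_rep_mat:
  "tr_mat (rep_mat m r r \<pi> B) = (\<Sum>i<r. gr_eval (B i i) (\<lambda>g. \<Sum>a<m. \<pi> a a g))"
proof -
  have "tr_mat (rep_mat m r r \<pi> B) = (\<Sum>k<r * m. gr_eval (B (k div m) (k div m)) (\<pi> (k mod m) (k mod m)))"
    unfolding tr_mat_def by (intro sum.cong) (auto simp: rep_mat_def)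
  also have "\<dots> = (\<Sum>i<r. \<Sum>a<m. gr_eval (B i i) (\<pi> a a))" by (rule sum_div_mod)
  finally show ?thesis by (simp add: gr_eval_sum_right)
qed

text \<open>The power sums of the eigenvalues see a representation only through its character. So
  the regular representation of a quotient can be compared with induced ones without an explicit
  intertwiner.\<close>

lemma rep_eigs_power_sum:
  assumes \<pi>: "matrix_rep G m \<pi>" and A: "group_ring_mat G r s A"
  shows "complex_of_real (\<Sum>x\<leftarrow>psd_eigs (rep_mat m r s \<pi> A). x ^ n)
    = (\<Sum>i<r. gr_eval (gr_mat_pow r (gr_mat_times G s A (gr_mat_adjoint G A)) n i i) (\<lambda>g. \<Sum>a<m. \<pi> a a g))"
proof -
  note A' = gr_adjoint_mat[OF A]
  note B = gr_mat_times_mat[OF A A']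
  show ?thesis
    unfolding psd_eigs(3)[OF rep_mat_carrier, symmetric] rep_mat_adjoint[OF \<pi> A, symmetric] rep_mat_times[OF \<pi> A A', symmetric]
      rep_mat_pow[OF \<pi> B, symmetric] by (rule tr_rep_mat)
qed

end

section \<open>Induced representations from an infinite cyclic subgroup\<close>


locale infinite_cyclic_transversal = group G for G (structure) +
  fixes x :: 'a and t :: "nat \<Rightarrow> 'a" and m :: nat
  assumes x [simp]: "x \<in> carrier G"
    and x_inf: "x [^] (k :: int) = \<one> \<Longrightarrow> k = 0"
    and t [simp]: "a < m \<Longrightarrow> t a \<in> carrier G"
    and transversal: "g \<in> carrier G \<Longrightarrow> \<exists>!a. a < m \<and> g \<otimes> inv (t a) \<in> range (\<lambda>k :: int. x [^] k)"
begin

definition Z where "Z = range (\<lambda>k :: int. x [^] k)"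
definition K :: "nat \<Rightarrow> 'a set" where "K n = range (\<lambda>k :: int. x [^] (int n * k))"

lemma xpow [simp]: "x [^] (k :: int) \<in> carrier G" by simp

lemma xpow_inj: "x [^] (k :: int) = x [^] (l :: int) \<longleftrightarrow> k = l"
proof
  assume "x [^] k = x [^] l"
  then have "x [^] (k + (- l)) = \<one>" unfolding int_pow_mult[OF x] int_pow_neg[OF x] by simp
  then show "k = l" using x_inf by fastforce
qed simp

lemma Z_carrier: "u \<in> Z \<Longrightarrow> u \<in> carrier G" by (auto simp: Z_def)
lemma Z_mult: "u \<in> Z \<Longrightarrow> v \<in> Z \<Longrightarrow> u \<otimes> v \<in> Z" by (auto simp: Z_def int_pow_mult[symmetric])
lemma Z_inv: "u \<in> Z \<Longrightarrow> inv u \<in> Z" by (auto simp: Z_def int_pow_neg[symmetric])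
lemma Z_one: "\<one> \<in> Z" unfolding Z_def by (rule range_eqI[of _ _ 0]) simp

lemma Z_mult_iff:
  assumes "u \<in> Z" "v \<in> carrier G" shows "u \<otimes> v \<in> Z \<longleftrightarrow> v \<in> Z"
proof
  assume "u \<otimes> v \<in> Z"
  then have "inv u \<otimes> (u \<otimes> v) \<in> Z" using assms Z_mult Z_inv by blast
  then show "v \<in> Z" using assms Z_carrier by (simp add: m_assoc[symmetric])
qed (use assms Z_mult in blast)

lemma transversal_unique:
  assumes "g \<in> carrier G" "a < m" "b < m" "g \<otimes> inv (t a) \<in> Z" "g \<otimes> inv (t b) \<in> Z" shows "a = b"
  using transversal[OF assms(1)] assms unfolding Z_def by blast

lemma transversal_ex:
  assumes "g \<in> carrier G" obtains a where "a < m" "g \<otimes> inv (t a) \<in> Z"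
  using transversal[OF assms] unfolding Z_def by blast

lemma m_pos: "m > 0"
  using transversal_ex[OF one_closed] by (metis gr0I not_less_zero)

definition zexp :: "'a \<Rightarrow> int" where "zexp u = (THE k. x [^] k = u)"

lemma zexp [simp]: "zexp (x [^] (k :: int)) = k"
  unfolding zexp_def xpow_inj by simp

text \<open>The character of Z that sends x to z, extended by zero to G as in the usual formula for
  induced characters.\<close>

definition chi :: "complex \<Rightarrow> 'a \<Rightarrow> complex" where
  "chi z u = (if u \<in> Z then z powi zexp u else 0)"

lemma chi_xpow: "chi z (x [^] (k :: int)) = z powi k" by (auto simp: chi_def Z_def)

lemma chi_mult:
  assumes z: "z \<noteq> 0" and u: "u \<in> Z" and v: "v \<in> carrier G"
  shows "chi z (u \<otimes> v) = chi z u * chi z v"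
proof (cases "v \<in> Z")
  case True
  obtain k l :: int where "u = x [^] k" "v = x [^] l" using u True by (auto simp: Z_def)
  then show ?thesis using z by (simp add: int_pow_mult[symmetric] chi_xpow power_int_add)
next
  case False
  then show ?thesis using Z_mult_iff[OF u v] by (simp add: chi_def)
qed

lemma chi_inv:
  assumes z: "cmod z = 1" and u: "u \<in> carrier G"
  shows "chi z (inv u) = cnj (chi z u)"
proof (cases "u \<in> Z")
  case True
  then obtain k :: int where k: "u = x [^] k" by (auto simp: Z_def)
  have z0: "z \<noteq> 0" using z by auto
  have "z * cnj z = 1" using complex_norm_square[of z] z by simp
  then have ci: "cnj z = inverse z" using z0 by (simp add: field_simps)
  have "cnj (z powi k) = cnj z powi k" by (cases k rule: int_cases2) (simp_all add: power_int_minus)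
  also have "\<dots> = z powi (- k)" using z0 by (simp add: ci power_int_minus power_int_inverse)
  finally show ?thesis by (simp add: k int_pow_neg[symmetric] chi_xpow)
next
  case False
  then have "inv u \<notin> Z" using Z_inv[of "inv u"] u by auto
  then show ?thesis using False by (simp add: chi_def)
qed

text \<open>Matrix coefficients of the representation of G induced from that character, in the basis
  given by the transversal.\<close>

definition ind_rep :: "complex \<Rightarrow> nat \<Rightarrow> nat \<Rightarrow> 'a \<Rightarrow> complex" where
  "ind_rep z a b g = chi z (t a \<otimes> g \<otimes> inv (t b))"

text \<open>The matrices are monomial: for given a and g exactly one b0 puts
  \<open>t a \<otimes> g \<otimes> inv (t b0)\<close> into Z, so the sum over b has one term, to
  which multiplicativity of the character applies.\<close>

lemma ind_rep: 
  assumes z: "cmod z = 1"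
  shows "matrix_rep G m (ind_rep z)"
  unfolding matrix_rep_def
proof (intro conjI allI impI ballI)
  have z0: "z \<noteq> 0" using z by auto
  fix a c g h assume a: "a < m" and c: "c < m" and g: "g \<in> carrier G" and h: "h \<in> carrier G"
  obtain b0 where b0: "b0 < m" "t a \<otimes> g \<otimes> inv (t b0) \<in> Z" using transversal_ex[of "t a \<otimes> g"] a g by auto
  have zero: "ind_rep z a b g = 0" if "b < m" "b \<noteq> b0" for b
  proof -
    have "t a \<otimes> g \<otimes> inv (t b) \<notin> Z" using transversal_unique[of "t a \<otimes> g" b b0] that b0 a g by auto
    then show ?thesis by (simp add: ind_rep_def chi_def)
  qed
  have "(\<Sum>b<m. ind_rep z a b g * ind_rep z b c h) = (\<Sum>b<m. if b = b0 then ind_rep z a b0 g * ind_rep z b0 c h else 0)"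
    by (intro sum.cong refl) (auto simp: zero)
  also have "\<dots> = ind_rep z a b0 g * ind_rep z b0 c h" using b0 by simp
  also have "\<dots> = chi z ((t a \<otimes> g \<otimes> inv (t b0)) \<otimes> (t b0 \<otimes> h \<otimes> inv (t c)))"
    unfolding ind_rep_def by (rule chi_mult[symmetric]) (use z0 a b0 c g h in auto)
  also have "(t a \<otimes> g \<otimes> inv (t b0)) \<otimes> (t b0 \<otimes> h \<otimes> inv (t c)) = t a \<otimes> (g \<otimes> h) \<otimes> inv (t c)"
  proof -
    have "(t a \<otimes> g \<otimes> inv (t b0)) \<otimes> (t b0 \<otimes> h \<otimes> inv (t c)) = t a \<otimes> g \<otimes> (inv (t b0) \<otimes> t b0) \<otimes> h \<otimes> inv (t c)"
      using a b0(1) c g h by (simp only: m_assoc t inv_closed m_closed)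
    also have "\<dots> = t a \<otimes> (g \<otimes> h) \<otimes> inv (t c)" using a b0(1) c g h by (simp add: m_assoc)
    finally show ?thesis .
  qed
  finally show "ind_rep z a c (g \<otimes> h) = (\<Sum>b<m. ind_rep z a b g * ind_rep z b c h)" by (simp add: ind_rep_def)
next
  fix a b g assume a: "a < m" and b: "b < m" and g: "g \<in> carrier G"
  have "t a \<otimes> inv g \<otimes> inv (t b) = inv (t b \<otimes> g \<otimes> inv (t a))"
    using a b g by (simp add: inv_mult_group m_assoc)
  then show "ind_rep z a b (inv g) = cnj (ind_rep z b a g)" unfolding ind_rep_def using a b g z by (simp add: chi_inv)
next
  fix a b assume a: "a < m" and b: "b < m"
  show "ind_rep z a b \<one> = (if a = b then 1 else 0)"
  proof (cases "a = b")
    case True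
    then show ?thesis using a chi_xpow[of z 0] by (simp add: ind_rep_def)
  next
    case False
    then have "t a \<otimes> inv (t b) \<notin> Z" using transversal_unique[of "t a" a b] a b Z_one by auto
    then show ?thesis using a b False by (simp add: ind_rep_def chi_def)
  qed
qed

definition ind_char :: "complex \<Rightarrow> 'a \<Rightarrow> complex" where
  "ind_char z g = (\<Sum>a<m. ind_rep z a a g)"

lemma conj_cancel:
  assumes h: "h \<in> carrier G" and g: "g \<in> carrier G"
  shows "inv h \<otimes> (h \<otimes> g \<otimes> inv h) \<otimes> h = g"
  using h g by (simp add: m_assoc inv_solve_left')

lemma conj_eq_one:
  assumes h: "h \<in> carrier G" and g: "g \<in> carrier G"
  shows "h \<otimes> g \<otimes> inv h = \<one> \<longleftrightarrow> g = \<one>"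
proof
  assume *: "h \<otimes> g \<otimes> inv h = \<one>"
  have "g = inv h \<otimes> (h \<otimes> g \<otimes> inv h) \<otimes> h" by (rule conj_cancel[OF h g, symmetric])
  also have "\<dots> = \<one>" unfolding * using h by simp
  finally show "g = \<one>" .
qed (use h in simp)

lemma sum_roots_of_unity:
  assumes n: "n > 0"
  shows "(\<Sum>j<n. cis (2 * pi * real j / real n) powi k) = (if int n dvd k then of_nat n else 0)"
proof -
  define w where "w = cis (2 * pi * real_of_int k / real n)"
  have pw: "cis (2 * pi * real j / real n) powi k = w ^ j" for j
    unfolding w_def Complex.DeMoivre cis_power_int by (simp add: field_simps)
  have wn: "w ^ n = 1"
    unfolding w_def Complex.DeMoivre using n by (simp add: cis_multiple_2pi mult.commute[of "real_of_int k"])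
  have w1: "w = 1 \<longleftrightarrow> int n dvd k"
  proof
    assume "w = 1"
    then have "cos (2 * pi * real_of_int k / real n) = 1" unfolding w_def by (simp add: complex_eq_iff)
    then obtain l :: int where "2 * pi * real_of_int k / real n = real_of_int l * 2 * pi" by (auto simp: cos_one_2pi_int)
    then have "real_of_int k = real_of_int (l * int n)" using n by (simp add: field_simps)
    then have "k = l * int n" by (simp only: of_int_eq_iff)
    then show "int n dvd k" by simp
  next
    assume "int n dvd k"
    then obtain l where "k = int n * l" by (elim dvdE)
    then have "2 * pi * real_of_int k / real n = 2 * pi * real_of_int l" using n by simp
    then show "w = 1" unfolding w_def by (simp add: cis_multiple_2pi)
  qed
  show ?thesis
  proof (cases "w = 1")
    case True
    then show ?thesis using w1 by (simp add: pw)
  next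
    case False
    have "(\<Sum>j<n. w ^ j) = 0" using geometric_sum[OF False, of n] wn by simp
    then show ?thesis using w1 False by (simp add: pw)
  qed
qed

lemma K_iff: "x [^] (k :: int) \<in> K n \<longleftrightarrow> int n dvd k"
  by (auto simp: K_def xpow_inj dvd_def)

lemma K_subset: "K n \<subseteq> Z" by (auto simp: K_def Z_def)

lemma sum_chi_roots:
  assumes n: "n > 0"
  shows "(\<Sum>j<n. chi (cis (2 * pi * real j / real n)) u) = (if u \<in> K n then of_nat n else 0)"
proof (cases "u \<in> Z")
  case True
  then obtain k :: int where k: "u = x [^] k" by (auto simp: Z_def)
  show ?thesis unfolding k chi_xpow sum_roots_of_unity[OF n] K_iff ..
next
  case False
  then show ?thesis using K_subset by (auto simp: chi_def)
qed

text \<open>The regular representation of G / K n is the sum of the representations induced from the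
  characters of Z that are trivial on K n; the identity states this for characters. Normality makes
  membership in K n stable under conjugation by \<open>t a\<close>.\<close>

lemma sum_ind_char_roots:
  assumes n: "n > 0" and norm: "K n \<lhd> G" and g: "g \<in> carrier G"
  shows "(\<Sum>j<n. ind_char (cis (2 * pi * real j / real n)) g) = (if g \<in> K n then of_nat (n * m) else 0)"
proof -
  interpret normal "K n" G by fact
  have "t a \<otimes> g \<otimes> inv (t a) \<in> K n \<longleftrightarrow> g \<in> K n" if a: "a < m" for a
  proof
    assume "t a \<otimes> g \<otimes> inv (t a) \<in> K n"
    then have "inv (t a) \<otimes> (t a \<otimes> g \<otimes> inv (t a)) \<otimes> t a \<in> K n" using inv_op_closed1 a by simp
    also have "inv (t a) \<otimes> (t a \<otimes> g \<otimes> inv (t a)) \<otimes> t a = g" by (rule conj_cancel) (use a g in auto)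
    finally show "g \<in> K n" .
  qed (use inv_op_closed2 a in simp)
  note eq = this
  have "(\<Sum>j<n. ind_char (cis (2 * pi * real j / real n)) g) = (\<Sum>a<m. \<Sum>j<n. chi (cis (2 * pi * real j / real n)) (t a \<otimes> g \<otimes> inv (t a)))"
    unfolding ind_char_def ind_rep_def by (rule sum.swap)
  also have "\<dots> = (\<Sum>a<m. if g \<in> K n then of_nat n else 0)"
    by (intro sum.cong refl) (simp add: sum_chi_roots[OF n] eq)
  finally show ?thesis by (simp add: mult.commute)
qed

lemma K_subgroup: "subgroup (K n) G"
proof
  show "K n \<subseteq> carrier G" by (auto simp: K_def)
  show "\<one> \<in> K n" using K_iff[of 0 n] by simp
next
  fix u v assume "u \<in> K n" "v \<in> K n"
  then obtain k l :: int where "u = x [^] (int n * k)" "v = x [^] (int n * l)" by (auto simp: K_def)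
  then show "u \<otimes> v \<in> K n" by (simp add: int_pow_mult[symmetric] K_iff)
next
  fix u assume "u \<in> K n"
  then obtain k :: int where "u = x [^] (int n * k)" by (auto simp: K_def)
  then show "inv u \<in> K n" by (simp add: int_pow_neg[symmetric] K_iff)
qed

lemma K_coset_eq: "g \<in> carrier G \<Longrightarrow> h \<in> carrier G \<Longrightarrow> K n #> g = K n #> h \<longleftrightarrow> g \<otimes> inv h \<in> K n"
  by (metis K_subgroup is_group subgroup.rcos_module rcos_self repr_independence)

lemma bij_K_cosets:
  assumes n: "n > 0"
  shows "bij_betw (\<lambda>(j, a). K n #> (x [^] int j \<otimes> t a)) ({..<n} \<times> {..<m}) (rcosets (K n))"
  unfolding bij_betw_def
proof
  show "inj_on (\<lambda>(j, a). K n #> (x [^] int j \<otimes> t a)) ({..<n} \<times> {..<m})"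
  proof (rule inj_onI, clarify)
    fix j a j' a' assume b: "j < n" "a < m" "j' < n" "a' < m"
      and eq: "K n #> (x [^] int j \<otimes> t a) = K n #> (x [^] int j' \<otimes> t a')"
    have mem: "(x [^] int j \<otimes> t a) \<otimes> inv (x [^] int j' \<otimes> t a') \<in> K n"
      using K_coset_eq eq b by (metis m_closed t xpow)
    have "(x [^] int j \<otimes> t a) \<otimes> inv (x [^] int j' \<otimes> t a') = x [^] int j \<otimes> ((t a \<otimes> inv (t a')) \<otimes> x [^] (- int j'))"
      using b by (simp add: inv_mult_group m_assoc int_pow_neg)
    with mem have mem': "x [^] int j \<otimes> ((t a \<otimes> inv (t a')) \<otimes> x [^] (- int j')) \<in> K n" by simp
    \<comment> \<open>Coarsening from K n to Z isolates the transversal part and yields a = a';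
      afterwards j and j' are compared modulo n.\<close>
    then have "x [^] int j \<otimes> ((t a \<otimes> inv (t a')) \<otimes> x [^] (- int j')) \<in> Z" using K_subset by blast
    then have "(t a \<otimes> inv (t a')) \<otimes> x [^] (- int j') \<in> Z"
      by (subst (asm) Z_mult_iff) (use b in \<open>auto simp: Z_def\<close>)
    then have "(t a \<otimes> inv (t a')) \<otimes> x [^] (- int j') \<otimes> x [^] int j' \<in> Z"
      by (rule Z_mult) (auto simp: Z_def)
    then have "t a \<otimes> inv (t a') \<in> Z" using b by (simp add: m_assoc int_pow_mult[symmetric])
    then have aa: "a = a'" using transversal_unique[of "t a" a a'] b Z_one by auto
    then have "x [^] (int j - int j') \<in> K n"
      using mem' b by (simp add: int_pow_mult[symmetric])
    then have "int n dvd int j - int j'" by (simp add: K_iff)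
    then have "int j mod int n = int j' mod int n" by (simp add: mod_eq_dvd_iff)
    then show "j = j' \<and> a = a'" using aa b by simp
  qed
  show "(\<lambda>(j, a). K n #> (x [^] int j \<otimes> t a)) ` ({..<n} \<times> {..<m}) = rcosets (K n)"
  proof
    show "(\<lambda>(j, a). K n #> (x [^] int j \<otimes> t a)) ` ({..<n} \<times> {..<m}) \<subseteq> rcosets (K n)"
      by (auto intro!: rcosetsI subgroup.subset[OF K_subgroup])
    show "rcosets (K n) \<subseteq> (\<lambda>(j, a). K n #> (x [^] int j \<otimes> t a)) ` ({..<n} \<times> {..<m})"
    proof
      fix C assume "C \<in> rcosets (K n)"
      then obtain g where g: "g \<in> carrier G" "C = K n #> g" by (auto simp: RCOSETS_def)
      obtain a where a: "a < m" "g \<otimes> inv (t a) \<in> Z" using transversal_ex[OF g(1)] .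
      then obtain k :: int where k: "g \<otimes> inv (t a) = x [^] k" by (auto simp: Z_def)
      define j where "j = nat (k mod int n)"
      have j: "j < n" "int j = k mod int n" using n by (simp_all add: j_def nat_less_iff)
      have "g \<otimes> inv (x [^] int j \<otimes> t a) = (g \<otimes> inv (t a)) \<otimes> x [^] (- int j)"
        using g a by (simp add: inv_mult_group m_assoc int_pow_neg)
      also have "\<dots> = x [^] (k - int j)" unfolding k by (simp add: int_pow_mult[symmetric])
      also have "\<dots> \<in> K n" unfolding K_iff j(2) by simp
      finally have "C = K n #> (x [^] int j \<otimes> t a)" using K_coset_eq[of g "x [^] int j \<otimes> t a" n] g a by simp
      then show "C \<in> (\<lambda>(j, a). K n #> (x [^] int j \<otimes> t a)) ` ({..<n} \<times> {..<m})"
        by (intro image_eqI[where x="(j, a)"]) (use j(1) a in simp_all)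
    qed
  qed
qed

lemma card_K_cosets:
  assumes "n > 0" shows "card (rcosets (K n)) = n * m" "finite (rcosets (K n))"
  using bij_betw_same_card[OF bij_K_cosets[OF assms]] bij_betw_finite[OF bij_K_cosets[OF assms]] by auto

end

section \<open>Regular representations of finite quotients\<close>

context group begin

text \<open>\<pi> is the regular representation of G / N pulled back to G. All its diagonal
  coefficients are 1 on N and 0 elsewhere, which gives the character.\<close>

lemma regular_mat_rep:
  assumes N: "N \<lhd> G" and fin: "finite (rcosets N)" and A: "group_ring_mat G r s A"
  obtains \<pi> where "matrix_rep G (card (rcosets N)) \<pi>"
    "regular_mat (G Mod N) r s (quotient_mat A) = rep_mat (card (rcosets N)) r s \<pi> A"
    "\<And>g. g \<in> carrier G \<Longrightarrow> (\<Sum>a<card (rcosets N). \<pi> a a g) = (if g \<in> N then of_nat (card (rcosets N)) else 0)"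
proof -
  interpret N: normal N G by fact
  define Q where "Q = G Mod N"
  interpret Q: group Q unfolding Q_def by (rule N.factorgroup_is_group)
  define n where "n = card (rcosets N)"
  have cQ: "carrier Q = rcosets N" by (simp add: Q_def FactGroup_def)
  have n: "card (carrier Q) = n" by (simp add: cQ n_def)
  \<comment> \<open>The same choice as inside \<open>regular_mat\<close>, so that the two matrices
    agree entry by entry and not only up to a permutation of the basis.\<close>
  define e where "e = (SOME e. bij_betw e {..<n} (carrier Q))"
  have "\<exists>e. bij_betw e {..<n} (carrier Q)"
    unfolding n[symmetric] using ex_bij_betw_nat_finite[of "carrier Q"] fin by (simp add: cQ lessThan_atLeast0)
  then have e: "bij_betw e {..<n} (carrier Q)" unfolding e_def by (rule someI_ex)
  have eQ [simp]: "e a \<in> carrier Q" if "a < n" for a using e that by (auto simp: bij_betw_def)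
  define q where "q g = N #> g" for g
  have qQ [simp]: "q g \<in> carrier Q" if "g \<in> carrier G" for g using that by (auto simp: q_def cQ RCOSETS_def)
  have q_mult: "q (g \<otimes> h) = q g \<otimes>\<^bsub>Q\<^esub> q h" if "g \<in> carrier G" "h \<in> carrier G" for g h
    using that N.rcos_sum by (simp add: q_def Q_def FactGroup_def)
  have q_one: "q \<one> = \<one>\<^bsub>Q\<^esub>" using N.subset by (simp add: q_def Q_def FactGroup_def coset_mult_one)
  have q_inv: "q (inv g) = inv\<^bsub>Q\<^esub> q g" if g: "g \<in> carrier G" for g
  proof -
    have "q (inv g) \<otimes>\<^bsub>Q\<^esub> q g = \<one>\<^bsub>Q\<^esub>" using g q_mult[of "inv g" g] q_one by simp
    then show ?thesis using g by (simp add: Q.inv_equality)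
  qed
  have mem: "g \<in> C \<longleftrightarrow> q g = C" if g: "g \<in> carrier G" and C: "C \<in> carrier Q" for g C
  proof -
    obtain h where h: "h \<in> carrier G" "C = N #> h" using C by (auto simp: cQ RCOSETS_def)
    show ?thesis using g h N.subgroup_axioms by (metis q_def rcos_self repr_independence)
  qed
  define \<pi> :: "nat \<Rightarrow> nat \<Rightarrow> 'a \<Rightarrow> complex" where "\<pi> a b g = (if e a \<otimes>\<^bsub>Q\<^esub> q g = e b then 1 else 0)" for a b g
  have "matrix_rep G n \<pi>"
    unfolding matrix_rep_def
  proof (intro conjI allI impI ballI)
    fix a c g h assume a: "a < n" and c: "c < n" and g: "g \<in> carrier G" and h: "h \<in> carrier G"
    have "e a \<otimes>\<^bsub>Q\<^esub> q g \<in> carrier Q" using a g by simp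
    then obtain b0 where b0: "b0 < n" "e b0 = e a \<otimes>\<^bsub>Q\<^esub> q g" using e by (metis bij_betw_def imageE lessThan_iff)
    have "(\<Sum>b<n. \<pi> a b g * \<pi> b c h) = (\<Sum>b<n. if b = b0 then \<pi> b0 c h else 0)"
    proof (intro sum.cong refl)
      fix b assume "b \<in> {..<n}"
      then have "e b = e b0 \<longleftrightarrow> b = b0" using e b0(1) inj_on_eq_iff[of e "{..<n}" b b0] by (simp add: bij_betw_def)
      then show "\<pi> a b g * \<pi> b c h = (if b = b0 then \<pi> b0 c h else 0)" using b0(2)[symmetric] by (auto simp: \<pi>_def)
    qed
    also have "\<dots> = \<pi> b0 c h" using b0 by simp
    also have "\<dots> = \<pi> a c (g \<otimes> h)" using a g h by (simp add: \<pi>_def b0(2) q_mult Q.m_assoc)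
    finally show "\<pi> a c (g \<otimes> h) = (\<Sum>b<n. \<pi> a b g * \<pi> b c h)" by simp
  next
    fix a b g assume a: "a < n" and b: "b < n" and g: "g \<in> carrier G"
    have "e a \<otimes>\<^bsub>Q\<^esub> inv\<^bsub>Q\<^esub> q g = e b \<longleftrightarrow> e b \<otimes>\<^bsub>Q\<^esub> q g = e a"
      by (subst Q.inv_solve_right') (use a b g in auto)
    then show "\<pi> a b (inv g) = cnj (\<pi> b a g)" using g by (simp add: \<pi>_def q_inv)
  next
    fix a b assume a: "a < n" and b: "b < n"
    then show "\<pi> a b \<one> = (if a = b then 1 else 0)"
      using e by (auto simp: \<pi>_def q_one bij_betw_def inj_on_eq_iff)
  qed
  moreover have "regular_mat Q r s (quotient_mat A) = rep_mat n r s \<pi> A"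
  proof (rule eq_matI)
    fix a b assume "a < dim_row (rep_mat n r s \<pi> A)" "b < dim_col (rep_mat n r s \<pi> A)"
    then have ab: "a < r * n" "b < s * n" by auto
    note bd = div_mod_bounds[OF ab(1)] div_mod_bounds[OF ab(2)]
    define i j where "i = a div n" and "j = b div n"
    have el: "gr_elem G (A i j)" using gr_mat_elem[OF A] bd by (simp add: i_def j_def)
    define C where "C = inv\<^bsub>Q\<^esub> e (a mod n) \<otimes>\<^bsub>Q\<^esub> e (b mod n)"
    have C: "C \<in> carrier Q" using bd by (simp add: C_def)
    have "g \<in> C \<longleftrightarrow> e (a mod n) \<otimes>\<^bsub>Q\<^esub> q g = e (b mod n)" if g: "g \<in> carrier G" for g
      unfolding mem[OF g C] unfolding C_def by (subst Q.inv_solve_left) (use bd g in auto)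
    then have pi: "\<pi> (a mod n) (b mod n) g = (if g \<in> C then 1 else 0)" if "g \<in> carrier G" for g
      using that by (simp add: \<pi>_def)
    have "quotient_mat A i j C = (\<Sum>g | A i j g \<noteq> 0. if g \<in> C then A i j g else 0)"
      unfolding quotient_mat_def using gr_elemD(1)[OF el]
      by (intro sum.mono_neutral_cong_left) auto
    also have "\<dots> = gr_eval (A i j) (\<pi> (a mod n) (b mod n))"
      unfolding gr_eval_def using gr_elemD(2)[OF el] by (intro sum.cong refl) (simp add: pi)
    finally show "regular_mat Q r s (quotient_mat A) $$ (a, b) = rep_mat n r s \<pi> A $$ (a, b)"
      using ab by (simp add: regular_mat_def n e_def[symmetric] rep_mat_def C_def i_def j_def Let_def)
  qed (simp_all add: regular_mat_def n Let_def)
  moreover have "(\<Sum>a<n. \<pi> a a g) = (if g \<in> N then of_nat n else 0)" if g: "g \<in> carrier G" for g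
  proof -
    have "g \<in> N \<longleftrightarrow> q g = \<one>\<^bsub>Q\<^esub>" using mem[OF g Q.one_closed] by (simp add: Q_def FactGroup_def)
    then have "\<pi> a a g = (if g \<in> N then 1 else 0)" if "a < n" for a
      using that g Q.l_cancel_one'[of "e a" "q g"] by (auto simp: \<pi>_def)
    then show ?thesis by simp
  qed
  ultimately show ?thesis using that[of \<pi>] unfolding n_def Q_def by blast
qed

end

section \<open>Eigenvalue families on the unit circle\<close>


text \<open>The logarithmic derivative at 0: the two lowest coefficients of a product of linear
  factors encode the sum of the reciprocals of its roots.\<close>

lemma coeff_prod_list_linear:
  fixes cs :: "complex list"
  assumes "0 \<notin> set cs"
  shows "coeff (\<Prod>c\<leftarrow>cs. [:- c, 1:]) 0 \<noteq> 0"
    "coeff (\<Prod>c\<leftarrow>cs. [:- c, 1:]) 1 = - (\<Sum>c\<leftarrow>cs. 1 / c) * coeff (\<Prod>c\<leftarrow>cs. [:- c, 1:]) 0"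
  using assms
proof (induction cs)
  case (Cons a cs)
  { case 1 then show ?case using Cons.IH(1) by (simp add: coeff_mult) }
  { case 2
    then have a: "a \<noteq> 0" and IH: "coeff (\<Prod>c\<leftarrow>cs. [:- c, 1:]) 1 = - (\<Sum>c\<leftarrow>cs. 1 / c) * coeff (\<Prod>c\<leftarrow>cs. [:- c, 1:]) 0"
      using Cons.IH(2) by auto
    define c0 c1 S where "c0 = coeff (\<Prod>c\<leftarrow>cs. [:- c, 1:]) 0" and "c1 = coeff (\<Prod>c\<leftarrow>cs. [:- c, 1:]) 1" and "S = (\<Sum>c\<leftarrow>cs. 1 / c)"
    have e: "coeff (\<Prod>c\<leftarrow>a # cs. [:- c, 1:]) 1 = - a * c1 + c0" "coeff (\<Prod>c\<leftarrow>a # cs. [:- c, 1:]) 0 = - a * c0"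
      "(\<Sum>c\<leftarrow>a # cs. 1 / c) = 1 / a + S"
      by (simp_all add: coeff_mult c0_def c1_def S_def)
    have "- a * c1 + c0 = - (1 / a + S) * (- a * c0)"
      using a IH unfolding c0_def[symmetric] c1_def[symmetric] S_def[symmetric] by (simp add: algebra_simps)
    then show ?case unfolding e . }
qed auto

lemma prod_list_linear_split:
  fixes cs :: "complex list"
  shows "(\<Prod>c\<leftarrow>cs. [:- c, 1:]) = monom 1 (count_list cs 0) * (\<Prod>c\<leftarrow>filter (\<lambda>c. c \<noteq> 0) cs. [:- c, 1:])"
proof (induction cs)
  case (Cons a cs)
  have "monom (1::complex) (Suc n) = [:0, 1:] * monom 1 n" for n by (simp add: monom_Suc)
  then show ?case using Cons by (cases "a = 0") (simp_all add: mult_ac del: mult_pCons_left mult_pCons_right)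
qed simp

lemma coeff_prod_list_linear_shift:
  fixes cs :: "complex list"
  shows "coeff (\<Prod>c\<leftarrow>cs. [:- c, 1:]) j = (if j < count_list cs 0 then 0 else coeff (\<Prod>c\<leftarrow>filter (\<lambda>c. c \<noteq> 0) cs. [:- c, 1:]) (j - count_list cs 0))"
  by (subst prod_list_linear_split) (simp add: coeff_monom_mult)

lemma prod_linear_power_dvd:
  fixes p :: "complex poly"
  assumes "finite W" "\<And>w. w \<in> W \<Longrightarrow> e w \<le> order w p" "p \<noteq> 0"
  shows "(\<Prod>w\<in>W. [:- w, 1:] ^ e w) dvd p"
  using assms
proof (induction W arbitrary: p rule: finite_induct)
  case (insert v W)
  have "[:- v, 1:] ^ e v dvd p" using insert.prems by (meson order_divides insertI1)
  then obtain p' where p': "p = [:- v, 1:] ^ e v * p'" by (elim dvdE)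
  have p'0: "p' \<noteq> 0" using insert.prems p' by auto
  have "order w p' = order w p" if "w \<in> W" for w
  proof -
    have "w \<noteq> v" using that insert.hyps by auto
    then have "order w ([:- v, 1:] ^ e v) = 0" by (intro order_0I) simp
    then show ?thesis unfolding p' using p'0 by (subst order_mult) auto
  qed
  then have "(\<Prod>w\<in>W. [:- w, 1:] ^ e w) dvd p'" by (intro insert.IH p'0) (simp add: insert.prems)
  then show ?case using insert.hyps by (simp add: p' mult_dvd_mono del: mult_pCons_left)
qed simp

lemma circle_bounds:
  fixes f :: "complex \<Rightarrow> complex"
  assumes "continuous_on (sphere 0 1) f"
  shows "\<exists>C>0. \<forall>z. cmod z = 1 \<longrightarrow> cmod (f z) \<le> C"
    and "(\<And>z. cmod z = 1 \<Longrightarrow> f z \<noteq> 0) \<Longrightarrow> \<exists>c>0. \<forall>z. cmod z = 1 \<longrightarrow> c \<le> cmod (f z)"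
proof -
  have cpt: "compact (sphere (0::complex) 1)" by simp
  have ne: "sphere (0::complex) 1 \<noteq> {}" by (auto intro!: exI[of _ 1])
  have cont: "continuous_on (sphere 0 1) (\<lambda>z. cmod (f z))" by (intro continuous_intros assms)
  obtain u where u: "u \<in> sphere 0 1" "\<And>z. z \<in> sphere 0 1 \<Longrightarrow> cmod (f z) \<le> cmod (f u)"
    using continuous_attains_sup[OF cpt ne cont] by blast
  show "\<exists>C>0. \<forall>z. cmod z = 1 \<longrightarrow> cmod (f z) \<le> C"
  proof (intro exI conjI allI impI)
    show "0 < cmod (f u) + 1" by (simp add: add_nonneg_pos)
    show "cmod (f z) \<le> cmod (f u) + 1" if "cmod z = 1" for z using u(2)[of z] that by simp
  qed
  obtain v where v: "v \<in> sphere 0 1" "\<And>z. z \<in> sphere 0 1 \<Longrightarrow> cmod (f v) \<le> cmod (f z)"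
    using continuous_attains_inf[OF cpt ne cont] by blast
  assume "\<And>z. cmod z = 1 \<Longrightarrow> f z \<noteq> 0"
  then show "\<exists>c>0. \<forall>z. cmod z = 1 \<longrightarrow> c \<le> cmod (f z)"
    using v by (intro exI[of _ "cmod (f v)"]) auto
qed

text \<open>Once the zeros of p on the circle are split off, the remaining factor u is bounded below
  there by compactness. The k-th powers raise the order of q at each point of W to at least that of
  p, so the same zeros divide \<open>R\<close>.\<close>

lemma poly_ratio_bound:
  fixes p q :: "complex poly"
  assumes p: "p \<noteq> 0" and W: "W = {z. cmod z = 1 \<and> poly p z = 0}"
    and k: "\<And>w. w \<in> W \<Longrightarrow> order w p \<le> order w q + k"
  shows "\<exists>C>0. \<forall>z. cmod z = 1 \<longrightarrow> cmod (poly q z) * (\<Prod>w\<in>W. cmod (z - w)) ^ k \<le> C * cmod (poly p z)"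
proof (cases "q = 0")
  case True
  then show ?thesis by (intro exI[of _ 1]) simp
next
  case False
  have fin: "finite W" unfolding W by (rule finite_subset[OF _ poly_roots_finite[OF p]]) auto
  let ?L = "\<lambda>w. [:- w, 1:] :: complex poly"
  have "(\<Prod>w\<in>W. ?L w ^ order w p) dvd p" by (rule prod_linear_power_dvd[OF fin _ p]) simp
  then obtain u where u: "p = (\<Prod>w\<in>W. ?L w ^ order w p) * u" by (elim dvdE)
  have u0: "u \<noteq> 0" using u p by auto
  have un: "poly u z \<noteq> 0" if z: "cmod z = 1" for z
  proof
    assume uz: "poly u z = 0"
    then have zW: "z \<in> W" unfolding W using z by (subst u) simp
    have "order z u \<noteq> 0" using uz u0 order_root by blast
    have "(\<Prod>w\<in>W. ?L w ^ order w p) = ?L z ^ order z p * (\<Prod>w\<in>W - {z}. ?L w ^ order w p)"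
      by (rule prod.remove[OF fin zW])
    then have "p = ?L z ^ order z p * ((\<Prod>w\<in>W - {z}. ?L w ^ order w p) * u)" using u by (simp add: mult.assoc)
    moreover obtain u' where "u = ?L z * u'" using uz poly_eq_0_iff_dvd by (metis dvdE)
    ultimately have "p = ?L z ^ Suc (order z p) * ((\<Prod>w\<in>W - {z}. ?L w ^ order w p) * u')" by (simp add: mult_ac del: mult_pCons_left mult_pCons_right)
    then have "?L z ^ Suc (order z p) dvd p" by (rule dvdI)
    then show False using order_2[OF p, of z] by blast
  qed
  define R where "R = q * (\<Prod>w\<in>W. ?L w ^ k)"
  have Lk0: "(\<Prod>w\<in>W. ?L w ^ k) \<noteq> 0" using fin by (subst prod_zero_iff) auto
  have R0: "R \<noteq> 0" unfolding R_def using False Lk0 by simp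
  have "(\<Prod>w\<in>W. ?L w ^ order w p) dvd R"
  proof (rule prod_linear_power_dvd[OF fin _ R0])
    fix w assume w: "w \<in> W"
    have "?L w ^ k dvd (\<Prod>w\<in>W. ?L w ^ k)" by (rule dvd_prodI[OF fin w])
    then have "k \<le> order w (\<Prod>w\<in>W. ?L w ^ k)" using Lk0 order_divides by blast
    then have "order w q + k \<le> order w R" unfolding R_def using R0 R_def by (subst order_mult) auto
    then show "order w p \<le> order w R" using k[OF w] by linarith
  qed
  then obtain v where v: "R = (\<Prod>w\<in>W. ?L w ^ order w p) * v" by (elim dvdE)
  have cp: "continuous_on (sphere 0 1) (\<lambda>z. poly p z)" for p :: "complex poly" by (intro continuous_intros)
  obtain Cv where Cv: "Cv > 0" "\<And>z. cmod z = 1 \<Longrightarrow> cmod (poly v z) \<le> Cv"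
    using circle_bounds(1)[OF cp[of v]] by blast
  obtain cu where cu: "cu > 0" "\<And>z. cmod z = 1 \<Longrightarrow> cu \<le> cmod (poly u z)"
    using circle_bounds(2)[OF cp[of u]] un by blast
  have "cmod (poly q z) * (\<Prod>w\<in>W. cmod (z - w)) ^ k \<le> Cv / cu * cmod (poly p z)" if z: "cmod z = 1" for z
  proof -
    define Pz where "Pz = cmod (\<Prod>w\<in>W. (z - w) ^ order w p)"
    have "poly R z = poly q z * (\<Prod>w\<in>W. z - w) ^ k" unfolding R_def by (simp add: poly_prod prod_power_distrib)
    then have "cmod (poly q z) * (\<Prod>w\<in>W. cmod (z - w)) ^ k = cmod (poly R z)"
      by (simp add: norm_mult norm_power prod_norm)
    also have "\<dots> = Pz * cmod (poly v z)" unfolding v Pz_def by (simp add: poly_prod norm_mult)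
    also have "\<dots> \<le> Pz * Cv" using Cv(2)[OF z] by (intro mult_left_mono) (auto simp: Pz_def)
    also have "\<dots> \<le> Pz * Cv * (cmod (poly u z) / cu)"
    proof -
      have "1 \<le> cmod (poly u z) / cu" using cu z by simp
      moreover have "0 \<le> Pz * Cv" using Cv(1) by (simp add: Pz_def)
      ultimately show ?thesis using mult_left_mono[of 1 "cmod (poly u z) / cu" "Pz * Cv"] by simp
    qed
    also have "\<dots> = Cv / cu * (Pz * cmod (poly u z))" by simp
    also have "Pz * cmod (poly u z) = cmod (poly p z)"
    proof -
      have "poly p z = (\<Prod>w\<in>W. (z - w) ^ order w p) * poly u z"
        by (rule trans[OF arg_cong[where f="\<lambda>p. poly p z", OF u]]) (simp add: poly_prod)
      then show ?thesis by (simp add: Pz_def norm_mult)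
    qed
    finally show ?thesis .
  qed
  then show ?thesis using Cv(1) cu(1) by (intro exI[of _ "Cv / cu"]) auto
qed

text \<open>Splitting off the powers of z - w leaves factors that are nonzero at w, hence bounded
  and bounded away from 0 nearby; the difference of the orders is k.\<close>

lemma poly_ratio_upper_near:
  fixes p q :: "complex poly"
  assumes p: "p \<noteq> 0" and q: "q \<noteq> 0" and k: "order w p = order w q + k"
  shows "\<exists>C>0. \<exists>\<delta>>0. \<forall>z. cmod z = 1 \<longrightarrow> 0 < cmod (z - w) \<longrightarrow> cmod (z - w) < \<delta> \<longrightarrow>
    poly p z \<noteq> 0 \<and> poly q z \<noteq> 0 \<and> cmod (poly p z) \<le> C * cmod (z - w) ^ k * cmod (poly q z)"
proof -
  obtain p1 where p1: "p = [:- w, 1:] ^ order w p * p1" "\<not> [:- w, 1:] dvd p1" using order_decomp[OF p] by blast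
  obtain q1 where q1: "q = [:- w, 1:] ^ order w q * q1" "\<not> [:- w, 1:] dvd q1" using order_decomp[OF q] by blast
  have w1: "poly p1 w \<noteq> 0" "poly q1 w \<noteq> 0" using p1 q1 by (auto simp: poly_eq_0_iff_dvd)
  have cp: "isCont (\<lambda>z. cmod (poly p1 z)) w" "isCont (\<lambda>z. cmod (poly q1 z)) w" by (intro continuous_intros)+
  have ev: "\<forall>\<^sub>F z in nhds w. cmod (poly p1 z) > 0 \<and> cmod (poly p1 z) < cmod (poly p1 w) + 1 \<and> cmod (poly q1 z) > cmod (poly q1 w) / 2"
  proof -
    note tp = tendsto_at_iff_tendsto_nhds[THEN iffD1, OF cp(1)[unfolded isCont_def]]
    note tq = tendsto_at_iff_tendsto_nhds[THEN iffD1, OF cp(2)[unfolded isCont_def]]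
    have "0 < cmod (poly p1 w)" "cmod (poly p1 w) < cmod (poly p1 w) + 1" "cmod (poly q1 w) / 2 < cmod (poly q1 w)"
      using w1 by auto
    then show ?thesis
      using order_tendstoD(1)[OF tp, of 0] order_tendstoD(2)[OF tp, of "cmod (poly p1 w) + 1"] order_tendstoD(1)[OF tq, of "cmod (poly q1 w) / 2"]
      by (intro eventually_conj) auto
  qed
  then obtain \<delta> where \<delta>: "\<delta> > 0" and near: "\<And>z. dist z w < \<delta> \<Longrightarrow> cmod (poly p1 z) > 0 \<and> cmod (poly p1 z) < cmod (poly p1 w) + 1 \<and> cmod (poly q1 z) > cmod (poly q1 w) / 2"
    unfolding eventually_nhds_metric by blast
  define C where "C = (cmod (poly p1 w) + 1) / (cmod (poly q1 w) / 2)"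
  have C: "C > 0" unfolding C_def using w1 by (intro divide_pos_pos add_nonneg_pos) auto
  have "poly p z \<noteq> 0 \<and> poly q z \<noteq> 0 \<and> cmod (poly p z) \<le> C * cmod (z - w) ^ k * cmod (poly q z)"
    if z: "0 < cmod (z - w)" "cmod (z - w) < \<delta>" for z
  proof -
    have N: "cmod (poly p1 z) > 0" "cmod (poly p1 z) < cmod (poly p1 w) + 1" "cmod (poly q1 z) > cmod (poly q1 w) / 2"
      using near[of z] z by (auto simp: dist_norm)
    have q1z: "cmod (poly q1 z) > 0" 
    proof -
      have "0 < cmod (poly q1 w) / 2" using w1 by simp
      then show ?thesis using N(3) by linarith
    qed
    have pz: "cmod (poly p z) = cmod (z - w) ^ order w p * cmod (poly p1 z)"
      by (subst p1(1)) (simp add: norm_mult norm_power)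
    have qz: "cmod (poly q z) = cmod (z - w) ^ order w q * cmod (poly q1 z)"
      by (subst q1(1)) (simp add: norm_mult norm_power)
    have "cmod (poly p1 z) \<le> C * (cmod (poly q1 w) / 2)" using N(2) w1 by (simp add: C_def)
    also have "\<dots> \<le> C * cmod (poly q1 z)" using N(3) C by (intro mult_left_mono) auto
    finally have "cmod (z - w) ^ order w p * cmod (poly p1 z) \<le> cmod (z - w) ^ order w p * (C * cmod (poly q1 z))"
      by (intro mult_left_mono) auto
    also have "\<dots> = C * cmod (z - w) ^ k * cmod (poly q z)" unfolding qz k by (simp add: power_add mult_ac)
    finally have "cmod (poly p z) \<le> C * cmod (z - w) ^ k * cmod (poly q z)" unfolding pz .
    moreover have "cmod (poly p z) > 0" "cmod (poly q z) > 0" unfolding pz qz using z N q1z by auto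
    ultimately show ?thesis by auto
  qed
  then show ?thesis using C \<delta> by blast
qed

text \<open>Every point of W except the nearest is at distance at least s, half the minimal
  separation, so dropping its factor costs only a constant.\<close>

lemma nearest_point_prod:
  fixes W :: "complex set"
  assumes fin: "finite W" and ne: "W \<noteq> {}"
  shows "\<exists>c>0. \<forall>z. \<exists>w\<in>W. c * cmod (z - w) ^ k \<le> (\<Prod>w\<in>W. cmod (z - w)) ^ k"
proof -
  \<comment> \<open>The entry 1 keeps the set nonempty when W is a single point and gives s \<le> 1,
    so that \<open>s ^ card W\<close> bounds the power with one factor less.\<close>
  define D where "D = insert 1 ((\<lambda>(u, v). cmod (u - v) / 2) ` {(u, v) \<in> W \<times> W. u \<noteq> v})"
  have D: "finite D" "D \<noteq> {}" unfolding D_def using finite_subset[of "{(u, v) \<in> W \<times> W. u \<noteq> v}" "W \<times> W"] fin by auto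
  define s where "s = Min D"
  have s: "0 < s" "s \<le> 1" unfolding s_def using D by (auto simp: D_def Min_le)
  have sep: "2 * s \<le> cmod (u - v)" if "u \<in> W" "v \<in> W" "u \<noteq> v" for u v
  proof -
    have "cmod (u - v) / 2 \<in> D" unfolding D_def using that by (auto simp: image_iff intro!: bexI[of _ "(u, v)"])
    then have "s \<le> cmod (u - v) / 2" unfolding s_def using D by (intro Min_le)
    then show ?thesis by simp
  qed
  have "\<exists>w\<in>W. (s ^ card W) ^ k * cmod (z - w) ^ k \<le> (\<Prod>w\<in>W. cmod (z - w)) ^ k" for z
  proof -
    obtain w where w: "w \<in> W" "\<And>v. v \<in> W \<Longrightarrow> cmod (z - w) \<le> cmod (z - v)"
      using ex_is_arg_min_if_finite[OF fin ne, of "\<lambda>w. cmod (z - w)"] by (auto simp: is_arg_min_linorder)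
    have "s \<le> cmod (z - v)" if "v \<in> W - {w}" for v
    proof -
      have "2 * s \<le> cmod (w - v)" using sep w that by auto
      also have "\<dots> \<le> cmod (z - w) + cmod (z - v)" using norm_triangle_ineq4[of "z - v" "z - w"] by simp
      also have "\<dots> \<le> 2 * cmod (z - v)" using w that by auto
      finally show ?thesis by simp
    qed
    then have "(\<Prod>v\<in>W - {w}. s) \<le> (\<Prod>v\<in>W - {w}. cmod (z - v))" using s by (intro prod_mono) auto
    moreover have "s ^ card W \<le> s ^ card (W - {w})" using s fin w by (intro power_decreasing card_mono) auto
    ultimately have "s ^ card W \<le> (\<Prod>v\<in>W - {w}. cmod (z - v))" by simp
    from mult_right_mono[OF this, of "cmod (z - w)"]
    have "s ^ card W * cmod (z - w) \<le> (\<Prod>v\<in>W. cmod (z - v))"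
      unfolding prod.remove[OF fin w(1)] by (simp add: mult.commute)
    then have "(s ^ card W * cmod (z - w)) ^ k \<le> (\<Prod>v\<in>W. cmod (z - v)) ^ k" using s by (intro power_mono) auto
    then show ?thesis using w(1) by (auto simp: power_mult_distrib)
  qed
  then show ?thesis using s by (intro exI[of _ "(s ^ card W) ^ k"]) auto
qed

text \<open>Off the zeros of the lowest nonzero coefficient p, the modulus of q / p is the sum of 1
  / x over the positive eigenvalues and lies between 1 / x_min and d / x_min. So orders of zeros of
  two polynomials control the smallest positive eigenvalue, and no eigenvalue has to be followed
  continuously.\<close>

lemma eigenvalue_family_dichotomy:
  fixes ev :: "complex \<Rightarrow> real list" and PP :: "complex poly poly"
  assumes len: "\<And>z. cmod z = 1 \<Longrightarrow> length (ev z) = d"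
    and nonneg: "\<And>z x. cmod z = 1 \<Longrightarrow> x \<in> set (ev z) \<Longrightarrow> 0 \<le> x"
    and PP: "\<And>z. cmod z = 1 \<Longrightarrow> map_poly (\<lambda>p. poly p z) PP = (\<Prod>x\<leftarrow>ev z. [:- (z ^ N * complex_of_real x), 1:])"
  obtains (gap) c where "c > 0" "\<And>z x. cmod z = 1 \<Longrightarrow> x \<in> set (ev z) \<Longrightarrow> 0 < x \<Longrightarrow> c \<le> x"
  | (zeros) W w0 k c C \<delta> where "finite W" "W \<subseteq> sphere 0 1" "w0 \<in> W" "1 \<le> k" "c > 0" "C > 0" "\<delta> > 0"
    "\<And>z x. cmod z = 1 \<Longrightarrow> z \<notin> W \<Longrightarrow> x \<in> set (ev z) \<Longrightarrow> 0 < x \<Longrightarrow> \<exists>w\<in>W. c * cmod (z - w) ^ k \<le> x"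
    "\<And>z x. z \<in> W \<Longrightarrow> x \<in> set (ev z) \<Longrightarrow> 0 < x \<Longrightarrow> c \<le> x"
    "\<And>z. cmod z = 1 \<Longrightarrow> 0 < cmod (z - w0) \<Longrightarrow> cmod (z - w0) < \<delta> \<Longrightarrow> \<exists>x\<in>set (ev z). 0 < x \<and> x \<le> C * cmod (z - w0) ^ k"
proof -
  define cs where "cs z = map (\<lambda>x. z ^ N * complex_of_real x) (ev z)" for z
  define ps where "ps z = filter (\<lambda>x. 0 < x) (ev z)" for z
  have cf: "poly (coeff PP j) z = coeff (\<Prod>c\<leftarrow>cs z. [:- c, 1:]) j" if "cmod z = 1" for z j
  proof -
    have "poly (coeff PP j) z = coeff (map_poly (\<lambda>p. poly p z) PP) j" by (simp add: coeff_map_poly)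
    then show ?thesis unfolding PP[OF that] cs_def by (simp add: comp_def)
  qed
  have filt: "filter (\<lambda>c. c \<noteq> 0) (cs z) = map (\<lambda>x. z ^ N * complex_of_real x) (ps z)" if z: "cmod z = 1" for z
  proof -
    have "z \<noteq> 0" using z by auto
    have "filter ((\<lambda>c. c \<noteq> 0) \<circ> (\<lambda>x. z ^ N * complex_of_real x)) (ev z) = filter (\<lambda>x. 0 < x) (ev z)"
    proof (rule filter_cong[OF refl])
      fix x assume "x \<in> set (ev z)"
      then have "0 \<le> x" by (rule nonneg[OF z])
      then show "((\<lambda>c. c \<noteq> 0) \<circ> (\<lambda>x. z ^ N * complex_of_real x)) x \<longleftrightarrow> 0 < x" using \<open>z \<noteq> 0\<close> by auto
    qed
    then show ?thesis unfolding cs_def ps_def filter_map by (rule arg_cong)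
  qed
  have "PP \<noteq> 0"
  proof
    assume "PP = 0"
    then have "(\<Prod>x\<leftarrow>ev 1. [:- (1 ^ N * complex_of_real x), 1:]) = 0" using PP[of 1] by simp
    then show False by (auto simp: prod_list_zero_iff)
  qed
  then have "\<exists>l. coeff PP l \<noteq> 0" by (metis leading_coeff_0_iff)
  \<comment> \<open>The generic multiplicity of the eigenvalue 0.\<close>
  define l where "l = (LEAST l. coeff PP l \<noteq> 0)"
  define p q where "p = coeff PP l" and "q = coeff PP (Suc l)"
  have p: "p \<noteq> 0" unfolding p_def l_def by (rule LeastI_ex) fact
  have below: "coeff PP j = 0" if "j < l" for j using not_less_Least[of j] that unfolding l_def by blast
  \<comment> \<open>Where p does not vanish the multiplicity of 0 is exactly l, and the common
    factor z ^ N of the roots has modulus 1.\<close>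
  have ratio: "cmod (poly q z) = (\<Sum>x\<leftarrow>ps z. 1 / x) * cmod (poly p z)" if z: "cmod z = 1" and pz: "poly p z \<noteq> 0" for z
  proof -
    define R where "R = (\<Prod>c\<leftarrow>map (\<lambda>x. z ^ N * complex_of_real x) (ps z). [:- c, 1:])"
    define n0 where "n0 = count_list (cs z) 0"
    have co: "poly (coeff PP j) z = (if j < n0 then 0 else coeff R (j - n0))" for j
      unfolding cf[OF z] by (subst coeff_prod_list_linear_shift) (simp add: filt[OF z] R_def n0_def)
    have no0: "0 \<notin> set (map (\<lambda>x. z ^ N * complex_of_real x) (ps z))" using z by (auto simp: ps_def)
    have R0: "coeff R 0 \<noteq> 0" unfolding R_def by (rule coeff_prod_list_linear(1)[OF no0])
    have "n0 \<le> l" using pz co[of l] unfolding p_def by (simp split: if_splits)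
    moreover have "\<not> n0 < l" using co[of n0] below[of n0] R0 by auto
    ultimately have "n0 = l" by simp
    then have pq: "poly p z = coeff R 0" "poly q z = coeff R 1" unfolding p_def q_def co by auto
    have "(\<Sum>c\<leftarrow>map (\<lambda>x. a * complex_of_real x) xs. 1 / c) = (1 / a) * complex_of_real (\<Sum>x\<leftarrow>xs. 1 / x)" for a xs
      by (induction xs) (auto simp: algebra_simps)
    note sm = this[of "z ^ N" "ps z"]
    have "0 \<le> (\<Sum>x\<leftarrow>ps z. 1 / x)" by (intro sum_list_nonneg) (auto simp: ps_def)
    then show ?thesis
      unfolding pq coeff_prod_list_linear(2)[OF no0, folded R_def] sm by (simp add: norm_mult norm_divide norm_power z)
  qed
  have psz: "0 < x" "x \<in> set (ev z)" if "x \<in> set (ps z)" for x z using that by (auto simp: ps_def)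
  have low: "cmod (poly p z) \<le> x * cmod (poly q z)" if z: "cmod z = 1" and pz: "poly p z \<noteq> 0" and x: "x \<in> set (ev z)" "0 < x" for z x
  proof -
    have "1 / x \<le> (\<Sum>x\<leftarrow>ps z. 1 / x)"
    proof (rule member_le_sum_list)
      show "1 / x \<in> set (map (\<lambda>x. 1 / x) (ps z))" using x by (simp add: ps_def)
      show "0 \<le> y" if "y \<in> set (map (\<lambda>x. 1 / x) (ps z))" for y using that by (auto simp: ps_def)
    qed
    then have "1 / x * cmod (poly p z) \<le> cmod (poly q z)" unfolding ratio[OF z pz] by (intro mult_right_mono) auto
    then show ?thesis using x by (simp add: field_simps)
  qed
  have up: "\<exists>x\<in>set (ev z). 0 < x \<and> x * cmod (poly q z) \<le> real d * cmod (poly p z)"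
    if z: "cmod z = 1" and pz: "poly p z \<noteq> 0" and qz: "poly q z \<noteq> 0" for z
  proof -
    have ne: "ps z \<noteq> []" using ratio[OF z pz] qz by auto
    define x where "x = Min (set (ps z))"
    have x: "x \<in> set (ps z)" unfolding x_def using ne by (intro Min_in) auto
    have "(\<Sum>y\<leftarrow>ps z. 1 / y) \<le> (\<Sum>y\<leftarrow>ps z. 1 / x)"
    proof (rule sum_list_mono)
      fix y assume "y \<in> set (ps z)"
      then have "x \<le> y" unfolding x_def by (intro Min_le) auto
      then show "1 / y \<le> 1 / x" using psz(1)[OF x] by (intro divide_left_mono) auto
    qed
    also have "\<dots> = real (length (ps z)) / x" by (simp add: sum_list_triv)
    also have "\<dots> \<le> real d / x"
      using psz(1)[OF x] len[OF z] length_filter_le[of "\<lambda>x. 0 < x" "ev z"] by (intro divide_right_mono) (auto simp: ps_def)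
    finally have "cmod (poly q z) \<le> real d / x * cmod (poly p z)" unfolding ratio[OF z pz] by (intro mult_right_mono) auto
    then have "x * cmod (poly q z) \<le> real d * cmod (poly p z)" using psz(1)[OF x] by (simp add: field_simps)
    then show ?thesis using psz[OF x] by blast
  qed
  \<comment> \<open>At these points the kernel is larger than generically. The finitely many
    eigenvalue lists over W have a positive lower bound of their own, \<open>c3\<close>.\<close>
  define W where "W = {z. cmod z = 1 \<and> poly p z = 0}"
  have finW: "finite W" unfolding W_def by (rule finite_subset[OF _ poly_roots_finite[OF p]]) auto
  define D where "D = insert 1 {x. \<exists>z\<in>W. x \<in> set (ev z) \<and> 0 < x}"
  have "{x. \<exists>z\<in>W. x \<in> set (ev z) \<and> 0 < x} \<subseteq> (\<Union>z\<in>W. set (ev z))" by auto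
  then have D: "finite D" "D \<noteq> {}" unfolding D_def using finW by (auto intro: finite_subset)
  define c3 where "c3 = Min D"
  have c3: "c3 > 0" unfolding c3_def using D by (auto simp: D_def)
  have c3W: "c3 \<le> x" if "z \<in> W" "x \<in> set (ev z)" "0 < x" for z x
    unfolding c3_def by (rule Min_le[OF D(1)]) (use that in \<open>auto simp: D_def\<close>)
  \<comment> \<open>Truncated subtraction records only points where p vanishes to higher order than
    q; for q \<noteq> 0, k = 0 means that q / p stays bounded on the circle.\<close>
  define k where "k = Max (insert 0 ((\<lambda>w. order w p - order w q) ` W))"
  have kW: "order w p - order w q \<le> k" if "w \<in> W" for w unfolding k_def using finW that by (intro Max_ge) auto
  then have "order w p \<le> order w q + k" if "w \<in> W" for w using that by fastforce
  then obtain C1 where C1: "C1 > 0" "\<And>z. cmod z = 1 \<Longrightarrow> cmod (poly q z) * (\<Prod>w\<in>W. cmod (z - w)) ^ k \<le> C1 * cmod (poly p z)"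
    using poly_ratio_bound[OF p W_def, of q k] by blast
  have bound: "(\<Prod>w\<in>W. cmod (z - w)) ^ k \<le> C1 * x" if z: "cmod z = 1" "z \<notin> W" and x: "x \<in> set (ev z)" "0 < x" for z x
  proof -
    have pz: "poly p z \<noteq> 0" using z by (auto simp: W_def)
    have l: "cmod (poly p z) \<le> x * cmod (poly q z)" by (rule low[OF z(1) pz x])
    then have q0: "cmod (poly q z) > 0" using pz by auto
    have "cmod (poly q z) * (\<Prod>w\<in>W. cmod (z - w)) ^ k \<le> C1 * (x * cmod (poly q z))"
      using C1(2)[OF z(1)] mult_left_mono[OF l, of C1] C1(1) by linarith
    then have "cmod (poly q z) * (\<Prod>w\<in>W. cmod (z - w)) ^ k \<le> cmod (poly q z) * (C1 * x)" by (simp add: mult_ac)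
    then show ?thesis using q0 by (simp only: mult_le_cancel_left_pos)
  qed
  show ?thesis
  proof (cases "k = 0 \<or> q = 0")
    \<comment> \<open>If q = 0 there are no positive eigenvalues off W; if k = 0 the estimate
      \<open>bound\<close> reads 1 \<le> C1 x.\<close>
    case True
    note kq = this
    show ?thesis
    proof (rule gap[of "min c3 (1 / C1)"])
      show "0 < min c3 (1 / C1)" using c3 C1 by simp
      fix z x assume z: "cmod z = 1" and x: "x \<in> set (ev z)" "0 < x"
      show "min c3 (1 / C1) \<le> x"
      proof (cases "z \<in> W")
        case True
        then show ?thesis using c3W[OF True x] by simp
      next
        case False
        have "poly p z \<noteq> 0" using z False by (auto simp: W_def)
        then have "q \<noteq> 0" using low[OF z _ x] by auto
        then have "1 \<le> C1 * x" using bound[OF z False x] kq by simp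
        then show ?thesis using C1(1) by (simp add: min_le_iff_disj field_simps)
      qed
    qed
  next
    case False
    have "k \<in> insert 0 ((\<lambda>w. order w p - order w q) ` W)" unfolding k_def using finW by (intro Max_in) auto
    then obtain w0 where w0: "w0 \<in> W" "k = order w0 p - order w0 q" using False by auto
    have q: "q \<noteq> 0" using False by simp
    have k': "order w0 p = order w0 q + k" using w0 False by simp
    obtain C2 \<delta> where C2: "C2 > 0" "\<delta> > 0" and near: "\<And>z. cmod z = 1 \<Longrightarrow> 0 < cmod (z - w0) \<Longrightarrow> cmod (z - w0) < \<delta> \<Longrightarrow>
        poly p z \<noteq> 0 \<and> poly q z \<noteq> 0 \<and> cmod (poly p z) \<le> C2 * cmod (z - w0) ^ k * cmod (poly q z)"
      using poly_ratio_upper_near[OF p q k'] by blast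
    have neW: "W \<noteq> {}" using w0 by auto
    obtain c4 where c4: "c4 > 0" "\<And>z. \<exists>w\<in>W. c4 * cmod (z - w) ^ k \<le> (\<Prod>w\<in>W. cmod (z - w)) ^ k"
      using nearest_point_prod[OF finW neW, of k] by blast
    show ?thesis
    \<comment> \<open>The summand 1 keeps the upper constant positive for d = 0.\<close>
    proof (rule zeros[of W w0 k "min c3 (c4 / C1)" "C2 * real d + 1" \<delta>])
      show "W \<subseteq> sphere 0 1" by (auto simp: W_def)
      show "0 < min c3 (c4 / C1)" using c3 c4 C1 by simp
      show "0 < C2 * real d + 1" using C2 by (simp add: add_nonneg_pos)
      show "\<exists>w\<in>W. min c3 (c4 / C1) * cmod (z - w) ^ k \<le> x" if z: "cmod z = 1" "z \<notin> W" "x \<in> set (ev z)" "0 < x" for z x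
      proof -
        obtain w where w: "w \<in> W" "c4 * cmod (z - w) ^ k \<le> (\<Prod>w\<in>W. cmod (z - w)) ^ k" using c4(2) by blast
        have "min c3 (c4 / C1) * cmod (z - w) ^ k \<le> (c4 / C1) * cmod (z - w) ^ k" by (intro mult_right_mono) auto
        also have "\<dots> = (c4 * cmod (z - w) ^ k) / C1" by simp
        also have "\<dots> \<le> (C1 * x) / C1" using w(2) bound[OF z] C1(1) by (intro divide_right_mono) auto
        also have "\<dots> = x" using C1 by simp
        finally show ?thesis using w(1) by blast
      qed
      show "min c3 (c4 / C1) \<le> x" if "z \<in> W" "x \<in> set (ev z)" "0 < x" for z x using c3W[OF that] by simp
      show "\<exists>x\<in>set (ev z). 0 < x \<and> x \<le> (C2 * real d + 1) * cmod (z - w0) ^ k"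
        if z: "cmod z = 1" "0 < cmod (z - w0)" "cmod (z - w0) < \<delta>" for z
      proof -
        note nz = near[OF z]
        obtain x where x: "x \<in> set (ev z)" "0 < x" "x * cmod (poly q z) \<le> real d * cmod (poly p z)"
          using up[OF z(1)] nz by blast
        have "x * cmod (poly q z) \<le> real d * (C2 * cmod (z - w0) ^ k * cmod (poly q z))"
          using x(3) mult_left_mono[of "cmod (poly p z)" "C2 * cmod (z - w0) ^ k * cmod (poly q z)" "real d"] nz by linarith
        then have "cmod (poly q z) * x \<le> cmod (poly q z) * (C2 * real d * cmod (z - w0) ^ k)" by (simp add: mult_ac)
        moreover have "0 < cmod (poly q z)" using nz by simp
        ultimately have "x \<le> C2 * real d * cmod (z - w0) ^ k" by (simp only: mult_le_cancel_left_pos)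
        also have "\<dots> \<le> (C2 * real d + 1) * cmod (z - w0) ^ k" by (intro mult_right_mono) auto
        finally show ?thesis using x by blast
      qed
    qed (use finW w0 False C2 in auto)
  qed
qed


section \<open>Circle integrals and eigenvalues of the induced matrices\<close>

lemma continuous_cis_int: "continuous_on UNIV (\<lambda>\<theta>. cis (of_int k * \<theta>))"
  unfolding cis_conv_exp by (intro continuous_intros)

lemma integral_cis_int:
  "(\<integral>\<theta>. cis (of_int k * \<theta>) \<partial>restrict_space lborel {0..2 * pi}) = (if k = 0 then of_real (2 * pi) else 0)"
proof (cases "k = 0")
  case True
  then show ?thesis by (simp add: integral_restrict_space measure_restrict_space space_restrict_space scaleR_conv_of_real)
next
  case False
  define f :: "complex \<Rightarrow> complex" where "f z = exp (\<i> * of_int k * z) / (\<i> * of_int k)" for z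
  have der: "((\<lambda>\<theta>. f (of_real \<theta>)) has_vector_derivative cis (of_int k * \<theta>)) (at \<theta> within {0..2 * pi})" for \<theta>
  proof (rule has_vector_derivative_real_field)
    show "(f has_field_derivative cis (of_int k * \<theta>)) (at (of_real \<theta>))"
      unfolding f_def using False by (auto intro!: derivative_eq_intros simp: cis_conv_exp mult_ac)
  qed
  have "has_bochner_integral lborel (\<lambda>\<theta>. indicator {0..2 * pi} \<theta> *\<^sub>R cis (of_int k * \<theta>)) (f (of_real (2 * pi)) - f (of_real 0))"
    by (rule has_bochner_integral_FTC_Icc[OF _ der continuous_on_subset[OF continuous_cis_int]]) auto
  moreover have "f (of_real (2 * pi)) = f (of_real 0)"
  proof -
    have "exp (\<i> * of_int k * of_real (2 * pi)) = cis (2 * pi * of_int k)" by (simp add: cis_conv_exp mult_ac)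
    then show ?thesis unfolding f_def by (simp add: cis_multiple_2pi)
  qed
  ultimately have "(\<integral>\<theta>. indicator {0..2 * pi} \<theta> *\<^sub>R cis (of_int k * \<theta>) \<partial>lborel) = 0"
    by (simp add: has_bochner_integral_iff)
  then show ?thesis using False by (subst integral_restrict_space) auto
qed

definition power_sum :: "nat \<Rightarrow> real list \<Rightarrow> real" where "power_sum n xs = (\<Sum>x\<leftarrow>xs. x ^ n)"

lemma sum_list_poly: "(\<Sum>x\<leftarrow>xs. poly p x) = (\<Sum>i\<le>degree p. coeff p i * power_sum i xs)" for xs :: "real list"
  unfolding power_sum_def poly_altdef by (induction xs) (auto simp: sum.distrib algebra_simps)

text \<open>The Lagrange polynomial that is 1 at a and 0 at all other entries counts the occurrences
  of a when summed over a list, and such a sum depends on the power sums alone.\<close>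

lemma count_list_eq_of_power_sums:
  fixes xs ys :: "real list"
  assumes "\<And>n. power_sum n xs = power_sum n ys"
  shows "count_list xs a = count_list ys a"
proof -
  define S where "S = set xs \<union> set ys - {a}"
  define p where "p = (\<Prod>s\<in>S. [:- s / (a - s), 1 / (a - s):])"
  have fS: "finite S" by (simp add: S_def)
  have pv: "poly p x = (\<Prod>s\<in>S. (x - s) / (a - s))" for x
    unfolding p_def poly_prod by (intro prod.cong refl) (simp add: diff_divide_distrib)
  have pa: "poly p a = 1" unfolding pv by (rule prod.neutral) (auto simp: S_def)
  have p0: "poly p x = 0" if "x \<in> S" for x unfolding pv using fS that by (auto intro!: prod_zero)
  have cnt: "(\<Sum>x\<leftarrow>zs. poly p x) = real (count_list zs a)" if "set zs \<subseteq> set xs \<union> set ys" for zs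
    using that by (induction zs) (auto simp: pa p0 S_def)
  have "real (count_list xs a) = (\<Sum>x\<leftarrow>xs. poly p x)" using cnt[of xs] by simp
  also have "\<dots> = (\<Sum>x\<leftarrow>ys. poly p x)" unfolding sum_list_poly assms ..
  also have "\<dots> = real (count_list ys a)" using cnt[of ys] by simp
  finally show ?thesis by simp
qed

lemma count_list_concat_map: "count_list (concat (map f xs)) a = (\<Sum>x\<leftarrow>xs. count_list (f x) a)"
  by (induction xs) auto

lemma power_sum_concat_map: "power_sum n (concat (map f xs)) = (\<Sum>x\<leftarrow>xs. power_sum n (f x))"
  by (induction xs) (auto simp: power_sum_def)

lemma (in group) gr_eval_norm_le:
  assumes "\<And>g. a g \<noteq> 0 \<Longrightarrow> cmod (\<phi> g) \<le> B"
  shows "cmod (gr_eval a \<phi>) \<le> (\<Sum>g | a g \<noteq> 0. cmod (a g)) * B"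
  unfolding gr_eval_def sum_distrib_right
  by (rule sum_norm_le) (use assms in \<open>auto simp: norm_mult intro!: mult_left_mono\<close>)

definition root_of_unity :: "nat \<Rightarrow> nat \<Rightarrow> complex" where "root_of_unity n j = cis (2 * pi * real j / real n)"

locale equivariant_matrix = infinite_cyclic_transversal +
  fixes r s :: nat and A :: "nat \<Rightarrow> nat \<Rightarrow> 'a \<Rightarrow> complex"
  assumes A: "group_ring_mat G r s A"
begin

definition B where "B = gr_mat_times G s A (gr_mat_adjoint G A)"
definition ev :: "complex \<Rightarrow> real list" where "ev z = psd_eigs (rep_mat m r s (ind_rep z) A)"

lemma B: "group_ring_mat G r r B"
  unfolding B_def by (rule gr_mat_times_mat[OF A gr_adjoint_mat[OF A]])

lemma B_pow: "group_ring_mat G r r (gr_mat_pow r B n)" by (rule gr_mat_pow_mat[OF B])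

lemma ev_length: "length (ev z) = r * m" unfolding ev_def by (rule psd_eigs(1)[OF rep_mat_carrier])
lemma ev_nonneg: "y \<in> set (ev z) \<Longrightarrow> 0 \<le> y" unfolding ev_def by (rule psd_eigs(2)[OF rep_mat_carrier])

lemma ev_power_sum:
  assumes "cmod z = 1"
  shows "complex_of_real (power_sum n (ev z)) = (\<Sum>i<r. gr_eval (gr_mat_pow r B n i i) (ind_char z))"
  using rep_eigs_power_sum[OF ind_rep[OF assms] A, of n]
  unfolding ev_def power_sum_def B_def[symmetric] ind_char_def[symmetric, abs_def] by simp

lemma cmod_chi: "cmod z = 1 \<Longrightarrow> cmod (chi z u) \<le> 1"
  by (simp add: chi_def norm_power_int)

lemma cmod_ind_char: "cmod z = 1 \<Longrightarrow> cmod (ind_char z g) \<le> real m"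
  unfolding ind_char_def ind_rep_def
  by (rule order_trans[OF norm_sum]) (use sum_mono[of "{..<m}" "\<lambda>a. cmod (chi z (t a \<otimes> g \<otimes> inv (t a)))" "\<lambda>_. 1"] cmod_chi in auto)

lemma ev_bounded: obtains M where "M > 0" "\<And>z x. cmod z = 1 \<Longrightarrow> x \<in> set (ev z) \<Longrightarrow> x \<le> M"
proof -
  define M where "M = (\<Sum>i<r. (\<Sum>g | gr_mat_pow r B 1 i i g \<noteq> 0. cmod (gr_mat_pow r B 1 i i g)) * real m) + 1"
  have M: "M > 0" unfolding M_def by (intro add_nonneg_pos sum_nonneg mult_nonneg_nonneg) auto
  moreover have "x \<le> M" if z: "cmod z = 1" and x: "x \<in> set (ev z)" for z x
  proof -
    have "x \<le> power_sum 1 (ev z)" unfolding power_sum_def using x ev_nonneg by (intro member_le_sum_list) auto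
    also have "\<dots> \<le> cmod (complex_of_real (power_sum 1 (ev z)))" by simp
    also have "\<dots> \<le> (\<Sum>i<r. (\<Sum>g | gr_mat_pow r B 1 i i g \<noteq> 0. cmod (gr_mat_pow r B 1 i i g)) * real m)"
      unfolding ev_power_sum[OF z] by (rule sum_norm_le) (rule gr_eval_norm_le, rule cmod_ind_char[OF z])
    finally show ?thesis by (simp add: M_def)
  qed
  ultimately show ?thesis by (rule that)
qed

lemma chi_cis:
  "chi (cis \<theta>) u = (if u \<in> Z then cis (of_int (zexp u) * \<theta>) else 0)"
  by (simp add: chi_def cis_power_int)

lemma continuous_chi: "continuous_on UNIV (\<lambda>\<theta>. chi (cis \<theta>) u)"
  using continuous_cis_int[of "zexp u"] by (cases "u \<in> Z") (simp_all add: chi_cis)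

lemma integral_chi:
  assumes "u \<in> carrier G"
  shows "(\<integral>\<theta>. chi (cis \<theta>) u \<partial>restrict_space lborel {0..2 * pi}) = (if u = \<one> then of_real (2 * pi) else 0)"
proof (cases "u \<in> Z")
  case True
  then obtain k :: int where k: "u = x [^] k" by (auto simp: Z_def)
  have "u = \<one> \<longleftrightarrow> k = 0" using xpow_inj[of k 0] by (simp add: k)
  then show ?thesis using True integral_cis_int[of k] by (simp add: chi_cis k)
next
  case False
  then show ?thesis using Z_one by (auto simp: chi_cis)
qed

lemma integrable_circle:
  fixes f :: "real \<Rightarrow> complex"
  assumes "continuous_on UNIV f"
  shows "integrable (restrict_space lborel {0..2 * pi}) f"
proof -
  have "set_integrable lborel {0..2 * pi} f"
    unfolding set_integrable_def by (rule borel_integrable_compact[OF compact_Icc continuous_on_subset[OF assms subset_UNIV]])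
  then show ?thesis by (simp add: set_integrable_def integrable_restrict_space)
qed

text \<open>The order of the list \<open>ev z\<close> is an arbitrary choice, so continuity is
  claimed for symmetric functions of the eigenvalues; these are finite combinations of
  characters.\<close>

lemma continuous_power_sum: "continuous_on UNIV (\<lambda>\<theta>. complex_of_real (power_sum n (ev (cis \<theta>))))"
  unfolding ev_power_sum[OF norm_cis] gr_eval_def ind_char_def ind_rep_def
  by (intro continuous_intros continuous_chi)

text \<open>Integration over the circle kills every power of z but the zeroth, so induced characters
  average to m times the delta function at the neutral element: Fourier inversion on Z.\<close>

lemma integral_power_sum:
  "(\<integral>\<theta>. complex_of_real (power_sum n (ev (cis \<theta>))) \<partial>restrict_space lborel {0..2 * pi}) = of_real (2 * pi * real m) * (\<Sum>i<r. gr_mat_pow r B n i i \<one>)"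
proof -
  let ?\<Theta> = "restrict_space lborel {0..2 * pi}"
  have char: "(\<integral>\<theta>. ind_char (cis \<theta>) g \<partial>?\<Theta>) = (if g = \<one> then of_real (2 * pi * real m) else 0)" if g: "g \<in> carrier G" for g
  proof -
    have "(\<integral>\<theta>. ind_char (cis \<theta>) g \<partial>?\<Theta>) = (\<Sum>a<m. \<integral>\<theta>. chi (cis \<theta>) (t a \<otimes> g \<otimes> inv (t a)) \<partial>?\<Theta>)"
      unfolding ind_char_def ind_rep_def
      by (rule Bochner_Integration.integral_sum) (rule integrable_circle[OF continuous_chi])
    also have "\<dots> = (\<Sum>a<m. if g = \<one> then of_real (2 * pi) else 0)"
      using g by (intro sum.cong refl) (simp add: integral_chi conj_eq_one)
    finally show ?thesis by simp
  qed
  have cc: "continuous_on UNIV (\<lambda>\<theta>. ind_char (cis \<theta>) g)" for g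
    unfolding ind_char_def ind_rep_def by (intro continuous_intros continuous_chi)
  have "(\<integral>\<theta>. complex_of_real (power_sum n (ev (cis \<theta>))) \<partial>?\<Theta>)
    = (\<Sum>i<r. \<Sum>g | gr_mat_pow r B n i i g \<noteq> 0. gr_mat_pow r B n i i g * (\<integral>\<theta>. ind_char (cis \<theta>) g \<partial>?\<Theta>))"
    unfolding ev_power_sum[OF norm_cis] gr_eval_def
    by (subst Bochner_Integration.integral_sum; (intro integrable_circle continuous_intros cc)?)
       (intro sum.cong refl; subst Bochner_Integration.integral_sum; (intro integrable_circle continuous_intros cc)?; simp)
  also have "\<dots> = (\<Sum>i<r. gr_eval (gr_mat_pow r B n i i) (\<lambda>g. if g = \<one> then of_real (2 * pi * real m) else 0))"
    unfolding gr_eval_def using gr_elemD(2)[OF gr_mat_elem[OF B_pow]] by (intro sum.cong refl) (auto simp: char)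
  also have "\<dots> = (\<Sum>i<r. of_real (2 * pi * real m) * gr_mat_pow r B n i i \<one>)"
  proof (intro sum.cong refl)
    fix i assume "i \<in> {..<r}"
    then have fin: "finite {g. gr_mat_pow r B n i i g \<noteq> 0}" using gr_elemD(1)[OF gr_mat_elem[OF B_pow]] by auto
    have "gr_eval (gr_mat_pow r B n i i) (\<lambda>g. if g = \<one> then of_real (2 * pi * real m) else 0)
       = (\<Sum>g\<in>insert \<one> {g. gr_mat_pow r B n i i g \<noteq> 0}. gr_mat_pow r B n i i g * (if g = \<one> then of_real (2 * pi * real m) else 0))"
      by (rule gr_eval_superset) (use fin in auto)
    also have "\<dots> = of_real (2 * pi * real m) * gr_mat_pow r B n i i \<one>"
      using fin by (simp add: if_distrib[where f="\<lambda>x. _ * x"] sum.delta cong: if_cong)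
    finally show "gr_eval (gr_mat_pow r B n i i) (\<lambda>g. if g = \<one> then of_real (2 * pi * real m) else 0) = of_real (2 * pi * real m) * gr_mat_pow r B n i i \<one>" .
  qed
  finally show ?thesis by (simp add: sum_distrib_left)
qed


text \<open>Equal characters give equal power sums, and these determine the multiplicities.\<close>

lemma quotient_eigs:
  assumes n: "n > 0" and norm: "K n \<lhd> G"
  obtains D where "D \<in> carrier_mat (r * (n * m)) (s * (n * m))" "regular_mat (G Mod K n) r s (quotient_mat A) = D"
    "\<And>a. count_list (psd_eigs D) a = (\<Sum>j<n. count_list (ev (root_of_unity n j)) a)"
proof -
  obtain \<pi> where \<pi>: "matrix_rep G (n * m) \<pi>"
    "regular_mat (G Mod K n) r s (quotient_mat A) = rep_mat (n * m) r s \<pi> A"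
    "\<And>g. g \<in> carrier G \<Longrightarrow> (\<Sum>a<n * m. \<pi> a a g) = (if g \<in> K n then of_nat (n * m) else 0)"
    by (rule regular_mat_rep[OF norm card_K_cosets(2)[OF n] A, unfolded card_K_cosets(1)[OF n]]) (rule that)
  define D where "D = rep_mat (n * m) r s \<pi> A"
  define ys where "ys = concat (map (\<lambda>j. ev (root_of_unity n j)) [0..<n])"
  have "power_sum k (psd_eigs D) = power_sum k ys" for k
  proof -
    have "complex_of_real (power_sum k (psd_eigs D)) = (\<Sum>i<r. gr_eval (gr_mat_pow r B k i i) (\<lambda>g. \<Sum>a<n * m. \<pi> a a g))"
      unfolding power_sum_def D_def B_def by (rule rep_eigs_power_sum[OF \<pi>(1) A])
    also have "\<dots> = (\<Sum>i<r. gr_eval (gr_mat_pow r B k i i) (\<lambda>g. \<Sum>j<n. ind_char (root_of_unity n j) g))"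
    proof (rule sum.cong[OF refl], rule gr_eval_cong)
      fix i g assume "i \<in> {..<r}" "gr_mat_pow r B k i i g \<noteq> 0"
      then have "g \<in> carrier G" using gr_elemD(2)[OF gr_mat_elem[OF B_pow]] by auto
      then show "(\<Sum>a<n * m. \<pi> a a g) = (\<Sum>j<n. ind_char (root_of_unity n j) g)"
        by (simp add: \<pi>(3) sum_ind_char_roots[OF n norm] root_of_unity_def)
    qed
    also have "\<dots> = (\<Sum>j<n. \<Sum>i<r. gr_eval (gr_mat_pow r B k i i) (ind_char (root_of_unity n j)))"
      unfolding gr_eval_sum_right by (rule sum.swap)
    also have "\<dots> = (\<Sum>j<n. complex_of_real (power_sum k (ev (root_of_unity n j))))"
      by (intro sum.cong refl ev_power_sum[symmetric]) (simp add: root_of_unity_def)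
    also have "\<dots> = complex_of_real (power_sum k ys)"
      unfolding ys_def power_sum_concat_map by (simp add: sum_list_distinct_conv_sum_set lessThan_atLeast0)
    finally show ?thesis by (simp only: of_real_eq_iff)
  qed
  then have "count_list (psd_eigs D) a = (\<Sum>j<n. count_list (ev (root_of_unity n j)) a)" for a
    using count_list_eq_of_power_sums[of "psd_eigs D" ys a]
    by (simp add: ys_def count_list_concat_map sum_list_distinct_conv_sum_set lessThan_atLeast0)
  then show ?thesis using that[of D] \<pi>(2) unfolding D_def by simp
qed

text \<open>The entries are Laurent polynomials in z with exponents of modulus at most N;
  multiplication by z ^ N makes them polynomials and scales the eigenvalues by z ^ N.\<close>

lemma char_poly_family:
  obtains N PP where "\<And>z. cmod z = 1 \<Longrightarrow> map_poly (\<lambda>p. poly p z) PP = (\<Prod>x\<leftarrow>ev z. [:- (z ^ N * complex_of_real x), 1:])"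
proof -
  define SS where "SS = (\<Union>i<r. \<Union>j<r. {g. B i j g \<noteq> 0})"
  have SSfin: "finite SS" unfolding SS_def using gr_elemD(1)[OF gr_mat_elem[OF B]] by auto
  define EE where "EE = (\<lambda>(a, b, g). nat \<bar>zexp (t a \<otimes> g \<otimes> inv (t b))\<bar>) ` ({..<m} \<times> {..<m} \<times> SS)"
  define N where "N = Max (insert 0 EE)"
  have fE: "finite EE" unfolding EE_def using SSfin by auto
  have N: "nat \<bar>zexp (t a \<otimes> g \<otimes> inv (t b))\<bar> \<le> N" if "a < m" "b < m" "g \<in> SS" for a b g
    unfolding N_def by (rule Max_ge) (use fE that in \<open>auto simp: EE_def image_iff intro!: bexI[of _ "(a, b, g)"]\<close>)
  define E where "E a b g = nat (int N + zexp (t a \<otimes> g \<otimes> inv (t b)))" for a b g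
  define Pm where "Pm = mat (r * m) (r * m) (\<lambda>(a, b). \<Sum>g | B (a div m) (b div m) g \<noteq> 0.
      if t (a mod m) \<otimes> g \<otimes> inv (t (b mod m)) \<in> Z then monom (B (a div m) (b div m) g) (E (a mod m) (b mod m) g) else 0)"
  have Pm: "Pm \<in> carrier_mat (r * m) (r * m)" by (simp add: Pm_def)
  define PP where "PP = char_poly Pm"
  have "map_poly (\<lambda>p. poly p z) PP = (\<Prod>x\<leftarrow>ev z. [:- (z ^ N * complex_of_real x), 1:])" if z: "cmod z = 1" for z
  proof -
    have z0: "z \<noteq> 0" using z by auto
    have h: "comm_ring_hom (\<lambda>p. poly p z)" by standard auto
    let ?D = "rep_mat m r s (ind_rep z) A"
    have DD: "?D * mat_adjoint ?D = rep_mat m r r (ind_rep z) B"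
      unfolding B_def rep_mat_times[OF ind_rep[OF z] A gr_adjoint_mat[OF A]] rep_mat_adjoint[OF ind_rep[OF z] A] ..
    have "map_mat (\<lambda>p. poly p z) Pm = z ^ N \<cdot>\<^sub>m (?D * mat_adjoint ?D)"
      unfolding DD
    proof (rule eq_matI)
      fix a b assume "a < dim_row (z ^ N \<cdot>\<^sub>m rep_mat m r r (ind_rep z) B)" "b < dim_col (z ^ N \<cdot>\<^sub>m rep_mat m r r (ind_rep z) B)"
      then have ab: "a < r * m" "b < r * m" by auto
      note bd = div_mod_bounds[OF ab(1)] div_mod_bounds[OF ab(2)]
      define i j a' b' where "i = a div m" and "j = b div m" and "a' = a mod m" and "b' = b mod m"
      have "map_mat (\<lambda>p. poly p z) Pm $$ (a, b) = (\<Sum>g | B i j g \<noteq> 0. if t a' \<otimes> g \<otimes> inv (t b') \<in> Z then B i j g * z ^ E a' b' g else 0)"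
        using ab by (simp add: Pm_def poly_sum poly_monom i_def j_def a'_def b'_def if_distrib[where f="\<lambda>p. poly p z"] cong: if_cong)
      also have "\<dots> = (\<Sum>g | B i j g \<noteq> 0. z ^ N * (B i j g * ind_rep z a' b' g))"
      proof (intro sum.cong refl)
        fix g assume "g \<in> {g. B i j g \<noteq> 0}"
        then have g: "g \<in> SS" using bd by (auto simp: SS_def i_def j_def)
        define e where "e = zexp (t a' \<otimes> g \<otimes> inv (t b'))"
        have "nat \<bar>e\<bar> \<le> N" unfolding e_def using N[OF _ _ g] bd by (simp add: a'_def b'_def)
        then have "int (E a' b' g) = int N + e" by (simp add: E_def e_def[symmetric])
        then have "z ^ E a' b' g = z ^ N * z powi e" using z0 by (metis power_int_add power_int_of_nat)
        then show "(if t a' \<otimes> g \<otimes> inv (t b') \<in> Z then B i j g * z ^ E a' b' g else 0) = z ^ N * (B i j g * ind_rep z a' b' g)"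
          by (simp add: ind_rep_def chi_def e_def)
      qed
      also have "\<dots> = (z ^ N \<cdot>\<^sub>m rep_mat m r r (ind_rep z) B) $$ (a, b)"
        using ab by (simp add: rep_mat_def gr_eval_def sum_distrib_left i_def j_def a'_def b'_def)
      finally show "map_mat (\<lambda>p. poly p z) Pm $$ (a, b) = (z ^ N \<cdot>\<^sub>m rep_mat m r r (ind_rep z) B) $$ (a, b)" .
    qed (auto simp: Pm_def)
    then have "map_poly (\<lambda>p. poly p z) PP = char_poly (z ^ N \<cdot>\<^sub>m (?D * mat_adjoint ?D))"
      unfolding PP_def comm_ring_hom.char_poly_hom[OF h Pm, symmetric] by simp
    also have "\<dots> = (\<Prod>x\<leftarrow>ev z. [:- (z ^ N * complex_of_real x), 1:])"
      unfolding ev_def by (rule psd_eigs(4)[OF rep_mat_carrier])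
    finally show ?thesis .
  qed
  then show ?thesis by (rule that)
qed

end

section \<open>The spectral distribution function\<close>


lemma abs_sum_list_le:
  "(\<And>x. x \<in> set xs \<Longrightarrow> \<bar>f x\<bar> \<le> K) \<Longrightarrow> \<bar>\<Sum>x\<leftarrow>xs. f x :: real\<bar> \<le> real (length xs) * K"
  by (induction xs) (auto simp: algebra_simps intro!: order_trans[OF abs_triangle_ineq] add_mono)

lemma tendsto_sum_list:
  "(\<And>x. x \<in> set xs \<Longrightarrow> (\<lambda>k. f k x) \<longlonglongrightarrow> g x) \<Longrightarrow> (\<lambda>k. \<Sum>x\<leftarrow>xs. f k x :: real) \<longlonglongrightarrow> (\<Sum>x\<leftarrow>xs. g x)"
  by (induction xs) (auto intro!: tendsto_add)

lemma sum_list_indicator: "(\<Sum>x\<leftarrow>xs. indicator S x :: real) = real (length (filter (\<lambda>x. x \<in> S) xs))"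
  by (induction xs) auto

text \<open>The left ramp vanishes at 0 and the right one is 1 up to L, which produces the half-open
  interval that belongs to F(l) - F(0).\<close>

lemma indicator_greaterThanAtMost_limit:
  fixes t L :: real
  shows "(\<lambda>n. min 1 (real n * max 0 t) * max 0 (1 - real n * max 0 (t - L))) \<longlonglongrightarrow> indicator {0<..L} t"
proof -
  have big: "\<forall>\<^sub>F n in sequentially. 1 \<le> real n * u" if "u > 0" for u :: real
  proof -
    obtain N where N: "1 / u < real N" using reals_Archimedean2 by blast
    show ?thesis using eventually_ge_at_top[of N]
    proof eventually_elim
      case (elim n)
      have "1 < real N * u" using N that by (simp add: field_simps)
      also have "\<dots> \<le> real n * u" using elim that by (intro mult_right_mono) auto
      finally show ?case by simp
    qed
  qed
  consider "t \<le> 0" | "0 < t" "t \<le> L" | "0 < t" "L < t" by linarith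
  then show ?thesis
  proof cases
    case 1
    then show ?thesis by simp
  next
    case 2
    have "\<forall>\<^sub>F n in sequentially. min 1 (real n * max 0 t) * max 0 (1 - real n * max 0 (t - L)) = 1"
      using big[OF 2(1)] by eventually_elim (use 2 in \<open>auto simp: max_def\<close>)
    then show ?thesis using 2 by (simp add: tendsto_eventually)
  next
    case 3
    then have "t - L > 0" by simp
    have "\<forall>\<^sub>F n in sequentially. min 1 (real n * max 0 t) * max 0 (1 - real n * max 0 (t - L)) = 0"
      using big[OF \<open>t - L > 0\<close>] by eventually_elim (use 3 in \<open>auto simp: max_def\<close>)
    then show ?thesis using 3 by (simp add: tendsto_eventually)
  qed
qed

context group begin

lemma spectral_distribution_mu:
  assumes A: "group_ring_mat G r s A"
  obtains \<mu> :: "nat \<Rightarrow> real measure" and M where "M > 0"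
    "\<And>i. i < r \<Longrightarrow> finite_measure (\<mu> i)" "\<And>i. i < r \<Longrightarrow> sets (\<mu> i) = sets borel"
    "\<And>i. i < r \<Longrightarrow> AE t in \<mu> i. 0 \<le> t \<and> t \<le> M"
    "\<And>i n. i < r \<Longrightarrow> (\<integral>t. t ^ n \<partial>\<mu> i) = Re (gr_mat_pow r (gr_mat_times G s A (gr_mat_adjoint G A)) n i i \<one>)"
    "\<And>l. spectral_distribution G r s A l = (\<Sum>i<r. measure (\<mu> i) {0..l\<^sup>2})"
proof -
  let ?B = "gr_mat_times G s A (gr_mat_adjoint G A)" and ?I = "{..<r} \<times> carrier G"
  have B: "group_ring_mat G r r ?B" by (rule gr_mat_times_mat[OF A gr_adjoint_mat[OF A]])
  obtain M where op: "ell2_positive_op ?I (right_mult G r r ?B) M" using right_mult_positive_op[OF A] .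
  interpret op: ell2_positive_op ?I "right_mult G r r ?B" M by (rule op)
  define \<mu> where "\<mu> i = op.mu (unit_vec_at (i, \<one>))" for i
  have d: "unit_vec_at (i, \<one>) \<in> ell2 ?I" if "i < r" for i using that by (intro ell2_unit_vec_at) auto
  have mom: "(\<integral>t. t ^ n \<partial>\<mu> i) = Re (gr_mat_pow r ?B n i i \<one>)" if i: "i < r" for i n
  proof -
    have "(\<integral>t. t ^ n \<partial>\<mu> i) = Re (ell2_inner ?I ((right_mult G r r ?B ^^ n) (unit_vec_at (i, \<one>))) (unit_vec_at (i, \<one>)))"
      unfolding \<mu>_def by (rule op.mu(4)[OF d[OF i]])
    also have "\<dots> = Re ((right_mult G r r ?B ^^ n) (unit_vec_at (i, \<one>)) (i, \<one>))"
      using i by (subst ell2_inner_unit_vec_at) auto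
    finally show ?thesis using right_mult_pow_unit[OF B i i one_closed] by simp
  qed
  have F: "spectral_distribution G r s A l = (\<Sum>i<r. measure (\<mu> i) {0..l\<^sup>2})" for l
  proof -
    have "spectral_distribution G r s A l = (\<Sum>i<r. Re (ell2_inner ?I (spectral_projection ?I (right_mult G r r ?B) {0..l\<^sup>2} (unit_vec_at (i, \<one>))) (unit_vec_at (i, \<one>))))"
      unfolding spectral_distribution_def vn_trace_def Let_def unit_vec_at_def by (simp add: Re_sum)
    also have "\<dots> = (\<Sum>i<r. measure (\<mu> i) {0..l\<^sup>2})"
      unfolding \<mu>_def using op.inner_spectral_projection[OF d, of _ "l\<^sup>2"] by (intro sum.cong refl) simp
    finally show ?thesis .
  qed
  show ?thesis
  proof (rule that[of M \<mu>])
    fix i assume "i < r"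
    note i = d[OF this]
    show "finite_measure (\<mu> i)" "sets (\<mu> i) = sets borel" "AE t in \<mu> i. 0 \<le> t \<and> t \<le> M"
      unfolding \<mu>_def by (rule op.mu(1)[OF i], rule op.mu(2)[OF i], rule op.mu(3)[OF i])
  qed (use op.M_pos mom F in auto)
qed

text \<open>Finite measures on a bounded interval with proportional moments are proportional. The
  parameter space is abstract so that the circle and, for finite groups, a single point are both
  covered.\<close>

lemma spectral_distribution_diff:
  fixes ev :: "'x \<Rightarrow> real list"
  assumes A: "group_ring_mat G r s A" and \<Theta>: "finite_measure \<Theta>"
    and ev: "\<And>\<theta> x. x \<in> set (ev \<theta>) \<Longrightarrow> 0 \<le> x" "\<And>\<theta> x. x \<in> set (ev \<theta>) \<Longrightarrow> x \<le> M'" "\<And>\<theta>. length (ev \<theta>) = d"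
    and meas: "\<And>n. (\<lambda>\<theta>. power_sum n (ev \<theta>)) \<in> borel_measurable \<Theta>"
    and mom: "\<And>n. (\<integral>\<theta>. power_sum n (ev \<theta>) \<partial>\<Theta>) = c * Re (\<Sum>i<r. gr_mat_pow r (gr_mat_times G s A (gr_mat_adjoint G A)) n i i \<one>)"
  shows "integrable \<Theta> (\<lambda>\<theta>. real (length (filter (\<lambda>x. 0 < x \<and> x \<le> l\<^sup>2) (ev \<theta>))))"
    and "(\<integral>\<theta>. real (length (filter (\<lambda>x. 0 < x \<and> x \<le> l\<^sup>2) (ev \<theta>))) \<partial>\<Theta>)
       = c * (spectral_distribution G r s A l - spectral_distribution G r s A 0)"
proof -
  interpret \<Theta>: finite_measure \<Theta> by (rule \<Theta>)
  obtain \<mu> :: "nat \<Rightarrow> real measure" and M1 where M1: "M1 > 0"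
    and \<mu>: "\<And>i. i < r \<Longrightarrow> finite_measure (\<mu> i)" "\<And>i. i < r \<Longrightarrow> sets (\<mu> i) = sets borel"
    "\<And>i. i < r \<Longrightarrow> AE t in \<mu> i. 0 \<le> t \<and> t \<le> M1"
    "\<And>i n. i < r \<Longrightarrow> (\<integral>t. t ^ n \<partial>\<mu> i) = Re (gr_mat_pow r (gr_mat_times G s A (gr_mat_adjoint G A)) n i i \<one>)"
    and F: "\<And>l. spectral_distribution G r s A l = (\<Sum>i<r. measure (\<mu> i) {0..l\<^sup>2})"
    by (rule spectral_distribution_mu[OF A]) (rule that)
  define M where "M = max M1 M'"
  have evM: "0 \<le> x \<and> x \<le> M" if "x \<in> set (ev \<theta>)" for x \<theta> using ev(1,2)[OF that] by (auto simp: M_def)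
  have \<mu>M: "AE t in \<mu> i. 0 \<le> t \<and> t \<le> M" if "i < r" for i using \<mu>(3)[OF that] by eventually_elim (auto simp: M_def)
  have \<mu>meas: "f \<in> borel_measurable (\<mu> i)" if "i < r" "f \<in> borel_measurable borel" for f :: "real \<Rightarrow> real" and i
    by (subst measurable_cong_sets[OF \<mu>(2)[OF that(1)] refl]) (rule that(2))
  have int\<mu>: "integrable (\<mu> i) f" if i: "i < r" and f: "f \<in> borel_measurable borel" "\<And>t. 0 \<le> t \<Longrightarrow> t \<le> M \<Longrightarrow> \<bar>f t\<bar> \<le> K" for f :: "real \<Rightarrow> real" and i K
  proof (rule finite_measure.integrable_const_bound[OF \<mu>(1)[OF i]])
    show "AE t in \<mu> i. norm (f t) \<le> K" using \<mu>M[OF i] by eventually_elim (use f(2) in auto)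
  qed (rule \<mu>meas[OF i f(1)])
  define S where "S f \<theta> = (\<Sum>x\<leftarrow>ev \<theta>. f x)" for f :: "real \<Rightarrow> real" and \<theta>
  have Sb: "\<bar>S f \<theta>\<bar> \<le> real d * K" if "\<And>t. 0 \<le> t \<Longrightarrow> t \<le> M \<Longrightarrow> \<bar>f t\<bar> \<le> K" for f \<theta> K
    unfolding S_def ev(3)[of \<theta>, symmetric] by (rule abs_sum_list_le) (use evM that in blast)
  \<comment> \<open>The test functions for which the identity holds; \<open>step\<close> closes this
    class under bounded pointwise limits on [0, M]. Measurability of \<open>S f\<close> is part of
    it, since it is inherited through such limits from the power sums.\<close>
  define Lam where "Lam f \<longleftrightarrow> f \<in> borel_measurable borel \<and> S f \<in> borel_measurable \<Theta> \<and>
     (\<integral>\<theta>. S f \<theta> \<partial>\<Theta>) = c * (\<Sum>i<r. \<integral>t. f t \<partial>\<mu> i)" for f :: "real \<Rightarrow> real"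
  have step: "Lam f" if L: "\<And>k. Lam (g k)" and f: "f \<in> borel_measurable borel"
    and conv: "\<And>t. 0 \<le> t \<Longrightarrow> t \<le> M \<Longrightarrow> (\<lambda>k. g k t) \<longlonglongrightarrow> f t"
    and K: "\<And>k t. 0 \<le> t \<Longrightarrow> t \<le> M \<Longrightarrow> \<bar>g k t\<bar> \<le> K" for f :: "real \<Rightarrow> real" and g :: "nat \<Rightarrow> real \<Rightarrow> real" and K
  proof -
    have Sc: "(\<lambda>k. S (g k) \<theta>) \<longlonglongrightarrow> S f \<theta>" for \<theta>
      unfolding S_def by (rule tendsto_sum_list) (use evM conv in blast)
    have Sm: "S f \<in> borel_measurable \<Theta>"
      by (rule borel_measurable_LIMSEQ_real[OF Sc]) (use L Lam_def in auto)
    have "(\<lambda>k. \<integral>\<theta>. S (g k) \<theta> \<partial>\<Theta>) \<longlonglongrightarrow> (\<integral>\<theta>. S f \<theta> \<partial>\<Theta>)"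
      by (rule integral_dominated_convergence[where w="\<lambda>_. real d * K"])
         (use Sm Sc Sb[OF K] L Lam_def in auto)
    moreover have "(\<lambda>k. c * (\<Sum>i<r. \<integral>t. g k t \<partial>\<mu> i)) \<longlonglongrightarrow> c * (\<Sum>i<r. \<integral>t. f t \<partial>\<mu> i)"
    proof (intro tendsto_mult tendsto_const tendsto_sum)
      fix i assume "i \<in> {..<r}"
      then have i: "i < r" by simp
      interpret finite_measure "\<mu> i" by (rule \<mu>(1)[OF i])
      show "(\<lambda>k. \<integral>t. g k t \<partial>\<mu> i) \<longlonglongrightarrow> (\<integral>t. f t \<partial>\<mu> i)"
      proof (rule integral_dominated_convergence[where w="\<lambda>_. K"])
        show "f \<in> borel_measurable (\<mu> i)" by (rule \<mu>meas[OF i f])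
        show "g k \<in> borel_measurable (\<mu> i)" for k by (rule \<mu>meas[OF i]) (use L Lam_def in auto)
        show "AE t in \<mu> i. (\<lambda>k. g k t) \<longlonglongrightarrow> f t" using \<mu>M[OF i] by eventually_elim (use conv in auto)
        show "AE t in \<mu> i. norm (g k t) \<le> K" for k using \<mu>M[OF i] by eventually_elim (use K in auto)
      qed simp
    qed
    moreover have "(\<integral>\<theta>. S (g k) \<theta> \<partial>\<Theta>) = c * (\<Sum>i<r. \<integral>t. g k t \<partial>\<mu> i)" for k using L[of k] unfolding Lam_def by blast
    ultimately have "(\<integral>\<theta>. S f \<theta> \<partial>\<Theta>) = c * (\<Sum>i<r. \<integral>t. f t \<partial>\<mu> i)" using LIMSEQ_unique by simp
    then show ?thesis unfolding Lam_def using f Sm by blast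
  qed
  have bdd: "\<exists>K. \<forall>t. 0 \<le> t \<longrightarrow> t \<le> M \<longrightarrow> \<bar>f t\<bar> \<le> K" if "continuous_on UNIV f" for f :: "real \<Rightarrow> real"
  proof -
    have "bounded (f ` {0..M})" by (intro compact_imp_bounded compact_continuous_image continuous_on_subset[OF that]) auto
    then show ?thesis unfolding bounded_iff by force
  qed
  have poly: "Lam (\<lambda>t. \<Sum>j\<le>n. a j * t ^ j)" for a n
  proof -
    have pm: "S (\<lambda>t. \<Sum>j\<le>n. a j * t ^ j) = (\<lambda>\<theta>. \<Sum>j\<le>n. a j * power_sum j (ev \<theta>))"
    proof
      fix \<theta>
      have "(\<Sum>x\<leftarrow>xs. \<Sum>j\<le>n. a j * x ^ j) = (\<Sum>j\<le>n. a j * power_sum j xs)" for xs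
        unfolding power_sum_def by (induction xs) (auto simp: sum.distrib algebra_simps)
      then show "S (\<lambda>t. \<Sum>j\<le>n. a j * t ^ j) \<theta> = (\<Sum>j\<le>n. a j * power_sum j (ev \<theta>))" by (simp add: S_def)
    qed
    have ip: "integrable \<Theta> (\<lambda>\<theta>. power_sum j (ev \<theta>))" for j
    proof -
      obtain K where K: "\<forall>t. 0 \<le> t \<longrightarrow> t \<le> M \<longrightarrow> \<bar>t ^ j\<bar> \<le> K" using bdd[of "\<lambda>t. t ^ j", OF continuous_on_power[OF continuous_on_id]] by blast
      have "\<bar>power_sum j (ev \<theta>)\<bar> \<le> real d * K" for \<theta>
        using Sb[of "\<lambda>t. t ^ j" K \<theta>] K by (simp add: S_def power_sum_def)
      then show ?thesis by (intro \<Theta>.integrable_const_bound[where B="real d * K"] meas) auto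
    qed
    have im: "integrable (\<mu> i) (\<lambda>t. t ^ j)" if "i < r" for i j
    proof -
      obtain K where K: "\<forall>t. 0 \<le> t \<longrightarrow> t \<le> M \<longrightarrow> \<bar>t ^ j\<bar> \<le> K" using bdd[of "\<lambda>t. t ^ j", OF continuous_on_power[OF continuous_on_id]] by blast
      show ?thesis by (rule int\<mu>[OF that, of _ K]) (use K in auto)
    qed
    have "(\<integral>\<theta>. S (\<lambda>t. \<Sum>j\<le>n. a j * t ^ j) \<theta> \<partial>\<Theta>) = (\<Sum>j\<le>n. a j * (\<integral>\<theta>. power_sum j (ev \<theta>) \<partial>\<Theta>))"
      unfolding pm by (subst Bochner_Integration.integral_sum) (auto intro!: ip)
    also have "\<dots> = (\<Sum>j\<le>n. a j * (c * (\<Sum>i<r. \<integral>t. t ^ j \<partial>\<mu> i)))"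
      unfolding mom Re_sum by (intro sum.cong refl) (simp add: \<mu>(4))
    also have "\<dots> = c * (\<Sum>i<r. \<Sum>j\<le>n. a j * (\<integral>t. t ^ j \<partial>\<mu> i))"
      unfolding sum_distrib_left by (subst sum.swap) (simp add: mult_ac)
    also have "(\<Sum>i<r. \<Sum>j\<le>n. a j * (\<integral>t. t ^ j \<partial>\<mu> i)) = (\<Sum>i<r. \<integral>t. (\<Sum>j\<le>n. a j * t ^ j) \<partial>\<mu> i)"
      by (intro sum.cong refl) (subst Bochner_Integration.integral_sum, auto intro!: im)
    finally show ?thesis unfolding Lam_def pm
      by (auto intro!: borel_measurable_sum borel_measurable_times meas)
  qed
  have cont: "Lam f" if f: "continuous_on UNIV f" for f
  proof -
    have "\<exists>p. real_polynomial_function p \<and> (\<forall>t\<in>{0..M}. \<bar>f t - p t\<bar> < 1 / real (Suc k))" for k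
    proof -
      obtain p where "real_polynomial_function p" "\<And>t. t \<in> {0..M} \<Longrightarrow> \<bar>f t - p t\<bar> < 1 / real (Suc k)"
        by (rule Stone_Weierstrass_real_polynomial_function[OF compact_Icc continuous_on_subset[OF f subset_UNIV], of "1 / real (Suc k)"]) auto
      then show ?thesis by blast
    qed
    then obtain p where p: "\<And>k. real_polynomial_function (p k)" "\<And>k t. t \<in> {0..M} \<Longrightarrow> \<bar>f t - p k t\<bar> < 1 / real (Suc k)" by metis
    obtain K where K: "\<And>t. 0 \<le> t \<Longrightarrow> t \<le> M \<Longrightarrow> \<bar>f t\<bar> \<le> K" using bdd[OF f] by blast
    show ?thesis
    proof (rule step[where g=p and K="K + 1"])
      show "Lam (p k)" for k using p(1)[of k] poly unfolding real_polynomial_function_iff_sum by auto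
      show "f \<in> borel_measurable borel" by (rule borel_measurable_continuous_onI[OF f])
      show "(\<lambda>k. p k t) \<longlonglongrightarrow> f t" if t: "0 \<le> t" "t \<le> M" for t
      proof (rule LIM_zero_cancel, rule Lim_null_comparison)
        show "\<forall>\<^sub>F k in sequentially. norm (p k t - f t) \<le> 1 / real (Suc k)"
          using p(2)[of t] t by (intro always_eventually allI) (auto simp: abs_minus_commute less_imp_le)
        show "(\<lambda>k. 1 / real (Suc k)) \<longlonglongrightarrow> 0" using LIMSEQ_inverse_real_of_nat by (simp add: inverse_eq_divide)
      qed
      show "\<bar>p k t\<bar> \<le> K + 1" if t: "0 \<le> t" "t \<le> M" for k t
      proof -
        have "\<bar>f t - p k t\<bar> < 1 / real (Suc k)" using p(2) t by auto
        moreover have "1 / real (Suc k) \<le> 1" by simp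
        ultimately show ?thesis using K[OF t] by linarith
      qed
    qed
  qed
  have L: "Lam (indicator {0<..l\<^sup>2})"
  proof (rule step[where g="\<lambda>n t. min 1 (real n * max 0 t) * max 0 (1 - real n * max 0 (t - l\<^sup>2))" and K=1])
    show "Lam (\<lambda>t. min 1 (real k * max 0 t) * max 0 (1 - real k * max 0 (t - l\<^sup>2)))" for k
      by (rule cont) (intro continuous_intros)
    show "\<bar>min 1 (real k * max 0 t) * max 0 (1 - real k * max 0 (t - l\<^sup>2))\<bar> \<le> 1" for k t
    proof -
      have "0 \<le> real k * max 0 t" "0 \<le> real k * max 0 (t - l\<^sup>2)" by (simp_all add: mult_nonneg_nonneg)
      then have "0 \<le> min 1 (real k * max 0 t)" "min 1 (real k * max 0 t) \<le> 1"
        "0 \<le> max 0 (1 - real k * max 0 (t - l\<^sup>2))" "max 0 (1 - real k * max 0 (t - l\<^sup>2)) \<le> 1" by simp_all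
      then show ?thesis by (metis abs_of_nonneg mult_le_one mult_nonneg_nonneg)
    qed
    show "(\<lambda>k. min 1 (real k * max 0 t) * max 0 (1 - real k * max 0 (t - l\<^sup>2))) \<longlonglongrightarrow> indicator {0<..l\<^sup>2} t" for t
      by (rule indicator_greaterThanAtMost_limit)
  qed auto
  have cnt: "S (indicator {0<..l\<^sup>2}) = (\<lambda>\<theta>. real (length (filter (\<lambda>x. 0 < x \<and> x \<le> l\<^sup>2) (ev \<theta>))))"
    unfolding S_def sum_list_indicator by simp
  have "\<bar>S (indicator {0<..l\<^sup>2}) \<theta>\<bar> \<le> real d * 1" for \<theta> by (rule Sb) (simp add: indicator_def)
  then have "integrable \<Theta> (S (indicator {0<..l\<^sup>2}))"
    using L by (intro \<Theta>.integrable_const_bound[where B="real d"]) (auto simp: Lam_def)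
  then show "integrable \<Theta> (\<lambda>\<theta>. real (length (filter (\<lambda>x. 0 < x \<and> x \<le> l\<^sup>2) (ev \<theta>))))" unfolding cnt .
  have "(\<integral>t. indicator {0<..l\<^sup>2} t \<partial>\<mu> i) = measure (\<mu> i) {0..l\<^sup>2} - measure (\<mu> i) {0..0\<^sup>2}" if i: "i < r" for i
  proof -
    interpret finite_measure "\<mu> i" by (rule \<mu>(1)[OF i])
    have sp: "space (\<mu> i) = UNIV" using sets_eq_imp_space_eq[OF \<mu>(2)[OF i]] by simp
    have "measure (\<mu> i) ({0..l\<^sup>2} - {0..0\<^sup>2}) = measure (\<mu> i) {0..l\<^sup>2} - measure (\<mu> i) {0..0\<^sup>2}"
      by (rule finite_measure_Diff) (use \<mu>(2)[OF i] in auto)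
    also have "{0..l\<^sup>2} - {0..0\<^sup>2} = {0<..l\<^sup>2}" by auto
    finally show ?thesis by (simp add: sp)
  qed
  then show "(\<integral>\<theta>. real (length (filter (\<lambda>x. 0 < x \<and> x \<le> l\<^sup>2) (ev \<theta>))) \<partial>\<Theta>)
       = c * (spectral_distribution G r s A l - spectral_distribution G r s A 0)"
    using L unfolding Lam_def cnt F by (simp add: sum_subtractf)
qed

end


section \<open>Arcs and distances on the circle\<close>

lemma cmod_cis_diff: "cmod (cis a - cis b) = 2 * \<bar>sin ((a - b) / 2)\<bar>"
proof -
  have "(cmod (cis a - cis b))\<^sup>2 = (cos a - cos b)\<^sup>2 + (sin a - sin b)\<^sup>2" by (simp add: cmod_power2)
  also have "\<dots> = 2 - 2 * (cos a * cos b + sin a * sin b)"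
    using sin_cos_squared_add[of a] sin_cos_squared_add[of b] by (simp add: power2_diff algebra_simps)
  also have "\<dots> = 2 - 2 * cos (a - b)" by (simp add: cos_diff)
  also have "cos (a - b) = 1 - 2 * (sin ((a - b) / 2))\<^sup>2" using cos_double_sin[of "(a - b) / 2"] by (simp only: mult_2 field_sum_of_halves)
  also have "2 - 2 * (1 - 2 * (sin ((a - b) / 2))\<^sup>2) = (2 * \<bar>sin ((a - b) / 2)\<bar>)\<^sup>2" by (simp add: power_mult_distrib)
  finally show ?thesis by (rule power2_eq_imp_eq) auto
qed

lemma cmod_cis_diff_le: "cmod (cis a - cis b) \<le> \<bar>a - b\<bar>"
  unfolding cmod_cis_diff using abs_sin_x_le_abs_x[of "(a - b) / 2"] by simp

text \<open>A crude form of sin v \<ge> 2 v / pi: sin u \<ge> u / 2 on [0, 1], where the derivative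
  cos u is at least 1 / 2, and then monotonicity up to pi / 2 together with pi < 4.\<close>

lemma sin_ge_quarter:
  assumes "0 \<le> v" "v \<le> pi / 2" shows "v / 4 \<le> sin v"
proof -
  have half: "u / 2 \<le> sin u" if u: "0 \<le> u" "u \<le> 1" for u :: real
  proof -
    have "(\<lambda>u. sin u - u / 2) 0 \<le> (\<lambda>u. sin u - u / 2) u"
    proof (rule DERIV_nonneg_imp_nondecreasing[OF u(1)], goal_cases)
      case (1 y)
      have "\<bar>sin (y / 2)\<bar> \<le> 1 / 2" using abs_sin_x_le_abs_x[of "y / 2"] 1 u by linarith
      then have "(sin (y / 2))\<^sup>2 \<le> (1 / 2)\<^sup>2" using abs_le_square_iff[of "sin (y / 2)" "1 / 2"] by simp
      then have "cos y \<ge> 1 / 2" using cos_double_sin[of "y / 2"] by (simp add: power2_eq_square del: cos_double_sin)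
      moreover have "((\<lambda>u. sin u - u / 2) has_real_derivative cos y - 1 / 2) (at y)" by (auto intro!: derivative_eq_intros)
      ultimately show ?case by (intro exI[of _ "cos y - 1 / 2"]) auto
    qed
    then show ?thesis by simp
  qed
  show ?thesis
  proof (cases "v \<le> 1")
    case True
    then show ?thesis using half[of v] assms by simp
  next
    case False
    have "v / 4 \<le> 1 / 2" using assms pi_less_4 by simp
    also have "\<dots> \<le> sin 1" using half[of 1] by simp
    also have "\<dots> \<le> sin v" using False assms by (intro sin_monotone_2pi_le) auto
    finally show ?thesis .
  qed
qed

lemma cmod_cis_diff_ge:
  assumes "\<bar>a - b\<bar> \<le> pi" shows "\<bar>a - b\<bar> / 4 \<le> cmod (cis a - cis b)"
proof -
  have "\<bar>a - b\<bar> / 2 / 4 \<le> sin (\<bar>a - b\<bar> / 2)" by (rule sin_ge_quarter) (use assms in auto)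
  also have "\<dots> \<le> \<bar>sin ((a - b) / 2)\<bar>"
  proof (cases "a \<ge> b")
    case False
    have "\<bar>a - b\<bar> / 2 = - ((a - b) / 2)" using False by (simp add: field_simps abs_if)
    then show ?thesis by (simp only: sin_minus)
  qed simp
  finally show ?thesis unfolding cmod_cis_diff by simp
qed

text \<open>Angles of nearby points may differ by a full turn in either direction, hence the three
  shifts e; the factor 4 comes from \<open>cmod_cis_diff_ge\<close>.\<close>

lemma cis_close_cases:
  assumes \<theta>: "0 \<le> \<theta>" "\<theta> \<le> 2 * pi" and \<phi>: "0 \<le> \<phi>" "\<phi> < 2 * pi" and le: "cmod (cis \<theta> - cis \<phi>) \<le> \<rho>"
  shows "\<exists>e\<in>{- 2 * pi, 0, 2 * pi}. \<bar>\<theta> - (\<phi> + e)\<bar> \<le> 4 * \<rho>"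
proof -
  have "\<exists>e\<in>{- 2 * pi, 0, 2 * pi}. \<bar>\<theta> - (\<phi> + e)\<bar> \<le> pi"
    using \<theta> \<phi> by (auto simp: abs_if)
  then obtain e where e: "e \<in> {- 2 * pi, 0, 2 * pi}" "\<bar>\<theta> - (\<phi> + e)\<bar> \<le> pi" by blast
  have "cis (\<phi> + e) = cis \<phi>" using e(1) by (auto simp: complex_eq_iff cos_diff sin_diff)
  then have "\<bar>\<theta> - (\<phi> + e)\<bar> / 4 \<le> \<rho>" using cmod_cis_diff_ge[OF e(2)] le by simp
  then show ?thesis using e(1) by (intro bexI[of _ e]) auto
qed

lemma circle_angle:
  assumes "cmod w = 1" obtains \<phi> where "0 \<le> \<phi>" "\<phi> < 2 * pi" "w = cis \<phi>"
  using Arg2pi[of w] assms that[of "Arg2pi w"] by (simp add: cis_conv_exp is_Arg_def)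

text \<open>24 is three shifts times the length 8 of an interval of radius 4 \<rho>, measured in
  units of \<rho>.\<close>

lemma measure_circle_near:
  assumes w: "cmod w = 1" and \<rho>: "0 \<le> \<rho>"
  shows "measure (restrict_space lborel {0..2 * pi}) {\<theta> \<in> {0..2 * pi}. cmod (cis \<theta> - w) \<le> \<rho>} \<le> 24 * \<rho>"
proof -
  obtain \<phi> where \<phi>: "0 \<le> \<phi>" "\<phi> < 2 * pi" "w = cis \<phi>" using circle_angle[OF w] .
  let ?E = "{- 2 * pi, 0, 2 * pi}"
  let ?S = "{\<theta> \<in> {0..2 * pi}. cmod (cis \<theta> - w) \<le> \<rho>}"
  have "closed {\<theta>. cmod (cis \<theta> - w) \<le> \<rho>}"
    using continuous_cis_int[of 1] by (auto intro!: closed_Collect_le continuous_intros)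
  moreover have "?S = {0..2 * pi} \<inter> {\<theta>. cmod (cis \<theta> - w) \<le> \<rho>}" by auto
  ultimately have "closed ?S" by (metis closed_Int closed_real_atLeastAtMost)
  then have S: "?S \<in> sets lborel" by simp
  have "measure (restrict_space lborel {0..2 * pi}) ?S = measure lborel ?S"
    by (rule measure_restrict_space) auto
  also have "\<dots> \<le> measure lborel (\<Union>e\<in>?E. {\<phi> + e - 4 * \<rho>..\<phi> + e + 4 * \<rho>})"
  proof (rule measure_mono_fmeasurable)
    show "?S \<subseteq> (\<Union>e\<in>?E. {\<phi> + e - 4 * \<rho>..\<phi> + e + 4 * \<rho>})"
    proof
      fix \<theta> assume "\<theta> \<in> ?S"
      then have "\<exists>e\<in>?E. \<bar>\<theta> - (\<phi> + e)\<bar> \<le> 4 * \<rho>" using \<phi> by (intro cis_close_cases) simp_all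
      then obtain e where "e \<in> ?E" "\<bar>\<theta> - (\<phi> + e)\<bar> \<le> 4 * \<rho>" by blast
      then show "\<theta> \<in> (\<Union>e\<in>?E. {\<phi> + e - 4 * \<rho>..\<phi> + e + 4 * \<rho>})" unfolding abs_le_iff by (intro UN_I[of e]) auto
    qed
    show "(\<Union>e\<in>?E. {\<phi> + e - 4 * \<rho>..\<phi> + e + 4 * \<rho>}) \<in> fmeasurable lborel"
      by (intro fmeasurable.finite_UN) (auto simp: fmeasurable_def emeasure_lborel_Icc_eq)
  qed (rule S)
  also have "\<dots> \<le> (\<Sum>e\<in>?E. measure lborel {\<phi> + e - 4 * \<rho>..\<phi> + e + 4 * \<rho>})"
    by (rule measure_UNION_le) auto
  also have "\<dots> = (\<Sum>e\<in>?E. 8 * \<rho>)" using \<rho> by (intro sum.cong refl) simp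
  also have "\<dots> = real (card ?E) * (8 * \<rho>)" by simp
  also have "\<dots> \<le> 3 * (8 * \<rho>)"
    using \<rho> card_insert_le_m1[of 3 "{0, 2 * pi}" "- 2 * pi"] card_insert_le_m1[of 2 "{2 * pi}" 0] by (intro mult_right_mono) auto
  finally show ?thesis by simp
qed

text \<open>A one-sided open arc starting at w suffices and omits w itself; \<open>\<rho>0\<close>
  keeps it inside the parameter interval and at most half a turn long.\<close>

lemma measure_circle_near_lower:
  assumes w: "cmod w = 1"
  obtains \<rho>0 where "\<rho>0 > 0" "\<And>\<rho>. 0 < \<rho> \<Longrightarrow> \<rho> \<le> \<rho>0 \<Longrightarrow>
    \<exists>S\<subseteq>{0..2 * pi}. S \<in> sets lborel \<and> measure (restrict_space lborel {0..2 * pi}) S = \<rho> \<and>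
      (\<forall>\<theta>\<in>S. 0 < cmod (cis \<theta> - w) \<and> cmod (cis \<theta> - w) < \<rho>)"
proof -
  obtain \<phi> where \<phi>: "0 \<le> \<phi>" "\<phi> < 2 * pi" "w = cis \<phi>" using circle_angle[OF w] .
  define \<rho>0 where "\<rho>0 = min (2 * pi - \<phi>) pi"
  have "\<rho>0 > 0" using \<phi> by (simp add: \<rho>0_def)
  moreover have "\<exists>S\<subseteq>{0..2 * pi}. S \<in> sets lborel \<and> measure (restrict_space lborel {0..2 * pi}) S = \<rho> \<and>
      (\<forall>\<theta>\<in>S. 0 < cmod (cis \<theta> - w) \<and> cmod (cis \<theta> - w) < \<rho>)" if \<rho>: "0 < \<rho>" "\<rho> \<le> \<rho>0" for \<rho>
  proof (intro exI conjI)
    have b: "\<phi> + \<rho> \<le> 2 * pi" "\<rho> \<le> pi" using \<rho> by (auto simp: \<rho>0_def)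
    show sub: "{\<phi><..<\<phi> + \<rho>} \<subseteq> {0..2 * pi}" using b \<phi> by auto
    show "{\<phi><..<\<phi> + \<rho>} \<in> sets lborel" by simp
    show "measure (restrict_space lborel {0..2 * pi}) {\<phi><..<\<phi> + \<rho>} = \<rho>"
      using \<rho> sub by (subst measure_restrict_space) auto
    show "\<forall>\<theta>\<in>{\<phi><..<\<phi> + \<rho>}. 0 < cmod (cis \<theta> - w) \<and> cmod (cis \<theta> - w) < \<rho>"
    proof
      fix \<theta> assume \<theta>: "\<theta> \<in> {\<phi><..<\<phi> + \<rho>}"
      have "cmod (cis \<theta> - w) \<le> \<bar>\<theta> - \<phi>\<bar>" unfolding \<phi>(3) by (rule cmod_cis_diff_le)
      moreover have "\<bar>\<theta> - \<phi>\<bar> / 4 \<le> cmod (cis \<theta> - w)" unfolding \<phi>(3) using \<theta> b by (intro cmod_cis_diff_ge) auto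
      ultimately show "0 < cmod (cis \<theta> - w) \<and> cmod (cis \<theta> - w) < \<rho>" using \<theta> by auto
    qed
  qed
  ultimately show ?thesis by (rule that)
qed

lemma power_law_log_limit:
  fixes f :: "real \<Rightarrow> real"
  assumes "c1 > 0" "c2 > 0" "l0 > 0" and b: "\<And>l. 0 < l \<Longrightarrow> l < l0 \<Longrightarrow> c1 * l powr \<alpha> \<le> f l \<and> f l \<le> c2 * l powr \<alpha>"
  shows "((\<lambda>l. ln (f l) / ln l) \<longlongrightarrow> \<alpha>) (at_right 0)"
proof (rule tendsto_sandwich)
  have l: "\<forall>\<^sub>F l in at_right 0. 0 < l \<and> l < min l0 1"
    using assms by (auto simp: eventually_at_right_field intro!: exI[of _ "min l0 1"])
  have ln: "ln (c * l powr \<alpha>) = ln c + \<alpha> * ln l" if "c > 0" "l > 0" for c l using that by (simp add: ln_mult ln_powr)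
  show "\<forall>\<^sub>F l in at_right 0. ln c2 / ln l + \<alpha> \<le> ln (f l) / ln l"
    using l
  proof eventually_elim
    case (elim l)
    have p: "0 < l powr \<alpha>" using elim by simp
    have f: "c1 * l powr \<alpha> \<le> f l" "f l \<le> c2 * l powr \<alpha>" using b[of l] elim by auto
    have "0 < c1 * l powr \<alpha>" using p assms by simp
    then have "ln (f l) \<le> ln c2 + \<alpha> * ln l" using f ln[OF assms(2), of l] elim by (metis less_le_trans ln_le_cancel_iff)
    moreover have lnl: "ln l < 0" using elim by simp
    ultimately have "(ln c2 + \<alpha> * ln l) / ln l \<le> ln (f l) / ln l" by (intro divide_right_mono_neg) auto
    then show ?case using lnl by (simp add: add_divide_distrib)
  qed
  show "\<forall>\<^sub>F l in at_right 0. ln (f l) / ln l \<le> ln c1 / ln l + \<alpha>"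
    using l
  proof eventually_elim
    case (elim l)
    have p: "0 < l powr \<alpha>" using elim by simp
    have f: "c1 * l powr \<alpha> \<le> f l" using b[of l] elim by auto
    have "0 < c1 * l powr \<alpha>" using p assms by simp
    then have "ln c1 + \<alpha> * ln l \<le> ln (f l)" using f ln[OF assms(1), of l] elim by (metis less_le_trans ln_le_cancel_iff)
    moreover have lnl: "ln l < 0" using elim by simp
    ultimately have "ln (f l) / ln l \<le> (ln c1 + \<alpha> * ln l) / ln l" by (intro divide_right_mono_neg) auto
    then show ?case using lnl by (simp add: add_divide_distrib)
  qed
  have "((\<lambda>l. c / ln l + \<alpha>) \<longlongrightarrow> 0 + \<alpha>) (at_right 0)" for c :: real
    by (intro tendsto_add tendsto_const tendsto_divide_0[OF tendsto_const] filterlim_at_infinity_imp_filterlim_at_bot filterlim_mono[OF ln_at_0 at_bot_le_at_infinity order_refl])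
  then show "((\<lambda>l. ln c2 / ln l + \<alpha>) \<longlongrightarrow> \<alpha>) (at_right 0)" "((\<lambda>l. ln c1 / ln l + \<alpha>) \<longlongrightarrow> \<alpha>) (at_right 0)" by simp_all
qed

lemma novikov_shubin_eqI:
  assumes "\<And>l. l > 0 \<Longrightarrow> spectral_distribution G r s A l \<noteq> spectral_distribution G r s A 0"
    and "((\<lambda>l. ln (spectral_distribution G r s A l - spectral_distribution G r s A 0) / ln l) \<longlongrightarrow> \<alpha>) (at_right 0)"
  shows "novikov_shubin G r s A = NS_val (ereal \<alpha>)"
proof -
  have lim: "((\<lambda>l. ereal (ln (spectral_distribution G r s A l - spectral_distribution G r s A 0) / ln l)) \<longlongrightarrow> ereal \<alpha>) (at_right 0)"
    using assms(2) by (rule tendsto_ereal)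
  have nb: "at_right (0::real) \<noteq> bot" by simp
  have "upper_novikov_shubin G r s A = NS_val (ereal \<alpha>)" "lower_novikov_shubin G r s A = NS_val (ereal \<alpha>)"
    using assms(1) lim_imp_Limsup[OF nb lim] lim_imp_Liminf[OF nb lim]
    by (auto simp: upper_novikov_shubin_def lower_novikov_shubin_def Let_def)
  then show ?thesis unfolding novikov_shubin_def by (intro the_equality) auto
qed

lemma novikov_shubin_Infinity_plus:
  assumes "l > 0" "spectral_distribution G r s A l = spectral_distribution G r s A 0"
  shows "novikov_shubin G r s A = Infinity_plus"
proof -
  have "upper_novikov_shubin G r s A = Infinity_plus" "lower_novikov_shubin G r s A = Infinity_plus"
    using assms by (auto simp: upper_novikov_shubin_def lower_novikov_shubin_def Let_def)
  then show ?thesis unfolding novikov_shubin_def by (intro the_equality) auto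
qed


section \<open>The Novikov-Shubin number of an eigenvalue family\<close>

context equivariant_matrix begin

abbreviation (input) circle :: "real measure" where "circle \<equiv> restrict_space lborel {0..2 * pi}"

definition count_small :: "real \<Rightarrow> real \<Rightarrow> real" where
  "count_small l \<theta> = real (length (filter (\<lambda>x. 0 < x \<and> x \<le> l\<^sup>2) (ev (cis \<theta>))))"

lemma finite_measure_circle: "finite_measure circle"
  by (rule finite_measureI) (simp add: emeasure_restrict_space space_restrict_space)

lemma integral_count_small:
  shows "integrable circle (count_small l)"
    and "(\<integral>\<theta>. count_small l \<theta> \<partial>circle) = 2 * pi * real m * (spectral_distribution G r s A l - spectral_distribution G r s A 0)"
proof -
  obtain M where M: "M > 0" "\<And>z x. cmod z = 1 \<Longrightarrow> x \<in> set (ev z) \<Longrightarrow> x \<le> M" by (rule ev_bounded) (rule that)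
  have meas: "(\<lambda>\<theta>. power_sum n (ev (cis \<theta>))) \<in> borel_measurable circle" for n
  proof -
    have "continuous_on UNIV (\<lambda>\<theta>. Re (complex_of_real (power_sum n (ev (cis \<theta>)))))"
      by (intro continuous_intros continuous_power_sum)
    then have "continuous_on UNIV (\<lambda>\<theta>. power_sum n (ev (cis \<theta>)))" by simp
    from borel_measurable_continuous_onI[OF this] have "(\<lambda>\<theta>. power_sum n (ev (cis \<theta>))) \<in> borel_measurable lborel" by simp
    then show ?thesis by (rule measurable_restrict_space1)
  qed
  have mom: "(\<integral>\<theta>. power_sum n (ev (cis \<theta>)) \<partial>circle) = 2 * pi * real m * Re (\<Sum>i<r. gr_mat_pow r (gr_mat_times G s A (gr_mat_adjoint G A)) n i i \<one>)" for n
  proof -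
    have "(\<integral>\<theta>. power_sum n (ev (cis \<theta>)) \<partial>circle) = Re (\<integral>\<theta>. complex_of_real (power_sum n (ev (cis \<theta>))) \<partial>circle)"
      by (simp only: integral_complex_of_real Re_complex_of_real)
    also have "\<dots> = 2 * pi * real m * Re (\<Sum>i<r. gr_mat_pow r B n i i \<one>)"
      unfolding integral_power_sum by (simp only: Re_complex_of_real Re_divide_of_real times_complex.sel Im_complex_of_real mult_zero_left diff_zero)
    finally show ?thesis unfolding B_def .
  qed
  note sd = spectral_distribution_diff[OF A finite_measure_circle ev_nonneg M(2)[OF norm_cis] ev_length meas mom, where l = l]
  show "integrable circle (count_small l)" unfolding count_small_def[abs_def] by (rule sd(1))
  show "(\<integral>\<theta>. count_small l \<theta> \<partial>circle) = 2 * pi * real m * (spectral_distribution G r s A l - spectral_distribution G r s A 0)"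
    unfolding count_small_def by (rule sd(2))
qed

lemma novikov_shubin_gap:
  assumes c: "c > 0" "\<And>z x. cmod z = 1 \<Longrightarrow> x \<in> set (ev z) \<Longrightarrow> 0 < x \<Longrightarrow> c \<le> x"
  shows "novikov_shubin G r s A = Infinity_plus"
proof (rule novikov_shubin_Infinity_plus)
  define l where "l = sqrt (c / 2)"
  have l: "l > 0" "l\<^sup>2 = c / 2" using c by (simp_all add: l_def)
  show "l > 0" by (rule l)
  have "count_small l \<theta> = 0" for \<theta>
    using c(2)[of "cis \<theta>"] c(1) unfolding count_small_def l by (fastforce simp: filter_empty_conv)
  then have "count_small l = (\<lambda>_. 0)" by (simp add: fun_eq_iff)
  then have "2 * pi * real m * (spectral_distribution G r s A l - spectral_distribution G r s A 0) = 0"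
    unfolding integral_count_small(2)[symmetric] by simp
  then show "spectral_distribution G r s A l = spectral_distribution G r s A 0" using m_pos by simp
qed

lemma count_small_mono: "0 \<le> l \<Longrightarrow> l \<le> l' \<Longrightarrow> count_small l \<theta> \<le> count_small l' \<theta>"
proof -
  assume l: "0 \<le> l" "l \<le> l'"
  have "l\<^sup>2 \<le> l'\<^sup>2" using l by (intro power_mono) auto
  then have "length (filter P xs) \<le> length (filter Q xs)" if "P = (\<lambda>x. 0 < x \<and> x \<le> l\<^sup>2)" "Q = (\<lambda>x. 0 < x \<and> x \<le> l'\<^sup>2)" for P Q xs
    unfolding that by (induction xs) auto
  then show ?thesis unfolding count_small_def by simp
qed

text \<open>A positive eigenvalue at most l^2 forces a distance at most (l^2 / c)^(1 / k) from W,
  and distances from w0 below (l^2 / C)^(1 / k) produce one. Arcs have length of the order of their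
  radius, so F(l) - F(0) is squeezed between multiples of l^(2 / k).\<close>

lemma novikov_shubin_zeros:
  assumes W: "finite W" "W \<subseteq> sphere 0 1" "w0 \<in> W" and k: "1 \<le> k" and c: "c > 0" and C: "C > 0" and \<delta>: "\<delta> > 0"
    and lower: "\<And>z x. cmod z = 1 \<Longrightarrow> z \<notin> W \<Longrightarrow> x \<in> set (ev z) \<Longrightarrow> 0 < x \<Longrightarrow> \<exists>w\<in>W. c * cmod (z - w) ^ k \<le> x"
    and lowerW: "\<And>z x. z \<in> W \<Longrightarrow> x \<in> set (ev z) \<Longrightarrow> 0 < x \<Longrightarrow> c \<le> x"
    and upper: "\<And>z. cmod z = 1 \<Longrightarrow> 0 < cmod (z - w0) \<Longrightarrow> cmod (z - w0) < \<delta> \<Longrightarrow> \<exists>x\<in>set (ev z). 0 < x \<and> x \<le> C * cmod (z - w0) ^ k"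
  shows "novikov_shubin G r s A = NS_val (ereal (2 / real k))"
proof -
  let ?F = "spectral_distribution G r s A"
  have rho: "((l\<^sup>2 / c) powr (1 / real k)) = c powr (- 1 / real k) * l powr (2 / real k)" if "l > 0" "c > 0" for l c
  proof -
    have "(l\<^sup>2 / c) powr (1 / real k) = (l powr 2) powr (1 / real k) / c powr (1 / real k)" using that by (simp add: powr_divide)
    also have "\<dots> = c powr (- 1 / real k) * l powr (2 / real k)" by (simp add: powr_powr powr_minus divide_simps del: powr_numeral)
    finally show ?thesis .
  qed
  have root: "((l\<^sup>2 / c) powr (1 / real k)) ^ k = l\<^sup>2 / c" if "l > 0" "c > 0" for l c :: real
    using that k by (simp add: powr_power)
  \<comment> \<open>The summand 1 makes the constant positive also for r = 0.\<close>
  have up: "?F l - ?F 0 \<le> (real (r * m) * real (card W) * 24 + 1) * c powr (- 1 / real k) / (2 * pi * real m) * l powr (2 / real k)"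
    if l: "0 < l" "l < sqrt c" for l
  proof -
    define \<rho> where "\<rho> = (l\<^sup>2 / c) powr (1 / real k)"
    define S where "S w = {\<theta> \<in> {0..2 * pi}. cmod (cis \<theta> - w) \<le> \<rho>}" for w
    have lc: "l\<^sup>2 < c" using l c power_strict_mono[of l "sqrt c" 2] by simp
    have Sm: "S w \<in> sets circle" for w
    proof -
      have "closed {\<theta>. cmod (cis \<theta> - w) \<le> \<rho>}"
        using continuous_cis_int[of 1] by (auto intro!: closed_Collect_le continuous_intros)
      then have "{\<theta>. cmod (cis \<theta> - w) \<le> \<rho>} \<in> sets lborel" by simp
      then show ?thesis unfolding S_def sets_restrict_space by (intro image_eqI[of _ _ "{\<theta>. cmod (cis \<theta> - w) \<le> \<rho>}"]) auto
    qed
    interpret finite_measure circle by (rule finite_measure_circle)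
    have pt: "count_small l \<theta> \<le> real (r * m) * (\<Sum>w\<in>W. indicator (S w) \<theta>)" if th: "\<theta> \<in> {0..2 * pi}" for \<theta>
    proof (cases "\<exists>x\<in>set (ev (cis \<theta>)). 0 < x \<and> x \<le> l\<^sup>2")
      case False
      then have "count_small l \<theta> = 0" unfolding count_small_def by (simp add: filter_empty_conv)
      then show ?thesis by (simp add: sum_nonneg)
    next
      case True
      then obtain x where x: "x \<in> set (ev (cis \<theta>))" "0 < x" "x \<le> l\<^sup>2" by blast
      \<comment> \<open>Over W the positive eigenvalues are at least c, which exceeds l^2.\<close>
      have "cis \<theta> \<notin> W" using lowerW[of "cis \<theta>" x] x lc by fastforce
      then obtain w where w: "w \<in> W" "c * cmod (cis \<theta> - w) ^ k \<le> x" using lower[OF norm_cis _ x(1,2)] by blast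
      have "cmod (cis \<theta> - w) ^ k \<le> l\<^sup>2 / c" using w(2) x(3) c by (simp add: field_simps)
      also have "\<dots> = \<rho> ^ k" unfolding \<rho>_def by (rule root[symmetric, OF l(1) c])
      finally have "cmod (cis \<theta> - w) \<le> \<rho>" using k by (intro power_mono_iff[THEN iffD1, of "cmod (cis \<theta> - w)" \<rho> k]) (auto simp: \<rho>_def)
      then have "1 \<le> (\<Sum>w\<in>W. indicator (S w) \<theta> :: real)"
        using w(1) W(1) th member_le_sum[of w W "\<lambda>w. indicator (S w) \<theta> :: real"] by (simp add: S_def)
      moreover have "count_small l \<theta> \<le> real (r * m)"
        unfolding count_small_def using length_filter_le[of _ "ev (cis \<theta>)"] unfolding ev_length by (simp del: of_nat_mult)
      ultimately show ?thesis using mult_left_mono[of 1 "\<Sum>w\<in>W. indicator (S w) \<theta> :: real" "real (r * m)"] by linarith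
    qed
    have int: "integrable circle (\<lambda>\<theta>. real (r * m) * (\<Sum>w\<in>W. indicator (S w) \<theta> :: real))"
      by (intro integrable_mult_right Bochner_Integration.integrable_sum integrable_real_indicator Sm) (simp add: less_top[symmetric])
    have "(\<integral>\<theta>. count_small l \<theta> \<partial>circle) \<le> (\<integral>\<theta>. real (r * m) * (\<Sum>w\<in>W. indicator (S w) \<theta>) \<partial>circle)"
      by (rule integral_mono[OF integral_count_small(1) int]) (rule pt, simp add: space_restrict_space)
    also have "\<dots> = real (r * m) * (\<Sum>w\<in>W. measure circle (S w))"
    proof -
      have sp: "S w \<inter> {0..2 * pi} = S w" for w by (auto simp: S_def)
      have "(\<integral>\<theta>. (\<Sum>w\<in>W. indicator (S w) \<theta> :: real) \<partial>circle) = (\<Sum>w\<in>W. measure circle (S w))"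
        using Sm by (subst Bochner_Integration.integral_sum) (simp_all add: less_top[symmetric] space_restrict_space sp)
      then show ?thesis by simp
    qed
    also have "\<dots> \<le> real (r * m) * (\<Sum>w\<in>W. 24 * \<rho>)"
      unfolding S_def by (intro mult_left_mono sum_mono measure_circle_near) (use W in \<open>auto simp: \<rho>_def\<close>)
    also have "\<dots> \<le> (real (r * m) * real (card W) * 24 + 1) * \<rho>" by (simp add: algebra_simps \<rho>_def)
    finally have "2 * pi * real m * (?F l - ?F 0) \<le> (real (r * m) * real (card W) * 24 + 1) * \<rho>"
      unfolding integral_count_small(2) .
    then have "?F l - ?F 0 \<le> (real (r * m) * real (card W) * 24 + 1) * \<rho> / (2 * pi * real m)"
      using m_pos by (simp add: pos_le_divide_eq mult.commute)
    then show ?thesis unfolding \<rho>_def rho[OF l(1) c] by (simp only: times_divide_eq_left mult.assoc)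
  qed
  have w0: "cmod w0 = 1" using W by auto
  obtain \<rho>0 where \<rho>0: "\<rho>0 > 0" "\<And>\<rho>. 0 < \<rho> \<Longrightarrow> \<rho> \<le> \<rho>0 \<Longrightarrow>
    \<exists>S\<subseteq>{0..2 * pi}. S \<in> sets lborel \<and> measure (restrict_space lborel {0..2 * pi}) S = \<rho> \<and>
      (\<forall>\<theta>\<in>S. 0 < cmod (cis \<theta> - w0) \<and> cmod (cis \<theta> - w0) < \<rho>)"
    by (rule measure_circle_near_lower[OF w0]) (rule that)
  \<comment> \<open>Below this radius both the arc from \<open>measure_circle_near_lower\<close> and
    the eigenvalue bound \<open>upper\<close> are available.\<close>
  define \<epsilon> where "\<epsilon> = min \<rho>0 \<delta>"
  have \<epsilon>: "\<epsilon> > 0" using \<rho>0 \<delta> by (simp add: \<epsilon>_def)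
  have low: "C powr (- 1 / real k) / (2 * pi * real m) * l powr (2 / real k) \<le> ?F l - ?F 0"
    if l: "0 < l" "l < sqrt (C * \<epsilon> ^ k)" for l
  proof -
    define \<rho> where "\<rho> = (l\<^sup>2 / C) powr (1 / real k)"
    have "l\<^sup>2 < C * \<epsilon> ^ k" using l C \<epsilon> power_strict_mono[of l "sqrt (C * \<epsilon> ^ k)" 2] by simp
    then have "\<rho> ^ k < \<epsilon> ^ k" unfolding \<rho>_def root[OF l(1) C] using C by (simp add: field_simps)
    then have \<rho>: "0 < \<rho>" "\<rho> < \<epsilon>" using \<epsilon> l C by (auto simp: \<rho>_def intro: power_less_imp_less_base)
    obtain S where S: "S \<subseteq> {0..2 * pi}" "S \<in> sets lborel" "measure circle S = \<rho>"
      "\<And>\<theta>. \<theta> \<in> S \<Longrightarrow> 0 < cmod (cis \<theta> - w0) \<and> cmod (cis \<theta> - w0) < \<rho>"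
      using \<rho>0(2)[of \<rho>] \<rho> by (auto simp: \<epsilon>_def)
    have Sm: "S \<in> sets circle" using S(1,2) unfolding sets_restrict_space by (intro image_eqI[of _ _ S]) auto
    interpret finite_measure circle by (rule finite_measure_circle)
    have pt: "indicator S \<theta> \<le> count_small l \<theta>" for \<theta>
    proof (cases "\<theta> \<in> S")
      case True
      then have "\<exists>x\<in>set (ev (cis \<theta>)). 0 < x \<and> x \<le> C * cmod (cis \<theta> - w0) ^ k"
        using S(4)[OF True] \<rho> by (intro upper) (auto simp: \<epsilon>_def)
      then obtain x where x: "x \<in> set (ev (cis \<theta>))" "0 < x" "x \<le> C * cmod (cis \<theta> - w0) ^ k" by blast
      have "C * cmod (cis \<theta> - w0) ^ k \<le> C * \<rho> ^ k"
        using S(4)[OF True] C by (intro mult_left_mono power_mono) auto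
      also have "\<dots> = l\<^sup>2" unfolding \<rho>_def root[OF l(1) C] using C by simp
      finally have "filter (\<lambda>x. 0 < x \<and> x \<le> l\<^sup>2) (ev (cis \<theta>)) \<noteq> []" using x by (auto simp: filter_empty_conv)
      then have "1 \<le> length (filter (\<lambda>x. 0 < x \<and> x \<le> l\<^sup>2) (ev (cis \<theta>)))" by (metis One_nat_def Suc_leI length_greater_0_conv)
      then show ?thesis using True unfolding count_small_def by simp
    qed (simp add: count_small_def)
    have "\<rho> = (\<integral>\<theta>. indicator S \<theta> \<partial>circle)" using Sm S(1,3) by (simp add: space_restrict_space inf.absorb1)
    also have "\<dots> \<le> (\<integral>\<theta>. count_small l \<theta> \<partial>circle)"
      by (rule integral_mono[OF _ integral_count_small(1) pt]) (use Sm in \<open>simp add: less_top[symmetric]\<close>)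
    finally have "\<rho> \<le> 2 * pi * real m * (?F l - ?F 0)" unfolding integral_count_small(2) .
    then have "\<rho> / (2 * pi * real m) \<le> ?F l - ?F 0"
      using m_pos by (simp add: pos_divide_le_eq mult.commute)
    then show ?thesis unfolding \<rho>_def rho[OF l(1) C] by (simp only: times_divide_eq_left mult.assoc)
  qed
  define l0 where "l0 = min (sqrt c) (sqrt (C * \<epsilon> ^ k))"
  have l0: "l0 > 0" using c C \<epsilon> by (simp add: l0_def)
  show ?thesis
  proof (rule novikov_shubin_eqI)
    fix l :: real assume l: "l > 0"
    \<comment> \<open>The lower bound holds for small l; monotonicity of F carries the strict
      increase to all l > 0.\<close>
    define l' where "l' = min l (l0 / 2)"
    have l': "0 < l'" "l' \<le> l" "l' < sqrt (C * \<epsilon> ^ k)" using l l0 unfolding l'_def l0_def by linarith+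
    have "0 < C powr (- 1 / real k) / (2 * pi * real m) * l' powr (2 / real k)" using C m_pos l' by simp
    also have "\<dots> \<le> ?F l' - ?F 0" by (rule low[OF l'(1,3)])
    finally have "0 < 2 * pi * real m * (?F l' - ?F 0)" using m_pos by simp
    also have "\<dots> \<le> 2 * pi * real m * (?F l - ?F 0)"
      unfolding integral_count_small(2)[symmetric] by (rule integral_mono[OF integral_count_small(1) integral_count_small(1)]) (use l' in \<open>simp add: count_small_mono\<close>)
    finally show "?F l \<noteq> ?F 0" by auto
  next
    show "((\<lambda>l. ln (?F l - ?F 0) / ln l) \<longlongrightarrow> 2 / real k) (at_right 0)"
    proof (rule power_law_log_limit[OF _ _ l0])
      show "0 < C powr (- 1 / real k) / (2 * pi * real m)" using C m_pos by simp
      show "0 < (real (r * m) * real (card W) * 24 + 1) * c powr (- 1 / real k) / (2 * pi * real m)"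
        using c m_pos by (intro divide_pos_pos mult_pos_pos add_nonneg_pos) auto
    qed (use low up in \<open>auto simp: l0_def\<close>)
  qed
qed

end

section \<open>Roots of unity\<close>


text \<open>The shape of both alpha estimates: up to constants the smallest positive eigenvalue is
  n^(-k) and the normalized multiplicity 1 / n; halving the denominator accounts for the square root
  in \<open>sigma_plus\<close>.\<close>

lemma log_ratio_limit:
  fixes a b k :: real
  assumes k: "k > 0"
  shows "(\<lambda>n. (ln (real n) + a) / ((k * ln (real n) + b) / 2)) \<longlonglongrightarrow> 2 / k"
proof -
  have ln: "filterlim (\<lambda>n. ln (real n)) at_top sequentially"
    by (rule filterlim_compose[OF ln_at_top filterlim_real_sequentially])
  have z: "(\<lambda>n. c / ln (real n)) \<longlonglongrightarrow> 0" for c :: real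
    by (intro tendsto_divide_0[OF tendsto_const] filterlim_at_top_imp_at_infinity ln)
  have "(\<lambda>n. (1 + a / ln (real n)) / ((k + b / ln (real n)) / 2)) \<longlonglongrightarrow> (1 + 0) / ((k + 0) / 2)"
    using k by (intro tendsto_intros z) auto
  moreover have "\<forall>\<^sub>F n in sequentially. (1 + a / ln (real n)) / ((k + b / ln (real n)) / 2) = (ln (real n) + a) / ((k * ln (real n) + b) / 2)"
    using eventually_gt_at_top[of 1]
  proof eventually_elim
    case (elim n)
    then have l: "ln (real n) > 0" by simp
    have e: "ln (real n) + a = ln (real n) * (1 + a / ln (real n))" "(k * ln (real n) + b) / 2 = ln (real n) * ((k + b / ln (real n)) / 2)"
      using l by (simp_all add: field_simps)
    show ?case unfolding e by (rule mult_divide_mult_cancel_left[symmetric]) (use l in simp)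
  qed
  ultimately show ?thesis by (simp add: tendsto_cong)
qed

lemma card_nat_interval_le:
  fixes u v :: real assumes "0 \<le> v"
  shows "finite {j :: nat. \<bar>real j - u\<bar> \<le> v}" "real (card {j :: nat. \<bar>real j - u\<bar> \<le> v}) \<le> 2 * v + 1"
proof -
  let ?S = "{j :: nat. \<bar>real j - u\<bar> \<le> v}"
  have sub: "int ` ?S \<subseteq> {\<lceil>u - v\<rceil>..\<lfloor>u + v\<rfloor>}" by (auto simp: ceiling_le_iff le_floor_iff abs_le_iff)
  then have fin: "finite (int ` ?S)" by (rule finite_subset) simp
  then show "finite ?S" by (simp add: finite_image_iff)
  have "card ?S = card (int ` ?S)" by (simp add: card_image)
  also have "\<dots> \<le> card {\<lceil>u - v\<rceil>..\<lfloor>u + v\<rfloor>}" by (rule card_mono[OF _ sub]) simp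
  finally have "card ?S \<le> nat (\<lfloor>u + v\<rfloor> - \<lceil>u - v\<rceil> + 1)" by simp
  moreover have "real (nat (\<lfloor>u + v\<rfloor> - \<lceil>u - v\<rceil> + 1)) \<le> 2 * v + 1"
  proof (cases "\<lfloor>u + v\<rfloor> - \<lceil>u - v\<rceil> + 1 \<ge> 0")
    case True
    then have "real (nat (\<lfloor>u + v\<rfloor> - \<lceil>u - v\<rceil> + 1)) = of_int \<lfloor>u + v\<rfloor> - of_int \<lceil>u - v\<rceil> + 1" by simp
    then show ?thesis using of_int_floor_le[of "u + v"] le_of_int_ceiling[of "u - v"] by linarith
  next
    case False
    then show ?thesis using assms by simp
  qed
  ultimately show "real (card ?S) \<le> 2 * v + 1" by linarith
qed

lemma cmod_root_of_unity [simp]: "cmod (root_of_unity n j) = 1" by (simp add: root_of_unity_def)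

lemma root_of_unity_power: "n > 0 \<Longrightarrow> root_of_unity n j ^ n = 1"
  unfolding root_of_unity_def Complex.DeMoivre by (simp add: cis_multiple_2pi mult.commute[of "real j"])

text \<open>Distance M / n means at most M in the index, as 4 / (2 pi) \<le> 1; each of the three
  shifts then admits at most 2 M + 1 indices.\<close>

lemma card_roots_of_unity_near:
  assumes w: "cmod w = 1" and n: "n > 0" and M: "0 \<le> M"
  shows "real (card {j. j < n \<and> cmod (root_of_unity n j - w) \<le> M / real n}) \<le> 3 * (2 * M + 1)"
proof -
  obtain \<phi> where \<phi>: "0 \<le> \<phi>" "\<phi> < 2 * pi" "w = cis \<phi>" using circle_angle[OF w] .
  let ?E = "{- 2 * pi, 0, 2 * pi}"
  let ?S = "{j. j < n \<and> cmod (root_of_unity n j - w) \<le> M / real n}"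
  let ?T = "\<lambda>e. {j. \<bar>real j - real n * (\<phi> + e) / (2 * pi)\<bar> \<le> M}"
  have "?S \<subseteq> (\<Union>e\<in>?E. ?T e)"
  proof
    fix j assume "j \<in> ?S"
    then have j: "j < n" "cmod (cis (2 * pi * real j / real n) - cis \<phi>) \<le> M / real n"
      by (auto simp: root_of_unity_def \<phi>(3))
    have "\<exists>e\<in>?E. \<bar>2 * pi * real j / real n - (\<phi> + e)\<bar> \<le> 4 * (M / real n)"
      by (rule cis_close_cases[OF _ _ \<phi>(1,2) j(2)]) (use j n in \<open>simp_all add: field_simps\<close>)
    then obtain e where e: "e \<in> ?E" "\<bar>2 * pi * real j / real n - (\<phi> + e)\<bar> \<le> 4 * (M / real n)" by blast
    have "real j - real n * (\<phi> + e) / (2 * pi) = (2 * pi * real j / real n - (\<phi> + e)) * (real n / (2 * pi))"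
      using n by (simp add: field_simps)
    then have "\<bar>real j - real n * (\<phi> + e) / (2 * pi)\<bar> = \<bar>2 * pi * real j / real n - (\<phi> + e)\<bar> * (real n / (2 * pi))"
      by (simp add: abs_mult)
    also have "\<dots> \<le> 4 * (M / real n) * (real n / (2 * pi))" by (intro mult_right_mono e(2)) simp
    also have "\<dots> = M * (2 / pi)" using n by (simp add: field_simps)
    also have "\<dots> \<le> M * 1" using M pi_ge_two by (intro mult_left_mono) (auto simp: field_simps)
    finally show "j \<in> (\<Union>e\<in>?E. ?T e)" using e(1) by (intro UN_I[of e]) auto
  qed
  moreover have "finite (\<Union>e\<in>?E. ?T e)" using card_nat_interval_le(1)[OF M] by blast
  ultimately have "card ?S \<le> card (\<Union>e\<in>?E. ?T e)" by (intro card_mono)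
  also have "\<dots> \<le> (\<Sum>e\<in>?E. card (?T e))" by (rule card_UN_le) simp
  finally have "real (card ?S) \<le> real (\<Sum>e\<in>?E. card (?T e))" by (rule of_nat_mono)
  also have "\<dots> = (\<Sum>e\<in>?E. real (card (?T e)))" by (rule of_nat_sum)
  also have "\<dots> \<le> (\<Sum>e\<in>?E. 2 * M + 1)" by (intro sum_mono card_nat_interval_le(2) M)
  also have "\<dots> = real (card ?E) * (2 * M + 1)" by simp
  also have "\<dots> \<le> 3 * (2 * M + 1)"
    using M card_insert_le_m1[of 3 "{0, 2 * pi}" "- 2 * pi"] card_insert_le_m1[of 2 "{2 * pi}" 0] by (intro mult_right_mono) auto
  finally show ?thesis .
qed

text \<open>Take the first n-th root of unity strictly after w, which differs from w even if w is
  such a root; n \<ge> 2 keeps the angle at most half a turn, where \<open>cmod_cis_diff_ge\<close>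
  applies.\<close>

lemma root_of_unity_near:
  assumes w: "cmod w = 1" and n: "n \<ge> 2"
  obtains j where "j < n" "0 < cmod (root_of_unity n j - w)" "cmod (root_of_unity n j - w) \<le> 2 * pi / real n"
proof -
  obtain \<phi> where \<phi>: "0 \<le> \<phi>" "\<phi> < 2 * pi" "w = cis \<phi>" using circle_angle[OF w] .
  define u where "u = real n * \<phi> / (2 * pi)"
  define j where "j = nat \<lfloor>u\<rfloor>"
  have u: "0 \<le> u" "u < real n" using \<phi> n by (simp_all add: u_def field_simps)
  have j: "real j \<le> u" "u < real j + 1" using u by (simp_all add: j_def)
  define \<psi> where "\<psi> = 2 * pi * real (Suc j) / real n"
  have "\<phi> = 2 * pi * u / real n" using n by (simp add: u_def)
  then have d: "\<psi> - \<phi> = 2 * pi * (real (Suc j) - u) / real n" by (simp add: \<psi>_def diff_divide_distrib right_diff_distrib)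
  have "0 < \<psi> - \<phi>" unfolding d using j n by simp
  have "2 * pi * (real (Suc j) - u) / real n \<le> 2 * pi * 1 / real n" using j by (intro divide_right_mono mult_left_mono) auto
  then have le: "\<psi> - \<phi> \<le> 2 * pi / real n" unfolding d by simp
  also have "\<dots> \<le> pi" using n by (simp add: field_simps)
  finally have small: "\<bar>\<psi> - \<phi>\<bar> \<le> pi" using \<open>0 < \<psi> - \<phi>\<close> by simp
  have pos: "0 < cmod (cis \<psi> - w)" unfolding \<phi>(3) using \<open>0 < \<psi> - \<phi>\<close> by (intro less_le_trans[OF _ cmod_cis_diff_ge[OF small]]) simp
  have near: "cmod (cis \<psi> - w) \<le> 2 * pi / real n" unfolding \<phi>(3) using cmod_cis_diff_le[of \<psi> \<phi>] \<open>0 < \<psi> - \<phi>\<close> le by simp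
  \<comment> \<open>\<open>Suc j\<close> may equal n; the index then wraps around to the root
    1.\<close>
  have "root_of_unity n (Suc j mod n) = cis \<psi>"
  proof (cases "Suc j = n")
    case True
    then show ?thesis using n by (simp add: root_of_unity_def \<psi>_def)
  next
    case False
    have "real j < real n" using j u by linarith
    then have "Suc j < n" using False by simp
    then show ?thesis by (simp add: root_of_unity_def \<psi>_def)
  qed
  then show ?thesis using that[of "Suc j mod n"] n pos near by simp
qed

lemma cmod_power_diff_le:
  assumes "cmod z = 1" "cmod w = 1" shows "cmod (z ^ n - w ^ n) \<le> real n * cmod (z - w)"
proof (induction n)
  case (Suc n)
  have "z ^ Suc n - w ^ Suc n = z * (z ^ n - w ^ n) + (z - w) * w ^ n" by (simp add: algebra_simps)
  then have "cmod (z ^ Suc n - w ^ Suc n) \<le> cmod (z * (z ^ n - w ^ n)) + cmod ((z - w) * w ^ n)" by (metis norm_triangle_ineq)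
  also have "\<dots> = cmod (z ^ n - w ^ n) + cmod (z - w)" using assms by (simp add: norm_mult norm_power)
  also have "\<dots> \<le> real (Suc n) * cmod (z - w)" using Suc by (simp add: algebra_simps)
  finally show ?case .
qed simp

text \<open>Division by w reduces this to the distance of v from 1. The angle of v is at least 2 pi
  / n away from both 0 and 2 pi, and a quarter of that is at least 1 / n.\<close>

lemma roots_of_unity_separated:
  assumes n: "n > 0" and z: "z ^ n = 1" and w: "w ^ n = 1" and ne: "z \<noteq> w"
  shows "1 / real n \<le> cmod (z - w)"
proof -
  have cm: "cmod u = 1" if "u ^ n = 1" for u :: complex
  proof -
    have "cmod u ^ n = 1 ^ n" using arg_cong[OF that, of cmod] by (simp add: norm_power)
    then show ?thesis using n by (subst (asm) power_eq_iff_eq_base) auto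
  qed
  note cm = cm[OF w] cm[OF z]
  define v where "v = z / w"
  have w0: "w \<noteq> 0" using cm by auto
  have v: "cmod v = 1" "v ^ n = 1" "v \<noteq> 1" using cm w0 z w ne by (simp_all add: v_def norm_divide power_divide)
  have "z - w = w * (v - 1)" using w0 by (simp add: v_def field_simps)
  then have eq: "cmod (z - w) = cmod (v - 1)" using cm by (simp add: norm_mult)
  obtain \<phi> where \<phi>: "0 \<le> \<phi>" "\<phi> < 2 * pi" "v = cis \<phi>" using circle_angle[OF v(1)] .
  have "cos (real n * \<phi>) = 1" using v(2) by (simp add: \<phi>(3) Complex.DeMoivre complex_eq_iff)
  then obtain l :: int where l: "real n * \<phi> = real_of_int l * 2 * pi" by (auto simp: cos_one_2pi_int)
  then have \<phi>l: "\<phi> = real_of_int l * (2 * pi / real n)" using n by (simp add: field_simps)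
  have "l > 0"
  proof (rule ccontr)
    assume "\<not> l > 0"
    then have "real_of_int l * (2 * pi / real n) \<le> 0" by (intro mult_nonpos_nonneg) auto
    then have "\<phi> = 0" using \<phi>l \<phi>(1) by linarith
    then show False using v(3) \<phi>(3) by simp
  qed
  moreover have "l < int n"
  proof -
    have "real_of_int l * 2 * pi < real n * (2 * pi)" unfolding l[symmetric] using \<phi>(2) n by (intro mult_strict_left_mono) auto
    then have "real_of_int l < real n" by (simp add: mult.assoc)
    then show ?thesis by linarith
  qed
  ultimately have l: "1 \<le> l" "l \<le> int n - 1" by auto
  have e: "2 * pi / real n \<le> \<phi>" "\<phi> \<le> 2 * pi - 2 * pi / real n"
  proof -
    show "2 * pi / real n \<le> \<phi>" unfolding \<phi>l using l(1) mult_right_mono[of 1 "real_of_int l" "2 * pi / real n"] by simp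
    have "real_of_int l * (2 * pi / real n) \<le> (real n - 1) * (2 * pi / real n)" using l(2) by (intro mult_right_mono) auto
    also have "\<dots> = 2 * pi - 2 * pi / real n" using n by (simp add: field_simps)
    finally show "\<phi> \<le> 2 * pi - 2 * pi / real n" unfolding \<phi>l .
  qed
  have q: "1 / real n \<le> 2 * pi / real n / 4" using divide_right_mono[of 1 "2 * pi / 4" "real n"] pi_ge_two by simp
  show ?thesis
  proof (cases "\<phi> \<le> pi")
    case True
    have "2 * pi / real n / 4 \<le> \<bar>\<phi> - 0\<bar> / 4" using e \<phi> by simp
    also have "\<dots> \<le> cmod (cis \<phi> - cis 0)" by (rule cmod_cis_diff_ge) (use True \<phi> in simp)
    finally show ?thesis using q unfolding eq \<phi>(3) by simp
  next
    case False
    have "2 * pi / real n / 4 \<le> \<bar>\<phi> - 2 * pi\<bar> / 4" using e \<phi> by simp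
    also have "\<dots> \<le> cmod (cis \<phi> - cis (2 * pi))" by (rule cmod_cis_diff_ge) (use False \<phi> in simp)
    finally show ?thesis using q unfolding eq \<phi>(3) by simp
  qed
qed

text \<open>For a point that is not a root of unity, two exponents with \<open>w ^ n\<close> close to \<open>1\<close> cannot lie at
  a bounded distance from each other; so among sufficiently many consecutive multiples of an integer
  one is good for all points at once.\<close>

lemma powers_away_from_one:
  fixes W :: "complex set"
  assumes W: "finite W" "W \<subseteq> sphere 0 1" and N: "N > 0"
  obtains \<kappa> where "0 < \<kappa>" "\<kappa> \<le> 1" "\<And>n0. \<exists>n\<ge>n0. N dvd n \<and> (\<forall>w\<in>W. w ^ n = 1 \<or> \<kappa> \<le> cmod (w ^ n - 1))"
proof -
  define T where "T = {w \<in> W. \<exists>q>0. w ^ q = 1}"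
  have "\<forall>w\<in>T. \<exists>q. q > 0 \<and> w ^ q = 1" by (auto simp: T_def)
  then obtain q where q: "\<And>w. w \<in> T \<Longrightarrow> q w > 0 \<and> w ^ q w = 1" by metis
  have fT: "finite T" using W by (simp add: T_def)
  \<comment> \<open>A common exponent for the roots of unity in W: multiples of P satisfy the
    condition at these points automatically.\<close>
  define P where "P = N * (\<Prod>w\<in>T. q w)"
  have P: "P > 0" "N dvd P" using N q by (auto simp: P_def prod_pos)
  have tors: "w ^ (P * a) = 1" if "w \<in> T" for w a
  proof -
    have "q w dvd P * a" using fT that by (simp add: P_def dvd_prod_eqI)
    then obtain b where "P * a = q w * b" by (elim dvdE)
    then show ?thesis using q[OF that] by (simp add: power_mult)
  qed
  define R where "R = card (W - T)"
  \<comment> \<open>Distances from 1 of the powers w ^ (P d) with d \<le> R, for the points that are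
    not roots of unity; they are halved so that two values below \<kappa> contradict
    \<open>sep\<close>.\<close>
  define D where "D = insert 1 ((\<lambda>(w, d). cmod (w ^ (P * d) - 1) / 2) ` ((W - T) \<times> {1..R}))"
  have D: "finite D" "D \<noteq> {}" using W by (simp_all add: D_def)
  define \<kappa> where "\<kappa> = Min D"
  have "\<forall>x\<in>D. 0 < x"
  proof
    fix x assume "x \<in> D"
    then consider "x = 1" | w d where "w \<in> W - T" "d \<in> {1..R}" "x = cmod (w ^ (P * d) - 1) / 2" by (auto simp: D_def)
    then show "0 < x"
    proof cases
      case 2
      have "P * d > 0" using P 2 by simp
      then have "w ^ (P * d) \<noteq> 1" using 2(1) unfolding T_def by blast
      then have "cmod (w ^ (P * d) - 1) > 0" by simp
      then show ?thesis unfolding 2(3) by simp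
    qed simp
  qed
  then have \<kappa>: "0 < \<kappa>" "\<kappa> \<le> 1" using D by (simp_all add: \<kappa>_def Min_le D_def)
  have sep: "2 * \<kappa> \<le> cmod (w ^ (P * d) - 1)" if "w \<in> W - T" "1 \<le> d" "d \<le> R" for w d
  proof -
    have "\<kappa> \<le> cmod (w ^ (P * d) - 1) / 2" unfolding \<kappa>_def
      by (rule Min_le[OF D(1)]) (unfold D_def, intro insertI2 image_eqI[of _ _ "(w, d)"], use that in auto)
    then show ?thesis by simp
  qed
  have "\<exists>n\<ge>n0. N dvd n \<and> (\<forall>w\<in>W. w ^ n = 1 \<or> \<kappa> \<le> cmod (w ^ n - 1))" for n0
  proof (rule ccontr)
    assume no: "\<not> ?thesis"
    have "\<exists>w\<in>W - T. cmod (w ^ (P * (n0 + i)) - 1) < \<kappa>" for i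
    proof -
      have "n0 \<le> P * (n0 + i)" using P(1) mult_le_mono[of 1 P n0 "n0 + i"] by simp
      moreover have "N dvd P * (n0 + i)" using P(2) by simp
      ultimately obtain w where "w \<in> W" "w ^ (P * (n0 + i)) \<noteq> 1" "cmod (w ^ (P * (n0 + i)) - 1) < \<kappa>"
        using no by (meson not_le)
      then show ?thesis using tors by blast
    qed
    then obtain f where f: "\<And>i. f i \<in> W - T" "\<And>i. cmod (f i ^ (P * (n0 + i)) - 1) < \<kappa>" by metis
    \<comment> \<open>There are R + 1 candidates but only R points, so two candidates fail at the
      same point; their exponents differ by P d with 1 \<le> d \<le> R.\<close>
    have "card (f ` {0..R}) \<le> R" unfolding R_def by (rule card_mono) (use W f in auto)
    then have "\<not> inj_on f {0..R}" by (intro pigeonhole) simp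
    then obtain i i' where i: "i < i'" "i' \<le> R" "f i = f i'" unfolding inj_on_def by (metis atLeastAtMost_iff linorder_neqE_nat)
    define w where "w = f i"
    have cw: "cmod w = 1" using f(1)[of i] W by (auto simp: w_def)
    have "n0 + i' = (n0 + i) + (i' - i)" using i by simp
    then have "P * (n0 + i') = P * (n0 + i) + P * (i' - i)" by (metis distrib_left)
    then have "w ^ (P * (n0 + i')) - w ^ (P * (n0 + i)) = w ^ (P * (n0 + i)) * (w ^ (P * (i' - i)) - 1)" by (simp add: power_add right_diff_distrib)
    then have "cmod (w ^ (P * (i' - i)) - 1) = cmod (w ^ (P * (n0 + i')) - w ^ (P * (n0 + i)))" using cw by (simp add: norm_mult norm_power)
    also have "\<dots> \<le> cmod (w ^ (P * (n0 + i')) - 1) + cmod (w ^ (P * (n0 + i)) - 1)"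
      using norm_triangle_ineq4[of "w ^ (P * (n0 + i')) - 1" "w ^ (P * (n0 + i)) - 1"] by simp
    also have "\<dots> < 2 * \<kappa>" using f(2)[of i] f(2)[of i'] i(3) by (simp add: w_def)
    finally show False using sep[of w "i' - i"] f(1)[of i] i unfolding w_def by linarith
  qed
  then show ?thesis using that \<kappa> by blast
qed

text \<open>If w^n = 1, distinct n-th roots of unity are separated; otherwise \<kappa> \<le> |z^n -
  w^n| \<le> n |z - w|.\<close>

lemma root_of_unity_away:
  assumes n: "n > 0" and \<kappa>: "0 < \<kappa>" "\<kappa> \<le> 1" and z: "z ^ n = 1" "cmod z = 1" and w: "cmod w = 1" "w ^ n = 1 \<or> \<kappa> \<le> cmod (w ^ n - 1)" and ne: "z \<noteq> w"
  shows "\<kappa> / real n \<le> cmod (z - w)"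
  using w(2)
proof
  assume "w ^ n = 1"
  then have "1 / real n \<le> cmod (z - w)" by (intro roots_of_unity_separated n z ne)
  moreover have "\<kappa> / real n \<le> 1 / real n" using \<kappa> by (intro divide_right_mono) auto
  ultimately show ?thesis by linarith
next
  assume "\<kappa> \<le> cmod (w ^ n - 1)"
  also have "\<dots> = cmod (z ^ n - w ^ n)" using z by (simp add: norm_minus_commute)
  also have "\<dots> \<le> real n * cmod (z - w)" by (rule cmod_power_diff_le) (use z w in auto)
  finally show ?thesis using n by (simp add: field_simps)
qed

section \<open>Alpha numbers of finite quotients\<close>


lemma sigma_plus_eigs:
  assumes D: "D \<in> carrier_mat n k" and x: "x \<in> set (psd_eigs D)" "0 < x"
  obtains y where "y \<in> set (psd_eigs D)" "0 < y" "\<And>x. x \<in> set (psd_eigs D) \<Longrightarrow> 0 < x \<Longrightarrow> y \<le> x"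
    "sigma_plus D = sqrt y" "1 \<le> mult_plus D" "mult_plus D \<le> count_list (psd_eigs D) y"
proof -
  define Q where "Q = {x \<in> set (psd_eigs D). 0 < x}"
  have Q: "finite Q" "Q \<noteq> {}" using x by (auto simp: Q_def)
  define y where "y = Min Q"
  have y: "y \<in> Q" "\<And>x. x \<in> Q \<Longrightarrow> y \<le> x" unfolding y_def using Q by simp_all
  have "positive_singular_values D = sqrt ` Q"
  proof (intro Set.set_eqI iffI)
    fix \<sigma> assume "\<sigma> \<in> positive_singular_values D"
    then have "\<sigma> > 0" "\<sigma>\<^sup>2 \<in> set (psd_eigs D)"
      unfolding positive_singular_values_def psd_eigs(5)[OF D] by auto
    then show "\<sigma> \<in> sqrt ` Q" unfolding Q_def by (intro image_eqI[of _ _ "\<sigma>\<^sup>2"]) auto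
  next
    fix \<sigma> assume "\<sigma> \<in> sqrt ` Q"
    then show "\<sigma> \<in> positive_singular_values D"
      unfolding positive_singular_values_def psd_eigs(5)[OF D] by (auto simp: Q_def)
  qed
  then have \<sigma>: "sigma_plus D = sqrt y"
    unfolding sigma_plus_def using y Q by (auto intro!: Min_eqI)
  have y': "y \<in> set (psd_eigs D)" "0 < y" using y by (auto simp: Q_def)
  have sq: "(sigma_plus D)\<^sup>2 = y" using y' by (simp add: \<sigma>)
  show ?thesis
  proof (rule that[OF y' _ \<sigma>])
    show "1 \<le> mult_plus D" "mult_plus D \<le> count_list (psd_eigs D) y"
      unfolding mult_plus_def sq using psd_eigs(6,7)[OF D] y' by auto
  qed (use y(2) in \<open>auto simp: Q_def\<close>)
qed

context equivariant_matrix begin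

text \<open>The eigenvalue \<open>v\<close> witnesses that the quotient matrix is nonzero, so the
  minimum that defines \<open>sigma_plus\<close> is taken over a nonempty set.\<close>

lemma alpha_number_K:
  assumes n: "n > 0" and norm: "K n \<lhd> G" and j: "j < n" and v: "v \<in> set (ev (root_of_unity n j))" "0 < v"
  obtains y \<mu> where "0 < y" "\<exists>j<n. y \<in> set (ev (root_of_unity n j))"
    "\<And>j x. j < n \<Longrightarrow> x \<in> set (ev (root_of_unity n j)) \<Longrightarrow> 0 < x \<Longrightarrow> y \<le> x"
    "1 \<le> \<mu>" "\<mu> \<le> (\<Sum>j<n. count_list (ev (root_of_unity n j)) y)"
    "alpha_number G r s A (K n) = ln (real \<mu> / (real n * real m)) / (ln y / 2)"
proof -
  obtain D where D: "D \<in> carrier_mat (r * (n * m)) (s * (n * m))" "regular_mat (G Mod K n) r s (quotient_mat A) = D"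
    "\<And>a. count_list (psd_eigs D) a = (\<Sum>j<n. count_list (ev (root_of_unity n j)) a)"
    by (rule quotient_eigs[OF n norm]) (rule that)
  have mem: "a \<in> set (psd_eigs D) \<longleftrightarrow> (\<exists>j<n. a \<in> set (ev (root_of_unity n j)))" for a
  proof -
    have "a \<in> set (psd_eigs D) \<longleftrightarrow> (\<Sum>j<n. count_list (ev (root_of_unity n j)) a) \<noteq> 0"
      unfolding D(3)[symmetric] by (simp add: count_list_0_iff)
    also have "\<dots> \<longleftrightarrow> (\<exists>j<n. count_list (ev (root_of_unity n j)) a \<noteq> 0)" by (subst sum_eq_0_iff) auto
    finally show ?thesis by (simp only: count_list_0_iff not_not)
  qed
  have v': "v \<in> set (psd_eigs D)" using mem j v by blast
  obtain y where y: "y \<in> set (psd_eigs D)" "0 < y"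
    "\<And>x. x \<in> set (psd_eigs D) \<Longrightarrow> 0 < x \<Longrightarrow> y \<le> x"
    "sigma_plus D = sqrt y" "1 \<le> mult_plus D" "mult_plus D \<le> count_list (psd_eigs D) y"
    by (rule sigma_plus_eigs[OF D(1) v' v(2)]) (rule that)
  show ?thesis
  proof (rule that[of y "mult_plus D"])
    show "alpha_number G r s A (K n) = ln (real (mult_plus D) / (real n * real m)) / (ln y / 2)"
      unfolding alpha_number_def D(2) Let_def card_K_cosets(1)[OF n] y(4) using y(2) by (simp add: ln_sqrt)
  qed (use y mem in \<open>auto simp: D(3)[symmetric]\<close>)
qed

text \<open>A root of unity near w0 carries a positive eigenvalue at most of order n^(-k), so -ln y
  \<ge> k ln n + b. The multiplicity is at least 1, and a larger one only lowers the
  quotient.\<close>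

lemma alpha_number_upper:
  assumes w0: "cmod w0 = 1" and k: "1 \<le> k" and C: "C > 0" and \<delta>: "\<delta> > 0"
    and upper: "\<And>z. cmod z = 1 \<Longrightarrow> 0 < cmod (z - w0) \<Longrightarrow> cmod (z - w0) < \<delta> \<Longrightarrow> \<exists>x\<in>set (ev z). 0 < x \<and> x \<le> C * cmod (z - w0) ^ k"
    and \<epsilon>: "\<epsilon> > 0"
  obtains n0 where "\<And>n. n \<ge> n0 \<Longrightarrow> K n \<lhd> G \<Longrightarrow> alpha_number G r s A (K n) \<le> 2 / real k + \<epsilon>"
proof -
  define b where "b = - ln (C * (2 * pi) ^ k)"
  have lim: "(\<lambda>n. (ln (real n) + ln (real m)) / ((real k * ln (real n) + b) / 2)) \<longlonglongrightarrow> 2 / real k"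
    by (rule log_ratio_limit) (use k in simp)
  have "\<forall>\<^sub>F n in sequentially. (ln (real n) + ln (real m)) / ((real k * ln (real n) + b) / 2) < 2 / real k + \<epsilon>"
    by (rule order_tendstoD(2)[OF lim]) (use \<epsilon> in simp)
  moreover have "\<forall>\<^sub>F n in sequentially. real k * ln (real n) + b > 0"
  proof -
    have "filterlim (\<lambda>n. b + real k * ln (real n)) at_top sequentially"
      by (intro filterlim_tendsto_add_at_top[OF tendsto_const] filterlim_tendsto_pos_mult_at_top[OF tendsto_const]
          filterlim_compose[OF ln_at_top filterlim_real_sequentially]) (use k in simp)
    then show ?thesis unfolding filterlim_at_top_dense by (simp add: add.commute)
  qed
  moreover have "\<forall>\<^sub>F n in sequentially. 2 * pi / \<delta> < real n"
    using filterlim_real_sequentially unfolding filterlim_at_top_dense by blast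
  moreover have "\<forall>\<^sub>F n :: nat in sequentially. n \<ge> 2" by (rule eventually_ge_at_top)
  ultimately have "\<forall>\<^sub>F n in sequentially. K n \<lhd> G \<longrightarrow> alpha_number G r s A (K n) \<le> 2 / real k + \<epsilon>"
  proof eventually_elim
    case (elim n)
    show ?case
    proof
      assume norm: "K n \<lhd> G"
      have n: "n > 0" using elim by simp
      obtain j where j: "j < n" "0 < cmod (root_of_unity n j - w0)" "cmod (root_of_unity n j - w0) \<le> 2 * pi / real n"
        by (rule root_of_unity_near[OF w0 elim(4)]) (rule that)
      have "2 * pi / real n < \<delta>" using elim(3) \<delta> n by (simp add: field_simps)
      then obtain x where x: "x \<in> set (ev (root_of_unity n j))" "0 < x" "x \<le> C * cmod (root_of_unity n j - w0) ^ k"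
        using upper[OF cmod_root_of_unity j(2)] j(3) by fastforce
      have "C * cmod (root_of_unity n j - w0) ^ k \<le> C * (2 * pi / real n) ^ k"
        using j(2,3) C by (intro mult_left_mono power_mono) auto
      then have xle: "x \<le> C * (2 * pi / real n) ^ k" using x by linarith
      obtain y \<mu> where y: "0 < y" "\<exists>j<n. y \<in> set (ev (root_of_unity n j))"
        "\<And>j x. j < n \<Longrightarrow> x \<in> set (ev (root_of_unity n j)) \<Longrightarrow> 0 < x \<Longrightarrow> y \<le> x"
        "1 \<le> \<mu>" "\<mu> \<le> (\<Sum>j<n. count_list (ev (root_of_unity n j)) y)"
        "alpha_number G r s A (K n) = ln (real \<mu> / (real n * real m)) / (ln y / 2)"
        by (rule alpha_number_K[OF n norm j(1) x(1,2)]) (rule that)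
      have "ln y \<le> ln (C * (2 * pi / real n) ^ k)" using y(1) y(3)[OF j(1) x(1,2)] xle by simp
      also have "\<dots> = ln (C * (2 * pi) ^ k) - real k * ln (real n)"
        using C n by (simp add: power_divide ln_div ln_realpow)
      finally have ly: "real k * ln (real n) + b \<le> - ln y" by (simp add: b_def)
      have "ln (real \<mu> / (real n * real m)) = ln (real \<mu>) - (ln (real n) + ln (real m))"
        using y(4) n m_pos by (simp add: ln_div ln_mult)
      then have "alpha_number G r s A (K n) = - (ln (real \<mu>) - (ln (real n) + ln (real m))) / (- (ln y / 2))"
        by (simp only: y(6) minus_divide_divide)
      also have "\<dots> = (ln (real n) + ln (real m) - ln (real \<mu>)) / (- ln y / 2)"
        by (simp only: minus_diff_eq minus_divide_left)
      also have "\<dots> \<le> (ln (real n) + ln (real m)) / (- ln y / 2)"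
        using ly elim(2) y(4) by (intro divide_right_mono) auto
      also have "\<dots> \<le> (ln (real n) + ln (real m)) / ((real k * ln (real n) + b) / 2)"
        using ly elim(2) n m_pos by (intro divide_left_mono mult_pos_pos add_nonneg_nonneg) auto
      also have "\<dots> \<le> 2 / real k + \<epsilon>" using elim(1) by simp
      finally show "alpha_number G r s A (K n) \<le> 2 / real k + \<epsilon>" .
    qed
  qed
  then show ?thesis using that unfolding eventually_sequentially by blast
qed

text \<open>For n from \<open>powers_away_from_one\<close>, roots of unity off W keep distance
  \<kappa> / n from W, so y \<ge> c (\<kappa> / n)^k. The multiplicity stays bounded because every
  root of unity that carries y lies within M / n of W.\<close>

lemma alpha_number_lower:
  assumes W: "finite W" "W \<subseteq> sphere 0 1" "w0 \<in> W" and k: "1 \<le> k" and c: "c > 0" and C: "C > 0" and \<delta>: "\<delta> > 0"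
    and lower: "\<And>z x. cmod z = 1 \<Longrightarrow> z \<notin> W \<Longrightarrow> x \<in> set (ev z) \<Longrightarrow> 0 < x \<Longrightarrow> \<exists>w\<in>W. c * cmod (z - w) ^ k \<le> x"
    and lowerW: "\<And>z x. z \<in> W \<Longrightarrow> x \<in> set (ev z) \<Longrightarrow> 0 < x \<Longrightarrow> c \<le> x"
    and upper: "\<And>z. cmod z = 1 \<Longrightarrow> 0 < cmod (z - w0) \<Longrightarrow> cmod (z - w0) < \<delta> \<Longrightarrow> \<exists>x\<in>set (ev z). 0 < x \<and> x \<le> C * cmod (z - w0) ^ k"
    and \<epsilon>: "\<epsilon> > 0" and N: "N > 0"
  shows "\<exists>n>0. N dvd n \<and> (K n \<lhd> G \<longrightarrow> 2 / real k - \<epsilon> \<le> alpha_number G r s A (K n))"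
proof -
  have w0: "cmod w0 = 1" using W by auto
  obtain \<kappa> where \<kappa>: "0 < \<kappa>" "\<kappa> \<le> 1" "\<And>n0. \<exists>n\<ge>n0. N dvd n \<and> (\<forall>w\<in>W. w ^ n = 1 \<or> \<kappa> \<le> cmod (w ^ n - 1))"
    by (rule powers_away_from_one[OF W(1,2) N]) (rule that)
  define b where "b = - ln (c * \<kappa> ^ k)"
  \<comment> \<open>Solves c (M / n)^k = C (2 pi / n)^k: the largest distance from W that the upper
    bound for y allows.\<close>
  define M where "M = 2 * pi * root k (C / c)"
  have M: "M \<ge> 0" "M ^ k = (2 * pi) ^ k * (C / c)"
    using k c C by (simp_all add: M_def power_mult_distrib)
  \<comment> \<open>At most r m eigenvalues at each root of unity, times the number of roots of
    unity within M / n of W.\<close>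
  define L where "L = real (r * m) * (real (card W) * (3 * (2 * M + 1)))"
  have L: "L \<ge> 0" unfolding L_def using M by (intro mult_nonneg_nonneg) auto
  have lim: "(\<lambda>n. (ln (real n) + (ln (real m) - ln (L + 1))) / ((real k * ln (real n) + b) / 2)) \<longlonglongrightarrow> 2 / real k"
    by (rule log_ratio_limit) (use k in simp)
  have lnlim: "filterlim (\<lambda>n. ln (real n)) at_top sequentially"
    by (rule filterlim_compose[OF ln_at_top filterlim_real_sequentially])
  have "\<forall>\<^sub>F n in sequentially. 2 / real k - \<epsilon> < (ln (real n) + (ln (real m) - ln (L + 1))) / ((real k * ln (real n) + b) / 2)"
    by (rule order_tendstoD(1)[OF lim]) (use \<epsilon> in simp)
  \<comment> \<open>Makes the numerator of the limit expression positive, so that passing to the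
    smaller denominator increases the quotient.\<close>
  moreover have "\<forall>\<^sub>F n in sequentially. ln (L + 1) - ln (real m) < ln (real n)"
    using lnlim unfolding filterlim_at_top_dense by blast
  moreover have "\<forall>\<^sub>F n in sequentially. 2 * pi / \<delta> < real n"
    using filterlim_real_sequentially unfolding filterlim_at_top_dense by blast
  \<comment> \<open>Pushes the upper bound for y below c, so that y does not occur over W, and below
    1, so that ln y is negative.\<close>
  moreover have "\<forall>\<^sub>F n in sequentially. 2 * pi * max (C / c) C < real n"
    using filterlim_real_sequentially unfolding filterlim_at_top_dense by blast
  moreover have "\<forall>\<^sub>F n in sequentially. 2 * pi < real n"
    using filterlim_real_sequentially unfolding filterlim_at_top_dense by blast
  moreover have "\<forall>\<^sub>F n :: nat in sequentially. n \<ge> 2" by (rule eventually_ge_at_top)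
  ultimately have ev: "\<forall>\<^sub>F n in sequentially. N dvd n \<and> (\<forall>w\<in>W. w ^ n = 1 \<or> \<kappa> \<le> cmod (w ^ n - 1)) \<longrightarrow>
    n > 0 \<and> (K n \<lhd> G \<longrightarrow> 2 / real k - \<epsilon> \<le> alpha_number G r s A (K n))"
  proof eventually_elim
    case (elim n)
    have n: "n > 0" using elim by simp
    show ?case
    proof (intro impI conjI n)
      assume away: "N dvd n \<and> (\<forall>w\<in>W. w ^ n = 1 \<or> \<kappa> \<le> cmod (w ^ n - 1))" and norm: "K n \<lhd> G"
      obtain j where j: "j < n" "0 < cmod (root_of_unity n j - w0)" "cmod (root_of_unity n j - w0) \<le> 2 * pi / real n"
        by (rule root_of_unity_near[OF w0 elim(6)]) (rule that)
      have "2 * pi / real n < \<delta>" using elim(3) \<delta> n by (simp add: field_simps)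
      then obtain x where x: "x \<in> set (ev (root_of_unity n j))" "0 < x" "x \<le> C * cmod (root_of_unity n j - w0) ^ k"
        using upper[OF cmod_root_of_unity j(2)] j(3) by fastforce
      have "C * cmod (root_of_unity n j - w0) ^ k \<le> C * (2 * pi / real n) ^ k"
        using j(2,3) C by (intro mult_left_mono power_mono) auto
      then have xle: "x \<le> C * (2 * pi / real n) ^ k" using x by linarith
      obtain y \<mu> where y: "0 < y" "\<exists>j<n. y \<in> set (ev (root_of_unity n j))"
        "\<And>j x. j < n \<Longrightarrow> x \<in> set (ev (root_of_unity n j)) \<Longrightarrow> 0 < x \<Longrightarrow> y \<le> x"
        "1 \<le> \<mu>" "\<mu> \<le> (\<Sum>j<n. count_list (ev (root_of_unity n j)) y)"
        "alpha_number G r s A (K n) = ln (real \<mu> / (real n * real m)) / (ln y / 2)"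
        by (rule alpha_number_K[OF n norm j(1) x(1,2)]) (rule that)
      have yle: "y \<le> C * (2 * pi / real n) ^ k" using y(3)[OF j(1) x(1,2)] xle by linarith
      have "(2 * pi / real n) ^ k \<le> (2 * pi / real n) ^ 1"
        using k elim(5) n by (intro power_decreasing) (auto simp: field_simps)
      then have "C * (2 * pi / real n) ^ k \<le> C * (2 * pi / real n)" using C by (intro mult_left_mono) simp_all
      moreover have "2 * pi * (C / c) < real n" "2 * pi * C < real n"
        by (rule le_less_trans[OF mult_left_mono[OF max.cobounded1] elim(4)], simp,
            rule le_less_trans[OF mult_left_mono[OF max.cobounded2] elim(4)], simp)
      then have "C * (2 * pi / real n) < c" "C * (2 * pi / real n) < 1"
        using n c by (simp_all add: field_simps)
      ultimately have small: "y < c" "y < 1" using yle by linarith+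
      have near: "\<exists>w\<in>W. root_of_unity n i \<noteq> w \<and> c * cmod (root_of_unity n i - w) ^ k \<le> y"
        if i: "y \<in> set (ev (root_of_unity n i))" for i
      proof -
        have "root_of_unity n i \<notin> W" using lowerW[OF _ i y(1)] small by fastforce
        moreover from lower[OF cmod_root_of_unity this i y(1)] obtain w
          where "w \<in> W" "c * cmod (root_of_unity n i - w) ^ k \<le> y" by blast
        ultimately show ?thesis by (intro bexI[of _ w]) auto
      qed
      have ly: "- ln y \<le> real k * ln (real n) + b"
      proof -
        obtain i where "y \<in> set (ev (root_of_unity n i))" using y(2) by blast
        from near[OF this] obtain w where w: "w \<in> W" "root_of_unity n i \<noteq> w" "c * cmod (root_of_unity n i - w) ^ k \<le> y" by blast
        have "\<kappa> / real n \<le> cmod (root_of_unity n i - w)"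
          by (rule root_of_unity_away[OF n \<kappa>(1,2) root_of_unity_power[OF n] cmod_root_of_unity _ _ w(2)]) (use w(1) W away in auto)
        then have "c * (\<kappa> / real n) ^ k \<le> c * cmod (root_of_unity n i - w) ^ k"
          using c \<kappa> by (intro mult_left_mono power_mono) auto
        then have "c * (\<kappa> / real n) ^ k \<le> y" using w(3) by linarith
        then have "ln (c * (\<kappa> / real n) ^ k) \<le> ln y" using c \<kappa> n y(1) by (subst ln_le_cancel_iff) auto
        also have "ln (c * (\<kappa> / real n) ^ k) = ln (c * \<kappa> ^ k) - real k * ln (real n)"
          using c \<kappa> n by (simp add: power_divide ln_div ln_realpow)
        finally show ?thesis by (simp add: b_def)
      qed
      have \<mu>L: "real \<mu> \<le> L"
      proof -
        define S where "S = {i. i < n \<and> y \<in> set (ev (root_of_unity n i))}"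
        have "(\<Sum>i<n. count_list (ev (root_of_unity n i)) y) = (\<Sum>i\<in>S. count_list (ev (root_of_unity n i)) y)"
          by (rule sum.mono_neutral_right) (auto simp: S_def count_list_0_iff)
        also have "\<dots> \<le> (\<Sum>i\<in>S. r * m)"
          by (intro sum_mono) (metis count_le_length ev_length)
        finally have "\<mu> \<le> r * m * card S" using y(5) by (simp add: mult.commute)
        then have "real \<mu> \<le> real (r * m) * real (card S)" by (metis of_nat_le_iff of_nat_mult)
        also have "\<dots> \<le> L"
          unfolding L_def
        proof (intro mult_left_mono)
          have "S \<subseteq> (\<Union>w\<in>W. {i. i < n \<and> cmod (root_of_unity n i - w) \<le> M / real n})"
          proof
            fix i assume i: "i \<in> S"
            then obtain w where w: "w \<in> W" "c * cmod (root_of_unity n i - w) ^ k \<le> y" using near[of i] by (auto simp: S_def)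
            have "cmod (root_of_unity n i - w) ^ k \<le> C * (2 * pi / real n) ^ k / c" using w(2) yle c by (simp add: pos_le_divide_eq mult.commute)
            also have "\<dots> = (M / real n) ^ k" unfolding power_divide M(2) by (simp add: mult_ac)
            finally have "cmod (root_of_unity n i - w) \<le> M / real n"
              using k M n by (intro power_mono_iff[THEN iffD1, of "cmod (root_of_unity n i - w)" "M / real n" k]) auto
            then show "i \<in> (\<Union>w\<in>W. {i. i < n \<and> cmod (root_of_unity n i - w) \<le> M / real n})" using w(1) i by (auto simp: S_def)
          qed
          then have "card S \<le> card (\<Union>w\<in>W. {i. i < n \<and> cmod (root_of_unity n i - w) \<le> M / real n})"
            by (intro card_mono) (use W in auto)
          also have "\<dots> \<le> (\<Sum>w\<in>W. card {i. i < n \<and> cmod (root_of_unity n i - w) \<le> M / real n})" by (rule card_UN_le[OF W(1)])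
          finally have "real (card S) \<le> real (\<Sum>w\<in>W. card {i. i < n \<and> cmod (root_of_unity n i - w) \<le> M / real n})" by (rule of_nat_mono)
          also have "\<dots> = (\<Sum>w\<in>W. real (card {i. i < n \<and> cmod (root_of_unity n i - w) \<le> M / real n}))" by (rule of_nat_sum)
          also have "\<dots> \<le> (\<Sum>w\<in>W. 3 * (2 * M + 1))"
            by (intro sum_mono card_roots_of_unity_near n M(1)) (use W in auto)
          finally show "real (card S) \<le> real (card W) * (3 * (2 * M + 1))" by simp
        qed simp
        finally show ?thesis .
      qed
      have lny: "ln y < 0" using y(1) small by simp
      have "ln (real \<mu>) \<le> ln (L + 1)" using \<mu>L y(4) by simp
      moreover have "ln (real \<mu> / (real n * real m)) = ln (real \<mu>) - (ln (real n) + ln (real m))"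
        using y(4) n m_pos by (simp add: ln_div ln_mult)
      ultimately have num: "ln (real n) + (ln (real m) - ln (L + 1)) \<le> - ln (real \<mu> / (real n * real m))" by linarith
      have "2 / real k - \<epsilon> \<le> (ln (real n) + (ln (real m) - ln (L + 1))) / ((real k * ln (real n) + b) / 2)"
        using elim(1) by simp
      also have "\<dots> \<le> (ln (real n) + (ln (real m) - ln (L + 1))) / (- ln y / 2)"
        using ly lny elim(2) by (intro divide_left_mono mult_pos_pos) auto
      also have "\<dots> \<le> (- ln (real \<mu> / (real n * real m))) / (- ln y / 2)"
        using num lny by (intro divide_right_mono) auto
      also have "\<dots> = alpha_number G r s A (K n)"
        by (simp only: y(6) minus_divide_divide minus_divide_left[symmetric])
      finally show "2 / real k - \<epsilon> \<le> alpha_number G r s A (K n)" .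
    qed
  qed
  then obtain n0 where "\<And>n. n \<ge> n0 \<Longrightarrow> N dvd n \<and> (\<forall>w\<in>W. w ^ n = 1 \<or> \<kappa> \<le> cmod (w ^ n - 1)) \<longrightarrow>
    n > 0 \<and> (K n \<lhd> G \<longrightarrow> 2 / real k - \<epsilon> \<le> alpha_number G r s A (K n))"
    unfolding eventually_sequentially by blast
  then show ?thesis using \<kappa>(3)[of n0] by blast
qed

end

section \<open>The upper limit along finite index normal subgroups\<close>


context group begin

lemma rcos_eq_iff:
  assumes H: "subgroup H G" and g: "g \<in> carrier G" and h: "h \<in> carrier G"
  shows "H #> g = H #> h \<longleftrightarrow> g \<otimes> inv h \<in> H"
  using subgroup.rcos_module[OF H is_group h g] repr_independence[OF _ h H, of g] rcos_self[OF g H] by auto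

lemma finite_index_power:
  assumes H: "subgroup H G" and fin: "finite (rcosets H)" and g: "g \<in> carrier G"
  obtains e :: nat where "e > 0" "g [^] e \<in> H"
proof -
  have "range (\<lambda>i :: nat. H #> g [^] i) \<subseteq> rcosets H" using g by (auto intro!: rcosetsI subgroup.subset[OF H])
  then have "finite (range (\<lambda>i :: nat. H #> g [^] i))" using fin by (rule finite_subset)
  then have "\<not> inj (\<lambda>i :: nat. H #> g [^] i)" using finite_imageD infinite_UNIV_nat by blast
  then obtain i j :: nat where ij: "i < j" "H #> g [^] j = H #> g [^] i" unfolding inj_on_def by (metis linorder_neqE_nat)
  have "g [^] j = g [^] (j - i) \<otimes> g [^] i" using ij g by (simp add: nat_pow_mult)
  then have "g [^] (j - i) = g [^] j \<otimes> inv (g [^] i)" using g by (simp add: m_assoc)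
  then have "g [^] (j - i) \<in> H" using ij(2) rcos_eq_iff[OF H, of "g [^] j" "g [^] i"] g by simp
  then show ?thesis using that[of "j - i"] ij(1) by simp
qed

lemma int_pow_conj:
  assumes g: "g \<in> carrier G" and u: "u \<in> carrier G"
  shows "g \<otimes> u [^] (k :: int) \<otimes> inv g = (g \<otimes> u \<otimes> inv g) [^] k"
proof -
  have mult: "g \<otimes> (a \<otimes> b) \<otimes> inv g = (g \<otimes> a \<otimes> inv g) \<otimes> (g \<otimes> b \<otimes> inv g)" if "a \<in> carrier G" "b \<in> carrier G" for a b
  proof -
    have "(g \<otimes> a \<otimes> inv g) \<otimes> (g \<otimes> b \<otimes> inv g) = g \<otimes> a \<otimes> ((inv g \<otimes> g) \<otimes> (b \<otimes> inv g))"
      using g that by (simp only: m_assoc m_closed inv_closed)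
    then show ?thesis using g that by (simp add: m_assoc)
  qed
  have nat: "g \<otimes> u [^] (n :: nat) \<otimes> inv g = (g \<otimes> u \<otimes> inv g) [^] n" for n
    by (induction n) (use g u in \<open>simp_all add: mult\<close>)
  show ?thesis
  proof (cases k rule: int_cases2)
    case (nonneg n)
    then show ?thesis by (simp add: int_pow_int nat)
  next
    case (nonpos n)
    have "g \<otimes> inv (u [^] n) \<otimes> inv g = inv (g \<otimes> u [^] n \<otimes> inv g)"
      using g u by (simp add: inv_mult_group m_assoc)
    then show ?thesis using g u by (simp add: nonpos int_pow_neg int_pow_int nat)
  qed
qed

text \<open>The regular representation of G has a finite eigenvalue list, so the distribution
  function is constant near 0. It arises here as the quotient by the trivial subgroup.\<close>

lemma finite_group_novikov_shubin:
  assumes fin: "finite (carrier G)" and A: "group_ring_mat G r s A"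
  shows "novikov_shubin G r s A = Infinity_plus"
proof -
  have sg: "subgroup {\<one>} G" by (rule triv_subgroup)
  have "rcosets {\<one>} \<subseteq> Pow (carrier G)" using subgroup.rcosets_carrier[OF sg is_group] by blast
  then have finc: "finite (rcosets {\<one>})" using fin by (meson finite_Pow_iff finite_subset)
  define n where "n = card (rcosets {\<one>})"
  have "rcosets {\<one>} \<noteq> {}" using rcosetsI[OF subgroup.subset[OF sg] one_closed] by blast
  then have n: "n > 0" using finc by (simp add: n_def card_gt_0_iff)
  obtain \<pi> where \<pi>: "matrix_rep G n \<pi>" "\<And>g. g \<in> carrier G \<Longrightarrow> (\<Sum>a<n. \<pi> a a g) = (if g \<in> {\<one>} then of_nat n else 0)"
    by (rule regular_mat_rep[OF one_is_normal finc A]) (rule that, unfold n_def)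
  define xs where "xs = psd_eigs (rep_mat n r s \<pi> A)"
  let ?B = "gr_mat_times G s A (gr_mat_adjoint G A)"
  have B: "group_ring_mat G r r ?B" by (rule gr_mat_times_mat[OF A gr_adjoint_mat[OF A]])
  have ps: "power_sum k xs = real n * Re (\<Sum>i<r. gr_mat_pow r ?B k i i \<one>)" for k
  proof -
    have "complex_of_real (power_sum k xs) = (\<Sum>i<r. gr_eval (gr_mat_pow r ?B k i i) (\<lambda>g. \<Sum>a<n. \<pi> a a g))"
      unfolding power_sum_def xs_def by (rule rep_eigs_power_sum[OF \<pi>(1) A])
    also have "\<dots> = (\<Sum>i<r. of_nat n * gr_mat_pow r ?B k i i \<one>)"
    proof (intro sum.cong refl)
      fix i assume "i \<in> {..<r}"
      then have e: "gr_elem G (gr_mat_pow r ?B k i i)" using gr_mat_elem[OF gr_mat_pow_mat[OF B]] by auto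
      have "gr_eval (gr_mat_pow r ?B k i i) (\<lambda>g. \<Sum>a<n. \<pi> a a g) = gr_eval (gr_mat_pow r ?B k i i) (\<lambda>g. if g = \<one> then of_nat n else 0)"
        unfolding gr_eval_def using gr_elemD(2)[OF e] by (intro sum.cong refl) (auto simp: \<pi>(2))
      also have "\<dots> = (\<Sum>g\<in>insert \<one> {g. gr_mat_pow r ?B k i i g \<noteq> 0}. gr_mat_pow r ?B k i i g * (if g = \<one> then of_nat n else 0))"
        by (rule gr_eval_superset) (use gr_elemD(1)[OF e] in auto)
      also have "\<dots> = of_nat n * gr_mat_pow r ?B k i i \<one>"
        using gr_elemD(1)[OF e] by (simp add: if_distrib[where f="\<lambda>x. _ * x"] sum.delta cong: if_cong)
      finally show "gr_eval (gr_mat_pow r ?B k i i) (\<lambda>g. \<Sum>a<n. \<pi> a a g) = of_nat n * gr_mat_pow r ?B k i i \<one>" .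
    qed
    finally have "Re (complex_of_real (power_sum k xs)) = Re (of_nat n * (\<Sum>i<r. gr_mat_pow r ?B k i i \<one>))"
      by (simp only: sum_distrib_left)
    then show ?thesis by simp
  qed
  \<comment> \<open>A one-point parameter space takes the place of the circle.\<close>
  define \<Theta> where "\<Theta> = return (count_space UNIV) ()"
  interpret \<Theta>: prob_space \<Theta> unfolding \<Theta>_def by (rule prob_space_return) simp
  have "\<exists>l>0. \<forall>x\<in>set xs. 0 < x \<longrightarrow> l\<^sup>2 < x"
  proof (intro exI conjI ballI impI)
    define u where "u = Min (insert 1 {x \<in> set xs. 0 < x})"
    have u: "0 < u" "\<And>x. x \<in> set xs \<Longrightarrow> 0 < x \<Longrightarrow> u \<le> x" by (auto simp: u_def)
    show "sqrt (u / 2) > 0" using u by simp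
    show "(sqrt (u / 2))\<^sup>2 < x" if "x \<in> set xs" "0 < x" for x using u(1) u(2)[OF that] by simp
  qed
  then obtain l where l: "l > 0" "\<And>x. x \<in> set xs \<Longrightarrow> 0 < x \<Longrightarrow> l\<^sup>2 < x" by blast
  have pos: "0 \<le> x" if "x \<in> set xs" for x using that psd_eigs(2)[OF rep_mat_carrier] unfolding xs_def by blast
  have "(\<integral>\<theta>. real (length (filter (\<lambda>x. 0 < x \<and> x \<le> l\<^sup>2) xs)) \<partial>\<Theta>) = real n * (spectral_distribution G r s A l - spectral_distribution G r s A 0)"
  proof (rule spectral_distribution_diff(2)[where ev = "\<lambda>_. xs" and M' = "sum_list xs" and d = "length xs", OF A \<Theta>.finite_measure_axioms pos])
    show "x \<le> sum_list xs" if "x \<in> set xs" for x using that pos by (intro member_le_sum_list) auto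
  qed (use ps in \<open>simp_all add: \<Theta>.prob_space\<close>)
  moreover have "filter (\<lambda>x. 0 < x \<and> x \<le> l\<^sup>2) xs = []" using l(2) by (fastforce simp: filter_empty_conv)
  ultimately have "spectral_distribution G r s A l = spectral_distribution G r s A 0" using n by simp
  then show ?thesis by (rule novikov_shubin_Infinity_plus[OF l(1)])
qed

text \<open>A finite index subgroup of an infinite group is infinite, so x has infinite order: a
  relation x^k = 1 with k \<noteq> 0 would leave at most |k| powers.\<close>

lemma infinite_cyclic_transversal_exists:
  assumes x: "x \<in> carrier G" and fin: "finite (rcosets (generate G {x}))" and inf: "infinite (carrier G)"
  obtains t m where "infinite_cyclic_transversal G x t m"
proof -
  define Z where "Z = generate G {x}"
  have Z: "Z = range (\<lambda>k :: int. x [^] k)" unfolding Z_def generate_pow[OF x] by auto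
  have sg: "subgroup Z G" unfolding Z_def by (rule generate_is_subgroup) (use x in simp)
  have "infinite Z"
  proof
    assume "finite Z"
    then have "finite (\<Union> (rcosets Z))" using fin rcosets_finite[OF _ subgroup.subset[OF sg]] unfolding Z_def[symmetric] by blast
    then show False using inf rcosets_part_G[OF sg] by simp
  qed
  have x_inf: "k = 0" if k: "x [^] k = \<one>" for k :: int
  proof (rule ccontr)
    assume "k \<noteq> 0"
    have "Z \<subseteq> (\<lambda>i. x [^] i) ` {0..<\<bar>k\<bar>}"
    proof
      fix u assume "u \<in> Z"
      then obtain i :: int where i: "u = x [^] i" by (auto simp: Z)
      have "x [^] (k * (i div k)) = \<one>" using x k by (simp add: int_pow_pow[symmetric])
      then have k': "x [^] (\<bar>k\<bar> * (i div \<bar>k\<bar>)) = \<one>" using x k by (cases "k \<ge> 0") (simp_all add: int_pow_pow[symmetric] int_pow_neg)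
      have "u = x [^] (\<bar>k\<bar> * (i div \<bar>k\<bar>) + i mod \<bar>k\<bar>)" by (simp add: i)
      also have "\<dots> = x [^] (i mod \<bar>k\<bar>)" unfolding int_pow_mult[OF x] k' using x by simp
      finally show "u \<in> (\<lambda>i. x [^] i) ` {0..<\<bar>k\<bar>}" using \<open>k \<noteq> 0\<close> by (intro image_eqI[of _ _ "i mod \<bar>k\<bar>"]) auto
    qed
    then show False using \<open>infinite Z\<close> finite_subset by blast
  qed
  define m where "m = card (rcosets Z)"
  obtain f where f: "bij_betw f {..<m} (rcosets Z)"
    using ex_bij_betw_nat_finite[OF fin] unfolding m_def Z_def atLeast0LessThan by blast
  have "\<forall>a\<in>{..<m}. \<exists>g. g \<in> carrier G \<and> f a = Z #> g"
    using bij_betwE[OF f] unfolding RCOSETS_def by blast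
  then obtain t where t: "\<And>a. a < m \<Longrightarrow> t a \<in> carrier G" "\<And>a. a < m \<Longrightarrow> f a = Z #> t a"
    unfolding Ball_def lessThan_iff by metis
  have "infinite_cyclic_transversal G x t m"
  proof (intro_locales, unfold_locales)
    fix g assume g: "g \<in> carrier G"
    have "Z #> g \<in> rcosets Z" using g by (intro rcosetsI subgroup.subset[OF sg])
    then have "Z #> g \<in> f ` {..<m}" unfolding bij_betw_imp_surj_on[OF f] .
    then obtain a where a: "a \<in> {..<m}" "Z #> g = f a" by (rule imageE)
    have "\<exists>!a. a \<in> {..<m} \<and> f a = Z #> g"
    proof (rule ex1I[of _ a])
      show "a' = a" if "a' \<in> {..<m} \<and> f a' = Z #> g" for a'
        using that a by (intro inj_onD[OF bij_betw_imp_inj_on[OF f]]) auto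
    qed (use a in auto)
    moreover have "a \<in> {..<m} \<and> f a = Z #> g \<longleftrightarrow> a < m \<and> g \<otimes> inv (t a) \<in> range (\<lambda>k :: int. x [^] k)" for a
      using rcos_eq_iff[OF sg g t(1), of a] t(2)[of a] unfolding Z by auto
    ultimately show "\<exists>!a. a < m \<and> g \<otimes> inv (t a) \<in> range (\<lambda>k :: int. x [^] k)" by simp
  qed (use x x_inf t in auto)
  then show ?thesis by (rule that)
qed

end

section \<open>Finite index subgroups inside the infinite cyclic subgroup\<close>

context infinite_cyclic_transversal begin

lemma Z_eq_K: "Z = K 1" by (simp add: Z_def K_def)

lemma finite_rcosets_Z: "finite (rcosets Z)" unfolding Z_eq_K by (rule card_K_cosets(2)) simp

lemma K_mono: "n dvd n' \<Longrightarrow> K n' \<subseteq> K n"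
  by (auto simp: K_def dvd_def mult.assoc)

lemma K_subset_iff: "K n' \<subseteq> K n \<longleftrightarrow> n dvd n'"
proof
  assume *: "K n' \<subseteq> K n"
  have "x [^] int n' \<in> K n'" by (simp add: K_iff)
  then have "x [^] int n' \<in> K n" using * by blast
  then show "n dvd n'" by (simp only: K_iff int_dvd_int_iff)
qed (rule K_mono)

text \<open>The exponent e excludes the trivial subgroup; d is the least positive exponent in H, and
  division with remainder shows that it generates.\<close>

lemma subgroup_of_Z:
  assumes H: "subgroup H G" "H \<subseteq> Z" and e: "e > 0" "x [^] int e \<in> H"
  obtains d where "d > 0" "H = K d"
proof -
  define d where "d = (LEAST d. d > 0 \<and> x [^] int d \<in> H)"
  have d: "d > 0" "x [^] int d \<in> H" using LeastI[of "\<lambda>d. d > 0 \<and> x [^] int d \<in> H" e] e by (auto simp: d_def)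
  have least: "d \<le> d'" if "d' > 0" "x [^] int d' \<in> H" for d' unfolding d_def by (rule Least_le) (use that in simp)
  have pw: "x [^] (int d * k) \<in> H" for k :: int
    using subgroup_int_pow_closed[OF H(1) d(2), of k] by (simp add: int_pow_pow)
  have "H = K d"
  proof
    show "K d \<subseteq> H" using pw by (auto simp: K_def)
    show "H \<subseteq> K d"
    proof
      fix u assume u: "u \<in> H"
      then obtain k :: int where k: "u = x [^] k" using H(2) by (auto simp: Z_def)
      have "x [^] (k + int d * (- (k div int d))) \<in> H"
        unfolding int_pow_mult[OF x] using subgroup.m_closed[OF H(1) u pw] unfolding k .
      then have "x [^] (k mod int d) \<in> H" by (simp add: minus_mult_div_eq_mod[symmetric])
      moreover have j: "int (nat (k mod int d)) = k mod int d" "nat (k mod int d) < d" using d(1) by (simp_all add: nat_less_iff)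
      ultimately have "nat (k mod int d) = 0" using least[of "nat (k mod int d)"] by force
      then have "k mod int d = 0" using j(1) by linarith
      then have "int d dvd k" by (rule dvd_eq_mod_eq_0[THEN iffD2])
      then show "u \<in> K d" unfolding k K_iff .
    qed
  qed
  then show ?thesis using that d(1) by blast
qed

lemma finite_index_contains_K:
  assumes H: "subgroup H G" "finite (rcosets H)"
  obtains N where "N > 0" "K N \<subseteq> H"
proof -
  obtain e :: nat where e: "e > 0" "x [^] e \<in> H" by (rule finite_index_power[OF H x]) (rule that)
  have "K e \<subseteq> H"
  proof
    fix u assume "u \<in> K e"
    then obtain k :: int where "u = x [^] (int e * k)" by (auto simp: K_def)
    then have "u = (x [^] e) [^] k" by (simp add: int_pow_pow[symmetric] int_pow_int)
    then show "u \<in> H" using subgroup_int_pow_closed[OF H(1) e(2)] by simp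
  qed
  then show ?thesis using that e(1) by blast
qed

lemma finite_index_subgroup_of_Z:
  assumes H: "subgroup H G" "finite (rcosets H)" "H \<subseteq> Z"
  obtains d where "d > 0" "H = K d"
proof -
  obtain N where N: "N > 0" "K N \<subseteq> H" by (rule finite_index_contains_K[OF H(1,2)]) (rule that)
  have "x [^] int N \<in> K N" by (simp add: K_iff)
  then have "x [^] int N \<in> H" using N(2) by blast
  then show ?thesis by (rule subgroup_of_Z[OF H(1,3) N(1)]) (rule that)
qed

text \<open>The normal core of the infinite cyclic subgroup has finite index, hence is some \<open>K d\<close>, and
  subgroups of a normal cyclic subgroup are again normal.\<close>

lemma normal_K_exists:
  obtains d where "d > 0" "\<And>n. K (d * n) \<lhd> G"
proof -
  have sgZ: "subgroup Z G" unfolding Z_eq_K by (rule K_subgroup)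
  have "\<forall>a. \<exists>e. a < m \<longrightarrow> e > 0 \<and> (t a \<otimes> x \<otimes> inv (t a)) [^] (e :: nat) \<in> Z"
    using finite_index_power[OF sgZ finite_rcosets_Z] by (metis t inv_closed m_closed x)
  then obtain e :: "nat \<Rightarrow> nat" where e: "\<And>a. a < m \<Longrightarrow> e a > 0" "\<And>a. a < m \<Longrightarrow> (t a \<otimes> x \<otimes> inv (t a)) [^] e a \<in> Z" by metis
  \<comment> \<open>A common exponent that brings the conjugates of x by all \<open>t a\<close> back
    into Z.\<close>
  define E where "E = (\<Prod>a<m. e a)"
  have E: "E > 0" using e by (simp add: E_def prod_pos)
  have tE: "t a \<otimes> x [^] int E \<otimes> inv (t a) \<in> Z" if a: "a < m" for a
  proof -
    have "e a dvd E" using a by (simp add: E_def dvd_prod_eqI)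
    then obtain b where b: "E = e a * b" by (elim dvdE)
    have "t a \<otimes> x [^] int E \<otimes> inv (t a) = (t a \<otimes> x \<otimes> inv (t a)) [^] int E"
      using a by (intro int_pow_conj) auto
    also have "\<dots> = ((t a \<otimes> x \<otimes> inv (t a)) [^] int (e a)) [^] int b"
      using a by (subst int_pow_pow) (simp_all add: b)
    also have "(t a \<otimes> x \<otimes> inv (t a)) [^] int (e a) = (t a \<otimes> x \<otimes> inv (t a)) [^] e a" by (rule int_pow_int)
    finally show ?thesis using subgroup_int_pow_closed[OF sgZ e(2)[OF a]] by simp
  qed
  define C where "C = {u \<in> carrier G. \<forall>g\<in>carrier G. g \<otimes> u \<otimes> inv g \<in> Z}"
  have sgC: "subgroup C G"
  proof
    show "C \<subseteq> carrier G" by (auto simp: C_def)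
    show "\<one> \<in> C" using Z_one by (simp add: C_def)
  next
    fix u v assume uv: "u \<in> C" "v \<in> C"
    have "g \<otimes> (u \<otimes> v) \<otimes> inv g \<in> Z" if g: "g \<in> carrier G" for g
    proof -
      have uv': "u \<in> carrier G" "v \<in> carrier G" using uv by (auto simp: C_def)
      have "(g \<otimes> u \<otimes> inv g) \<otimes> (g \<otimes> v \<otimes> inv g) = g \<otimes> u \<otimes> ((inv g \<otimes> g) \<otimes> (v \<otimes> inv g))"
        using g uv' by (simp only: m_assoc m_closed inv_closed)
      then have "(g \<otimes> u \<otimes> inv g) \<otimes> (g \<otimes> v \<otimes> inv g) = g \<otimes> (u \<otimes> v) \<otimes> inv g" using g uv' by (simp add: m_assoc)
      then show ?thesis using Z_mult[of "g \<otimes> u \<otimes> inv g" "g \<otimes> v \<otimes> inv g"] uv g by (simp add: C_def)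
    qed
    then show "u \<otimes> v \<in> C" using uv by (simp add: C_def)
  next
    fix u assume u: "u \<in> C"
    have "g \<otimes> inv u \<otimes> inv g \<in> Z" if g: "g \<in> carrier G" for g
    proof -
      have "g \<otimes> inv u \<otimes> inv g = inv (g \<otimes> u \<otimes> inv g)" using g u by (simp add: C_def inv_mult_group m_assoc)
      then show ?thesis using Z_inv u g by (simp add: C_def)
    qed
    then show "inv u \<in> C" using u by (simp add: C_def)
  qed
  have normC: "g \<otimes> u \<otimes> inv g \<in> C" if u: "u \<in> C" and g: "g \<in> carrier G" for g u
  proof -
    have "h \<otimes> (g \<otimes> u \<otimes> inv g) \<otimes> inv h \<in> Z" if h: "h \<in> carrier G" for h
    proof -
      have "h \<otimes> (g \<otimes> u \<otimes> inv g) \<otimes> inv h = (h \<otimes> g) \<otimes> u \<otimes> inv (h \<otimes> g)"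
        using g h u by (simp add: C_def inv_mult_group m_assoc)
      then show ?thesis using u g h by (simp add: C_def)
    qed
    then show ?thesis using u g by (simp add: C_def)
  qed
  have CZ: "C \<subseteq> Z"
  proof
    fix u assume "u \<in> C"
    then have "\<one> \<otimes> u \<otimes> inv \<one> \<in> Z" "u \<in> carrier G" using one_closed unfolding C_def by blast+
    then show "u \<in> Z" by simp
  qed
  have xE: "x [^] int E \<in> C"
  proof -
    have "g \<otimes> x [^] int E \<otimes> inv g \<in> Z" if g: "g \<in> carrier G" for g
    proof -
      obtain a where a: "a < m" "g \<otimes> inv (t a) \<in> Z" using transversal_ex[OF g] .
      \<comment> \<open>Every g is z \<open>t a\<close> with z in Z, and conjugation by z preserves
        Z, so conjugation by the transversal decides.\<close>
      define z where "z = g \<otimes> inv (t a)"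
      have gz: "g = z \<otimes> t a" using g a by (simp add: z_def m_assoc)
      have z: "z \<in> carrier G" "z \<in> Z" using a g by (simp_all add: z_def)
      have "g \<otimes> x [^] int E \<otimes> inv g = z \<otimes> (t a \<otimes> x [^] int E \<otimes> inv (t a)) \<otimes> inv z"
        unfolding gz using z a by (simp add: inv_mult_group m_assoc)
      then show ?thesis using Z_mult Z_inv z tE[OF a(1)] by simp
    qed
    then show ?thesis by (simp add: C_def)
  qed
  obtain d where d: "d > 0" "C = K d" by (rule subgroup_of_Z[OF sgC CZ E xE]) (rule that)
  have xd: "x [^] int d \<in> C" by (simp add: d K_iff)
  have "K (d * n) \<lhd> G" for n
  proof (rule normal_invI[OF K_subgroup])
    fix g u assume g: "g \<in> carrier G" and "u \<in> K (d * n)"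
    then obtain k :: int where u: "u = (x [^] int d) [^] (int n * k)" by (auto simp: K_def int_pow_pow mult.assoc)
    have "g \<otimes> x [^] int d \<otimes> inv g \<in> K d" using normC[OF xd g] d(2) by simp
    then obtain l :: int where l: "g \<otimes> x [^] int d \<otimes> inv g = x [^] (int d * l)" by (auto simp: K_def)
    have "g \<otimes> u \<otimes> inv g = (x [^] (int d * l)) [^] (int n * k)" unfolding u int_pow_conj[OF g xpow] l ..
    then show "g \<otimes> u \<otimes> inv g \<in> K (d * n)" by (simp add: int_pow_pow K_iff)
  qed
  then show ?thesis using that d(1) by blast
qed

end

text \<open>The subgroups K (d n) are cofinal. Every H below K n1 is some K n with n1 dividing n, so
  the eventual upper estimate covers a whole tail; and every H contains some K N, below which good
  multiples of N d are found.\<close>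

lemma (in equivariant_matrix) novikov_shubin_eq_limsup:
  assumes lt: "novikov_shubin G r s A < Infinity_plus"
  shows "novikov_shubin G r s A = NS_val (net_limsup (finite_index_normal G) (alpha_number G r s A))"
proof -
  obtain N PP where "\<And>z. cmod z = 1 \<Longrightarrow> map_poly (\<lambda>p. poly p z) PP = (\<Prod>x\<leftarrow>ev z. [:- (z ^ N * complex_of_real x), 1:])"
    by (rule char_poly_family) (rule that)
  from ev_length ev_nonneg this show ?thesis
  proof (rule eigenvalue_family_dichotomy)
    fix c :: real assume c: "c > 0" "\<And>z x. cmod z = 1 \<Longrightarrow> x \<in> set (ev z) \<Longrightarrow> 0 < x \<Longrightarrow> c \<le> x"
    have "novikov_shubin G r s A = Infinity_plus" by (rule novikov_shubin_gap[OF c])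
    then show ?thesis using lt by simp
  next
    fix W w0 k and c C \<delta> :: real
    assume W: "finite W" "W \<subseteq> sphere 0 1" "w0 \<in> W" and k: "1 \<le> k" and c: "c > 0" and C: "C > 0" and \<delta>: "\<delta> > 0"
      and lower: "\<And>z x. cmod z = 1 \<Longrightarrow> z \<notin> W \<Longrightarrow> x \<in> set (ev z) \<Longrightarrow> 0 < x \<Longrightarrow> \<exists>w\<in>W. c * cmod (z - w) ^ k \<le> x"
      and lowerW: "\<And>z x. z \<in> W \<Longrightarrow> x \<in> set (ev z) \<Longrightarrow> 0 < x \<Longrightarrow> c \<le> x"
      and upper: "\<And>z. cmod z = 1 \<Longrightarrow> 0 < cmod (z - w0) \<Longrightarrow> cmod (z - w0) < \<delta> \<Longrightarrow> \<exists>x\<in>set (ev z). 0 < x \<and> x \<le> C * cmod (z - w0) ^ k"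
    have ns: "novikov_shubin G r s A = NS_val (ereal (2 / real k))"
      by (rule novikov_shubin_zeros[OF W k c C \<delta> lower lowerW upper])
    obtain d where d: "d > 0" "\<And>n. K (d * n) \<lhd> G" by (rule normal_K_exists) (rule that)
    let ?F = "finite_index_normal G" and ?\<alpha> = "alpha_number G r s A"
    have mem: "K n \<in> ?F" if "n > 0" "K n \<lhd> G" for n
      unfolding finite_index_normal_def using that card_K_cosets(2) by simp
    have w0: "cmod w0 = 1" using W by auto
    have le: "net_limsup ?F ?\<alpha> \<le> ereal (2 / real k)"
    proof (rule ereal_le_epsilon2)
      fix \<epsilon> :: real assume \<epsilon>: "0 < \<epsilon>"
      obtain n0 where n0: "\<And>n. n \<ge> n0 \<Longrightarrow> K n \<lhd> G \<Longrightarrow> ?\<alpha> (K n) \<le> 2 / real k + \<epsilon>"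
        by (rule alpha_number_upper[OF w0 k C \<delta> upper \<epsilon>]) (assumption+, rule that)
      \<comment> \<open>The factor d makes K n1 normal, and \<open>Suc n0\<close> makes n1 positive
        and at least n0.\<close>
      define n1 where "n1 = d * Suc n0"
      have n1: "n1 > 0" "n0 \<le> n1" using d(1) mult_le_mono[of 1 d n0 "Suc n0"] by (auto simp: n1_def)
      have norm1: "K n1 \<lhd> G" unfolding n1_def by (rule d(2))
      have "net_limsup ?F ?\<alpha> \<le> (SUP H\<in>{H \<in> ?F. H \<subseteq> K n1}. ereal (?\<alpha> H))"
        unfolding net_limsup_def by (rule INF_lower[OF mem[OF n1(1) norm1]])
      also have "\<dots> \<le> ereal (2 / real k) + ereal \<epsilon>"
      proof (rule SUP_least)
        fix H assume "H \<in> {H \<in> ?F. H \<subseteq> K n1}"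
        then have H: "H \<lhd> G" "finite (rcosets H)" "H \<subseteq> K n1" by (auto simp: finite_index_normal_def)
        obtain n where n: "n > 0" "H = K n"
          by (rule finite_index_subgroup_of_Z[OF normal_imp_subgroup[OF H(1)] H(2)]) (use H(3) K_subset in blast, rule that)
        have "n1 dvd n" using H(3) unfolding n(2) K_subset_iff .
        from dvd_imp_le[OF this n(1)] have "n0 \<le> n" using n1(2) by linarith
        then show "ereal (?\<alpha> H) \<le> ereal (2 / real k) + ereal \<epsilon>" using n0[of n] H(1) unfolding n(2) by simp
      qed
      finally show "net_limsup ?F ?\<alpha> \<le> ereal (2 / real k) + ereal \<epsilon>" .
    qed
    have ge: "ereal (2 / real k) \<le> net_limsup ?F ?\<alpha>"
      unfolding net_limsup_def
    proof (rule INF_greatest)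
      fix H assume "H \<in> ?F"
      then have H: "H \<lhd> G" "finite (rcosets H)" by (auto simp: finite_index_normal_def)
      obtain N where N: "N > 0" "K N \<subseteq> H"
        by (rule finite_index_contains_K[OF normal_imp_subgroup[OF H(1)] H(2)]) (rule that)
      show "ereal (2 / real k) \<le> (SUP H\<in>{H' \<in> ?F. H' \<subseteq> H}. ereal (?\<alpha> H))"
      proof (rule ereal_le_epsilon2)
        fix \<epsilon> :: real assume \<epsilon>: "0 < \<epsilon>"
        \<comment> \<open>Divisibility by N puts K n inside H and divisibility by d makes it
          normal.\<close>
        have "N * d > 0" using N d by simp
        have "\<exists>n>0. N * d dvd n \<and> (K n \<lhd> G \<longrightarrow> 2 / real k - \<epsilon> \<le> ?\<alpha> (K n))"
          by (rule alpha_number_lower[OF W k c C \<delta> lower lowerW upper \<epsilon> \<open>N * d > 0\<close>])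
        then obtain n where n: "n > 0" "N * d dvd n" "K n \<lhd> G \<longrightarrow> 2 / real k - \<epsilon> \<le> ?\<alpha> (K n)"
          by (elim exE conjE) (rule that)
        obtain b where "n = N * d * b" using n(2) by (elim dvdE)
        then have "n = d * (N * b)" by (simp only: mult_ac)
        then have norm: "K n \<lhd> G" using d(2)[of "N * b"] by (simp only:)
        have "K n \<subseteq> H" by (rule order_trans[OF K_mono[OF dvd_mult_left[OF n(2)]] N(2)])
        then have "ereal (?\<alpha> (K n)) \<le> (SUP H\<in>{H' \<in> ?F. H' \<subseteq> H}. ereal (?\<alpha> H))"
          by (intro SUP_upper) (use mem[OF n(1) norm] in simp)
        then have "ereal (?\<alpha> (K n)) + ereal \<epsilon> \<le> (SUP H\<in>{H' \<in> ?F. H' \<subseteq> H}. ereal (?\<alpha> H)) + ereal \<epsilon>"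
          by (rule add_right_mono)
        moreover have "ereal (2 / real k) \<le> ereal (?\<alpha> (K n)) + ereal \<epsilon>" using n(3) norm by simp
        ultimately show "ereal (2 / real k) \<le> (SUP H\<in>{H' \<in> ?F. H' \<subseteq> H}. ereal (?\<alpha> H)) + ereal \<epsilon>" by (rule order_trans[rotated])
      qed
    qed
    show ?thesis unfolding ns using le ge by simp
  qed
qed

lemma virtually_cyclic_novikov_shubin:
  assumes G: "virtually_cyclic G" and A: "group_ring_mat G r s A" and lt: "novikov_shubin G r s A < Infinity_plus"
  shows "novikov_shubin G r s A = NS_val (net_limsup (finite_index_normal G) (alpha_number G r s A))"
proof -
  interpret group G using G by (simp add: virtually_cyclic_def)
  obtain x where x: "x \<in> carrier G" "finite (rcosets\<^bsub>G\<^esub> (generate G {x}))" using G by (auto simp: virtually_cyclic_def)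
  show ?thesis
  proof (cases "finite (carrier G)")
    case True
    \<comment> \<open>A finite group contradicts the assumption \<open>lt\<close>.\<close>
    have "novikov_shubin G r s A = Infinity_plus" by (rule finite_group_novikov_shubin[OF True A])
    from lt[unfolded this] show ?thesis by simp
  next
    case False
    obtain t m where "infinite_cyclic_transversal G x t m"
      by (rule infinite_cyclic_transversal_exists[OF x False]) (rule that)
    then interpret infinite_cyclic_transversal G x t m .
    interpret equivariant_matrix G x t m r s A by unfold_locales (rule A)
    show ?thesis by (rule novikov_shubin_eq_limsup[OF lt])
  qed
qed

theorem theorem1:
  fixes X :: "'a topology"
    and K :: "('a, 'c) cell_structure"
    and E :: "'b topology"
    and q :: "'b \<Rightarrow> 'a"
    and e :: 'b
    and p r s :: nat
    and A :: "nat \<Rightarrow> nat \<Rightarrow> (real \<Rightarrow> 'a) set \<Rightarrow> int"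
  defines "G \<equiv> fundamental_group X (q e)"
    and "A_C \<equiv> (\<lambda>i j g. complex_of_int (A i j g))"
  assumes "cw_complex X K" and "compact_space X" and "connected_space X"
    and "universal_covering E X q" and "e \<in> topspace E"
    and "virtually_cyclic G"
    and "p \<ge> 1"
    and "represents_differential X K E q e p r s A"
    and "novikov_shubin G r s A_C < Infinity_plus"
  shows "novikov_shubin G r s A_C =
    NS_val (net_limsup (finite_index_normal G) (alpha_number G r s A_C))"
proof (rule virtually_cyclic_novikov_shubin)
  have "group_ring_mat G r s A"
    using \<open>represents_differential X K E q e p r s A\<close> unfolding represents_differential_def G_def by (rule conjunct1)
  then show "group_ring_mat G r s A_C" by (simp add: group_ring_mat_def A_C_def)
qed fact+

end
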